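(* Let $\Omega_0\subseteq\mathbb{R}^N$ be nonempty, open, bounded with Lipschitz boundary, $T>0$, and let $B\in C^{0,1}([0,T]\times\overline{\Omega_0};\mathbb{R}^{N\times N}_{\rm sym})$ be uniformly elliptic, i.e. $(B(t,y)w)\cdot w\ge c_B|w|^2$ for some $c_B>0$, all $w\in\mathbb{R}^N$, all $(t,y)$; $a\in L^\infty([0,T]\times\overline{\Omega_0};\mathbb{R}^N)$; $b\in C^{0,1}([0,T]\times\overline{\Omega_0};\mathbb{R}^N)$; $g\in L^2((0,T)\times\Omega_0)$; $v_0\in H^1_0(\Omega_0)$; $v_1\in L^2(\Omega_0)$. Then there exists a strong-weak solution $v$ of $$\ddot v-\operatorname{div}(B\nabla v)+a\cdot\nabla v-2b\cdot\nabla\dot v=g\ \text{in }(0,T)\times\Omega_0,\quad v=0\ \text{on }(0,T)\times\partial\Omega_0,\quad v(0)=v_0,\ \dot v(0)=v_1,$$ which satisfies $v\in C^0_w([0,T];H^1_0(\Omega_0))$ and $\dot v\in C^0_w([0,T];L^2(\Omega_0))$.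
   Context: A strong-weak solution is $v:[0,T]\times\overline{\Omega_0}\to\mathbb{R}$ such that: (i) $v\in L^2(0,T;H^1_0(\Omega_0))$, $\dot v\in L^2(0,T;L^2(\Omega_0))$, $\ddot v\in L^2(0,T;H^{-1}(\Omega_0))$; (ii) $v\in C^0([0,T];L^2(\Omega_0))$ with $v(0)=v_0$ and $\dot v\in C^0([0,T];H^{-1}(\Omega_0))$ with $\dot v(0)=v_1$; (iii) for a.e. $t$ and every $\phi\in H^1_0(\Omega_0)$: $\langle\ddot v(t),\phi\rangle_{H^{-1},H^1_0}+\langle B(t)\nabla v(t),\nabla\phi\rangle_{L^2}+\langle a(t)\cdot\nabla v(t),\phi\rangle_{L^2}+2\langle\dot v(t),\operatorname{div}(b(t)\phi)\rangle_{L^2}=\langle g(t),\phi\rangle_{L^2}$. $C^0_w([0,T];X)$ denotes maps continuous into $X$ endowed with its weak topology. *)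

theory Defs
  imports "HOL-Analysis.Analysis"
begin

fun dderiv :: "'a list \<Rightarrow> ('a::real_normed_vector \<Rightarrow> real) \<Rightarrow> 'a \<Rightarrow> real" where
  "dderiv [] f = f"
| "dderiv (e # es) f = (\<lambda>x. frechet_derivative (dderiv es f) (at x) e)"

definition smooth_fun :: "('a::real_normed_vector \<Rightarrow> real) \<Rightarrow> bool" where
  "smooth_fun f \<longleftrightarrow> (\<forall>es x. dderiv es f differentiable (at x))"

definition test_fun :: "'a::euclidean_space set \<Rightarrow> ('a \<Rightarrow> real) \<Rightarrow> bool" where
  "test_fun U \<phi> \<longleftrightarrow> smooth_fun \<phi> \<and> compact (closure {x. \<phi> x \<noteq> 0})
      \<and> closure {x. \<phi> x \<noteq> 0} \<subseteq> U"

definition L2 :: "'a::euclidean_space set \<Rightarrow> ('a \<Rightarrow> real) \<Rightarrow> bool" where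
  "L2 U f \<longleftrightarrow> f \<in> borel_measurable (lebesgue_on U)
      \<and> integrable (lebesgue_on U) (\<lambda>x. (f x)^2)"

definition L2v :: "'a::euclidean_space set \<Rightarrow> ('a \<Rightarrow> 'b::euclidean_space) \<Rightarrow> bool" where
  "L2v U F \<longleftrightarrow> F \<in> borel_measurable (lebesgue_on U)
      \<and> integrable (lebesgue_on U) (\<lambda>x. (norm (F x))^2)"

definition L2norm :: "'a::euclidean_space set \<Rightarrow> ('a \<Rightarrow> real) \<Rightarrow> real" where
  "L2norm U f = sqrt (\<integral>x. (f x)^2 \<partial>lebesgue_on U)"

text \<open>The L2 pairing; also the embedding of L2 into H^{-1}.\<close>
definition l2pair :: "'a::euclidean_space set \<Rightarrow> ('a \<Rightarrow> real) \<Rightarrow> ('a \<Rightarrow> real) \<Rightarrow> real" where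
  "l2pair U f g = (\<integral>x. f x * g x \<partial>lebesgue_on U)"

definition cgrad :: "(real^'n \<Rightarrow> real) \<Rightarrow> real^'n \<Rightarrow> real^'n" where
  "cgrad \<phi> x = (\<chi> i. frechet_derivative \<phi> (at x) (axis i 1))"

definition is_weak_grad :: "(real^'n) set \<Rightarrow> (real^'n \<Rightarrow> real) \<Rightarrow> (real^'n \<Rightarrow> real^'n) \<Rightarrow> bool" where
  "is_weak_grad U u G \<longleftrightarrow> (\<forall>\<phi>. test_fun U \<phi> \<longrightarrow> (\<forall>i.
      (\<integral>x. u x * cgrad \<phi> x $ i \<partial>lebesgue_on U) = - (\<integral>x. G x $ i * \<phi> x \<partial>lebesgue_on U)))"

definition H1 :: "(real^'n) set \<Rightarrow> (real^'n \<Rightarrow> real) \<Rightarrow> bool" where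
  "H1 U u \<longleftrightarrow> L2 U u \<and> (\<exists>G. L2v U G \<and> is_weak_grad U u G)"

text \<open>The weak gradient (unique up to null sets; only used inside integrals).\<close>
definition wgrad :: "(real^'n) set \<Rightarrow> (real^'n \<Rightarrow> real) \<Rightarrow> real^'n \<Rightarrow> real^'n" where
  "wgrad U u = (SOME G. L2v U G \<and> is_weak_grad U u G)"

definition H1norm :: "(real^'n) set \<Rightarrow> (real^'n \<Rightarrow> real) \<Rightarrow> real" where
  "H1norm U u = sqrt ((\<integral>x. (u x)^2 \<partial>lebesgue_on U) + (\<integral>x. (norm (wgrad U u x))^2 \<partial>lebesgue_on U))"

definition H10 :: "(real^'n) set \<Rightarrow> (real^'n \<Rightarrow> real) \<Rightarrow> bool" where
  "H10 U u \<longleftrightarrow> H1 U u \<and> (\<exists>\<phi>s. (\<forall>k. test_fun U (\<phi>s k))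
      \<and> (\<lambda>k. H1norm U (\<lambda>x. u x - \<phi>s k x)) \<longlonglongrightarrow> 0)"

definition Hm1 :: "(real^'n) set \<Rightarrow> ((real^'n \<Rightarrow> real) \<Rightarrow> real) \<Rightarrow> bool" where
  "Hm1 U F \<longleftrightarrow> (\<forall>u w c. H10 U u \<longrightarrow> H10 U w \<longrightarrow> F (\<lambda>x. u x + c * w x) = F u + c * F w)
      \<and> (\<exists>C. \<forall>u. H10 U u \<longrightarrow> \<bar>F u\<bar> \<le> C * H1norm U u)"

definition Hm1norm :: "(real^'n) set \<Rightarrow> ((real^'n \<Rightarrow> real) \<Rightarrow> real) \<Rightarrow> real" where
  "Hm1norm U F = Sup {\<bar>F u\<bar> | u. H10 U u \<and> H1norm U u \<le> 1}"

definition is_weak_div :: "(real^'n) set \<Rightarrow> (real^'n \<Rightarrow> real^'n) \<Rightarrow> (real^'n \<Rightarrow> real) \<Rightarrow> bool" where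
  "is_weak_div U F d \<longleftrightarrow> (\<forall>\<phi>. test_fun U \<phi> \<longrightarrow>
      (\<integral>x. d x * \<phi> x \<partial>lebesgue_on U) = - (\<integral>x. F x \<bullet> cgrad \<phi> x \<partial>lebesgue_on U))"

definition wdiv :: "(real^'n) set \<Rightarrow> (real^'n \<Rightarrow> real^'n) \<Rightarrow> real^'n \<Rightarrow> real" where
  "wdiv U F = (SOME d. L2 U d \<and> is_weak_div U F d)"

text \<open>Locally, U is the region below the graph of a Lipschitz function, in suitable
  orthonormal coordinates (\<nu> is the "vertical" direction; \<gamma> does not depend on it).\<close>
definition lipschitz_boundary :: "(real^'n) set \<Rightarrow> bool" where
  "lipschitz_boundary U \<longleftrightarrow> (\<forall>x0\<in>frontier U. \<exists>r>0. \<exists>\<nu> \<gamma> L. norm \<nu> = 1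
      \<and> L-lipschitz_on UNIV \<gamma> \<and> (\<forall>x s. \<gamma> (x + s *\<^sub>R \<nu>) = \<gamma> x)
      \<and> U \<inter> ball x0 r = {x \<in> ball x0 r. x \<bullet> \<nu> < \<gamma> x})"

text \<open>Measurability is weak measurability (equivalent to strong measurability by Pettis'
  theorem, the spaces being separable).\<close>
definition L2_H10 :: "real \<Rightarrow> (real^'n) set \<Rightarrow> (real \<Rightarrow> real^'n \<Rightarrow> real) \<Rightarrow> bool" where
  "L2_H10 T U v \<longleftrightarrow> (AE t in lebesgue_on {0..T}. H10 U (v t))
     \<and> (\<forall>\<psi> \<Psi>. L2 U \<psi> \<longrightarrow> L2v U \<Psi> \<longrightarrow>
          (\<lambda>t. l2pair U (v t) \<psi> + (\<integral>x. wgrad U (v t) x \<bullet> \<Psi> x \<partial>lebesgue_on U))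
            \<in> borel_measurable (lebesgue_on {0..T}))
     \<and> (\<integral>\<^sup>+t. ennreal ((H1norm U (v t))^2) \<partial>lebesgue_on {0..T}) < \<infinity>"

definition L2_L2 :: "real \<Rightarrow> (real^'n) set \<Rightarrow> (real \<Rightarrow> real^'n \<Rightarrow> real) \<Rightarrow> bool" where
  "L2_L2 T U w \<longleftrightarrow> (AE t in lebesgue_on {0..T}. L2 U (w t))
     \<and> (\<forall>\<psi>. L2 U \<psi> \<longrightarrow> (\<lambda>t. l2pair U (w t) \<psi>) \<in> borel_measurable (lebesgue_on {0..T}))
     \<and> (\<integral>\<^sup>+t. ennreal ((L2norm U (w t))^2) \<partial>lebesgue_on {0..T}) < \<infinity>"

definition L2_Hm1 :: "real \<Rightarrow> (real^'n) set \<Rightarrow> (real \<Rightarrow> (real^'n \<Rightarrow> real) \<Rightarrow> real) \<Rightarrow> bool" where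
  "L2_Hm1 T U F \<longleftrightarrow> (AE t in lebesgue_on {0..T}. Hm1 U (F t))
     \<and> (\<forall>\<psi>. H10 U \<psi> \<longrightarrow> (\<lambda>t. F t \<psi>) \<in> borel_measurable (lebesgue_on {0..T}))
     \<and> (\<integral>\<^sup>+t. ennreal ((Hm1norm U (F t))^2) \<partial>lebesgue_on {0..T}) < \<infinity>"

definition time_deriv_L2 :: "real \<Rightarrow> (real^'n) set \<Rightarrow> (real \<Rightarrow> real^'n \<Rightarrow> real)
    \<Rightarrow> (real \<Rightarrow> real^'n \<Rightarrow> real) \<Rightarrow> bool" where
  "time_deriv_L2 T U v w \<longleftrightarrow> (\<forall>\<phi> \<psi>. test_fun {0<..<T} \<phi> \<longrightarrow> L2 U \<psi> \<longrightarrow>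
      (\<integral>t. l2pair U (v t) \<psi> * deriv \<phi> t \<partial>lebesgue_on {0<..<T})
        = - (\<integral>t. l2pair U (w t) \<psi> * \<phi> t \<partial>lebesgue_on {0<..<T}))"

definition time_deriv_Hm1 :: "real \<Rightarrow> (real^'n) set \<Rightarrow> (real \<Rightarrow> real^'n \<Rightarrow> real)
    \<Rightarrow> (real \<Rightarrow> (real^'n \<Rightarrow> real) \<Rightarrow> real) \<Rightarrow> bool" where
  "time_deriv_Hm1 T U w F \<longleftrightarrow> (\<forall>\<phi> \<psi>. test_fun {0<..<T} \<phi> \<longrightarrow> H10 U \<psi> \<longrightarrow>
      (\<integral>t. F t \<psi> * \<phi> t \<partial>lebesgue_on {0<..<T})
        = - (\<integral>t. l2pair U (w t) \<psi> * deriv \<phi> t \<partial>lebesgue_on {0<..<T}))"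

text \<open>v is the solution, vd its first and vdd its second time derivative
  (vd(t) represented by an L2 function, acting on H^1_0 through the L2 pairing).\<close>
definition strong_weak_solution_with ::
  "real \<Rightarrow> (real^'n) set \<Rightarrow> (real \<Rightarrow> real^'n \<Rightarrow> real^'n^'n) \<Rightarrow> (real \<Rightarrow> real^'n \<Rightarrow> real^'n)
   \<Rightarrow> (real \<Rightarrow> real^'n \<Rightarrow> real^'n) \<Rightarrow> (real \<Rightarrow> real^'n \<Rightarrow> real) \<Rightarrow> (real^'n \<Rightarrow> real)
   \<Rightarrow> (real^'n \<Rightarrow> real) \<Rightarrow> (real \<Rightarrow> real^'n \<Rightarrow> real) \<Rightarrow> (real \<Rightarrow> real^'n \<Rightarrow> real)
   \<Rightarrow> (real \<Rightarrow> (real^'n \<Rightarrow> real) \<Rightarrow> real) \<Rightarrow> bool" where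
  "strong_weak_solution_with T U B a b g v0 v1 v vd vdd \<longleftrightarrow>
     \<comment> \<open>(i)\<close>
     L2_H10 T U v \<and> time_deriv_L2 T U v vd \<and> L2_L2 T U vd
     \<and> time_deriv_Hm1 T U vd vdd \<and> L2_Hm1 T U vdd
     \<comment> \<open>(ii)\<close>
     \<and> (\<forall>t\<in>{0..T}. L2 U (v t))
     \<and> (\<forall>t\<in>{0..T}. ((\<lambda>s. L2norm U (\<lambda>x. v s x - v t x)) \<longlongrightarrow> 0) (at t within {0..T}))
     \<and> (AE x in lebesgue_on U. v 0 x = v0 x)
     \<and> (\<forall>t\<in>{0..T}. Hm1 U (l2pair U (vd t)))
     \<and> (\<forall>t\<in>{0..T}. ((\<lambda>s. Hm1norm U (l2pair U (\<lambda>x. vd s x - vd t x))) \<longlongrightarrow> 0)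
                      (at t within {0..T}))
     \<and> (\<forall>\<psi>. H10 U \<psi> \<longrightarrow> l2pair U (vd 0) \<psi> = l2pair U v1 \<psi>)
     \<comment> \<open>(iii)\<close>
     \<and> (AE t in lebesgue_on {0..T}. \<forall>\<phi>. H10 U \<phi> \<longrightarrow>
          vdd t \<phi>
          + (\<integral>x. (B t x *v wgrad U (v t) x) \<bullet> wgrad U \<phi> x \<partial>lebesgue_on U)
          + (\<integral>x. (a t x \<bullet> wgrad U (v t) x) * \<phi> x \<partial>lebesgue_on U)
          + 2 * l2pair U (vd t) (wdiv U (\<lambda>x. \<phi> x *\<^sub>R b t x))
          = l2pair U (g t) \<phi>)"

definition strong_weak_solution where
  "strong_weak_solution T U B a b g v0 v1 v \<longleftrightarrow>
     (\<exists>vd vdd. strong_weak_solution_with T U B a b g v0 v1 v vd vdd)"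

definition weakly_cont_H10 :: "real \<Rightarrow> (real^'n) set \<Rightarrow> (real \<Rightarrow> real^'n \<Rightarrow> real) \<Rightarrow> bool" where
  "weakly_cont_H10 T U v \<longleftrightarrow> (\<forall>t\<in>{0..T}. H10 U (v t))
     \<and> (\<forall>\<Lambda>. Hm1 U \<Lambda> \<longrightarrow> continuous_on {0..T} (\<lambda>t. \<Lambda> (v t)))"

definition weakly_cont_L2 :: "real \<Rightarrow> (real^'n) set \<Rightarrow> (real \<Rightarrow> real^'n \<Rightarrow> real) \<Rightarrow> bool" where
  "weakly_cont_L2 T U w \<longleftrightarrow> (\<forall>t\<in>{0..T}. L2 U (w t))
     \<and> (\<forall>\<psi>. L2 U \<psi> \<longrightarrow> continuous_on {0..T} (\<lambda>t. l2pair U (w t) \<psi>))"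

end

theory Submission
  imports Defs "HOL-Complex_Analysis.Great_Picard"
begin

text \<open>The equation is discretised in time by implicit Euler steps. Each step is an elliptic problem,
  solved by Lax--Milgram in \<open>H\<^sup>1\<^sub>0\<close>. Testing with the discrete velocity gives an energy inequality: the
  transport term \<open>2 \<langle>v', div (b v')\<rangle>\<close> loses no derivative, because \<open>v \<mapsto> div (b v)\<close> is skew up to a bounded
  operator, and the first order term is absorbed by a discrete Gronwall argument. Weak compactness along a
  diagonal subsequence yields a weakly continuous limit, and the equation passes to the limit in its
  time-integrated form because all terms are linear. The coefficients \<open>a\<close> and \<open>g\<close>, given up to null sets of the
  space-time cylinder, are replaced by Borel versions, for which the time slices are well behaved.\<close>

section \<open>Hilbert spaces\<close>

text \<open>The statement speaks of functions, \<open>SOME\<close>-chosen gradients and divergences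
  and Lebesgue measurable data, while the argument wants closed subspaces and bounded operators.
  \<open>H10\<close> is therefore realised as the closed graph of pairs (u, grad u) in a product of
  two L2 spaces, with \<open>\<iota>\<close> the first projection; of the equation, the scheme sees
  only a list of operator bounds on that graph. Regularity in time shapes the scheme.
  \<open>a\<close> and \<open>g\<close> are only measurable in time, so an Euler step integrates the
  coefficients over the step instead of sampling them, and the interpolants then satisfy the
  integrated equation exactly between grid points. \<open>v1\<close> is only in L2, so velocities
  live merely in the closure of the image of \<open>V\<close>. Of the space regularity of
  \<open>b\<close> only the bound and the Lipschitz constant enter: the estimates on div (b \<phi>)
  rest on one bound for the integral of a Lipschitz function against the derivative of a product. An
  L2 inner product is added to the principal part to make it coercive on the graph, and subtracted
  again in the first order part.\<close>

definition linear_form_on :: "'a::real_vector set \<Rightarrow> ('a \<Rightarrow> real) \<Rightarrow> bool" where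
  "linear_form_on V f \<longleftrightarrow> (\<forall>x\<in>V. \<forall>y\<in>V. \<forall>c. f (x + c *\<^sub>R y) = f x + c * f y)"

lemma linear_form_onD:
  "linear_form_on V f \<Longrightarrow> x \<in> V \<Longrightarrow> y \<in> V \<Longrightarrow> f (x + c *\<^sub>R y) = f x + c * f y"
  by (auto simp: linear_form_on_def)

lemma linear_form_on_add:
  "linear_form_on V f \<Longrightarrow> x \<in> V \<Longrightarrow> y \<in> V \<Longrightarrow> f (x + y) = f x + f y"
  using linear_form_onD[of V f x y 1] by simp

lemma linear_form_on_diff:
  "linear_form_on V f \<Longrightarrow> x \<in> V \<Longrightarrow> y \<in> V \<Longrightarrow> f (x - y) = f x - f y"
  using linear_form_onD[of V f x y "-1"] by simp

lemma linear_form_on_zero: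
  assumes "linear_form_on V f" "subspace V" shows "f 0 = 0"
  using linear_form_on_diff[OF assms(1) subspace_0[OF assms(2)] subspace_0[OF assms(2)]] by simp

lemma linear_form_on_scale:
  assumes "linear_form_on V f" "subspace V" "x \<in> V" shows "f (c *\<^sub>R x) = c * f x"
  using linear_form_onD[OF assms(1) subspace_0[OF assms(2)] assms(3), of c]
    linear_form_on_zero[OF assms(1,2)] by simp

text \<open>The representer minimises \<open>\<parallel>x\<parallel>\<^sup>2 - 2 f x\<close> over \<open>V\<close>; by the parallelogram law a
  minimising sequence is Cauchy.\<close>
lemma riesz_representation_dense:
  fixes V :: "'a::{real_inner,banach} set"
  assumes V: "subspace V" and f: "linear_form_on V f"
    and K: "\<And>x. x \<in> V \<Longrightarrow> \<bar>f x\<bar> \<le> K * norm x"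
  obtains z where "z \<in> closure V" "\<And>x. x \<in> V \<Longrightarrow> f x = x \<bullet> z"
proof -
  define q where "q x = x \<bullet> x - 2 * f x" for x
  define m where "m = Inf (q ` V)"
  have qlow: "q x \<ge> - K\<^sup>2" if "x \<in> V" for x
  proof -
    have "0 \<le> (norm x - K)\<^sup>2" by simp
    moreover have "f x \<le> K * norm x" using K[OF that] by linarith
    ultimately show ?thesis
      unfolding q_def by (simp add: power2_eq_square algebra_simps flip: power2_norm_eq_inner)
  qed
  have bdd: "bdd_below (q ` V)" using qlow by (intro bdd_belowI2)
  have ne: "q ` V \<noteq> {}" using subspace_0[OF V] by auto
  have mle: "m \<le> q x" if "x \<in> V" for x unfolding m_def using bdd that by (intro cInf_lower) auto
  have "\<exists>x\<in>V. q x < m + 1 / real (Suc n)" for n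
  proof -
    have "Inf (q ` V) < m + 1 / real (Suc n)" by (simp add: m_def)
    then show ?thesis using cInf_lessD[OF ne] by blast
  qed
  then obtain X where X: "\<And>n. X n \<in> V" "\<And>n. q (X n) < m + 1 / real (Suc n)" by metis
  have f_half: "f ((1/2) *\<^sub>R (x + y)) = (f x + f y) / 2" if "x \<in> V" "y \<in> V" for x y
    using linear_form_on_scale[OF f V subspace_add[OF V that], of "1/2"]
      linear_form_on_add[OF f that] by simp
  have par: "(norm (x - y))\<^sup>2 \<le> 2 * (q x - m) + 2 * (q y - m)" if "x \<in> V" "y \<in> V" for x y
  proof -
    have "(1/2) *\<^sub>R (x + y) \<in> V" using V that by (meson subspace_add subspace_scale)
    from mle[OF this] have "4 * m \<le> 4 * q ((1/2) *\<^sub>R (x + y))" by simp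
    also have "\<dots> = 2 * q x + 2 * q y - (norm (x - y))\<^sup>2"
      unfolding q_def f_half[OF that] power2_norm_eq_inner
      by (simp add: inner_diff_left inner_diff_right inner_add_left inner_add_right inner_commute algebra_simps)
    finally show ?thesis by (simp add: algebra_simps)
  qed
  have "Cauchy X"
  proof (rule metric_CauchyI)
    fix e :: real assume e: "e > 0"
    obtain N where N: "4 / real (Suc N) < e\<^sup>2"
    proof -
      obtain N where "4 / e\<^sup>2 < real N" using reals_Archimedean2 by blast
      then have "4 / e\<^sup>2 < real (Suc N)" by simp
      then have "4 < real (Suc N) * e\<^sup>2" using e by (simp add: field_simps)
      then have "4 / real (Suc N) < e\<^sup>2" by (simp add: field_simps)
      then show ?thesis using that by blast
    qed
    have N': "4 * (1 / real (Suc N)) < e\<^sup>2" using N by simp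
    have "dist (X i) (X j) < e" if "i \<ge> N" "j \<ge> N" for i j
    proof -
      have "1 / real (Suc i) \<le> 1 / real (Suc N)" "1 / real (Suc j) \<le> 1 / real (Suc N)"
        using that by (auto simp: field_simps)
      then have "q (X i) - m < 1 / real (Suc N)" "q (X j) - m < 1 / real (Suc N)"
        using X(2)[of i] X(2)[of j] by linarith+
      then have "(norm (X i - X j))\<^sup>2 < e\<^sup>2"
        using par[OF X(1) X(1), of i j] N' by (smt (verit))
      then show ?thesis using e by (simp add: dist_norm power_less_imp_less_base)
    qed
    then show "\<exists>N. \<forall>i\<ge>N. \<forall>j\<ge>N. dist (X i) (X j) < e" by blast
  qed
  then obtain z where z: "X \<longlonglongrightarrow> z" using Cauchy_convergent convergent_def by blast
  have zV: "z \<in> closure V" unfolding closure_sequential using X(1) z by blast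
  have qX: "(\<lambda>n. q (X n)) \<longlonglongrightarrow> m"
  proof (rule real_tendsto_sandwich)
    show "\<forall>\<^sub>F n in sequentially. m \<le> q (X n)" using mle[OF X(1)] by (intro always_eventually allI)
    show "\<forall>\<^sub>F n in sequentially. q (X n) \<le> m + 1 / real (Suc n)" using X(2) by (intro always_eventually allI less_imp_le)
    have "(\<lambda>n. m + 1 / real (Suc n)) \<longlonglongrightarrow> m + 0"
      by (intro tendsto_intros LIMSEQ_Suc[OF lim_1_over_n])
    then show "(\<lambda>n. m + 1 / real (Suc n)) \<longlonglongrightarrow> m" by simp
  qed simp
  have "f x = x \<bullet> z" if x: "x \<in> V" for x
  proof (cases "x = 0")
    case True then show ?thesis using linear_form_on_zero[OF f V] by simp
  next
    case False
    define r where "r = f x - x \<bullet> z"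
    \<comment> \<open>The perturbation is applied to \<open>X n\<close> and not to z, because f is
      controlled only on \<open>V\<close>. This \<open>t\<close> minimises the limiting quadratic;
      the gain r^2 / |x|^2 must vanish since \<open>m\<close> is the infimum.\<close>
    define t where "t = r / (x \<bullet> x)"
    have xx: "x \<bullet> x > 0" using False by simp
    have "m \<le> q (X n) + 2 * t * (x \<bullet> X n - f x) + t * t * (x \<bullet> x)" for n
    proof -
      have "m \<le> q (X n + t *\<^sub>R x)" using mle x X(1) V by (meson subspace_add subspace_scale)
      also have "\<dots> = q (X n) + 2 * t * (x \<bullet> X n - f x) + t * t * (x \<bullet> x)"
        unfolding q_def linear_form_onD[OF f X(1) x]
        by (simp add: inner_add_left inner_add_right inner_commute algebra_simps)
      finally show ?thesis .
    qed
    moreover have "(\<lambda>n. q (X n) + 2 * t * (x \<bullet> X n - f x) + t * t * (x \<bullet> x)) \<longlonglongrightarrow> m + 2 * t * (x \<bullet> z - f x) + t * t * (x \<bullet> x)"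
      by (intro tendsto_intros qX z)
    ultimately have "m \<le> m + 2 * t * (x \<bullet> z - f x) + t * t * (x \<bullet> x)"
      using LIMSEQ_le_const by blast
    also have "\<dots> = m - 2 * t * r + t * t * (x \<bullet> x)" by (simp add: r_def algebra_simps)
    also have "\<dots> = m - r\<^sup>2 / (x \<bullet> x)" unfolding t_def using xx by (simp add: field_simps power2_eq_square)
    finally have "r\<^sup>2 / (x \<bullet> x) \<le> 0" by simp
    then have "r = 0" using xx by (simp add: divide_le_0_iff)
    then show ?thesis by (simp add: r_def)
  qed
  with zV that show ?thesis by blast
qed

lemma riesz_representation_on:
  fixes V :: "'a::{real_inner,banach} set"
  assumes V: "subspace V" "closed V" and f: "linear_form_on V f"
    and K: "\<And>x. x \<in> V \<Longrightarrow> \<bar>f x\<bar> \<le> K * norm x"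
  obtains z where "z \<in> V" "\<And>x. x \<in> V \<Longrightarrow> f x = x \<bullet> z"
  using riesz_representation_dense[OF V(1) f K] unfolding closure_closed[OF V(2)] by metis

lemma orthogonal_projection_on:
  fixes V :: "'a::{real_inner,banach} set"
  assumes V: "subspace V" "closed V"
  obtains z where "z \<in> V" "\<And>x. x \<in> V \<Longrightarrow> x \<bullet> y = x \<bullet> z"
proof -
  have "linear_form_on V (\<lambda>x. x \<bullet> y)" by (simp add: linear_form_on_def inner_add_left)
  moreover have "\<bar>x \<bullet> y\<bar> \<le> norm y * norm x" for x
    using Cauchy_Schwarz_ineq2[of x y] by (simp add: mult.commute)
  ultimately obtain z where "z \<in> V" "\<And>x. x \<in> V \<Longrightarrow> x \<bullet> y = x \<bullet> z"
    using riesz_representation_on[OF V, of "\<lambda>x. x \<bullet> y" "norm y"] by metis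
  then show ?thesis using that by metis
qed

text \<open>First order and mixed terms make the form nonsymmetric, so the solution is found as a
  fixed point and not as a minimiser: with A the Riesz representer of the form, coercivity makes u
  |-> u - \<rho> (A u - F) a contraction of \<open>V\<close> for a suitable \<rho>.\<close>

lemma lax_milgram_on:
  fixes V :: "'a::{real_inner,banach} set"
  assumes V: "subspace V" "closed V"
    and lin1: "\<And>v. v \<in> V \<Longrightarrow> linear_form_on V (\<lambda>u. a u v)"
    and lin2: "\<And>u. u \<in> V \<Longrightarrow> linear_form_on V (a u)"
    and K: "\<And>u v. u \<in> V \<Longrightarrow> v \<in> V \<Longrightarrow> \<bar>a u v\<bar> \<le> K * norm u * norm v"
    and c: "c > 0" "\<And>u. u \<in> V \<Longrightarrow> a u u \<ge> c * (norm u)\<^sup>2"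
    and f: "linear_form_on V f" and L: "\<And>x. x \<in> V \<Longrightarrow> \<bar>f x\<bar> \<le> L * norm x"
  obtains u where "u \<in> V" "\<And>v. v \<in> V \<Longrightarrow> a u v = f v"
proof -
  have "\<exists>z\<in>V. \<forall>v\<in>V. a u v = v \<bullet> z" if u: "u \<in> V" for u
    using riesz_representation_on[OF V lin2[OF u], of "K * norm u"] K[OF u] by metis
  then obtain A where A: "\<And>u. u \<in> V \<Longrightarrow> A u \<in> V" "\<And>u v. u \<in> V \<Longrightarrow> v \<in> V \<Longrightarrow> a u v = v \<bullet> A u"
    by metis
  obtain F where F: "F \<in> V" "\<And>v. v \<in> V \<Longrightarrow> f v = v \<bullet> F"
    using riesz_representation_on[OF V f L] by metis
  \<comment> \<open>\<open>M\<close> also dominates \<open>c\<close>, which keeps the radicand 1 -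
    c^2 / M^2 in \<open>k\<close> nonnegative.\<close>
  define M where "M = max 1 (max K c)"
  have M: "M > 0" "K \<le> M" "c \<le> M" by (auto simp: M_def)
  have Adiff: "A u - A w = A (u - w)" if "u \<in> V" "w \<in> V" for u w
  proof -
    let ?d = "A u - A w - A (u - w)"
    have d: "?d \<in> V" using A(1) that V(1) by (simp add: subspace_diff)
    have "?d \<bullet> ?d = ?d \<bullet> A u - ?d \<bullet> A w - ?d \<bullet> A (u - w)" by (simp add: inner_diff_right)
    also have "\<dots> = a u ?d - a w ?d - a (u - w) ?d"
      using that d A(2) V(1) by (simp add: subspace_diff)
    also have "\<dots> = 0" using linear_form_on_diff[OF lin1[OF d] that] by simp
    finally show ?thesis by simp
  qed
  have Anorm: "norm (A u) \<le> M * norm u" if u: "u \<in> V" for u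
  proof -
    have "norm (A u) * norm (A u) = a u (A u)" using A(2)[OF u A(1)[OF u]] by (simp add: power2_norm_eq_inner flip: power2_eq_square)
    also have "\<dots> \<le> K * norm u * norm (A u)" using K[OF u A(1)[OF u]] by linarith
    also have "\<dots> \<le> (M * norm u) * norm (A u)" using M by (intro mult_right_mono) auto
    finally show ?thesis by (cases "A u = 0") (use M in auto)
  qed
  \<comment> \<open>The minimiser of 1 - 2 \<rho> c + \<rho>^2 M^2, which bounds the squared
    contraction factor; the minimum is the square of \<open>k\<close>.\<close>
  define \<rho> where "\<rho> = c / M\<^sup>2"
  define \<Phi> where "\<Phi> u = u - \<rho> *\<^sub>R (A u - F)" for u
  define k where "k = sqrt (1 - c\<^sup>2 / M\<^sup>2)"
  have cM: "c\<^sup>2 / M\<^sup>2 \<le> 1" "0 < c\<^sup>2 / M\<^sup>2" using c M by (auto simp: divide_le_eq power_mono)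
  have k: "0 \<le> k" "k < 1" "k\<^sup>2 = 1 - c\<^sup>2 / M\<^sup>2" using cM by (auto simp: k_def real_sqrt_lt_1_iff)
  have contr: "dist (\<Phi> u) (\<Phi> w) \<le> k * dist u w" if "u \<in> V" "w \<in> V" for u w
  proof -
    let ?d = "u - w"
    have d: "?d \<in> V" using that V(1) by (simp add: subspace_diff)
    have e: "\<Phi> u - \<Phi> w = ?d - \<rho> *\<^sub>R A ?d" unfolding \<Phi>_def using Adiff[OF that, symmetric]
      by (simp add: scaleR_diff_right)
    have "(norm (\<Phi> u - \<Phi> w))\<^sup>2 = (norm ?d)\<^sup>2 - 2 * \<rho> * (?d \<bullet> A ?d) + \<rho>\<^sup>2 * (norm (A ?d))\<^sup>2"
      unfolding e power2_norm_eq_inner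
      by (simp add: inner_diff_left inner_diff_right inner_commute power2_eq_square algebra_simps)
    also have "\<dots> \<le> (norm ?d)\<^sup>2 - 2 * \<rho> * (c * (norm ?d)\<^sup>2) + \<rho>\<^sup>2 * (M * norm ?d)\<^sup>2"
      using c(2)[OF d] A(2)[OF d d] Anorm[OF d] c(1) M(1)
      by (intro add_mono diff_mono mult_left_mono power_mono) (auto simp: \<rho>_def)
    also have "\<dots> = (1 - c\<^sup>2 / M\<^sup>2) * (norm ?d)\<^sup>2"
      unfolding \<rho>_def using M(1) by (simp add: field_simps power2_eq_square)
    also have "\<dots> = (k * norm ?d)\<^sup>2" by (simp add: k power_mult_distrib)
    finally show ?thesis unfolding dist_norm by (rule power2_le_imp_le) (use k in auto)
  qed
  have "\<exists>!u\<in>V. \<Phi> u = u"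
  proof (rule Banach_fix)
    show "complete V" using V(2) by (simp add: complete_eq_closed)
    show "V \<noteq> {}" using F(1) by auto
    show "\<Phi> ` V \<subseteq> V" using A(1) F(1) V(1) by (auto simp: \<Phi>_def intro!: subspace_diff subspace_scale)
    show "\<And>x y. x \<in> V \<Longrightarrow> y \<in> V \<Longrightarrow> dist (\<Phi> x) (\<Phi> y) \<le> k * dist x y" by (rule contr)
  qed (use k in auto)
  then obtain u where u: "u \<in> V" "\<Phi> u = u" by blast
  have "\<rho> \<noteq> 0" using c M by (auto simp: \<rho>_def)
  then have "A u = F" using u(2) by (simp add: \<Phi>_def)
  then show ?thesis using that u(1) A(2) F(2) by metis
qed

section \<open>Weak limits and weakly convergent subsequences\<close>

text \<open>The norm bound gives closedness, by an e/3 argument. Being a closed subspace, the set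
  admits orthogonal projections, which is how convergence is later transferred to arbitrary test
  vectors.\<close>

lemma closed_subspace_convergent_inner:
  fixes x :: "nat \<Rightarrow> 'a::real_inner"
  assumes K: "\<And>n. norm (x n) \<le> K"
  shows "subspace {y. convergent (\<lambda>n. x n \<bullet> y)}" "closed {y. convergent (\<lambda>n. x n \<bullet> y)}"
proof -
  show "subspace {y. convergent (\<lambda>n. x n \<bullet> y)}"
    unfolding subspace_def mem_Collect_eq inner_add_right inner_scaleR_right
    by (intro conjI ballI allI impI convergent_add convergent_mult[OF convergent_const])
      (simp_all add: convergent_const)
  have K0: "0 \<le> K" using K[of 0] norm_ge_zero order_trans by blast
  show "closed {y. convergent (\<lambda>n. x n \<bullet> y)}"
    unfolding closed_sequential_limits
  proof (intro allI impI, elim conjE)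
    fix Y l assume Y: "\<forall>n. Y n \<in> {y. convergent (\<lambda>n. x n \<bullet> y)}" and l: "Y \<longlonglongrightarrow> l"
    have "Cauchy (\<lambda>n. x n \<bullet> l)"
    proof (rule metric_CauchyI)
      fix e :: real assume e: "e > 0"
      have e': "e / (3 * (K + 1)) > 0" using e K0 by simp
      obtain m where m: "norm (Y m - l) < e / (3 * (K + 1))"
        using LIMSEQ_D[OF l e'] by blast
      have "Cauchy (\<lambda>n. x n \<bullet> Y m)" using Y by (auto simp: Cauchy_convergent_iff)
      then obtain N where N: "\<And>i j. i \<ge> N \<Longrightarrow> j \<ge> N \<Longrightarrow> dist (x i \<bullet> Y m) (x j \<bullet> Y m) < e / 3"
        using metric_CauchyD[of "\<lambda>n. x n \<bullet> Y m" "e / 3"] e by auto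
      have *: "\<bar>x i \<bullet> l - x i \<bullet> Y m\<bar> \<le> e / 3" for i
      proof -
        have "\<bar>x i \<bullet> (l - Y m)\<bar> \<le> norm (x i) * norm (l - Y m)" by (rule Cauchy_Schwarz_ineq2)
        also have "\<dots> \<le> (K + 1) * (e / (3 * (K + 1)))"
          using m K[of i] K0 e by (intro mult_mono) (auto simp: norm_minus_commute)
        also have "\<dots> = e / 3" using K0 by (simp add: field_simps)
        finally show ?thesis by (simp add: inner_diff_right)
      qed
      have "dist (x i \<bullet> l) (x j \<bullet> l) < e" if "i \<ge> N" "j \<ge> N" for i j
        using N[OF that] *[of i] *[of j] unfolding dist_real_def by linarith
      then show "\<exists>N. \<forall>i\<ge>N. \<forall>j\<ge>N. dist (x i \<bullet> l) (x j \<bullet> l) < e" by blast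
    qed
    then show "l \<in> {y. convergent (\<lambda>n. x n \<bullet> y)}" by (simp add: Cauchy_convergent_iff)
  qed
qed

text \<open>Testing with \<open>V\<close> suffices: any vector has the same products with the
  sequence as its projection onto \<open>V\<close>. The pointwise limit is a bounded linear form on
  \<open>V\<close>, and Riesz turns it into a vector.\<close>

lemma weak_limit_exists:
  fixes x :: "nat \<Rightarrow> 'a::{real_inner,banach}"
  assumes K: "\<And>n. norm (x n) \<le> K" and V: "subspace V" "closed V" "\<And>n. x n \<in> V"
    and conv: "\<And>y. y \<in> V \<Longrightarrow> convergent (\<lambda>n. x n \<bullet> y)"
  obtains z where "z \<in> V" "norm z \<le> K" "\<And>y. (\<lambda>n. x n \<bullet> y) \<longlonglongrightarrow> z \<bullet> y"
proof -
  define f where "f y = lim (\<lambda>n. x n \<bullet> y)" for y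
  have fl: "(\<lambda>n. x n \<bullet> y) \<longlonglongrightarrow> f y" if "y \<in> V" for y
    using conv[OF that] by (simp add: f_def convergent_LIMSEQ_iff)
  have fK: "\<bar>f y\<bar> \<le> K * norm y" if "y \<in> V" for y
  proof (rule tendsto_upperbound[OF tendsto_rabs[OF fl[OF that]]])
    show "\<forall>\<^sub>F n in sequentially. \<bar>x n \<bullet> y\<bar> \<le> K * norm y"
      using K by (intro always_eventually allI order_trans[OF Cauchy_Schwarz_ineq2] mult_right_mono) auto
  qed simp
  have "linear_form_on V f"
    unfolding linear_form_on_def
  proof (intro ballI allI)
    fix y w c assume yw: "y \<in> V" "w \<in> V"
    have "(\<lambda>n. x n \<bullet> (y + c *\<^sub>R w)) \<longlonglongrightarrow> f y + c * f w"
      unfolding inner_add_right inner_scaleR_right by (intro tendsto_intros fl yw)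
    then show "f (y + c *\<^sub>R w) = f y + c * f w"
      using LIMSEQ_unique[OF fl[OF subspace_add[OF V(1) yw(1) subspace_scale[OF V(1) yw(2)]]]] by simp
  qed
  then obtain z where z: "z \<in> V" "\<And>y. y \<in> V \<Longrightarrow> f y = y \<bullet> z"
    using riesz_representation_on[OF V(1,2) _ fK] by metis
  have zlim: "(\<lambda>n. x n \<bullet> y) \<longlonglongrightarrow> z \<bullet> y" for y
  proof -
    obtain p where p: "p \<in> V" "\<And>x. x \<in> V \<Longrightarrow> x \<bullet> y = x \<bullet> p"
      using orthogonal_projection_on[OF V(1,2)] by metis
    show ?thesis using fl[OF p(1)] p(2)[OF V(3)] p(2)[OF z(1)] z(2)[OF p(1)] by (simp add: inner_commute)
  qed
  have "norm z * norm z \<le> K * norm z"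
    using fK[OF z(1)] z(2)[OF z(1)] by (simp add: power2_norm_eq_inner flip: power2_eq_square)
  moreover have "0 \<le> K" using K[of 0] norm_ge_zero order_trans by blast
  ultimately have "norm z \<le> K" by (cases "z = 0") auto
  with z(1) zlim show ?thesis by (intro that[of z]) auto
qed

text \<open>The countable set fed to the diagonal argument consists of the values
  \<open>x n i\<close> themselves, so the argument works in any Hilbert space: an arbitrary y has
  the same products with these values as its projection onto the closed subspace of vectors for
  which convergence is already known.\<close>

lemma weakly_convergent_subsequence_countable:
  fixes x :: "nat \<Rightarrow> 'i \<Rightarrow> 'a::{real_inner,banach}"
  assumes S: "countable S" and K: "\<And>n i. i \<in> S \<Longrightarrow> norm (x n i) \<le> K"
  obtains r where "strict_mono (r :: nat \<Rightarrow> nat)"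
    "\<And>i y. i \<in> S \<Longrightarrow> convergent (\<lambda>n. x (r n) i \<bullet> y)"
proof -
  define D where "D = (\<lambda>(n, i). x n i) ` (UNIV \<times> S)"
  have D: "countable D" using S by (auto simp: D_def)
  have "\<bar>x n i \<bullet> d\<bar> \<le> K * K" if "i \<in> S" "d \<in> D" for n i d
  proof -
    have "norm d \<le> K" using that K by (auto simp: D_def)
    moreover have "0 \<le> K" using K[OF that(1), of 0] norm_ge_zero order_trans by blast
    ultimately show ?thesis
      using K[OF that(1)] by (intro order_trans[OF Cauchy_Schwarz_ineq2] mult_mono) auto
  qed
  then have "\<And>n p. p \<in> S \<times> D \<Longrightarrow> norm ((\<lambda>n (i, d). x n i \<bullet> d) n p) \<le> K * K" by auto
  then obtain r where r: "strict_mono (r :: nat \<Rightarrow> nat)"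
    "\<And>p. p \<in> S \<times> D \<Longrightarrow> \<exists>l. (\<lambda>n. (\<lambda>n (i, d). x n i \<bullet> d) (r n) p) \<longlonglongrightarrow> l"
    by (rule function_convergent_subsequence[of "S \<times> D" "\<lambda>n (i, d). x n i \<bullet> d" "K * K", OF countable_SIGMA[OF S D]]) blast+
  have "convergent (\<lambda>n. x (r n) i \<bullet> y)" if i: "i \<in> S" for i y
  proof -
    let ?Y = "{y. convergent (\<lambda>n. x (r n) i \<bullet> y)}"
    have Y: "subspace ?Y" "closed ?Y"
      using closed_subspace_convergent_inner[of "\<lambda>n. x (r n) i" K] K[OF i] by auto
    have "x (r n) i \<in> ?Y" for n
    proof -
      have "(i, x (r n) i) \<in> S \<times> D" using i by (auto simp: D_def)
      from r(2)[OF this] show ?thesis by (auto simp: convergent_def)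
    qed
    moreover obtain p where p: "p \<in> ?Y" "\<And>x. x \<in> ?Y \<Longrightarrow> x \<bullet> y = x \<bullet> p"
      using orthogonal_projection_on[OF Y] by metis
    ultimately show ?thesis by simp
  qed
  then show ?thesis using r(1) that by blast
qed

section \<open>The abstract Cauchy problem: implicit time discretisation\<close>

lemma linear_form_on_integral:
  fixes F :: "'a::real_vector \<Rightarrow> real \<Rightarrow> real"
  assumes "\<And>x. x \<in> V \<Longrightarrow> F x integrable_on I" "\<And>s. s \<in> I \<Longrightarrow> linear_form_on V (\<lambda>x. F x s)"
    "subspace V"
  shows "linear_form_on V (\<lambda>x. integral I (F x))"
  unfolding linear_form_on_def
proof (intro ballI allI)
  fix x y c assume xy: "x \<in> V" "y \<in> V"
  have "integral I (F (x + c *\<^sub>R y)) = integral I (\<lambda>s. F x s + c * F y s)"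
    using linear_form_onD[OF assms(2) xy] by (intro integral_cong) auto
  also have "\<dots> = integral I (F x) + c * integral I (F y)"
    using assms(1)[OF xy(1)] assms(1)[OF xy(2)]
    by (subst Henstock_Kurzweil_Integration.integral_add) (auto intro: integrable_on_mult_right)
  finally show "integral I (F (x + c *\<^sub>R y)) = integral I (F x) + c * integral I (F y)" .
qed

lemma linear_form_on_plus:
  "linear_form_on V f \<Longrightarrow> linear_form_on V h \<Longrightarrow> linear_form_on V (\<lambda>x. f x + h x)"
  by (auto simp: linear_form_on_def algebra_simps)

lemma linear_form_on_cmult: "linear_form_on V f \<Longrightarrow> linear_form_on V (\<lambda>x. r * f x)"
  by (auto simp: linear_form_on_def algebra_simps)

lemma linear_form_on_inner_linear:
  "linear L \<Longrightarrow> linear_form_on V (\<lambda>x. h \<bullet> L x)" "linear L \<Longrightarrow> linear_form_on V (\<lambda>x. L x \<bullet> h)"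
  by (auto simp: linear_form_on_def linear_add linear_scale inner_add_right inner_add_left)

lemma has_integral_grid:
  fixes f :: "real \<Rightarrow> real"
  assumes "\<tau> \<ge> 0" "i \<le> j"
    "\<And>k. i \<le> k \<Longrightarrow> k < j \<Longrightarrow> (f has_integral (X (Suc k) - X k)) {real k * \<tau>..real (Suc k) * \<tau>}"
  shows "(f has_integral (X j - X i)) {real i * \<tau>..real j * \<tau>}"
  using assms(2,3)
proof (induction j rule: dec_induct)
  case base show ?case by (simp add: has_integral_refl)
next
  case (step k)
  have "(f has_integral (X k - X i)) {real i * \<tau>..real k * \<tau>}" using step by auto
  moreover have "(f has_integral (X (Suc k) - X k)) {real k * \<tau>..real (Suc k) * \<tau>}" using step by auto
  ultimately have "(f has_integral (X k - X i) + (X (Suc k) - X k)) {real i * \<tau>..real (Suc k) * \<tau>}"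
    using assms(1) step(1) by (intro has_integral_combine) (auto intro: mult_right_mono)
  then show ?case by simp
qed

text \<open>Pointwise convergence spreads from a dense set. The moduli \<open>\<theta> n\<close> may
  jump (they will be integrals up to grid points); continuity of their limit
  \<open>\<theta>'\<close> is enough, since only two times are compared at once.\<close>

lemma convergent_of_dense_equicontinuous:
  fixes f \<theta> :: "nat \<Rightarrow> real \<Rightarrow> real"
  assumes le: "\<And>n s t. s \<in> I \<Longrightarrow> t \<in> I \<Longrightarrow> \<bar>f n t - f n s\<bar> \<le> \<bar>\<theta> n t - \<theta> n s\<bar>"
    and lim: "\<And>t. t \<in> I \<Longrightarrow> (\<lambda>n. \<theta> n t) \<longlonglongrightarrow> \<theta>' t" and cont: "continuous_on I \<theta>'"
    and S: "S \<subseteq> I" "I \<subseteq> closure S" and conv: "\<And>s. s \<in> S \<Longrightarrow> convergent (\<lambda>n. f n s)"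
    and t: "t \<in> I"
  shows "convergent (\<lambda>n. f n t)"
proof -
  have "Cauchy (\<lambda>n. f n t)"
  proof (rule metric_CauchyI)
    fix e :: real assume e: "e > 0"
    \<comment> \<open>e / 6 for \<open>\<theta>'\<close> and twice e / 12 for
      \<open>\<theta> n\<close> against \<open>\<theta>'\<close> bound the increment of
      \<open>f n\<close> by e / 3.\<close>
    obtain d where d: "d > 0" "\<And>s. s \<in> I \<Longrightarrow> dist s t < d \<Longrightarrow> dist (\<theta>' s) (\<theta>' t) < e / 6"
      using cont t e unfolding continuous_on_iff by (metis zero_less_divide_iff zero_less_numeral)
    obtain s where s: "s \<in> S" "dist s t < d" using S(2) t d(1) by (metis closure_approachable subsetD)
    have sI: "s \<in> I" using s S by auto
    obtain N1 where N1: "\<And>n. n \<ge> N1 \<Longrightarrow> \<bar>\<theta> n t - \<theta>' t\<bar> < e / 12"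
      using LIMSEQ_D[OF lim[OF t], of "e/12"] e by auto
    obtain N2 where N2: "\<And>n. n \<ge> N2 \<Longrightarrow> \<bar>\<theta> n s - \<theta>' s\<bar> < e / 12"
      using LIMSEQ_D[OF lim[OF sI], of "e/12"] e by auto
    have "Cauchy (\<lambda>n. f n s)" using conv[OF s(1)] by (simp add: Cauchy_convergent_iff)
    then obtain N3 where N3: "\<And>m n. m \<ge> N3 \<Longrightarrow> n \<ge> N3 \<Longrightarrow> dist (f m s) (f n s) < e / 3"
      using metric_CauchyD[of "\<lambda>n. f n s" "e/3"] e by auto
    have near: "\<bar>f n t - f n s\<bar> < e / 3" if "n \<ge> N1" "n \<ge> N2" for n
      using le[OF sI t, of n] N1[OF that(1)] N2[OF that(2)] d(2)[OF sI s(2)] unfolding dist_real_def by linarith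
    have "dist (f m t) (f n t) < e" if "m \<ge> N1 + N2 + N3" "n \<ge> N1 + N2 + N3" for m n
    proof -
      have "m \<ge> N1" "m \<ge> N2" "m \<ge> N3" "n \<ge> N1" "n \<ge> N2" "n \<ge> N3" using that by auto
      then show ?thesis using near[of m] near[of n] N3[of m n] unfolding dist_real_def by linarith
    qed
    then show "\<exists>N. \<forall>m\<ge>N. \<forall>n\<ge>N. dist (f m t) (f n t) < e" by blast
  qed
  then show ?thesis by (simp add: Cauchy_convergent_iff)
qed

text \<open>\<open>V\<close> plays the role of \<open>H\<^sup>1\<^sub>0\<close>, \<open>\<iota>\<close> that of its embedding into \<open>L\<^sup>2\<close>. The operators act on the test
  function: the forms are \<open>u \<bullet> Bo t \<phi>\<close> (principal part), \<open>u \<bullet> Co t \<phi>\<close> (first order in space) and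
  \<open>w \<bullet> Do t \<phi>\<close> (the mixed derivative, with \<open>w\<close> the velocity), so that each of them passes to weak limits.\<close>
locale hyperbolic_system =
  fixes V :: "'x::{real_inner,banach} set" and \<iota> :: "'x \<Rightarrow> 'h::{real_inner,banach}"
    and Bo Co :: "real \<Rightarrow> 'x \<Rightarrow> 'x" and Do :: "real \<Rightarrow> 'x \<Rightarrow> 'h" and g :: "real \<Rightarrow> 'h"
    and T M c :: real and u0 :: 'x and w1 :: 'h
  assumes T: "T > 0" and M: "M \<ge> 0" and c: "c > 0" and V: "subspace V" "closed V"
    and \<iota>: "linear \<iota>" "\<And>x. norm (\<iota> x) \<le> norm x" "\<And>x. x \<in> V \<Longrightarrow> \<iota> x = 0 \<Longrightarrow> x = 0"
    and Bo_lin: "\<And>s x. s \<in> {0..T} \<Longrightarrow> linear_form_on V (\<lambda>y. x \<bullet> Bo s y)"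
    and Bo_norm: "\<And>s y. s \<in> {0..T} \<Longrightarrow> y \<in> V \<Longrightarrow> norm (Bo s y) \<le> M * norm y"
    and Bo_sym: "\<And>s x y. s \<in> {0..T} \<Longrightarrow> x \<in> V \<Longrightarrow> y \<in> V \<Longrightarrow> x \<bullet> Bo s y = y \<bullet> Bo s x"
    and Bo_coercive: "\<And>s x. s \<in> {0..T} \<Longrightarrow> x \<in> V \<Longrightarrow> x \<bullet> Bo s x \<ge> c * (norm x)\<^sup>2"
    and Bo_lip: "\<And>s r x y. s \<in> {0..T} \<Longrightarrow> r \<in> {0..T} \<Longrightarrow> x \<in> V \<Longrightarrow> y \<in> V \<Longrightarrow>
        \<bar>x \<bullet> Bo s y - x \<bullet> Bo r y\<bar> \<le> M * \<bar>s - r\<bar> * norm x * norm y"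
    and Co_lin: "\<And>s x. s \<in> {0..T} \<Longrightarrow> linear_form_on V (\<lambda>y. x \<bullet> Co s y)"
    and Co_norm: "\<And>s y. s \<in> {0..T} \<Longrightarrow> y \<in> V \<Longrightarrow> norm (Co s y) \<le> M * norm (\<iota> y)"
    and Co_meas: "\<And>x y. x \<in> V \<Longrightarrow> y \<in> V \<Longrightarrow> (\<lambda>s. x \<bullet> Co s y) \<in> borel_measurable (lebesgue_on {0..T})"
    and Do_lin: "\<And>s h. s \<in> {0..T} \<Longrightarrow> linear_form_on V (\<lambda>y. h \<bullet> Do s y)"
    and Do_norm: "\<And>s y. s \<in> {0..T} \<Longrightarrow> y \<in> V \<Longrightarrow> norm (Do s y) \<le> M * norm y"
    and Do_skew: "\<And>s y. s \<in> {0..T} \<Longrightarrow> y \<in> V \<Longrightarrow> \<iota> y \<bullet> Do s y \<ge> - M * (norm (\<iota> y))\<^sup>2"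
    and Do_meas: "\<And>x y. x \<in> V \<Longrightarrow> y \<in> V \<Longrightarrow> (\<lambda>s. \<iota> x \<bullet> Do s y) \<in> borel_measurable (lebesgue_on {0..T})"
    and g_meas: "\<And>y. y \<in> V \<Longrightarrow> (\<lambda>s. g s \<bullet> \<iota> y) \<in> borel_measurable (lebesgue_on {0..T})"
    and g_int: "(\<lambda>s. (norm (g s))\<^sup>2) integrable_on {0..T}"
    and u0: "u0 \<in> V" and w1: "w1 \<in> closure (\<iota> ` V)"
begin

lemma subset_T: "0 \<le> a \<Longrightarrow> b \<le> T \<Longrightarrow> {a..b} \<subseteq> {0..T}" by auto

lemma bounded_measurable_integrable:
  assumes "f \<in> borel_measurable (lebesgue_on {0..T})" "k integrable_on {0..T}"
    "\<And>s. s \<in> {0..T} \<Longrightarrow> \<bar>f s\<bar> \<le> k s" "0 \<le> a" "b \<le> T"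
  shows "(f::real \<Rightarrow> real) integrable_on {a..b}"
proof -
  have "f integrable_on {0..T}"
    using assms by (intro measurable_bounded_by_integrable_imp_integrable[of f "{0..T}" k]) auto
  then show ?thesis using integrable_on_subinterval subset_T assms by blast
qed

lemma Bo_integrable:
  assumes "x \<in> V" "y \<in> V" "0 \<le> a" "b \<le> T" shows "(\<lambda>s. x \<bullet> Bo s y) integrable_on {a..b}"
proof (intro integrable_continuous_interval lipschitz_on_continuous_on lipschitz_onI)
  show "dist (x \<bullet> Bo s y) (x \<bullet> Bo r y) \<le> (M * norm x * norm y) * dist s r" if "s \<in> {a..b}" "r \<in> {a..b}" for s r
    using Bo_lip[of s r x y] assms that by (auto simp: dist_real_def mult_ac)
  show "0 \<le> M * norm x * norm y" using M by simp
qed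

lemma Co_bound: "s \<in> {0..T} \<Longrightarrow> y \<in> V \<Longrightarrow> \<bar>x \<bullet> Co s y\<bar> \<le> M * norm x * norm (\<iota> y)"
  using order_trans[OF Cauchy_Schwarz_ineq2[of x "Co s y"] mult_left_mono[OF Co_norm norm_ge_zero]]
  by (simp add: mult_ac)

lemma Bo_bound: "s \<in> {0..T} \<Longrightarrow> y \<in> V \<Longrightarrow> \<bar>x \<bullet> Bo s y\<bar> \<le> M * norm x * norm y"
  using order_trans[OF Cauchy_Schwarz_ineq2[of x "Bo s y"] mult_left_mono[OF Bo_norm norm_ge_zero]]
  by (simp add: mult_ac)

lemma Do_bound: "s \<in> {0..T} \<Longrightarrow> y \<in> V \<Longrightarrow> \<bar>h \<bullet> Do s y\<bar> \<le> M * norm h * norm y"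
  using order_trans[OF Cauchy_Schwarz_ineq2[of h "Do s y"] mult_left_mono[OF Do_norm norm_ge_zero]]
  by (simp add: mult_ac)

lemma g_bound: "\<bar>g s \<bullet> \<iota> y\<bar> \<le> (1 + (norm (g s))\<^sup>2) * norm y"
proof -
  have "\<bar>g s \<bullet> \<iota> y\<bar> \<le> norm (g s) * norm y"
    by (rule order_trans[OF Cauchy_Schwarz_ineq2 mult_left_mono[OF \<iota>(2)]]) simp
  moreover have "norm (g s) \<le> 1 + (norm (g s))\<^sup>2"
    using sum_power2_ge_zero[of "norm (g s) - 1/2" 0] by (simp add: power2_eq_square algebra_simps)
  ultimately show ?thesis by (meson mult_right_mono norm_ge_zero order_trans)
qed

lemma Co_integrable:
  assumes "x \<in> V" "y \<in> V" "0 \<le> a" "b \<le> T" shows "(\<lambda>s. x \<bullet> Co s y) integrable_on {a..b}"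
  by (rule bounded_measurable_integrable[OF Co_meas[OF assms(1,2)] integrable_const_ivl Co_bound[OF _ assms(2)] assms(3,4)])

lemma Do_integrable:
  assumes "x \<in> V" "y \<in> V" "0 \<le> a" "b \<le> T" shows "(\<lambda>s. \<iota> x \<bullet> Do s y) integrable_on {a..b}"
  by (rule bounded_measurable_integrable[OF Do_meas[OF assms(1,2)] integrable_const_ivl Do_bound[OF _ assms(2)] assms(3,4)])

lemma majorant_integrable: "(\<lambda>s. 1 + (norm (g s))\<^sup>2) integrable_on {0..T}"
  using g_int by (intro integrable_add) auto

lemma g_integrable:
  assumes "y \<in> V" "0 \<le> a" "b \<le> T" shows "(\<lambda>s. g s \<bullet> \<iota> y) integrable_on {a..b}"
  by (rule bounded_measurable_integrable[OF g_meas[OF assms(1)] _ g_bound assms(2,3)])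
    (intro integrable_on_mult_left majorant_integrable)

section \<open>The implicit Euler step\<close>

text \<open>All terms of the weak equation except the acceleration: the equation reads d/ds (w
  \<bullet> \<iota> y) = - flux u w y s.\<close>

definition "flux u w y s = u \<bullet> Bo s y + u \<bullet> Co s y + w \<bullet> Do s y - g s \<bullet> \<iota> y"

lemma flux_integrable:
  assumes "u \<in> V" "x \<in> V" "y \<in> V" "0 \<le> a" "b \<le> T" shows "flux u (\<iota> x) y integrable_on {a..b}"
  unfolding flux_def[abs_def]
  using assms by (intro integrable_add integrable_diff Bo_integrable Co_integrable Do_integrable g_integrable)

text \<open>What coercivity of one Euler step requires: the losses relative to |\<iota> u|^2, namely
  \<tau> M from the mixed term and \<tau>^2 M^2 / (2 c) from absorbing \<open>Co\<close> by Young's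
  inequality, add up to at most 1.\<close>

definition "small \<tau> \<longleftrightarrow> 0 < \<tau> \<and> \<tau> * M \<le> 1 / 2 \<and> \<tau> * \<tau> * M\<^sup>2 / (2 * c) \<le> 1 / 2"

text \<open>Multiplied by the step length, the equation for the new state is a Lax-Milgram problem:
  |\<iota> u|^2 from the acceleration and a coercive part of order \<tau>^2 from \<open>Bo\<close>
  absorb the rest. The coefficients are integrated over the step because \<open>Co\<close>,
  \<open>Do\<close> and \<open>g\<close> carry no information at single times.\<close>

lemma implicit_step:
  assumes ab: "0 \<le> a" "a < b" "b \<le> T" and sm: "small (b - a)" and p: "p \<in> V"
  obtains u where "u \<in> V" "\<And>y. y \<in> V \<Longrightarrow>
    (\<iota> ((u - p) /\<^sub>R (b - a)) - w) \<bullet> \<iota> y + integral {a..b} (flux u (\<iota> ((u - p) /\<^sub>R (b - a))) y) = 0"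
proof -
  define \<tau> where "\<tau> = b - a"
  have \<tau>: "\<tau> > 0" "small \<tau>" using ab sm by (auto simp: \<tau>_def)
  define A where "A u y = integral {a..b} (\<lambda>s. u \<bullet> Bo s y) + integral {a..b} (\<lambda>s. u \<bullet> Co s y)" for u y
  define R where "R x y = integral {a..b} (\<lambda>s. \<iota> x \<bullet> Do s y)" for x y
  \<comment> \<open>\<open>A\<close> and \<open>R\<close> contain one factor \<tau> through the
    integration. Hence the principal part is of order \<tau>^2, while the mixed part, in which u had
    been divided by \<tau>, is of order \<tau>.\<close>
  define form where "form u y = \<iota> u \<bullet> \<iota> y + \<tau> * A u y + R u y" for u y
  define rhs where "rhs y = (\<iota> p + \<tau> *\<^sub>R w) \<bullet> \<iota> y + \<tau> * integral {a..b} (\<lambda>s. g s \<bullet> \<iota> y) + R p y" for y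
  have sT: "s \<in> {0..T}" if "s \<in> {a..b}" for s using that ab by auto
  have norm_int: "\<bar>integral {a..b} f\<bar> \<le> B * \<tau>"
    if "f integrable_on {a..b}" "\<And>s. s \<in> {a..b} \<Longrightarrow> \<bar>f s\<bar> \<le> B" for f B
  proof -
    have "norm (integral {a..b} f) \<le> integral {a..b} (\<lambda>s. B)"
      using that by (intro Henstock_Kurzweil_Integration.integral_norm_bound_integral) auto
    then show ?thesis using ab(2) by (simp add: \<tau>_def mult.commute)
  qed
  have I: "(\<lambda>s. u \<bullet> Bo s y) integrable_on {a..b}" "(\<lambda>s. u \<bullet> Co s y) integrable_on {a..b}"
      "(\<lambda>s. \<iota> u \<bullet> Do s y) integrable_on {a..b}" if "u \<in> V" "y \<in> V" for u y
    using Bo_integrable Co_integrable Do_integrable that ab by auto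
  obtain u where u: "u \<in> V" "\<And>y. y \<in> V \<Longrightarrow> form u y = rhs y"
  proof (rule lax_milgram_on[OF V, of form])
    show "linear_form_on V (form u)" if u: "u \<in> V" for u
      unfolding form_def[abs_def] A_def R_def
      using I u V(1) Bo_lin Co_lin Do_lin sT
      by (intro linear_form_on_plus linear_form_on_cmult linear_form_on_integral
          linear_form_on_inner_linear[OF \<iota>(1)]) auto
    have linl: "linear_form_on V (\<lambda>u. u \<bullet> h)" for h :: 'x
      by (simp add: linear_form_on_def inner_add_left)
    show "linear_form_on V (\<lambda>u. form u y)" if y: "y \<in> V" for y
      unfolding form_def[abs_def] A_def R_def
      using I y V(1)
      by (intro linear_form_on_plus linear_form_on_cmult linear_form_on_integral
          linear_form_on_inner_linear[OF \<iota>(1)] linl) auto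
    show "linear_form_on V rhs"
      unfolding rhs_def[abs_def] R_def
      using I p V(1) Do_lin sT g_integrable ab
      by (intro linear_form_on_plus linear_form_on_cmult linear_form_on_integral
          linear_form_on_inner_linear[OF \<iota>(1)]) auto
    show "\<bar>form u y\<bar> \<le> (1 + \<tau> * (M * \<tau> + M * \<tau>) + M * \<tau>) * norm u * norm y" if uy: "u \<in> V" "y \<in> V" for u y
    proof -
      have "\<bar>\<iota> u \<bullet> \<iota> y\<bar> \<le> norm u * norm y"
        by (rule order_trans[OF Cauchy_Schwarz_ineq2]) (intro mult_mono \<iota>(2), auto)
      moreover have "\<bar>integral {a..b} (\<lambda>s. u \<bullet> Bo s y)\<bar> \<le> M * norm u * norm y * \<tau>"
        using Bo_bound sT uy by (intro norm_int I) auto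
      moreover have "\<bar>integral {a..b} (\<lambda>s. u \<bullet> Co s y)\<bar> \<le> M * norm u * norm y * \<tau>"
        by (rule norm_int[OF I(2)[OF uy] order_trans[OF Co_bound[OF sT uy(2)] mult_left_mono[OF \<iota>(2)]]]) (use M in auto)
      moreover have "\<bar>R u y\<bar> \<le> M * norm u * norm y * \<tau>" unfolding R_def
        by (rule norm_int[OF I(3)[OF uy] order_trans[OF Do_bound[OF sT uy(2)]]])
          (use M \<iota>(2) in \<open>auto intro!: mult_right_mono mult_left_mono\<close>)
      moreover have "\<bar>\<tau> * A u y\<bar> \<le> \<tau> * (M * norm u * norm y * \<tau> + M * norm u * norm y * \<tau>)"
        unfolding abs_mult abs_of_pos[OF \<tau>(1)] A_def
        using calculation \<tau>(1) by (intro mult_left_mono order_trans[OF abs_triangle_ineq] add_mono) auto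
      ultimately have "\<bar>form u y\<bar> \<le> norm u * norm y + \<tau> * (M * norm u * norm y * \<tau> + M * norm u * norm y * \<tau>) + M * norm u * norm y * \<tau>"
        unfolding form_def by linarith
      then show ?thesis by (simp add: algebra_simps)
    qed
    show "form u u \<ge> (\<tau>\<^sup>2 * c / 2) * (norm u)\<^sup>2" if u: "u \<in> V" for u
    proof -
      let ?k = "c * (norm u)\<^sup>2 - M * norm u * norm (\<iota> u)"
      have "?k * (b - a) \<le> integral {a..b} (\<lambda>s. u \<bullet> Bo s u + u \<bullet> Co s u)"
      proof (rule has_integral_le)
        show "((\<lambda>s. ?k) has_integral ?k * (b - a)) {a..b}"
          using has_integral_const_real[of ?k a b] ab by (simp add: mult.commute)
        show "((\<lambda>s. u \<bullet> Bo s u + u \<bullet> Co s u) has_integral integral {a..b} (\<lambda>s. u \<bullet> Bo s u + u \<bullet> Co s u)) {a..b}"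
          using I u by (intro integrable_integral integrable_add) auto
        show "?k \<le> u \<bullet> Bo s u + u \<bullet> Co s u" if "s \<in> {a..b}" for s
          using Bo_coercive[OF sT[OF that] u] Co_bound[OF sT[OF that] u, of u] by linarith
      qed
      also have "\<dots> = A u u" unfolding A_def using I u
        by (subst Henstock_Kurzweil_Integration.integral_add) auto
      finally have A: "?k * \<tau> \<le> A u u" by (simp add: \<tau>_def)
      have R: "(- M * (norm (\<iota> u))\<^sup>2) * \<tau> \<le> R u u" unfolding R_def
      proof (rule has_integral_le)
        show "((\<lambda>s. - M * (norm (\<iota> u))\<^sup>2) has_integral (- M * (norm (\<iota> u))\<^sup>2) * \<tau>) {a..b}"
          using has_integral_const_real[of "- M * (norm (\<iota> u))\<^sup>2" a b] ab by (simp add: mult.commute \<tau>_def)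
        show "((\<lambda>s. \<iota> u \<bullet> Do s u) has_integral integral {a..b} (\<lambda>s. \<iota> u \<bullet> Do s u)) {a..b}"
          using I u by (intro integrable_integral) auto
      qed (use Do_skew[OF sT u] in auto)
      \<comment> \<open>Young's inequality spends half of the coercivity, which explains the factor
        c / 2 in the claim.\<close>
      have "M * norm u * norm (\<iota> u) \<le> c / 2 * (norm u)\<^sup>2 + M\<^sup>2 / (2 * c) * (norm (\<iota> u))\<^sup>2"
      proof -
        have "0 \<le> (c * norm u - M * norm (\<iota> u))\<^sup>2 / (2 * c)" using c by simp
        also have "\<dots> = c / 2 * (norm u)\<^sup>2 + M\<^sup>2 / (2 * c) * (norm (\<iota> u))\<^sup>2 - M * norm u * norm (\<iota> u)"
          using c by (simp add: field_simps power2_eq_square)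
        finally show ?thesis by simp
      qed
      then have "\<tau> * (\<tau> * (M * norm u * norm (\<iota> u))) \<le> \<tau> * (\<tau> * (c / 2 * (norm u)\<^sup>2 + M\<^sup>2 / (2 * c) * (norm (\<iota> u))\<^sup>2))"
        using \<tau>(1) by (intro mult_left_mono) auto
      moreover have "\<tau> * (?k * \<tau>) \<le> \<tau> * A u u" using A \<tau>(1) by (intro mult_left_mono) auto
      moreover have "(\<tau> * M + \<tau> * \<tau> * M\<^sup>2 / (2 * c)) * (norm (\<iota> u))\<^sup>2 \<le> 1 * (norm (\<iota> u))\<^sup>2"
        using \<tau>(2) by (intro mult_right_mono) (auto simp: small_def)
      ultimately show ?thesis using R unfolding form_def power2_norm_eq_inner[symmetric]
        by (simp add: algebra_simps power2_eq_square)
    qed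
    show "0 < \<tau>\<^sup>2 * c / 2" using \<tau> c by simp
    define m where "m = integral {a..b} (\<lambda>s. 1 + (norm (g s))\<^sup>2)"
    show "\<bar>rhs y\<bar> \<le> (norm (\<iota> p + \<tau> *\<^sub>R w) + \<tau> * m + M * norm (\<iota> p) * \<tau>) * norm y" if y: "y \<in> V" for y
    proof -
      have "\<bar>(\<iota> p + \<tau> *\<^sub>R w) \<bullet> \<iota> y\<bar> \<le> norm (\<iota> p + \<tau> *\<^sub>R w) * norm y"
        by (rule order_trans[OF Cauchy_Schwarz_ineq2 mult_left_mono[OF \<iota>(2)]]) simp
      moreover have "\<bar>R p y\<bar> \<le> M * norm (\<iota> p) * norm y * \<tau>" unfolding R_def
        by (rule norm_int[OF I(3)[OF p y] Do_bound[OF sT y]])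
      moreover have "\<bar>integral {a..b} (\<lambda>s. g s \<bullet> \<iota> y)\<bar> \<le> m * norm y"
      proof -
        have mi: "(\<lambda>s. 1 + (norm (g s))\<^sup>2) integrable_on {a..b}"
          using integrable_on_subinterval[OF majorant_integrable] subset_T ab by auto
        have "norm (integral {a..b} (\<lambda>s. g s \<bullet> \<iota> y)) \<le> integral {a..b} (\<lambda>s. (1 + (norm (g s))\<^sup>2) * norm y)"
          using g_integrable[OF y ab(1,3)] mi g_bound
          by (intro Henstock_Kurzweil_Integration.integral_norm_bound_integral integrable_on_mult_left) auto
        then show ?thesis by (simp add: m_def)
      qed
      moreover have "\<bar>\<tau> * integral {a..b} (\<lambda>s. g s \<bullet> \<iota> y)\<bar> \<le> \<tau> * (m * norm y)"
        unfolding abs_mult abs_of_pos[OF \<tau>(1)] using calculation \<tau>(1) by (intro mult_left_mono) auto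
      ultimately have "\<bar>rhs y\<bar> \<le> norm (\<iota> p + \<tau> *\<^sub>R w) * norm y + \<tau> * (m * norm y) + M * norm (\<iota> p) * norm y * \<tau>"
        unfolding rhs_def by linarith
      then show ?thesis by (simp add: algebra_simps)
    qed
  qed (rule that)
  show ?thesis
  proof (rule that[OF u(1)])
    fix y assume y: "y \<in> V"
    let ?y = "(u - p) /\<^sub>R (b - a)"
    have yV: "?y \<in> V" using u p V(1) by (simp add: subspace_diff subspace_scale)
    have "integral {a..b} (flux u (\<iota> ?y) y) = A u y + R ?y y - integral {a..b} (\<lambda>s. g s \<bullet> \<iota> y)"
      unfolding flux_def[abs_def] A_def R_def
      using I u(1) y yV g_integrable[OF y ab(1,3)]
      by (simp add: Henstock_Kurzweil_Integration.integral_add Henstock_Kurzweil_Integration.integral_diff integrable_add)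
    moreover have "\<tau> * R ?y y = R u y - R p y"
    proof -
      have "\<tau> * R ?y y = integral {a..b} (\<lambda>s. \<tau> * (\<iota> ?y \<bullet> Do s y))" by (simp add: R_def)
      also have "\<dots> = integral {a..b} (\<lambda>s. \<iota> u \<bullet> Do s y - \<iota> p \<bullet> Do s y)"
      proof -
        have "\<tau> *\<^sub>R \<iota> ?y = \<iota> u - \<iota> p"
          using \<tau>(1) \<iota>(1) by (simp add: linear_scale linear_diff \<tau>_def)
        then have "\<tau> * (\<iota> ?y \<bullet> h) = \<iota> u \<bullet> h - \<iota> p \<bullet> h" for h
          by (metis inner_diff_left inner_scaleR_left)
        then show ?thesis by simp
      qed
      also have "\<dots> = R u y - R p y" unfolding R_def using I u(1) p y
        by (intro Henstock_Kurzweil_Integration.integral_diff) auto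
      finally show ?thesis .
    qed
    moreover have "\<tau> * ((\<iota> ?y - w) \<bullet> \<iota> y) = \<iota> u \<bullet> \<iota> y - \<iota> p \<bullet> \<iota> y - \<tau> * (w \<bullet> \<iota> y)"
    proof -
      have "\<tau> *\<^sub>R \<iota> ?y = \<iota> u - \<iota> p"
        using \<tau>(1) \<iota>(1) by (simp add: linear_scale linear_diff \<tau>_def)
      then have "\<tau> * (\<iota> ?y \<bullet> \<iota> y) = \<iota> u \<bullet> \<iota> y - \<iota> p \<bullet> \<iota> y"
        by (metis inner_diff_left inner_scaleR_left)
      then show ?thesis by (simp add: inner_diff_left right_diff_distrib)
    qed
    ultimately have "\<tau> * ((\<iota> ?y - w) \<bullet> \<iota> y + integral {a..b} (flux u (\<iota> ?y) y)) = form u y - rhs y"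
      by (simp add: form_def rhs_def distrib_left right_diff_distrib inner_add_left)
    then show "(\<iota> ?y - w) \<bullet> \<iota> y + integral {a..b} (flux u (\<iota> ?y) y) = 0"
      using u(2)[OF y] \<tau>(1) by simp
  qed
qed

section \<open>The discrete energy estimate\<close>

definition "energy t u w = (norm w)\<^sup>2 + u \<bullet> Bo t u"

text \<open>The coefficients that arise in \<open>energy_step\<close>: 4 M |u|^2 and 2 M |p|^2 are
  turned into 4 M / c times the form of \<open>Bo\<close> by coercivity, and (3 M + 1) |v|^2 is
  kinetic.\<close>

definition "gronwall_const = 4 * M / c + 3 * M + 1"

text \<open>The test vector is u - p, that is \<tau> times the new velocity. Both (v - w) . v and u
  . Bo (u - p) dominate half a difference of squares, which is where the implicit scheme pays off.
  \<open>Do_skew\<close> bounds the mixed term by the velocity in the weak norm alone, and the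
  Lipschitz dependence of \<open>Bo\<close> on time costs O(\<tau>).\<close>

lemma energy_step:
  assumes ab: "0 \<le> a" "a < b" "b \<le> T" and p: "p \<in> V" "u \<in> V"
    and eq: "\<And>y. y \<in> V \<Longrightarrow>
      (\<iota> ((u - p) /\<^sub>R (b - a)) - w) \<bullet> \<iota> y + integral {a..b} (flux u (\<iota> ((u - p) /\<^sub>R (b - a))) y) = 0"
  shows "energy b u (\<iota> ((u - p) /\<^sub>R (b - a))) - energy a p w
    \<le> gronwall_const * (b - a) * (energy b u (\<iota> ((u - p) /\<^sub>R (b - a))) + energy a p w)
      + integral {a..b} (\<lambda>s. (norm (g s))\<^sup>2)"
proof -
  define \<tau> where "\<tau> = b - a"
  define y where "y = (u - p) /\<^sub>R \<tau>"
  define v where "v = \<iota> y"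
  have \<tau>: "\<tau> > 0" using ab by (simp add: \<tau>_def)
  have yV: "y \<in> V" using p V(1) by (simp add: y_def subspace_diff subspace_scale)
  have upV: "u - p \<in> V" using p V(1) by (simp add: subspace_diff)
  have up: "u - p = \<tau> *\<^sub>R y" using \<tau> by (simp add: y_def)
  have bT: "b \<in> {0..T}" "a \<in> {0..T}" using ab by auto
  \<comment> \<open>The part of the lower bound for the tested flux that does not depend on s; only
    the forcing stays under the integral.\<close>
  define k where "k = u \<bullet> Bo b u / 2 - p \<bullet> Bo a p / 2 - M * \<tau> * (norm p)\<^sup>2 / 2
      - M * \<tau> * norm u * (norm u + norm p) - \<tau> * M * norm u * norm v - \<tau> * M * (norm v)\<^sup>2 - \<tau> / 2 * (norm v)\<^sup>2"
  have point: "k - \<tau> / 2 * (norm (g s))\<^sup>2 \<le> flux u v (u - p) s" if s: "s \<in> {a..b}" for s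
  proof -
    have sT: "s \<in> {0..T}" using s ab by auto
    have "\<bar>u \<bullet> Bo s (u - p) - u \<bullet> Bo b (u - p)\<bar> \<le> M * \<bar>s - b\<bar> * norm u * norm (u - p)"
      by (rule Bo_lip[OF sT bT(1) p(2) upV])
    also have "\<dots> \<le> M * \<tau> * norm u * (norm u + norm p)"
      using M s \<tau> by (intro mult_mono norm_triangle_ineq4) (auto simp: \<tau>_def)
    finally have 1: "u \<bullet> Bo s (u - p) \<ge> u \<bullet> Bo b (u - p) - M * \<tau> * norm u * (norm u + norm p)" by linarith
    \<comment> \<open>This term is the numerical dissipation of the scheme; discarding it turns u .
      Bo (u - p) into at least half the jump of the quadratic form.\<close>
    have "0 \<le> (u - p) \<bullet> Bo b (u - p)"
      using Bo_coercive[OF bT(1) upV] c by (meson mult_nonneg_nonneg less_imp_le zero_le_power2 order_trans)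
    also have "\<dots> = u \<bullet> Bo b (u - p) - p \<bullet> Bo b (u - p)" by (simp add: inner_diff_left)
    finally have 2: "2 * (u \<bullet> Bo b (u - p)) \<ge> u \<bullet> Bo b u - p \<bullet> Bo b p"
      using linear_form_on_diff[OF Bo_lin[OF bT(1)] p(2,1), of u] linear_form_on_diff[OF Bo_lin[OF bT(1)] p(2,1), of p]
        Bo_sym[OF bT(1) p] by linarith
    have "\<bar>p \<bullet> Bo b p - p \<bullet> Bo a p\<bar> \<le> M * \<bar>b - a\<bar> * norm p * norm p" by (rule Bo_lip[OF bT p(1) p(1)])
    then have 3: "p \<bullet> Bo b p \<le> p \<bullet> Bo a p + M * \<tau> * (norm p)\<^sup>2"
      using ab(2) by (simp add: \<tau>_def power2_eq_square mult_ac)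
    have 4: "u \<bullet> Co s (u - p) \<ge> - (\<tau> * M * norm u * norm v)"
      using Co_bound[OF sT upV, of u] \<tau> \<iota>(1) unfolding up v_def by (simp add: linear_scale mult_ac)
    \<comment> \<open>Since v = \<iota> y, the mixed term takes the form \<iota> y . Do y to which
      skewness applies.\<close>
    have "v \<bullet> Do s (u - p) = \<tau> * (v \<bullet> Do s y)" unfolding up
      by (rule linear_form_on_scale[OF Do_lin[OF sT] V(1) yV])
    also have "\<dots> \<ge> \<tau> * (- M * (norm v)\<^sup>2)" using Do_skew[OF sT yV] \<tau> unfolding v_def by (intro mult_left_mono) auto
    finally have 5: "v \<bullet> Do s (u - p) \<ge> - (\<tau> * M * (norm v)\<^sup>2)" by (simp add: mult_ac)
    have "g s \<bullet> \<iota> (u - p) = \<tau> * (g s \<bullet> v)" unfolding up v_def using \<iota>(1) by (simp add: linear_scale)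
    also have "\<dots> \<le> \<tau> * (((norm (g s))\<^sup>2 + (norm v)\<^sup>2) / 2)"
    proof (intro mult_left_mono)
      have "g s \<bullet> v \<le> norm (g s) * norm v" by (rule norm_cauchy_schwarz)
      moreover have "0 \<le> (norm (g s) - norm v)\<^sup>2" by simp
      ultimately show "g s \<bullet> v \<le> ((norm (g s))\<^sup>2 + (norm v)\<^sup>2) / 2" by (simp add: power2_eq_square algebra_simps)
    qed (use \<tau> in auto)
    finally have 6: "g s \<bullet> \<iota> (u - p) \<le> \<tau> / 2 * (norm (g s))\<^sup>2 + \<tau> / 2 * (norm v)\<^sup>2"
      by (simp add: algebra_simps)
    show ?thesis unfolding flux_def k_def using 1 2 3 4 5 6 by linarith
  qed
  have gi: "(\<lambda>s. (norm (g s))\<^sup>2) integrable_on {a..b}"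
    using integrable_on_subinterval[OF g_int] subset_T ab by auto
  define G where "G = integral {a..b} (\<lambda>s. (norm (g s))\<^sup>2)"
  have "((\<lambda>s. k - \<tau> / 2 * (norm (g s))\<^sup>2) has_integral (k * \<tau> - \<tau> / 2 * G)) {a..b}"
  proof (intro has_integral_diff has_integral_mult_right)
    show "((\<lambda>s. k) has_integral k * \<tau>) {a..b}"
      using has_integral_const_real[of k a b] ab by (simp add: \<tau>_def mult.commute)
    show "((\<lambda>s. (norm (g s))\<^sup>2) has_integral G) {a..b}" unfolding G_def by (rule integrable_integral[OF gi])
  qed
  then have "k * \<tau> - \<tau> / 2 * G \<le> integral {a..b} (flux u v (u - p))"
    using point flux_integrable[OF p(2) yV upV ab(1,3)] unfolding v_def
    by (intro has_integral_le[OF _ integrable_integral]) auto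
  also have "\<dots> = - \<tau> * ((v - w) \<bullet> v)"
  proof -
    have "(v - w) \<bullet> \<iota> (u - p) + integral {a..b} (flux u v (u - p)) = 0"
      using eq[OF upV] unfolding v_def y_def \<tau>_def .
    moreover have "\<iota> (u - p) = \<tau> *\<^sub>R v" unfolding up v_def using \<iota>(1) by (simp add: linear_scale)
    ultimately show ?thesis by simp
  qed
  finally have "\<tau> * (k - G / 2) \<le> \<tau> * (- ((v - w) \<bullet> v))" by (simp add: algebra_simps)
  then have k: "k - G / 2 \<le> - ((v - w) \<bullet> v)" using \<tau> mult_le_cancel_left_pos by blast
  have "2 * ((v - w) \<bullet> v) \<ge> (norm v)\<^sup>2 - (norm w)\<^sup>2"
  proof -
    have "0 \<le> (norm (v - w))\<^sup>2" by simp
    then show ?thesis by (simp add: power2_norm_eq_inner inner_diff_left inner_diff_right inner_commute)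
  qed
  with k have 1: "energy b u v - energy a p w \<le> M * \<tau> * (norm p)\<^sup>2
      + 2 * (M * \<tau> * norm u * (norm u + norm p)) + 2 * (\<tau> * M * norm u * norm v) + 2 * (\<tau> * M * (norm v)\<^sup>2) + \<tau> * (norm v)\<^sup>2 + G"
    unfolding energy_def k_def by (simp add: field_simps)
  have Mt: "M * \<tau> \<ge> 0" using M \<tau> by simp
  have am: "2 * (x * y) \<le> x\<^sup>2 + y\<^sup>2" for x y :: real using sum_squares_bound[of x y] by (simp add: mult.assoc)
  have 2: "M * \<tau> * (2 * (norm u * norm p)) \<le> M * \<tau> * ((norm u)\<^sup>2 + (norm p)\<^sup>2)"
    "M * \<tau> * (2 * (norm u * norm v)) \<le> M * \<tau> * ((norm u)\<^sup>2 + (norm v)\<^sup>2)"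
    using Mt am by (auto intro!: mult_left_mono)
  have "energy b u v - energy a p w \<le> \<tau> * (2 * M * (norm p)\<^sup>2 + 4 * M * (norm u)\<^sup>2 + (3 * M + 1) * (norm v)\<^sup>2) + G"
    using 1 2 by (simp add: algebra_simps power2_eq_square)
  also have "\<dots> \<le> \<tau> * (gronwall_const * (energy b u v + energy a p w)) + G"
  proof -
    have nu: "c * (norm u)\<^sup>2 \<le> u \<bullet> Bo b u" "c * (norm p)\<^sup>2 \<le> p \<bullet> Bo a p" using Bo_coercive bT p by auto
    have 3: "4 * M * (norm u)\<^sup>2 \<le> 4 * M / c * (u \<bullet> Bo b u)"
    proof -
      have "4 * M / c * (c * (norm u)\<^sup>2) \<le> 4 * M / c * (u \<bullet> Bo b u)" using M c nu by (intro mult_left_mono) auto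
      then show ?thesis using c by simp
    qed
    have 4: "2 * M * (norm p)\<^sup>2 \<le> 4 * M / c * (p \<bullet> Bo a p)"
    proof -
      have "4 * M / c * (c * (norm p)\<^sup>2) \<le> 4 * M / c * (p \<bullet> Bo a p)" using M c nu by (intro mult_left_mono) auto
      moreover have "2 * M * (norm p)\<^sup>2 \<le> 4 * M * (norm p)\<^sup>2" using M by (intro mult_right_mono) auto
      ultimately show ?thesis using c by simp
    qed
    have pos: "0 \<le> u \<bullet> Bo b u" "0 \<le> p \<bullet> Bo a p"
      using nu c by (meson mult_nonneg_nonneg less_imp_le zero_le_power2 order_trans)+
    have "2 * M * (norm p)\<^sup>2 + 4 * M * (norm u)\<^sup>2 + (3 * M + 1) * (norm v)\<^sup>2
       \<le> 4 * M / c * (u \<bullet> Bo b u + p \<bullet> Bo a p) + (3 * M + 1) * (norm v)\<^sup>2"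
      using 3 4 by (simp add: distrib_left)
    also have "\<dots> \<le> gronwall_const * (u \<bullet> Bo b u + p \<bullet> Bo a p) + gronwall_const * ((norm v)\<^sup>2 + (norm w)\<^sup>2)"
      using pos M c by (intro add_mono mult_mono) (auto simp: gronwall_const_def)
    finally show ?thesis using \<tau> unfolding energy_def by (intro add_right_mono mult_left_mono) (auto simp: algebra_simps)
  qed
  finally show ?thesis unfolding v_def y_def \<tau>_def[symmetric] G_def by (simp add: mult_ac)
qed

end

text \<open>The new energy also stands on the right and is absorbed by means of x \<le> 1 / 2: (1 +
  x) / (1 - x) \<le> (1 + 2 x) (1 + x) \<le> exp (3 x), and 1 / (1 - x) \<le> 2.\<close>

lemma gronwall_step:
  fixes E E' x G :: real
  assumes "E' - E \<le> x * (E' + E) + G" "0 \<le> x" "x \<le> 1 / 2" "0 \<le> E" "0 \<le> G"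
  shows "E' \<le> exp (3 * x) * E + 2 * G"
proof -
  have le: "1 / (1 - x) \<le> 1 + 2 * x" "1 / (1 - x) \<le> 2"
    using assms(2,3) mult_left_mono[of "2 * x" 1 x] by (auto simp: field_simps)
  have "(1 - x) * E' \<le> (1 + x) * E + G" using assms(1) by (simp add: algebra_simps)
  then have "E' \<le> ((1 + x) * E + G) / (1 - x)" using assms(3) by (simp add: pos_le_divide_eq mult.commute)
  also have "\<dots> = 1 / (1 - x) * ((1 + x) * E) + 1 / (1 - x) * G" by (simp add: add_divide_distrib)
  also have "\<dots> \<le> (1 + 2 * x) * ((1 + x) * E) + 2 * G" using le assms by (intro add_mono mult_right_mono) auto
  also have "\<dots> \<le> (exp (2 * x) * exp x) * E + 2 * G"
    using assms(2,4) exp_ge_add_one_self[of x] exp_ge_add_one_self[of "2 * x"]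
    by (auto simp: mult.assoc intro!: mult_mono)
  also have "exp (2 * x) * exp x = exp (3 * x)" by (simp flip: exp_add)
  finally show ?thesis .
qed

context hyperbolic_system
begin

text \<open>Dependent choice on pairs (displacement, velocity): the velocity belongs to the state
  because the initial one is not a difference quotient. From index \<open>n\<close> on the recursion
  demands nothing but membership in \<open>V\<close>, which keeps the sequences total.\<close>

lemma discrete_solution:
  assumes n: "n > 0" and sm: "small (T / real n)"
  obtains U W where "U 0 = u0" "W 0 = w1" "\<And>j. U j \<in> V"
    "\<And>j. j < n \<Longrightarrow> W (Suc j) = \<iota> ((U (Suc j) - U j) /\<^sub>R (T / real n))"
    "\<And>j y. j < n \<Longrightarrow> y \<in> V \<Longrightarrow> (W (Suc j) - W j) \<bullet> \<iota> y
       + integral {real j * (T / real n)..real (Suc j) * (T / real n)} (flux (U (Suc j)) (W (Suc j)) y) = 0"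
proof -
  define \<tau> where "\<tau> = T / real n"
  let ?Q = "\<lambda>j (p, w) (u, v). j < n \<longrightarrow> v = \<iota> ((u - p) /\<^sub>R \<tau>) \<and>
     (\<forall>y\<in>V. (v - w) \<bullet> \<iota> y + integral {real j * \<tau>..real (Suc j) * \<tau>} (flux u v y) = 0)"
  let ?P = "\<lambda>j (u, w). u \<in> V \<and> (j = (0::nat) \<longrightarrow> u = u0 \<and> w = w1)"
  have \<tau>: "\<tau> > 0" using n T by (simp add: \<tau>_def)
  have "\<exists>f. \<forall>j. ?P j (f j) \<and> ?Q j (f j) (f (Suc j))"
  proof (rule dependent_nat_choice)
    show "\<exists>x. ?P 0 x" using u0 by auto
    fix x j assume x: "?P j x"
    obtain p w where pw: "x = (p, w)" by (cases x)
    have p: "p \<in> V" using x pw by auto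
    show "\<exists>y. ?P (Suc j) y \<and> ?Q j x y"
    proof (cases "j < n")
      case True
      have d: "real (Suc j) * \<tau> - real j * \<tau> = \<tau>" by (simp add: algebra_simps)
      have "real (Suc j) * \<tau> \<le> real n * \<tau>" using True \<tau> by (intro mult_right_mono) auto
      then have "real (Suc j) * \<tau> \<le> T" using n by (simp add: \<tau>_def)
      moreover have "real j * \<tau> < real (Suc j) * \<tau>" using \<tau> by simp
      moreover have "0 \<le> real j * \<tau>" using \<tau> by simp
      ultimately obtain u where "u \<in> V" "\<And>y. y \<in> V \<Longrightarrow>
          (\<iota> ((u - p) /\<^sub>R \<tau>) - w) \<bullet> \<iota> y + integral {real j * \<tau>..real (Suc j) * \<tau>} (flux u (\<iota> ((u - p) /\<^sub>R \<tau>)) y) = 0"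
        using implicit_step[of "real j * \<tau>" "real (Suc j) * \<tau>" p w] sm p unfolding d \<tau>_def[symmetric] by blast
      then show ?thesis using pw by (intro exI[of _ "(u, \<iota> ((u - p) /\<^sub>R \<tau>))"]) auto
    qed (use p pw in auto)
  qed
  then obtain f where f0: "\<forall>j. ?P j (f j) \<and> ?Q j (f j) (f (Suc j))" by (rule exE)
  have f: "?P j (f j)" "?Q j (f j) (f (Suc j))" for j using f0[THEN spec, of j] by (rule conjunct1, rule conjunct2)
  show ?thesis
  proof (rule that[of "\<lambda>j. fst (f j)" "\<lambda>j. snd (f j)"])
    show "fst (f 0) = u0" "snd (f 0) = w1" using f(1)[of 0] by (auto simp: case_prod_beta)
    show "fst (f j) \<in> V" for j using f(1)[of j] by (auto simp: case_prod_beta)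
    show "snd (f (Suc j)) = \<iota> ((fst (f (Suc j)) - fst (f j)) /\<^sub>R (T / real n))" if "j < n" for j
      using f(2)[of j] that by (simp add: case_prod_beta \<tau>_def)
    show "(snd (f (Suc j)) - snd (f j)) \<bullet> \<iota> y + integral {real j * (T / real n)..real (Suc j) * (T / real n)}
        (flux (fst (f (Suc j))) (snd (f (Suc j))) y) = 0" if "j < n" "y \<in> V" for j y
      using f(2)[of j] that unfolding case_prod_beta \<tau>_def[symmetric] by blast
  qed
qed

definition "energy_bound = exp (3 * gronwall_const * T) *
  (energy 0 u0 w1 + 2 * integral {0..T} (\<lambda>s. (norm (g s))\<^sup>2))"

lemma gronwall_const_pos: "gronwall_const > 0"
proof -
  have "0 \<le> 4 * M / c" using M c by simp
  then show ?thesis unfolding gronwall_const_def using M by linarith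
qed

lemma energy_nonneg: "t \<in> {0..T} \<Longrightarrow> u \<in> V \<Longrightarrow> 0 \<le> energy t u w"
  unfolding energy_def using Bo_coercive[of t u] c
  by (smt (verit) mult_nonneg_nonneg zero_le_power2)

text \<open>Iterating the Gronwall step gives the factor exp (3 x j), and j \<tau> \<le> T makes it
  independent of \<open>n\<close>. The forcing accumulates additively because each new contribution
  may be multiplied by a factor of at least 1.\<close>

lemma discrete_energy_bound:
  assumes n: "n > 0" and K: "gronwall_const * (T / real n) \<le> 1 / 2"
    and U: "U 0 = u0" "W 0 = w1" "\<And>j. U j \<in> V"
    and W: "\<And>j. j < n \<Longrightarrow> W (Suc j) = \<iota> ((U (Suc j) - U j) /\<^sub>R (T / real n))"
    and eq: "\<And>j y. j < n \<Longrightarrow> y \<in> V \<Longrightarrow> (W (Suc j) - W j) \<bullet> \<iota> y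
       + integral {real j * (T / real n)..real (Suc j) * (T / real n)} (flux (U (Suc j)) (W (Suc j)) y) = 0"
    and j: "j \<le> n"
  shows "energy (real j * (T / real n)) (U j) (W j) \<le> energy_bound"
proof -
  define \<tau> where "\<tau> = T / real n"
  define x where "x = gronwall_const * \<tau>"
  define I where "I t = integral {0..t} (\<lambda>s. (norm (g s))\<^sup>2)" for t
  have \<tau>: "\<tau> > 0" using n T by (simp add: \<tau>_def)
  have x: "0 \<le> x" "x \<le> 1 / 2" using K gronwall_const_pos \<tau> by (auto simp: x_def \<tau>_def[symmetric])
  have tle: "real k * \<tau> \<le> T" "0 \<le> real k * \<tau>" if "k \<le> n" for k
  proof -
    have "real k * \<tau> \<le> real n * \<tau>" using that \<tau> by (intro mult_right_mono) auto
    then show "real k * \<tau> \<le> T" using n by (simp add: \<tau>_def)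
    show "0 \<le> real k * \<tau>" using \<tau> by simp
  qed
  have gi: "(\<lambda>s. (norm (g s))\<^sup>2) integrable_on {a..b}" if "0 \<le> a" "b \<le> T" for a b
    using integrable_on_subinterval[OF g_int] subset_T that by auto
  have Inn: "0 \<le> integral {a..b} (\<lambda>s. (norm (g s))\<^sup>2)" if "0 \<le> a" "b \<le> T" for a b
    using gi[OF that] by (rule Henstock_Kurzweil_Integration.integral_nonneg) auto
  have "energy (real j * \<tau>) (U j) (W j) \<le> exp (3 * x * real j) * (energy 0 u0 w1 + 2 * I (real j * \<tau>))"
    using j
  proof (induction j)
    case 0 show ?case by (simp add: U I_def)
  next
    case (Suc k)
    let ?a = "real k * \<tau>" and ?b = "real (Suc k) * \<tau>"
    let ?G = "integral {?a..?b} (\<lambda>s. (norm (g s))\<^sup>2)"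
    have d: "?b - ?a = \<tau>" by (simp add: algebra_simps)
    have k: "k < n" using Suc by simp
    have ab: "0 \<le> ?a" "?a < ?b" "?b \<le> T" using tle[of k] tle[of "Suc k"] Suc \<tau> by auto
    have Weq: "\<iota> ((U (Suc k) - U k) /\<^sub>R \<tau>) = W (Suc k)" using W[OF k] by (simp add: \<tau>_def)
    have "energy ?b (U (Suc k)) (W (Suc k)) - energy ?a (U k) (W k)
      \<le> x * (energy ?b (U (Suc k)) (W (Suc k)) + energy ?a (U k) (W k)) + ?G"
      using energy_step[OF ab U(3)[of k] U(3)[of "Suc k"], of "W k"] eq[OF k]
      unfolding d Weq x_def \<tau>_def[symmetric] by blast
    then have "energy ?b (U (Suc k)) (W (Suc k)) \<le> exp (3 * x) * energy ?a (U k) (W k) + 2 * ?G"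
      by (rule gronwall_step[OF _ x]) (use energy_nonneg[of ?a "U k"] ab U Inn in auto)
    also have "\<dots> \<le> exp (3 * x) * (exp (3 * x * real k) * (energy 0 u0 w1 + 2 * I ?a)) + exp (3 * x * real (Suc k)) * (2 * ?G)"
    proof (intro add_mono mult_left_mono)
      show "energy ?a (U k) (W k) \<le> exp (3 * x * real k) * (energy 0 u0 w1 + 2 * I ?a)" using Suc by simp
      have "1 * (2 * ?G) \<le> exp (3 * x * real (Suc k)) * (2 * ?G)" using x Inn[OF ab(1,3)] by (intro mult_right_mono) auto
      then show "2 * ?G \<le> exp (3 * x * real (Suc k)) * (2 * ?G)" by simp
    qed auto
    also have "\<dots> = exp (3 * x * real (Suc k)) * (energy 0 u0 w1 + 2 * (I ?a + ?G))"
      by (simp add: algebra_simps exp_add)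
    also have "I ?a + ?G = I ?b" unfolding I_def
      using ab gi by (intro Henstock_Kurzweil_Integration.integral_combine) auto
    finally show ?case .
  qed
  also have "\<dots> \<le> exp (3 * gronwall_const * T) * (energy 0 u0 w1 + 2 * I T)"
  proof (intro mult_mono add_left_mono mult_left_mono)
    have "x * real j \<le> gronwall_const * T"
      using tle[OF j] gronwall_const_pos by (simp add: x_def mult.assoc mult.commute[of \<tau>])
    then show "exp (3 * x * real j) \<le> exp (3 * gronwall_const * T)" by simp
    show "I (real j * \<tau>) \<le> I T" unfolding I_def
      using tle[OF j] gi T by (intro integral_subset_le) auto
    show "0 \<le> energy 0 u0 w1 + 2 * I (real j * \<tau>)"
      using energy_nonneg[of 0 u0 w1] u0 T Inn[of 0, OF _ tle(1)[OF j]] by (simp add: I_def)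
  qed (use Inn[of 0, OF _ tle(1)[OF j]] in \<open>auto simp: I_def\<close>)
  finally show ?thesis by (simp add: energy_bound_def I_def \<tau>_def)
qed

text \<open>A sum, so that one constant bounds both displacement and velocity.\<close>

definition "sol_bound = sqrt energy_bound + sqrt (energy_bound / c)"

lemma energy_bound_imp:
  assumes "energy t u w \<le> energy_bound" "t \<in> {0..T}" "u \<in> V"
  shows "norm u \<le> sol_bound" "norm w \<le> sol_bound"
proof -
  have "c * (norm u)\<^sup>2 \<le> u \<bullet> Bo t u" using Bo_coercive assms by auto
  moreover have "0 \<le> c * (norm u)\<^sup>2" using c by simp
  ultimately have 1: "(norm w)\<^sup>2 \<le> energy_bound" "c * (norm u)\<^sup>2 \<le> energy_bound" "0 \<le> energy_bound"
    using assms(1) zero_le_power2[of "norm w"] unfolding energy_def by linarith+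
  have "norm w \<le> sqrt energy_bound" using 1(1) by (rule real_le_rsqrt)
  moreover have "norm u \<le> sqrt (energy_bound / c)"
    using 1(2) c by (intro real_le_rsqrt) (simp add: pos_le_divide_eq mult.commute)
  moreover have "0 \<le> sqrt energy_bound" "0 \<le> sqrt (energy_bound / c)" using 1(3) c by auto
  ultimately show "norm u \<le> sol_bound" "norm w \<le> sol_bound" unfolding sol_bound_def by linarith+
qed

section \<open>Piecewise constant interpolation in time\<close>

text \<open>The first grid point at or after t. Rounding up matches backward Euler: during a step
  the interpolant has the value computed for the right end of the step.\<close>

definition "grid_up n t = real (nat \<lceil>t * real n / T\<rceil>) * (T / real n)"

lemma grid_up:
  assumes n: "n > 0" and t: "t \<in> {0..T}"
  shows "nat \<lceil>t * real n / T\<rceil> \<le> n" "t \<le> grid_up n t" "grid_up n t \<le> t + T / real n" "grid_up n t \<in> {0..T}"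
proof -
  have nn: "0 \<le> t * real n / T" using t T by simp
  have "t * real n \<le> T * real n" using t by (intro mult_right_mono) auto
  then have "t * real n / T \<le> real n" using T by (simp add: divide_le_eq mult.commute)
  then have "\<lceil>t * real n / T\<rceil> \<le> int n" by (simp add: ceiling_le_iff)
  then show le: "nat \<lceil>t * real n / T\<rceil> \<le> n" by linarith
  have r: "real (nat \<lceil>t * real n / T\<rceil>) = of_int \<lceil>t * real n / T\<rceil>" using nn by simp
  have "t * real n / T * (T / real n) \<le> grid_up n t" unfolding grid_up_def r
    using T n by (intro mult_right_mono) auto
  then show 1: "t \<le> grid_up n t" using T n by simp
  have "grid_up n t \<le> (t * real n / T + 1) * (T / real n)" unfolding grid_up_def r
    using T n of_int_ceiling_le_add_one by (intro mult_right_mono) auto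
  then show "grid_up n t \<le> t + T / real n" using T n by (simp add: add_divide_distrib distrib_right)
  have "grid_up n t \<le> real n * (T / real n)" unfolding grid_up_def using le T by (intro mult_right_mono) auto
  then show "grid_up n t \<in> {0..T}" using 1 t n by auto
qed

text \<open>Between grid points both equations are exact integral identities, because the velocity
  is a difference quotient and each step integrates the flux with its states frozen. Only the
  rounding of the end points remains to be controlled in the limit.\<close>

lemma step_approximation:
  assumes n: "n > 0" and sm: "small (T / real n)" and K: "gronwall_const * (T / real n) \<le> 1 / 2"
  obtains uu ww where "uu 0 = u0" "ww 0 = w1"
    "\<And>t. t \<in> {0..T} \<Longrightarrow> uu t \<in> V \<and> ww t \<in> closure (\<iota> ` V) \<and> norm (uu t) \<le> sol_bound \<and> norm (ww t) \<le> sol_bound"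
    "\<And>s t h. s \<in> {0..T} \<Longrightarrow> t \<in> {0..T} \<Longrightarrow> s \<le> t \<Longrightarrow>
      ((\<lambda>r. ww r \<bullet> h) has_integral (\<iota> (uu t) \<bullet> h - \<iota> (uu s) \<bullet> h)) {grid_up n s..grid_up n t}"
    "\<And>s t y. s \<in> {0..T} \<Longrightarrow> t \<in> {0..T} \<Longrightarrow> s \<le> t \<Longrightarrow> y \<in> V \<Longrightarrow>
      ((\<lambda>r. - flux (uu r) (ww r) y r) has_integral (ww t \<bullet> \<iota> y - ww s \<bullet> \<iota> y)) {grid_up n s..grid_up n t}"
proof -
  obtain U W where U: "U 0 = u0" "W 0 = w1" "\<And>j. U j \<in> V"
    and W: "\<And>j. j < n \<Longrightarrow> W (Suc j) = \<iota> ((U (Suc j) - U j) /\<^sub>R (T / real n))"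
    and eq: "\<And>j y. j < n \<Longrightarrow> y \<in> V \<Longrightarrow> (W (Suc j) - W j) \<bullet> \<iota> y
       + integral {real j * (T / real n)..real (Suc j) * (T / real n)} (flux (U (Suc j)) (W (Suc j)) y) = 0"
    using discrete_solution[OF n sm] by blast
  define \<tau> where "\<tau> = T / real n"
  have \<tau>: "\<tau> > 0" using n T by (simp add: \<tau>_def)
  define J where "J t = nat \<lceil>t * real n / T\<rceil>" for t
  have gJ: "grid_up n t = real (J t) * \<tau>" for t by (simp add: grid_up_def J_def \<tau>_def)
  have Jn: "J t \<le> n" if "t \<in> {0..T}" for t using grid_up(1)[OF n that] by (simp add: J_def)
  have Jmono: "J s \<le> J t" if "s \<le> t" for s t
    unfolding J_def using that T by (intro nat_mono ceiling_mono divide_right_mono mult_right_mono) auto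
  \<comment> \<open>At the left end of a step \<open>J\<close> still has the old value; this single
    point is removed as a spike below.\<close>
  have Jint: "J r = Suc k" if "r \<in> {real k * \<tau>..real (Suc k) * \<tau>} - {real k * \<tau>}" for r k
  proof -
    have "real k * \<tau> < r" "r \<le> (real k + 1) * \<tau>" using that by (auto simp: add.commute)
    then have "real k < r / \<tau>" "r / \<tau> \<le> real k + 1" using \<tau> by (auto simp: pos_less_divide_eq pos_divide_le_eq)
    moreover have "r / \<tau> = r * real n / T" by (simp add: \<tau>_def)
    ultimately have "\<lceil>r * real n / T\<rceil> = int k + 1" by (intro ceiling_unique) auto
    then show ?thesis by (simp add: J_def nat_add_distrib)
  qed
  have tT: "real k * \<tau> \<in> {0..T}" if "k \<le> n" for k
  proof -
    have "real k * \<tau> \<le> real n * \<tau>" using that \<tau> by (intro mult_right_mono) auto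
    moreover have "real n * \<tau> = T" using n by (simp add: \<tau>_def)
    ultimately show "real k * \<tau> \<in> {0..T}" using \<tau> by simp
  qed
  have bnd: "norm (U j) \<le> sol_bound" "norm (W j) \<le> sol_bound" if "j \<le> n" for j
    using energy_bound_imp[OF discrete_energy_bound[OF n K U W eq that] _ U(3)] tT[OF that] by (auto simp: \<tau>_def)
  have Wcl: "W j \<in> closure (\<iota> ` V)" if "j \<le> n" for j
  proof (cases j)
    case 0 then show ?thesis using w1 U by simp
  next
    case (Suc k)
    have "(U (Suc k) - U k) /\<^sub>R (T / real n) \<in> V" using U(3) V(1) by (intro subspace_scale subspace_diff) auto
    then show ?thesis using W[of k] Suc that closure_subset by fastforce
  qed
  show ?thesis
  proof (rule that[of "\<lambda>t. U (J t)" "\<lambda>t. W (J t)"])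
    show "U (J 0) = u0" "W (J 0) = w1" using U by (auto simp: J_def)
    show "U (J t) \<in> V \<and> W (J t) \<in> closure (\<iota> ` V) \<and> norm (U (J t)) \<le> sol_bound \<and> norm (W (J t)) \<le> sol_bound"
      if "t \<in> {0..T}" for t using U(3) Wcl bnd Jn[OF that] by auto
    show "((\<lambda>r. W (J r) \<bullet> h) has_integral (\<iota> (U (J t)) \<bullet> h - \<iota> (U (J s)) \<bullet> h)) {grid_up n s..grid_up n t}"
      if st: "s \<in> {0..T}" "t \<in> {0..T}" "s \<le> t" for s t h
      unfolding gJ
    proof (rule has_integral_grid[where X="\<lambda>j. \<iota> (U j) \<bullet> h"])
      fix k assume "k < J t"
      then have k: "k < n" using Jn[OF st(2)] by simp
      have "\<tau> * (W (Suc k) \<bullet> h) = \<iota> (U (Suc k)) \<bullet> h - \<iota> (U k) \<bullet> h"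
      proof -
        have "\<tau> *\<^sub>R W (Suc k) = \<iota> (U (Suc k)) - \<iota> (U k)"
          using W[OF k] \<iota>(1) \<tau> by (simp add: linear_scale linear_diff \<tau>_def[symmetric])
        then show ?thesis by (metis inner_diff_left inner_scaleR_left)
      qed
      moreover have "((\<lambda>r. W (Suc k) \<bullet> h) has_integral \<tau> * (W (Suc k) \<bullet> h)) {real k * \<tau>..real (Suc k) * \<tau>}"
        using has_integral_const_real[of "W (Suc k) \<bullet> h" "real k * \<tau>" "real (Suc k) * \<tau>"] \<tau> by (simp add: algebra_simps)
      ultimately have h: "((\<lambda>r. W (Suc k) \<bullet> h) has_integral (\<iota> (U (Suc k)) \<bullet> h - \<iota> (U k) \<bullet> h)) {real k * \<tau>..real (Suc k) * \<tau>}"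
        by (simp only:)
      show "((\<lambda>r. W (J r) \<bullet> h) has_integral (\<iota> (U (Suc k)) \<bullet> h - \<iota> (U k) \<bullet> h)) {real k * \<tau>..real (Suc k) * \<tau>}"
      proof (rule has_integral_spike_finite[OF _ _ h])
        show "W (J r) \<bullet> h = W (Suc k) \<bullet> h" if "r \<in> {real k * \<tau>..real (Suc k) * \<tau>} - {real k * \<tau>}" for r
          using Jint[OF that] by simp
      qed simp
    qed (use \<tau> Jmono[OF st(3)] in auto)
    show "((\<lambda>r. - flux (U (J r)) (W (J r)) y r) has_integral (W (J t) \<bullet> \<iota> y - W (J s) \<bullet> \<iota> y)) {grid_up n s..grid_up n t}"
      if st: "s \<in> {0..T}" "t \<in> {0..T}" "s \<le> t" "y \<in> V" for s t y
      unfolding gJ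
    proof (rule has_integral_grid[where X="\<lambda>j. W j \<bullet> \<iota> y"])
      fix k assume "k < J t"
      then have k: "k < n" using Jn[OF st(2)] by simp
      let ?I = "{real k * \<tau>..real (Suc k) * \<tau>}"
      have yV: "(U (Suc k) - U k) /\<^sub>R (T / real n) \<in> V" using U(3) V(1) by (intro subspace_scale subspace_diff) auto
      have "flux (U (Suc k)) (W (Suc k)) y integrable_on ?I"
        unfolding W[OF k] using tT[of k] tT[of "Suc k"] k by (intro flux_integrable U yV st) auto
      then have "((\<lambda>r. - flux (U (Suc k)) (W (Suc k)) y r) has_integral - integral ?I (flux (U (Suc k)) (W (Suc k)) y)) ?I"
        by (intro has_integral_neg integrable_integral)
      moreover have "- integral ?I (flux (U (Suc k)) (W (Suc k)) y) = W (Suc k) \<bullet> \<iota> y - W k \<bullet> \<iota> y"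
        using eq[OF k st(4)] by (simp add: \<tau>_def inner_diff_left)
      ultimately have h: "((\<lambda>r. - flux (U (Suc k)) (W (Suc k)) y r) has_integral (W (Suc k) \<bullet> \<iota> y - W k \<bullet> \<iota> y)) ?I"
        by (simp only:)
      show "((\<lambda>r. - flux (U (J r)) (W (J r)) y r) has_integral (W (Suc k) \<bullet> \<iota> y - W k \<bullet> \<iota> y)) ?I"
      proof (rule has_integral_spike_finite[OF _ _ h])
        show "- flux (U (J r)) (W (J r)) y r = - flux (U (Suc k)) (W (Suc k)) y r" if "r \<in> ?I - {real k * \<tau>}" for r
          using Jint[OF that] by simp
      qed simp
    qed (use \<tau> Jmono[OF st(3)] in auto)
  qed
qed

end

section \<open>Passage to the limit in the scheme\<close>

text \<open>The intervals of integration vary with n. Dominated convergence handles {0..t}, and the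
  excess up to \<open>\<theta> n\<close> is at most \<kappa> (\<theta> n) - \<kappa> t for the
  continuous primitive \<kappa> of the majorant.\<close>

lemma has_integral_dominated_limit:
  fixes f :: "nat \<Rightarrow> real \<Rightarrow> real"
  assumes t: "0 \<le> t" "\<And>n. t \<le> \<theta> n" "\<And>n. \<theta> n \<le> T" "\<theta> \<longlonglongrightarrow> t"
    and k: "k integrable_on {0..T}" "\<And>n s. s \<in> {0..T} \<Longrightarrow> \<bar>f n s\<bar> \<le> k s"
    and conv: "\<And>s. s \<in> {0..T} \<Longrightarrow> (\<lambda>n. f n s) \<longlonglongrightarrow> f' s"
    and int: "\<And>n. (f n has_integral L n) {0..\<theta> n}" and L: "L \<longlonglongrightarrow> L'"
  shows "(f' has_integral L') {0..t}"
proof -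
  have tT: "t \<le> T" using t(2)[of 0] t(3)[of 0] by linarith
  define \<kappa> where "\<kappa> r = integral {0..r} k" for r
  have \<kappa>: "continuous_on {0..T} \<kappa>" unfolding \<kappa>_def using k(1) by (rule indefinite_integral_continuous_1)
  have ki: "k integrable_on {a..b}" if "0 \<le> a" "b \<le> T" for a b
    using integrable_on_subinterval[OF k(1)] that by auto
  have fi: "f n integrable_on {a..b}" if "0 \<le> a" "b \<le> \<theta> n" for n a b
    using integrable_on_subinterval[OF has_integral_integrable[OF int[of n]]] that by auto
  have dct: "f' integrable_on {0..t}" "(\<lambda>n. integral {0..t} (f n)) \<longlonglongrightarrow> integral {0..t} f'"
    using dominated_convergence[of f "{0..t}" k f'] fi t(2) ki tT k(2) conv by auto
  have "(\<lambda>n. \<kappa> (\<theta> n)) \<longlonglongrightarrow> \<kappa> t"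
    using continuous_on_tendsto_compose[OF \<kappa> t(4)] t tT order_trans[OF t(1) t(2)] by auto
  then have k0: "(\<lambda>n. \<kappa> (\<theta> n) - \<kappa> t) \<longlonglongrightarrow> 0" by (simp add: LIM_zero)
  have "(\<lambda>n. L n - integral {0..t} (f n)) \<longlonglongrightarrow> 0"
  proof (rule Lim_null_comparison[OF _ k0], intro always_eventually allI)
    fix n
    have "integral {0..t} (f n) + integral {t..\<theta> n} (f n) = integral {0..\<theta> n} (f n)"
      using t fi[of 0 "\<theta> n" n] by (intro Henstock_Kurzweil_Integration.integral_combine) auto
    then have "L n - integral {0..t} (f n) = integral {t..\<theta> n} (f n)" using integral_unique[OF int[of n]] by simp
    moreover have "norm (integral {t..\<theta> n} (f n)) \<le> integral {t..\<theta> n} k"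
      using t fi ki k(2) order_trans[OF _ t(3)]
      by (intro Henstock_Kurzweil_Integration.integral_norm_bound_integral) auto
    moreover have "\<kappa> t + integral {t..\<theta> n} k = \<kappa> (\<theta> n)"
      unfolding \<kappa>_def using t ki[of 0 "\<theta> n"] by (intro Henstock_Kurzweil_Integration.integral_combine) auto
    ultimately show "norm (L n - integral {0..t} (f n)) \<le> \<kappa> (\<theta> n) - \<kappa> t" by simp
  qed
  then have "(\<lambda>n. L n - (L n - integral {0..t} (f n))) \<longlonglongrightarrow> L' - 0" by (intro tendsto_diff L)
  then have "integral {0..t} f' = L'" using LIMSEQ_unique[OF dct(2)] by simp
  then show ?thesis using dct(1) by (simp add: has_integral_integrable_integral)
qed

lemma subspace_closure:
  fixes S :: "'a::real_normed_vector set"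
  assumes "subspace S" shows "subspace (closure S)"
proof (rule subspaceI)
  show "0 \<in> closure S" using subspace_0[OF assms] closure_subset by blast
  fix x y c assume x: "x \<in> closure S"
  obtain a where a: "\<And>n. a n \<in> S" "a \<longlonglongrightarrow> x" using x by (auto simp: closure_sequential)
  show "c *\<^sub>R x \<in> closure S"
    unfolding closure_sequential using a subspace_scale[OF assms] by (intro exI[of _ "\<lambda>n. c *\<^sub>R a n"]) (auto intro: tendsto_intros)
  assume y: "y \<in> closure S"
  obtain b where b: "\<And>n. b n \<in> S" "b \<longlonglongrightarrow> y" using y by (auto simp: closure_sequential)
  show "x + y \<in> closure S"
    unfolding closure_sequential using a b subspace_add[OF assms] by (intro exI[of _ "\<lambda>n. a n + b n"]) (auto intro: tendsto_intros)
qed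

context hyperbolic_system
begin

lemma closed_range_closure: "subspace (closure (\<iota> ` V))" "closed (closure (\<iota> ` V))"
  using V(1) \<iota>(1) by (auto intro!: subspace_closure linear_subspace_image)

text \<open>In effect the adjoint of \<open>\<iota>\<close> on \<open>V\<close>: products of
  embedded vectors become products in \<open>V\<close>, so weak convergence in \<open>V\<close> is
  inherited by the images.\<close>

lemma iota_riesz:
  obtains z where "z \<in> V" "\<And>v. v \<in> V \<Longrightarrow> \<iota> v \<bullet> h = v \<bullet> z"
proof -
  have "\<bar>\<iota> v \<bullet> h\<bar> \<le> norm h * norm v" for v
    using order_trans[OF Cauchy_Schwarz_ineq2[of "\<iota> v" h] mult_right_mono[OF \<iota>(2) norm_ge_zero]] by (simp add: mult.commute)
  then show ?thesis
    using riesz_representation_on[OF V linear_form_on_inner_linear(2)[OF \<iota>(1), of V h], of "norm h"] that by metis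
qed

text \<open>Injectivity of \<open>\<iota>\<close> lifts weak convergence of the images to
  \<open>V\<close>. If d in \<open>V\<close> is orthogonal to all admissible test vectors of
  \<open>V\<close>, it is orthogonal to the adjoint image of \<iota> d, which is admissible by
  hypothesis; hence |\<iota> d|^2 = 0.\<close>

lemma weak_limit_V:
  assumes x: "\<And>n. x n \<in> V" "\<And>n. norm (x n) \<le> K" and conv: "\<And>h. convergent (\<lambda>n. \<iota> (x n) \<bullet> h)"
  obtains z where "z \<in> V" "norm z \<le> K" "\<And>y. (\<lambda>n. x n \<bullet> y) \<longlonglongrightarrow> z \<bullet> y"
proof -
  let ?Y = "V \<inter> {y. convergent (\<lambda>n. x n \<bullet> y)}"
  have Y: "subspace ?Y" "closed ?Y"
    using closed_subspace_convergent_inner[OF x(2)] V by (auto intro: subspace_inter)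
  have "y \<in> ?Y" if y: "y \<in> V" for y
  proof -
    obtain p where p: "p \<in> ?Y" "\<And>z. z \<in> ?Y \<Longrightarrow> z \<bullet> y = z \<bullet> p" using orthogonal_projection_on[OF Y] by metis
    define d where "d = y - p"
    have dV: "d \<in> V" using p(1) y V(1) by (auto simp: d_def subspace_diff)
    obtain r where r: "r \<in> V" "\<And>v. v \<in> V \<Longrightarrow> \<iota> v \<bullet> \<iota> d = v \<bullet> r"
      using iota_riesz by metis
    have "(\<lambda>n. x n \<bullet> r) = (\<lambda>n. \<iota> (x n) \<bullet> \<iota> d)" using r(2) x(1) by auto
    then have "r \<in> ?Y" using conv r(1) by auto
    then have "r \<bullet> d = 0" using p(2) by (simp add: d_def inner_diff_right)
    then have "\<iota> d \<bullet> \<iota> d = 0" using r(2)[OF dV] by (simp add: inner_commute)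
    then have "d = 0" using \<iota>(3)[OF dV] by simp
    then show ?thesis using p(1) by (simp add: d_def)
  qed
  then show ?thesis using weak_limit_exists[of x K, OF x(2) V x(1)] that by blast
qed

lemma weak_limit_H:
  assumes x: "\<And>n. x n \<in> closure (\<iota> ` V)" "\<And>n. norm (x n) \<le> K"
    and conv: "\<And>y. y \<in> V \<Longrightarrow> convergent (\<lambda>n. x n \<bullet> \<iota> y)"
  obtains z where "z \<in> closure (\<iota> ` V)" "norm z \<le> K" "\<And>y. (\<lambda>n. x n \<bullet> y) \<longlonglongrightarrow> z \<bullet> y"
proof -
  have "closure (\<iota> ` V) \<subseteq> {y. convergent (\<lambda>n. x n \<bullet> y)}"
    using conv by (intro closure_minimal closed_subspace_convergent_inner[OF x(2)]) auto
  then have "convergent (\<lambda>n. x n \<bullet> y)" if "y \<in> closure (\<iota> ` V)" for y using that by auto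
  then show ?thesis using weak_limit_exists[of x K, OF x(2) closed_range_closure x(1)] that by blast
qed

lemma eq_of_inner_V:
  assumes "u \<in> V" "v \<in> V" "\<And>h. \<iota> u \<bullet> h = \<iota> v \<bullet> h" shows "u = v"
proof -
  have "\<iota> (u - v) \<bullet> \<iota> (u - v) = 0"
    using assms(3)[of "\<iota> (u - v)"] \<iota>(1) by (simp add: linear_diff inner_diff_left)
  then show ?thesis using \<iota>(3)[of "u - v"] assms V(1) by (simp add: subspace_diff)
qed

lemma eq_of_inner_H:
  assumes "u \<in> closure (\<iota> ` V)" "v \<in> closure (\<iota> ` V)" "\<And>y. y \<in> V \<Longrightarrow> u \<bullet> \<iota> y = v \<bullet> \<iota> y" shows "u = v"
proof -
  have "closure (\<iota> ` V) \<subseteq> {h. (u - v) \<bullet> h = 0}"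
    using assms(3) by (intro closure_minimal closed_hyperplane) (auto simp: inner_diff_left)
  moreover have "u - v \<in> closure (\<iota> ` V)" using assms closed_range_closure(1) by (simp add: subspace_diff)
  ultimately have "(u - v) \<bullet> (u - v) = 0" by blast
  then show ?thesis by simp
qed

lemma flux_bound:
  assumes s: "s \<in> {0..T}" and y: "y \<in> V" and "norm u \<le> K" "norm w \<le> K"
  shows "\<bar>flux u w y s\<bar> \<le> (3 * M * K + 1 + (norm (g s))\<^sup>2) * norm y"
proof -
  have K: "0 \<le> K" using assms(3) norm_ge_zero order_trans by blast
  have "\<bar>u \<bullet> Bo s y\<bar> \<le> M * K * norm y"
    by (rule order_trans[OF Bo_bound[OF s y]]) (use M assms in \<open>auto intro!: mult_right_mono mult_left_mono\<close>)
  moreover have "\<bar>u \<bullet> Co s y\<bar> \<le> M * K * norm y"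
    by (rule order_trans[OF Co_bound[OF s y]]) (use M assms K \<iota>(2) in \<open>auto intro!: mult_mono\<close>)
  moreover have "\<bar>w \<bullet> Do s y\<bar> \<le> M * K * norm y"
    by (rule order_trans[OF Do_bound[OF s y]]) (use M assms in \<open>auto intro!: mult_right_mono mult_left_mono\<close>)
  moreover have "\<bar>g s \<bullet> \<iota> y\<bar> \<le> (1 + (norm (g s))\<^sup>2) * norm y" by (rule g_bound)
  ultimately show ?thesis unfolding flux_def by (simp add: algebra_simps)
qed

text \<open>Supplies the moduli that \<open>convergent_of_dense_equicontinuous\<close> asks for,
  with \<theta> the rounding to the grid.\<close>

lemma increment_bound:
  fixes f k :: "real \<Rightarrow> real"
  assumes int: "\<And>s t. s \<in> {0..T} \<Longrightarrow> t \<in> {0..T} \<Longrightarrow> s \<le> t \<Longrightarrow> (f has_integral (X t - X s)) {\<theta> s..\<theta> t}"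
    and \<theta>: "\<And>s. s \<in> {0..T} \<Longrightarrow> \<theta> s \<in> {0..T}" "\<And>s t. s \<le> t \<Longrightarrow> \<theta> s \<le> \<theta> t"
    and k: "k integrable_on {0..T}" "\<And>s. s \<in> {0..T} \<Longrightarrow> \<bar>f s\<bar> \<le> k s"
    and st: "s \<in> {0..T}" "t \<in> {0..T}"
  shows "\<bar>X t - X s\<bar> \<le> \<bar>integral {0..\<theta> t} k - integral {0..\<theta> s} k\<bar>"
proof -
  have *: "\<bar>X t - X s\<bar> \<le> \<bar>integral {0..\<theta> t} k - integral {0..\<theta> s} k\<bar>"
    if st: "s \<in> {0..T}" "t \<in> {0..T}" "s \<le> t" for s t
  proof -
    have sub: "{\<theta> s..\<theta> t} \<subseteq> {0..T}" using \<theta>(1)[OF st(1)] \<theta>(1)[OF st(2)] by auto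
    have ki: "k integrable_on {a..b}" if "0 \<le> a" "b \<le> T" for a b
      using integrable_on_subinterval[OF k(1)] that by auto
    have "norm (integral {\<theta> s..\<theta> t} f) \<le> integral {\<theta> s..\<theta> t} k"
      using int[OF st] ki \<theta>(1)[OF st(1)] \<theta>(1)[OF st(2)] k(2) sub
      by (intro Henstock_Kurzweil_Integration.integral_norm_bound_integral) auto
    moreover have "integral {0..\<theta> s} k + integral {\<theta> s..\<theta> t} k = integral {0..\<theta> t} k"
      using \<theta>(1)[OF st(1)] \<theta>(1)[OF st(2)] \<theta>(2)[OF st(3)] ki
      by (intro Henstock_Kurzweil_Integration.integral_combine) auto
    ultimately show ?thesis using integral_unique[OF int[OF st]] by simp
  qed
  show ?thesis
  proof (cases "s \<le> t")
    case False then show ?thesis using *[OF st(2,1)] by (simp add: abs_minus_commute)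
  qed (use * st in blast)
qed

text \<open>Weak continuity cannot come from the interpolants, which jump. The limit identities give
  continuity against embedded test vectors, and boundedness extends it to all test vectors through
  \<open>weak_limit_V\<close> and \<open>weak_limit_H\<close>, the limit being identified by
  \<open>eq_of_inner_V\<close> and \<open>eq_of_inner_H\<close>.\<close>

theorem weak_solution_exists:
  obtains u w where
    "\<And>t. t \<in> {0..T} \<Longrightarrow> u t \<in> V \<and> norm (u t) \<le> sol_bound"
    "\<And>t. t \<in> {0..T} \<Longrightarrow> w t \<in> closure (\<iota> ` V) \<and> norm (w t) \<le> sol_bound"
    "u 0 = u0" "w 0 = w1"
    "\<And>y. continuous_on {0..T} (\<lambda>t. u t \<bullet> y)" "\<And>h. continuous_on {0..T} (\<lambda>t. w t \<bullet> h)"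
    "\<And>t h. t \<in> {0..T} \<Longrightarrow> ((\<lambda>s. w s \<bullet> h) has_integral (\<iota> (u t) \<bullet> h - \<iota> u0 \<bullet> h)) {0..t}"
    "\<And>t y. t \<in> {0..T} \<Longrightarrow> y \<in> V \<Longrightarrow>
       ((\<lambda>s. - flux (u s) (w s) y s) has_integral (w t \<bullet> \<iota> y - w1 \<bullet> \<iota> y)) {0..t}"
proof -
  let ?K = sol_bound
  obtain n0 where n0: "n0 > 0" "\<And>n. n \<ge> n0 \<Longrightarrow> small (T / real n) \<and> gronwall_const * (T / real n) \<le> 1 / 2"
  proof -
    have lim: "(\<lambda>n. r * (T / real n)) \<longlonglongrightarrow> 0" for r :: real
      using tendsto_mult_right_zero[OF lim_const_over_n[of T]] .
    have lim2: "(\<lambda>n. (T / real n) * (T / real n) * M\<^sup>2 / (2 * c)) \<longlonglongrightarrow> 0 * 0 * M\<^sup>2 / (2 * c)"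
      by (intro tendsto_intros lim_const_over_n) (use c in auto)
    have "\<forall>\<^sub>F n in sequentially. M * (T / real n) < 1 / 2" by (rule order_tendstoD(2)[OF lim]) simp
    moreover have "\<forall>\<^sub>F n in sequentially. gronwall_const * (T / real n) < 1 / 2" by (rule order_tendstoD(2)[OF lim]) simp
    moreover have "\<forall>\<^sub>F n in sequentially. (T / real n) * (T / real n) * M\<^sup>2 / (2 * c) < 1 / 2"
      by (rule order_tendstoD(2)[OF lim2]) simp
    moreover have "\<forall>\<^sub>F n in sequentially. n > (0::nat)" by (rule eventually_gt_at_top)
    ultimately have "\<forall>\<^sub>F n in sequentially. small (T / real n) \<and> gronwall_const * (T / real n) \<le> 1 / 2"
    proof eventually_elim
      case (elim n)
      then show ?case using T by (simp add: small_def mult.commute less_imp_le)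
    qed
    then obtain N where N: "\<And>n. n \<ge> N \<Longrightarrow> small (T / real n) \<and> gronwall_const * (T / real n) \<le> 1 / 2"
      by (auto simp: eventually_sequentially)
    show ?thesis by (rule that[of "Suc N", OF _ N[OF Suc_leD]]) auto
  qed
  define Q where "Q n uu ww \<longleftrightarrow> uu 0 = u0 \<and> ww 0 = w1 \<and>
    (\<forall>t\<in>{0..T}. uu t \<in> V \<and> ww t \<in> closure (\<iota> ` V) \<and> norm (uu t) \<le> sol_bound \<and> norm (ww t) \<le> sol_bound) \<and>
    (\<forall>s t h. s \<in> {0..T} \<longrightarrow> t \<in> {0..T} \<longrightarrow> s \<le> t \<longrightarrow>
      ((\<lambda>r. ww r \<bullet> h) has_integral (\<iota> (uu t) \<bullet> h - \<iota> (uu s) \<bullet> h)) {grid_up n s..grid_up n t}) \<and>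
    (\<forall>s t y. s \<in> {0..T} \<longrightarrow> t \<in> {0..T} \<longrightarrow> s \<le> t \<longrightarrow> y \<in> V \<longrightarrow>
      ((\<lambda>r. - flux (uu r) (ww r) y r) has_integral (ww t \<bullet> \<iota> y - ww s \<bullet> \<iota> y)) {grid_up n s..grid_up n t})" for n uu ww
  have "\<exists>uu ww. Q n uu ww" if "n \<ge> n0" for n
  proof -
    have "n > 0" using n0(1) that by simp
    then show ?thesis
      by (rule step_approximation[OF _ conjunct1[OF n0(2)[OF that]] conjunct2[OF n0(2)[OF that]]])
        (rule exI, rule exI, unfold Q_def, rule conjI, assumption, rule conjI, assumption, blast)
  qed
  then have "\<forall>n. \<exists>uu ww. Q (n0 + n) uu ww" by simp
  then obtain uu0 ww0 where Q0: "\<And>n. Q (n0 + n) (uu0 n) (ww0 n)" by metis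
  define S where "S = {0..T} \<inter> \<rat>"
  have S: "countable S" "S \<subseteq> {0..T}" "{0..T} \<subseteq> closure S"
  proof -
    show "countable S" unfolding S_def using countable_rat by (rule countable_Int2)
    show "{0..T} \<subseteq> closure S"
    proof
      fix t assume t: "t \<in> {0..T}"
      have "\<exists>r\<in>S. dist r t < e" if e: "e > 0" for e
      proof -
        have "max 0 (t - e) < min T (t + e)" using t e T by auto
        then obtain r where "r \<in> \<rat>" "max 0 (t - e) < r" "r < min T (t + e)" using Rats_dense_in_real by blast
        then show ?thesis by (intro bexI[of _ r]) (auto simp: S_def dist_real_def)
      qed
      then show "t \<in> closure S" by (auto simp: closure_approachable)
    qed
  qed (auto simp: S_def)
  \<comment> \<open>Displacement and velocity form one vector of the product space, so that a single
    subsequence serves both.\<close>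
  have "norm (uu0 n t, ww0 n t) \<le> ?K + ?K" if "t \<in> S" for n t
  proof (rule order_trans[OF norm_Pair_le add_mono])
    show "norm (uu0 n t) \<le> ?K" "norm (ww0 n t) \<le> ?K" using Q0[of n] S(2) that unfolding Q_def by blast+
  qed
  then obtain r where r: "strict_mono (r :: nat \<Rightarrow> nat)"
    "\<And>t y. t \<in> S \<Longrightarrow> convergent (\<lambda>n. (uu0 (r n) t, ww0 (r n) t) \<bullet> y)"
    by (rule weakly_convergent_subsequence_countable[OF S(1), of "\<lambda>n t. (uu0 n t, ww0 n t)" "?K + ?K"]) blast+
  define N where "N n = n0 + r n" for n
  define uu where "uu n = uu0 (r n)" for n
  define ww where "ww n = ww0 (r n)" for n
  have Q: "Q (N n) (uu n) (ww n)" for n using Q0[of "r n"] by (simp add: N_def uu_def ww_def)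
  have Npos: "N n > 0" for n using n0(1) by (simp add: N_def)
  have uuS: "convergent (\<lambda>n. uu n t \<bullet> x)" if "t \<in> S" for t x
    using r(2)[OF that, of "(x, 0)"] by (simp add: uu_def)
  have wwS: "convergent (\<lambda>n. ww n t \<bullet> h)" if "t \<in> S" for t h
    using r(2)[OF that, of "(0, h)"] by (simp add: ww_def)
  have init: "uu n 0 = u0" "ww n 0 = w1" for n using Q[of n] by (auto simp: Q_def)
  have bnd: "uu n t \<in> V" "ww n t \<in> closure (\<iota> ` V)" "norm (uu n t) \<le> ?K" "norm (ww n t) \<le> ?K"
    if "t \<in> {0..T}" for n t using Q[of n] that by (auto simp: Q_def)
  have intu: "((\<lambda>r. ww n r \<bullet> h) has_integral (\<iota> (uu n t) \<bullet> h - \<iota> (uu n s) \<bullet> h)) {grid_up (N n) s..grid_up (N n) t}"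
    if "s \<in> {0..T}" "t \<in> {0..T}" "s \<le> t" for n s t h using Q[of n] that by (simp add: Q_def)
  have intw: "((\<lambda>r. - flux (uu n r) (ww n r) y r) has_integral (ww n t \<bullet> \<iota> y - ww n s \<bullet> \<iota> y)) {grid_up (N n) s..grid_up (N n) t}"
    if "s \<in> {0..T}" "t \<in> {0..T}" "s \<le> t" "y \<in> V" for n s t y using Q[of n] that by (simp add: Q_def)
  have g0: "grid_up n 0 = 0" for n by (simp add: grid_up_def)
  have gmono: "grid_up n s \<le> grid_up n t" if "s \<le> t" for n s t
    unfolding grid_up_def using that T
    by (intro mult_right_mono of_nat_mono nat_mono ceiling_mono divide_right_mono) auto
  have glim: "(\<lambda>n. grid_up (N n) t) \<longlonglongrightarrow> t" if t: "t \<in> {0..T}" for t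
  proof (rule real_tendsto_sandwich)
    show "\<forall>\<^sub>F n in sequentially. t \<le> grid_up (N n) t" using grid_up(2)[OF Npos t] by simp
    show "\<forall>\<^sub>F n in sequentially. grid_up (N n) t \<le> t + T / real (N n)" using grid_up(3)[OF Npos t] by simp
    have "strict_mono N" using r(1) by (simp add: N_def strict_mono_def)
    then have "(\<lambda>n. T / real (N n)) \<longlonglongrightarrow> 0"
      using LIMSEQ_subseq_LIMSEQ[OF lim_const_over_n[of T]] by (simp add: o_def)
    then show "(\<lambda>n. t + T / real (N n)) \<longlonglongrightarrow> t" using tendsto_add[OF tendsto_const[of t]] by fastforce
  qed auto
  have cont_int: "continuous_on {0..T} (\<lambda>t. integral {0..t} k)" if "k integrable_on {0..T}" for k :: "real \<Rightarrow> real"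
    using that by (rule indefinite_integral_continuous_1)
  have klim: "(\<lambda>n. integral {0..grid_up (N n) t} k) \<longlonglongrightarrow> integral {0..t} k"
    if "k integrable_on {0..T}" "t \<in> {0..T}" for k :: "real \<Rightarrow> real" and t
    using continuous_on_tendsto_compose[OF cont_int[OF that(1)] glim[OF that(2)] that(2)] grid_up(4)[OF Npos that(2)] by simp
  have flux_k: "(\<lambda>s. (3 * M * ?K + 1 + (norm (g s))\<^sup>2) * norm y) integrable_on {0..T}" for y :: 'x
    using g_int by (intro integrable_on_mult_left integrable_add) auto
  have flux_b: "\<bar>- flux (uu n s) (ww n s) y s\<bar> \<le> (3 * M * ?K + 1 + (norm (g s))\<^sup>2) * norm y"
    if "y \<in> V" "s \<in> {0..T}" for n y s
    using flux_bound[OF that(2,1) bnd(3,4)[OF that(2)]] by simp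
  have w_b: "\<bar>ww n s \<bullet> h\<bar> \<le> ?K * norm h" if "s \<in> {0..T}" for n s h
    using order_trans[OF Cauchy_Schwarz_ineq2 mult_right_mono[OF bnd(4)[OF that] norm_ge_zero]] .
  have cu: "convergent (\<lambda>n. \<iota> (uu n t) \<bullet> h)" if t: "t \<in> {0..T}" for t h
  proof (rule convergent_of_dense_equicontinuous[OF _ klim cont_int S(2,3) _ t])
    show "\<bar>\<iota> (uu n t) \<bullet> h - \<iota> (uu n s) \<bullet> h\<bar> \<le> \<bar>integral {0..grid_up (N n) t} (\<lambda>_. ?K * norm h) - integral {0..grid_up (N n) s} (\<lambda>_. ?K * norm h)\<bar>"
      if "s \<in> {0..T}" "t \<in> {0..T}" for n s t
      using increment_bound[where X="\<lambda>t. \<iota> (uu n t) \<bullet> h", OF intu grid_up(4)[OF Npos] gmono integrable_const_ivl w_b that] by blast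
    obtain z where z: "z \<in> V" "\<And>v. v \<in> V \<Longrightarrow> \<iota> v \<bullet> h = v \<bullet> z"
      using iota_riesz by metis
    show "convergent (\<lambda>n. \<iota> (uu n s) \<bullet> h)" if "s \<in> S" for s
      using uuS[OF that, of z] z(2)[OF bnd(1)] S(2) that by (simp add: subset_iff)
  qed auto
  have "\<exists>z. z \<in> V \<and> norm z \<le> ?K \<and> (\<forall>y. (\<lambda>n. uu n t \<bullet> y) \<longlonglongrightarrow> z \<bullet> y)" if "t \<in> {0..T}" for t
    using weak_limit_V[of "\<lambda>n. uu n t" ?K, OF bnd(1)[OF that] bnd(3)[OF that] cu[OF that]] by blast
  then have "\<forall>t\<in>{0..T}. \<exists>z. z \<in> V \<and> norm z \<le> ?K \<and> (\<forall>y. (\<lambda>n. uu n t \<bullet> y) \<longlonglongrightarrow> z \<bullet> y)" by blast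
  from bchoice[OF this] obtain u where "\<forall>t\<in>{0..T}. u t \<in> V \<and> norm (u t) \<le> ?K \<and> (\<forall>y. (\<lambda>n. uu n t \<bullet> y) \<longlonglongrightarrow> u t \<bullet> y)"
    by (rule exE)
  then have u: "\<And>t. t \<in> {0..T} \<Longrightarrow> u t \<in> V \<and> norm (u t) \<le> ?K"
    "\<And>t y. t \<in> {0..T} \<Longrightarrow> (\<lambda>n. uu n t \<bullet> y) \<longlonglongrightarrow> u t \<bullet> y" by auto
  have cw: "convergent (\<lambda>n. ww n t \<bullet> \<iota> y)" if t: "t \<in> {0..T}" and y: "y \<in> V" for t y
  proof (rule convergent_of_dense_equicontinuous[OF _ klim[OF flux_k] cont_int[OF flux_k] S(2,3) _ t])
    show "\<bar>ww n t \<bullet> \<iota> y - ww n s \<bullet> \<iota> y\<bar> \<le> \<bar>integral {0..grid_up (N n) t} (\<lambda>s. (3 * M * ?K + 1 + (norm (g s))\<^sup>2) * norm y)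
        - integral {0..grid_up (N n) s} (\<lambda>s. (3 * M * ?K + 1 + (norm (g s))\<^sup>2) * norm y)\<bar>"
      if "s \<in> {0..T}" "t \<in> {0..T}" for n s t
      using increment_bound[where X="\<lambda>t. ww n t \<bullet> \<iota> y", OF intw[OF _ _ _ y] grid_up(4)[OF Npos] gmono flux_k flux_b[OF y] that] by blast
  qed (use wwS in auto)
  have "\<exists>z. z \<in> closure (\<iota> ` V) \<and> norm z \<le> ?K \<and> (\<forall>y. (\<lambda>n. ww n t \<bullet> y) \<longlonglongrightarrow> z \<bullet> y)" if "t \<in> {0..T}" for t
    using weak_limit_H[of "\<lambda>n. ww n t" ?K, OF bnd(2)[OF that] bnd(4)[OF that] cw[OF that]] by blast
  then have "\<forall>t\<in>{0..T}. \<exists>z. z \<in> closure (\<iota> ` V) \<and> norm z \<le> ?K \<and> (\<forall>y. (\<lambda>n. ww n t \<bullet> y) \<longlonglongrightarrow> z \<bullet> y)" by blast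
  from bchoice[OF this] obtain w where "\<forall>t\<in>{0..T}. w t \<in> closure (\<iota> ` V) \<and> norm (w t) \<le> ?K \<and> (\<forall>y. (\<lambda>n. ww n t \<bullet> y) \<longlonglongrightarrow> w t \<bullet> y)"
    by (rule exE)
  then have w: "\<And>t. t \<in> {0..T} \<Longrightarrow> w t \<in> closure (\<iota> ` V) \<and> norm (w t) \<le> ?K"
    "\<And>t y. t \<in> {0..T} \<Longrightarrow> (\<lambda>n. ww n t \<bullet> y) \<longlonglongrightarrow> w t \<bullet> y" by auto
  have iu: "(\<lambda>n. \<iota> (uu n t) \<bullet> h) \<longlonglongrightarrow> \<iota> (u t) \<bullet> h" if t: "t \<in> {0..T}" for t h
  proof -
    obtain z where z: "z \<in> V" "\<And>v. v \<in> V \<Longrightarrow> \<iota> v \<bullet> h = v \<bullet> z" using iota_riesz by metis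
    show ?thesis using u(2)[OF t, of z] z(2)[OF bnd(1)[OF t]] z(2) u(1)[OF t] by simp
  qed
  have zero: "0 \<in> {0..T}" using T by simp
  have u00: "u 0 = u0"
    using u(1)[OF zero] u0 LIMSEQ_unique[OF iu[OF zero]] by (intro eq_of_inner_V) (auto simp: init)
  have w00: "w 0 = w1"
    using w(1)[OF zero] w1 LIMSEQ_unique[OF w(2)[OF zero]] by (intro eq_of_inner_H) (auto simp: init)
  have Iu: "((\<lambda>s. w s \<bullet> h) has_integral (\<iota> (u t) \<bullet> h - \<iota> u0 \<bullet> h)) {0..t}" if t: "t \<in> {0..T}" for t h
  proof (rule has_integral_dominated_limit[where T=T and \<theta>="\<lambda>n. grid_up (N n) t" and k="\<lambda>_. ?K * norm h" and f="\<lambda>n s. ww n s \<bullet> h"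
        and L="\<lambda>n. \<iota> (uu n t) \<bullet> h - \<iota> u0 \<bullet> h"])
    show "((\<lambda>s. ww n s \<bullet> h) has_integral (\<iota> (uu n t) \<bullet> h - \<iota> u0 \<bullet> h)) {0..grid_up (N n) t}" for n
      using intu[OF zero t, of n h] t by (simp add: g0 init)
    show "(\<lambda>n. \<iota> (uu n t) \<bullet> h - \<iota> u0 \<bullet> h) \<longlonglongrightarrow> \<iota> (u t) \<bullet> h - \<iota> u0 \<bullet> h" by (intro tendsto_intros iu t)
  qed (use t grid_up[OF Npos t] glim[OF t] w_b w(2) in auto)
  have Iw: "((\<lambda>s. - flux (u s) (w s) y s) has_integral (w t \<bullet> \<iota> y - w1 \<bullet> \<iota> y)) {0..t}" if t: "t \<in> {0..T}" and y: "y \<in> V" for t y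
  proof (rule has_integral_dominated_limit[where T=T and \<theta>="\<lambda>n. grid_up (N n) t" and f="\<lambda>n s. - flux (uu n s) (ww n s) y s"
        and L="\<lambda>n. ww n t \<bullet> \<iota> y - w1 \<bullet> \<iota> y", OF _ _ _ _ flux_k[of y]])
    show "((\<lambda>s. - flux (uu n s) (ww n s) y s) has_integral (ww n t \<bullet> \<iota> y - w1 \<bullet> \<iota> y)) {0..grid_up (N n) t}" for n
      using intw[OF zero t _ y, of n] t by (simp add: g0 init)
    show "(\<lambda>n. ww n t \<bullet> \<iota> y - w1 \<bullet> \<iota> y) \<longlonglongrightarrow> w t \<bullet> \<iota> y - w1 \<bullet> \<iota> y" by (intro tendsto_intros w t)
    show "(\<lambda>n. - flux (uu n s) (ww n s) y s) \<longlonglongrightarrow> - flux (u s) (w s) y s" if "s \<in> {0..T}" for s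
      unfolding flux_def by (intro tendsto_intros u(2) w(2) that)
    show "\<bar>- flux (uu n s) (ww n s) y s\<bar> \<le> (3 * M * ?K + 1 + (norm (g s))\<^sup>2) * norm y" if "s \<in> {0..T}" for n s
      by (rule flux_b[OF y that])
  qed (use t grid_up[OF Npos t] glim[OF t] in auto)
  have cont_of: "continuous_on {0..T} F" if "\<And>t. t \<in> {0..T} \<Longrightarrow> (f has_integral (F t - C)) {0..t}" for f F :: "real \<Rightarrow> real" and C
  proof -
    have "f integrable_on {0..T}" using that[of T] T by auto
    then have "continuous_on {0..T} (\<lambda>t. C + integral {0..t} f)" by (intro continuous_intros cont_int)
    then show ?thesis by (rule continuous_on_eq) (use integral_unique[OF that] in auto)
  qed
  have Cw: "continuous_on {0..T} (\<lambda>t. w t \<bullet> h)" for h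
    unfolding continuous_on_sequentially
  proof (intro allI ballI impI, elim conjE)
    fix x a assume a: "a \<in> {0..T}" and x: "\<forall>n::nat. x n \<in> {0..T}" "x \<longlonglongrightarrow> a"
    have c: "(\<lambda>n. w (x n) \<bullet> \<iota> y) \<longlonglongrightarrow> w a \<bullet> \<iota> y" if "y \<in> V" for y
      using continuous_on_tendsto_compose[OF cont_of[OF Iw[OF _ that]] x(2) a] x(1) by simp
    have cl: "\<And>n. w (x n) \<in> closure (\<iota> ` V)" "\<And>n. norm (w (x n)) \<le> ?K" using w(1) x(1) by auto
    obtain z where z: "z \<in> closure (\<iota> ` V)" "\<And>y. (\<lambda>n. w (x n) \<bullet> y) \<longlonglongrightarrow> z \<bullet> y"
      using weak_limit_H[of "\<lambda>n. w (x n)" ?K, OF cl convergentI[OF c]] by blast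
    have "z = w a" using z(1) w(1)[OF a] LIMSEQ_unique[OF z(2) c] by (intro eq_of_inner_H) auto
    then show "((\<lambda>t. w t \<bullet> h) \<circ> x) \<longlonglongrightarrow> w a \<bullet> h" using z(2) by (simp add: o_def)
  qed
  have Cu: "continuous_on {0..T} (\<lambda>t. u t \<bullet> y)" for y
    unfolding continuous_on_sequentially
  proof (intro allI ballI impI, elim conjE)
    fix x a assume a: "a \<in> {0..T}" and x: "\<forall>n::nat. x n \<in> {0..T}" "x \<longlonglongrightarrow> a"
    have c: "(\<lambda>n. \<iota> (u (x n)) \<bullet> h) \<longlonglongrightarrow> \<iota> (u a) \<bullet> h" for h
      using continuous_on_tendsto_compose[OF cont_of[OF Iu] x(2) a] x(1) by simp
    have cl: "\<And>n. u (x n) \<in> V" "\<And>n. norm (u (x n)) \<le> ?K" using u(1) x(1) by auto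
    obtain z where z: "z \<in> V" "\<And>y. (\<lambda>n. u (x n) \<bullet> y) \<longlonglongrightarrow> z \<bullet> y"
      using weak_limit_V[of "\<lambda>n. u (x n)" ?K, OF cl convergentI[OF c]] by blast
    have "\<iota> z \<bullet> h = \<iota> (u a) \<bullet> h" for h
    proof -
      obtain r where r: "r \<in> V" "\<And>v. v \<in> V \<Longrightarrow> \<iota> v \<bullet> h = v \<bullet> r" using iota_riesz by metis
      show ?thesis using LIMSEQ_unique[OF z(2)[of r]] c[of h] r(2)[OF cl(1)] r(2)[OF z(1)] by simp
    qed
    then have "z = u a" using z(1) u(1)[OF a] by (intro eq_of_inner_V) auto
    then show "((\<lambda>t. u t \<bullet> y) \<circ> x) \<longlonglongrightarrow> u a \<bullet> y" using z(2) by (simp add: o_def)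
  qed
  show ?thesis by (rule that[of u w, OF u(1) w(1) u00 w00 Cu Cw Iu Iw])
qed

end

section \<open>The Hilbert space of square integrable functions\<close>

definition sq_integrable :: "('a::euclidean_space \<Rightarrow> 'b::euclidean_space) \<Rightarrow> bool" where
  "sq_integrable f \<longleftrightarrow> f \<in> borel_measurable lebesgue \<and> integrable lebesgue (\<lambda>x. (norm (f x))\<^sup>2)"

lemma sq_integrable_measurable[measurable_dest]: "sq_integrable f \<Longrightarrow> f \<in> borel_measurable lebesgue"
  by (simp add: sq_integrable_def)

lemma sq_integrable_norm: "sq_integrable f \<Longrightarrow> integrable lebesgue (\<lambda>x. (norm (f x))\<^sup>2)"
  by (simp add: sq_integrable_def)

lemma sq_integrable_inner:
  assumes f: "sq_integrable f" and g: "sq_integrable g"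
  shows "integrable lebesgue (\<lambda>x. f x \<bullet> g x)"
proof (rule Bochner_Integration.integrable_bound)
  show "integrable lebesgue (\<lambda>x. (norm (f x))\<^sup>2 + (norm (g x))\<^sup>2)"
    using f g by (intro Bochner_Integration.integrable_add sq_integrable_norm)
  show "(\<lambda>x. f x \<bullet> g x) \<in> borel_measurable lebesgue"
    using f g by (intro borel_measurable_inner sq_integrable_measurable)
  show "AE x in lebesgue. norm (f x \<bullet> g x) \<le> norm ((norm (f x))\<^sup>2 + (norm (g x))\<^sup>2)"
  proof (rule AE_I2)
    fix x
    have "\<bar>f x \<bullet> g x\<bar> \<le> norm (f x) * norm (g x)" by (rule Cauchy_Schwarz_ineq2)
    also have "\<dots> \<le> (norm (f x))\<^sup>2 + (norm (g x))\<^sup>2"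
      using sum_squares_bound[of "norm (f x)" "norm (g x)"]
        mult_nonneg_nonneg[OF norm_ge_zero norm_ge_zero, of "f x" "g x"] by linarith
    finally show "norm (f x \<bullet> g x) \<le> norm ((norm (f x))\<^sup>2 + (norm (g x))\<^sup>2)" by simp
  qed
qed

lemma sq_integrable_bound:
  assumes f: "f \<in> borel_measurable lebesgue" and h: "integrable lebesgue h" "\<And>x. (norm (f x))\<^sup>2 \<le> h x"
  shows "sq_integrable f"
  unfolding sq_integrable_def
proof (intro conjI f Bochner_Integration.integrable_bound[OF h(1)])
  show "(\<lambda>x. (norm (f x))\<^sup>2) \<in> borel_measurable lebesgue" using f by measurable
  show "AE x in lebesgue. norm ((norm (f x))\<^sup>2) \<le> norm (h x)"
    by (intro AE_I2) (use order_trans[OF h(2) abs_ge_self] in auto)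
qed

lemma sq_integrable_zero: "sq_integrable (\<lambda>_. 0)"
  by (simp add: sq_integrable_def)

lemma sq_integrable_add:
  assumes "sq_integrable f" "sq_integrable g" shows "sq_integrable (\<lambda>x. f x + g x)"
proof (rule sq_integrable_bound)
  show "(\<lambda>x. f x + g x) \<in> borel_measurable lebesgue" using assms by (intro borel_measurable_add sq_integrable_measurable)
  show "integrable lebesgue (\<lambda>x. 2 * (norm (f x))\<^sup>2 + 2 * (norm (g x))\<^sup>2)"
    using assms by (intro Bochner_Integration.integrable_add integrable_mult_right sq_integrable_norm)
  show "(norm (f x + g x))\<^sup>2 \<le> 2 * (norm (f x))\<^sup>2 + 2 * (norm (g x))\<^sup>2" for x
  proof -
    have "(norm (f x + g x))\<^sup>2 \<le> (norm (f x) + norm (g x))\<^sup>2" by (intro power_mono norm_triangle_ineq) auto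
    also have "\<dots> \<le> 2 * (norm (f x))\<^sup>2 + 2 * (norm (g x))\<^sup>2"
      using sum_squares_bound[of "norm (f x)" "norm (g x)"] by (simp add: power2_sum)
    finally show ?thesis .
  qed
qed

lemma sq_integrable_scaleR: "sq_integrable f \<Longrightarrow> sq_integrable (\<lambda>x. c *\<^sub>R f x)"
  by (auto simp: sq_integrable_def power_mult_distrib)

lemma sq_integrable_diff: "sq_integrable f \<Longrightarrow> sq_integrable g \<Longrightarrow> sq_integrable (\<lambda>x. f x - g x)"
  using sq_integrable_add[of f "\<lambda>x. - 1 *\<^sub>R g x"] sq_integrable_scaleR[of g "-1"] by simp

lemma sq_integrable_uminus: "sq_integrable f \<Longrightarrow> sq_integrable (\<lambda>x. - f x)"
  using sq_integrable_scaleR[of f "-1"] by simp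

text \<open>Fatou's lemma for the squared norms. The index \<open>N\<close> admits a bound that
  holds only eventually, as for distances to a fixed member of a Cauchy sequence.\<close>

lemma sq_integrable_AE_limit:
  assumes f: "\<And>n. sq_integrable (f n)" and F: "F \<in> borel_measurable lebesgue"
    and lim: "AE x in lebesgue. (\<lambda>n. f n x) \<longlonglongrightarrow> F x"
    and C: "\<And>n. n \<ge> N \<Longrightarrow> (\<integral>x. (norm (f n x))\<^sup>2 \<partial>lebesgue) \<le> C"
  shows "sq_integrable F" "(\<integral>x. (norm (F x))\<^sup>2 \<partial>lebesgue) \<le> C"
proof -
  have C0: "0 \<le> C" by (rule order_trans[OF _ C[OF order_refl]]) simp
  have "(\<integral>\<^sup>+x. ennreal ((norm (F x))\<^sup>2) \<partial>lebesgue) = (\<integral>\<^sup>+x. liminf (\<lambda>n. ennreal ((norm (f n x))\<^sup>2)) \<partial>lebesgue)"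
  proof (rule nn_integral_cong_AE, use lim in eventually_elim)
    case (elim x)
    then have "(\<lambda>n. ennreal ((norm (f n x))\<^sup>2)) \<longlonglongrightarrow> ennreal ((norm (F x))\<^sup>2)" by (intro tendsto_intros)
    then show ?case by (intro lim_imp_Liminf[symmetric]) auto
  qed
  also have "\<dots> \<le> liminf (\<lambda>n. \<integral>\<^sup>+x. ennreal ((norm (f n x))\<^sup>2) \<partial>lebesgue)"
    using sq_integrable_measurable[OF f] by (intro nn_integral_liminf) measurable
  also have "\<dots> = liminf (\<lambda>n. ennreal (\<integral>x. (norm (f n x))\<^sup>2 \<partial>lebesgue))"
    using sq_integrable_norm[OF f] by (simp add: nn_integral_eq_integral)
  also have "\<dots> \<le> liminf (\<lambda>n. ennreal C)"
    using C by (intro Liminf_mono) (auto simp: eventually_sequentially intro!: exI[of _ N] ennreal_leI)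
  also have "\<dots> = ennreal C" by (simp add: Liminf_const)
  finally have le: "(\<integral>\<^sup>+x. ennreal ((norm (F x))\<^sup>2) \<partial>lebesgue) \<le> ennreal C" .
  then have "(\<integral>\<^sup>+x. ennreal ((norm (F x))\<^sup>2) \<partial>lebesgue) < \<infinity>" by (simp add: le_less_trans)
  then show sq: "sq_integrable F"
    unfolding sq_integrable_def using F by (intro conjI integrableI_bounded) auto
  show "(\<integral>x. (norm (F x))\<^sup>2 \<partial>lebesgue) \<le> C"
    using le C0 by (simp add: nn_integral_eq_integral[OF sq_integrable_norm[OF sq]])
qed

\<comment> \<open>A type is required because the Hilbert space results are stated for the classes
  \<open>real_inner\<close> and \<open>banach\<close>. It is built over the whole space, as a type
  cannot depend on the domain \<open>U\<close>; functions on \<open>U\<close> enter extended by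
  zero. The relation is partial, so that only square integrable functions have classes.\<close>
quotient_type (overloaded) ('a, 'b) l2 = "'a::euclidean_space \<Rightarrow> 'b::euclidean_space" /
  partial: "\<lambda>f g. sq_integrable f \<and> sq_integrable g \<and> (AE x in lebesgue. f x = g x)"
proof (rule part_equivpI)
  show "\<exists>f::'a \<Rightarrow> 'b. sq_integrable f \<and> sq_integrable f \<and> (AE x in lebesgue. f x = f x)"
    using sq_integrable_zero by auto
  show "symp (\<lambda>(f::'a \<Rightarrow> 'b) g. sq_integrable f \<and> sq_integrable g \<and> (AE x in lebesgue. f x = g x))"
    by (auto simp: symp_def elim: eventually_mono)
  show "transp (\<lambda>(f::'a \<Rightarrow> 'b) g. sq_integrable f \<and> sq_integrable g \<and> (AE x in lebesgue. f x = g x))"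
  proof (rule transpI)
    fix f g h :: "'a \<Rightarrow> 'b"
    assume a: "sq_integrable f \<and> sq_integrable g \<and> (AE x in lebesgue. f x = g x)"
      "sq_integrable g \<and> sq_integrable h \<and> (AE x in lebesgue. g x = h x)"
    have "AE x in lebesgue. f x = h x"
      using a(1)[THEN conjunct2, THEN conjunct2] a(2)[THEN conjunct2, THEN conjunct2] by eventually_elim simp
    with a show "sq_integrable f \<and> sq_integrable h \<and> (AE x in lebesgue. f x = h x)" by simp
  qed
qed

lemma sq_integrable_rep: "sq_integrable (rep_l2 u)"
  using Quotient3_rep_reflp[OF Quotient3_l2, of u] by simp

lemma abs_rep_l2: "abs_l2 (rep_l2 u) = u"
  by (rule Quotient3_abs_rep[OF Quotient3_l2])

lemma abs_l2_eq_iff: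
  "sq_integrable f \<Longrightarrow> sq_integrable g \<Longrightarrow> abs_l2 f = abs_l2 g \<longleftrightarrow> (AE x in lebesgue. f x = g x)"
  using Quotient3_rel[OF Quotient3_l2, of f g] by auto

lemma rep_abs_l2: "sq_integrable f \<Longrightarrow> AE x in lebesgue. rep_l2 (abs_l2 f) x = f x"
  using abs_l2_eq_iff[OF sq_integrable_rep] abs_rep_l2 by blast

instantiation l2 :: (euclidean_space, euclidean_space) real_vector
begin

definition "0 = abs_l2 (\<lambda>_. 0)"
definition "u + v = abs_l2 (\<lambda>x. rep_l2 u x + rep_l2 v x)" for u v :: "('a, 'b) l2"
definition "u - v = abs_l2 (\<lambda>x. rep_l2 u x - rep_l2 v x)" for u v :: "('a, 'b) l2"
definition "- u = abs_l2 (\<lambda>x. - rep_l2 u x)" for u :: "('a, 'b) l2"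
definition "c *\<^sub>R u = abs_l2 (\<lambda>x. c *\<^sub>R rep_l2 u x)" for u :: "('a, 'b) l2"

lemma rep_l2_plus: "AE x in lebesgue. rep_l2 (u + v) x = rep_l2 u x + rep_l2 v x"
  unfolding plus_l2_def by (intro rep_abs_l2 sq_integrable_add sq_integrable_rep)

lemma rep_l2_minus: "AE x in lebesgue. rep_l2 (u - v) x = rep_l2 u x - rep_l2 v x"
  unfolding minus_l2_def by (intro rep_abs_l2 sq_integrable_diff sq_integrable_rep)

lemma rep_l2_uminus: "AE x in lebesgue. rep_l2 (- u) x = - rep_l2 u x"
  unfolding uminus_l2_def by (intro rep_abs_l2 sq_integrable_uminus sq_integrable_rep)

lemma rep_l2_scaleR: "AE x in lebesgue. rep_l2 (c *\<^sub>R u) x = c *\<^sub>R rep_l2 u x"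
  unfolding scaleR_l2_def by (intro rep_abs_l2 sq_integrable_scaleR sq_integrable_rep)

lemma rep_l2_zero: "AE x in lebesgue. rep_l2 0 x = 0"
  unfolding zero_l2_def by (intro rep_abs_l2 sq_integrable_zero)

lemma l2_eqI: "AE x in lebesgue. rep_l2 u x = rep_l2 v x \<Longrightarrow> u = v"
  using abs_l2_eq_iff[OF sq_integrable_rep sq_integrable_rep, of u v] by (simp add: abs_rep_l2)

instance
proof
  fix a b c :: "('a, 'b) l2" and r s :: real
  note * = rep_l2_plus rep_l2_minus rep_l2_uminus rep_l2_scaleR rep_l2_zero
  show "a + b + c = a + (b + c)" 
    by (rule l2_eqI, use *(1)[of "a + b" c] *(1)[of a b] *(1)[of a "b + c"] *(1)[of b c] in eventually_elim) simp
  show "a + b = b + a" by (rule l2_eqI, use *(1)[of a b] *(1)[of b a] in eventually_elim) simp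
  show "0 + a = a" by (rule l2_eqI, use *(1)[of 0 a] *(5) in eventually_elim) simp
  show "- a + a = 0" by (rule l2_eqI, use *(1)[of "- a" a] *(3)[of a] *(5) in eventually_elim) simp
  show "a - b = a + - b" by (rule l2_eqI, use *(2)[of a b] *(1)[of a "- b"] *(3)[of b] in eventually_elim) simp
  show "r *\<^sub>R (a + b) = r *\<^sub>R a + r *\<^sub>R b"
    by (rule l2_eqI, use *(4)[of r "a + b"] *(1)[of a b] *(1)[of "r *\<^sub>R a" "r *\<^sub>R b"] *(4)[of r a] *(4)[of r b] in eventually_elim)
      (simp add: algebra_simps)
  show "(r + s) *\<^sub>R a = r *\<^sub>R a + s *\<^sub>R a"
    by (rule l2_eqI, use *(4)[of "r + s" a] *(1)[of "r *\<^sub>R a" "s *\<^sub>R a"] *(4)[of r a] *(4)[of s a] in eventually_elim)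
      (simp add: algebra_simps)
  show "r *\<^sub>R s *\<^sub>R a = (r * s) *\<^sub>R a"
    by (rule l2_eqI, use *(4)[of r "s *\<^sub>R a"] *(4)[of s a] *(4)[of "r * s" a] in eventually_elim) simp
  show "1 *\<^sub>R a = a" by (rule l2_eqI, use *(4)[of 1 a] in eventually_elim) simp
qed

end

instantiation l2 :: (euclidean_space, euclidean_space) real_inner
begin

definition "u \<bullet> v = (\<integral>x. rep_l2 u x \<bullet> rep_l2 v x \<partial>lebesgue)" for u v :: "('a, 'b) l2"
definition "norm u = sqrt (u \<bullet> u)" for u :: "('a, 'b) l2"
definition "dist u v = norm (u - v)" for u v :: "('a, 'b) l2"
definition "sgn u = u /\<^sub>R norm u" for u :: "('a, 'b) l2"
definition "(uniformity :: (('a, 'b) l2 \<times> ('a, 'b) l2) filter) = (INF e\<in>{0<..}. principal {(x, y). dist x y < e})"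
definition "open S = (\<forall>x\<in>S. \<forall>\<^sub>F (x', y) in uniformity. x' = x \<longrightarrow> y \<in> S)" for S :: "('a, 'b) l2 set"

lemma inner_l2_cong:
  assumes "AE x in lebesgue. rep_l2 u x = f x" "AE x in lebesgue. rep_l2 v x = g x" "sq_integrable f" "sq_integrable g"
  shows "u \<bullet> v = (\<integral>x. f x \<bullet> g x \<partial>lebesgue)"
  unfolding inner_l2_def
proof (rule integral_cong_AE)
  show "AE x in lebesgue. rep_l2 u x \<bullet> rep_l2 v x = f x \<bullet> g x" using assms(1,2) by eventually_elim simp
  show "(\<lambda>x. rep_l2 u x \<bullet> rep_l2 v x) \<in> borel_measurable lebesgue"
    by (intro borel_measurable_inner sq_integrable_measurable[OF sq_integrable_rep])
  show "(\<lambda>x. f x \<bullet> g x) \<in> borel_measurable lebesgue"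
    by (intro borel_measurable_inner sq_integrable_measurable assms)
qed

instance
proof
  fix a b c :: "('a, 'b) l2" and r s :: real
  note * = rep_l2_plus rep_l2_minus rep_l2_uminus rep_l2_scaleR rep_l2_zero
  show "a \<bullet> b = b \<bullet> a" by (simp add: inner_l2_def inner_commute)
  have "(a + b) \<bullet> c = (\<integral>x. (rep_l2 a x + rep_l2 b x) \<bullet> rep_l2 c x \<partial>lebesgue)"
    by (intro inner_l2_cong *(1) sq_integrable_add sq_integrable_rep) auto
  also have "\<dots> = a \<bullet> c + b \<bullet> c"
    unfolding inner_add_left inner_l2_def by (intro Bochner_Integration.integral_add sq_integrable_inner sq_integrable_rep)
  finally show "(a + b) \<bullet> c = a \<bullet> c + b \<bullet> c" .
  have "(r *\<^sub>R a) \<bullet> b = (\<integral>x. (r *\<^sub>R rep_l2 a x) \<bullet> rep_l2 b x \<partial>lebesgue)"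
    by (intro inner_l2_cong *(4) sq_integrable_scaleR sq_integrable_rep) auto
  also have "\<dots> = r * (a \<bullet> b)" unfolding inner_l2_def by simp
  finally show "(r *\<^sub>R a) \<bullet> b = r * (a \<bullet> b)" .
  show "0 \<le> a \<bullet> a" by (simp add: inner_l2_def)
  show "(a \<bullet> a = 0) = (a = 0)"
  proof
    assume "a \<bullet> a = 0"
    then have "AE x in lebesgue. rep_l2 a x \<bullet> rep_l2 a x = 0"
      unfolding inner_l2_def by (subst (asm) integral_nonneg_eq_0_iff_AE) (auto intro: sq_integrable_inner sq_integrable_rep)
    then have "AE x in lebesgue. rep_l2 a x = rep_l2 0 x" using *(5) by eventually_elim simp
    then show "a = 0" by (rule l2_eqI)
  next
    assume "a = 0"
    then have "a \<bullet> a = (\<integral>x. 0 \<bullet> (0::'b) \<partial>(lebesgue :: 'a measure))"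
      by (intro inner_l2_cong) (use *(5) sq_integrable_zero in auto)
    then show "a \<bullet> a = 0" by simp
  qed
qed (auto simp: norm_l2_def dist_l2_def sgn_l2_def uniformity_l2_def open_l2_def)

end

text \<open>Riesz-Fischer. Along a subsequence with distances below 4^-n, the sum of 4^n |f (n+1) -
  f n|^2 has finite integral, since its terms integrate to at most 4^n 16^-n. Where the sum is
  finite the increments are O(2^-n), so the subsequence converges almost everywhere.\<close>

instance l2 :: (euclidean_space, euclidean_space) banach
proof
  fix X :: "nat \<Rightarrow> ('a, 'b) l2" assume X: "Cauchy X"
  have "\<exists>M. \<forall>m\<ge>M. \<forall>n\<ge>M. dist (X m) (X n) < (1/4) ^ k" for k :: nat
    using X by (intro metric_CauchyD) auto
  then obtain M where M: "\<And>k m n. m \<ge> M k \<Longrightarrow> n \<ge> M k \<Longrightarrow> dist (X m) (X n) < (1/4) ^ k" by metis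
  \<comment> \<open>The summand \<open>n\<close> makes \<open>r\<close> strictly increasing; the sum
    dominates every \<open>M k\<close> with k \<le> n.\<close>
  define r where "r n = n + (\<Sum>k\<le>n. M k)" for n
  have r: "strict_mono r" by (rule strict_mono_Suc_iff[THEN iffD2]) (simp add: r_def)
  have rM: "r n \<ge> M k" if "k \<le> n" for k n
    using member_le_sum[of k "{..n}" M] that by (auto simp: r_def)
  define f where "f n = rep_l2 (X (r n))" for n
  have f: "sq_integrable (f n)" for n by (simp add: f_def sq_integrable_rep)
  have fdist: "(\<integral>x. (norm (f m x - f n x))\<^sup>2 \<partial>lebesgue) = (dist (X (r m)) (X (r n)))\<^sup>2" for m n
  proof -
    have "(norm (X (r m) - X (r n)))\<^sup>2 = (\<integral>x. (f m x - f n x) \<bullet> (f m x - f n x) \<partial>lebesgue)"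
      unfolding power2_norm_eq_inner f_def by (intro inner_l2_cong rep_l2_minus sq_integrable_diff sq_integrable_rep)
    then show ?thesis by (simp add: dist_norm power2_norm_eq_inner)
  qed
  have fi: "integrable lebesgue (\<lambda>x. (norm (f m x - f n x))\<^sup>2)" for m n
    by (intro sq_integrable_norm sq_integrable_diff f)
  have meas: "f n \<in> borel_measurable lebesgue" for n using f sq_integrable_measurable by blast
  let ?h = "\<lambda>n x. 4 ^ n * (norm (f (Suc n) x - f n x))\<^sup>2"
  have "(\<integral>\<^sup>+x. (\<Sum>n. ennreal (?h n x)) \<partial>lebesgue) = (\<Sum>n. \<integral>\<^sup>+x. ennreal (?h n x) \<partial>lebesgue)"
    using meas by (intro nn_integral_suminf) measurable
  also have "\<dots> \<le> (\<Sum>n. ennreal ((1/4) ^ n))"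
  proof (intro suminf_le)
    fix n
    have "(dist (X (r (Suc n))) (X (r n)))\<^sup>2 \<le> ((1/4) ^ n)\<^sup>2"
      using M[OF rM rM, of n "Suc n" n] by (intro power_mono) auto
    then have "4 ^ n * (dist (X (r (Suc n))) (X (r n)))\<^sup>2 \<le> 4 ^ n * ((1/4) ^ n)\<^sup>2" by (intro mult_left_mono) auto
    also have "\<dots> = (1/4) ^ n" by (simp add: power2_eq_square field_simps)
    finally have "ennreal (\<integral>x. ?h n x \<partial>lebesgue) \<le> ennreal ((1/4) ^ n)" using fdist by (intro ennreal_leI) simp
    then show "(\<integral>\<^sup>+x. ennreal (?h n x) \<partial>lebesgue) \<le> ennreal ((1/4) ^ n)"
      using fi by (subst nn_integral_eq_integral) (auto intro: integrable_mult_right)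
  qed auto
  also have "\<dots> = ennreal (\<Sum>n. (1/4) ^ n)" by (intro suminf_ennreal2) (auto intro: summable_geometric)
  finally have "(\<integral>\<^sup>+x. (\<Sum>n. ennreal (?h n x)) \<partial>lebesgue) \<noteq> \<infinity>" by (auto simp: top_unique)
  then have "AE x in lebesgue. (\<Sum>n. ennreal (?h n x)) \<noteq> \<infinity>"
    using meas by (intro nn_integral_noteq_infinite) measurable
  then have conv: "AE x in lebesgue. (\<lambda>n. f n x) \<longlonglongrightarrow> lim (\<lambda>n. f n x)"
  proof eventually_elim
    case (elim x)
    define S where "S = (\<Sum>n. ennreal (?h n x))"
    have "S \<noteq> \<infinity>" using elim by (simp only: S_def not_False_eq_True)
    then obtain C where C: "C \<ge> 0" "S = ennreal C" by (cases S rule: ennreal_cases) auto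
    have nb: "norm (f (Suc n) x - f n x) \<le> sqrt C * (1/2) ^ n" for n
    proof -
      have "ennreal (?h n x) = (\<Sum>i\<in>{n}. ennreal (?h i x))" by simp
      also have "\<dots> \<le> S" unfolding S_def by (rule sum_le_suminf) (auto intro: summableI)
      finally have "ennreal (?h n x) \<le> ennreal C" by (simp only: C(2))
      then have "?h n x \<le> C" using C(1) by simp
      have "(norm (f (Suc n) x - f n x))\<^sup>2 \<le> (sqrt C * (1/2) ^ n)\<^sup>2"
      proof -
        have "(sqrt C * (1/2) ^ n)\<^sup>2 = C * ((1/2)\<^sup>2) ^ n"
          using C(1) by (simp add: power_mult_distrib flip: power_mult) (simp add: mult.commute)
        also have "\<dots> = C / 4 ^ n" by (simp add: power2_eq_square power_divide)
        finally show ?thesis using \<open>?h n x \<le> C\<close> by (simp add: pos_le_divide_eq mult.commute)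
      qed
      then show ?thesis by (rule power2_le_imp_le) (use C(1) in auto)
    qed
    have "summable (\<lambda>n. sqrt C * (1/2) ^ n)" by (intro summable_mult summable_geometric) simp
    then have "summable (\<lambda>n. f (Suc n) x - f n x)" by (rule summable_comparison_test') (rule nb)
    then have "convergent (\<lambda>n. (\<Sum>i<n. f (Suc i) x - f i x) + f 0 x)"
      unfolding summable_iff_convergent by (rule convergent_add) (rule convergent_const)
    moreover have "(\<Sum>i<n. f (Suc i) x - f i x) + f 0 x = f n x" for n
      using sum_lessThan_telescope[of "\<lambda>i. f i x" n] by simp
    ultimately have "convergent (\<lambda>n. f n x)" by simp
    then show ?case by (simp add: convergent_LIMSEQ_iff)
  qed
  define F where "F x = lim (\<lambda>n. f n x)" for x
  have Fm: "F \<in> borel_measurable lebesgue" unfolding F_def using meas by (rule borel_measurable_lim_metric)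
  have bd: "sq_integrable (\<lambda>x. F x - f m x)" "(\<integral>x. (norm (F x - f m x))\<^sup>2 \<partial>lebesgue) \<le> ((1/4) ^ m)\<^sup>2" for m
  proof -
    have 1: "AE x in lebesgue. (\<lambda>n. f n x - f m x) \<longlonglongrightarrow> F x - f m x"
      using conv by eventually_elim (auto simp: F_def intro: tendsto_intros)
    have 2: "(\<integral>x. (norm (f n x - f m x))\<^sup>2 \<partial>lebesgue) \<le> ((1/4) ^ m)\<^sup>2" if "n \<ge> m" for n
      unfolding fdist using M[OF rM rM, of m n m] that by (intro power_mono) auto
    have 3: "(\<lambda>x. F x - f m x) \<in> borel_measurable lebesgue" using Fm meas by measurable
    show "sq_integrable (\<lambda>x. F x - f m x)" "(\<integral>x. (norm (F x - f m x))\<^sup>2 \<partial>lebesgue) \<le> ((1/4) ^ m)\<^sup>2"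
      using sq_integrable_AE_limit[OF sq_integrable_diff[OF f f] 3 1 2] by auto
  qed
  have F: "sq_integrable F" using sq_integrable_add[OF bd(1)[of 0] f[of 0]] by simp
  have "norm (X (r m) - abs_l2 F) \<le> (1/4) ^ m" for m
  proof -
    have "AE x in lebesgue. rep_l2 (abs_l2 F - X (r m)) x = F x - f m x"
      using rep_l2_minus[of "abs_l2 F" "X (r m)"] rep_abs_l2[OF F] by eventually_elim (simp add: f_def)
    from inner_l2_cong[OF this this bd(1) bd(1)]
    have "(norm (abs_l2 F - X (r m)))\<^sup>2 \<le> ((1/4) ^ m)\<^sup>2"
      using bd(2)[of m] by (simp only: power2_norm_eq_inner)
    then have "norm (abs_l2 F - X (r m)) \<le> (1/4) ^ m" by (rule power2_le_imp_le) simp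
    then show ?thesis by (simp only: norm_minus_commute)
  qed
  then have "\<forall>\<^sub>F m in sequentially. norm (X (r m) - abs_l2 F) \<le> (1/4) ^ m" by (intro always_eventually allI)
  moreover have "(\<lambda>m. (1/4) ^ m) \<longlonglongrightarrow> (0::real)" by (rule LIMSEQ_power_zero) simp
  ultimately have "(\<lambda>m. X (r m) - abs_l2 F) \<longlonglongrightarrow> 0" by (rule Lim_null_comparison)
  then have "(X \<circ> r) \<longlonglongrightarrow> abs_l2 F" unfolding o_def by (rule LIM_zero_cancel)
  then have "X \<longlonglongrightarrow> abs_l2 F" by (rule Cauchy_converges_subseq[OF X r])
  then show "convergent X" by (rule convergentI)
qed

section \<open>Test functions\<close>

text \<open>A class of differentiable functions closed under directional derivatives contains all
  iterated derivatives of its members; this spares any formula for higher derivatives.\<close>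

lemma smooth_fun_coinduct:
  assumes "P f" "\<And>f x. P f \<Longrightarrow> f differentiable (at x)"
    "\<And>f e. P f \<Longrightarrow> P (\<lambda>x. frechet_derivative f (at x) e)"
  shows "smooth_fun f"
proof -
  have "P (dderiv es f)" for es by (induction es) (use assms in auto)
  then show ?thesis unfolding smooth_fun_def using assms(2) by blast
qed

lemma smooth_fun_differentiable: "smooth_fun f \<Longrightarrow> f differentiable (at x)"
  unfolding smooth_fun_def by (drule spec[of _ "[]"]) simp

lemma smooth_fun_has_derivative: "smooth_fun f \<Longrightarrow> (f has_derivative frechet_derivative f (at x)) (at x)"
  using smooth_fun_differentiable frechet_derivative_works by blast

lemma smooth_fun_continuous: "smooth_fun f \<Longrightarrow> continuous_on UNIV f"
  by (meson continuous_at_imp_continuous_on differentiable_imp_continuous_within smooth_fun_differentiable)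

lemma smooth_fun_continuous_derivative:
  assumes "smooth_fun f" shows "continuous_on UNIV (\<lambda>x. frechet_derivative f (at x) e)"
proof -
  have "dderiv [e] f differentiable (at x)" for x using assms by (simp add: smooth_fun_def del: dderiv.simps)
  then show ?thesis by (simp add: continuous_at_imp_continuous_on differentiable_imp_continuous_within)
qed

lemma smooth_fun_linear:
  assumes f: "smooth_fun f" and g: "smooth_fun g" shows "smooth_fun (\<lambda>x. f x + c * g x)"
proof -
  have "dderiv es (\<lambda>x. f x + c * g x) = (\<lambda>x. dderiv es f x + c * dderiv es g x)" for es
  proof (induction es)
    case (Cons e es)
    have "frechet_derivative (\<lambda>x. dderiv es f x + c * dderiv es g x) (at x)
        = (\<lambda>e. frechet_derivative (dderiv es f) (at x) e + c * frechet_derivative (dderiv es g) (at x) e)" for x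
    proof (rule frechet_derivative_at[symmetric])
      have "(dderiv es f has_derivative frechet_derivative (dderiv es f) (at x)) (at x)"
        "(dderiv es g has_derivative frechet_derivative (dderiv es g) (at x)) (at x)"
        using f g by (auto simp: smooth_fun_def simp flip: frechet_derivative_works)
      then show "((\<lambda>x. dderiv es f x + c * dderiv es g x) has_derivative
          (\<lambda>e. frechet_derivative (dderiv es f) (at x) e + c * frechet_derivative (dderiv es g) (at x) e)) (at x)"
        by (auto intro!: derivative_eq_intros)
    qed
    then show ?case by (simp add: Cons)
  qed simp
  then show ?thesis using f g by (auto simp: smooth_fun_def intro!: derivative_intros)
qed

lemma smooth_fun_zero: "smooth_fun (\<lambda>x. 0)"
  by (rule smooth_fun_coinduct[of "\<lambda>f. f = (\<lambda>x. 0)"]) auto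

lemma test_fun_zero: "test_fun U (\<lambda>x. 0)"
  by (simp add: test_fun_def smooth_fun_zero)

lemma test_fun_linear:
  assumes "test_fun U f" "test_fun U g" shows "test_fun U (\<lambda>x. f x + c * g x)"
proof -
  have sub: "{x. f x + c * g x \<noteq> 0} \<subseteq> closure {x. f x \<noteq> 0} \<union> closure {x. g x \<noteq> 0}"
  proof
    fix x assume "x \<in> {x. f x + c * g x \<noteq> 0}"
    then have "f x \<noteq> 0 \<or> g x \<noteq> 0" by auto
    then show "x \<in> closure {x. f x \<noteq> 0} \<union> closure {x. g x \<noteq> 0}"
      using closure_subset[of "{x. f x \<noteq> 0}"] closure_subset[of "{x. g x \<noteq> 0}"] by auto
  qed
  then have sub': "closure {x. f x + c * g x \<noteq> 0} \<subseteq> closure {x. f x \<noteq> 0} \<union> closure {x. g x \<noteq> 0}"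
    by (intro closure_minimal) auto
  have "compact (closure {x. f x \<noteq> 0} \<union> closure {x. g x \<noteq> 0})"
    using assms by (intro compact_Un) (auto simp: test_fun_def)
  then have "compact (closure {x. f x + c * g x \<noteq> 0})"
    unfolding compact_eq_bounded_closed[of "closure {x. f x + c * g x \<noteq> 0}"]
    using bounded_subset[OF compact_imp_bounded sub'] closed_closure by blast
  then show ?thesis using assms sub' by (auto simp: test_fun_def smooth_fun_linear)
qed

section \<open>Smooth bump functions on boxes\<close>

text \<open>\<open>flat 0 k\<close> is the classical smooth function that is flat at 0. The powers
  of 1 / s are included because differentiation produces them, so that the family is closed under it
  up to linear combinations.\<close>

definition flat :: "nat \<Rightarrow> real \<Rightarrow> real \<Rightarrow> real" where
  "flat n k s = (if s > 0 then (1 / s) ^ n * exp (- k / s) else 0)"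

lemma flat_limit:
  assumes k: "k > 0" shows "((\<lambda>s. (1 / s) ^ n * exp (- k / s)) \<longlongrightarrow> 0) (at_right (0::real))"
proof -
  have "filterlim (\<lambda>s. k * inverse s) at_top (at_right (0::real))"
    using k by (intro filterlim_tendsto_pos_mult_at_top[OF tendsto_const] filterlim_inverse_at_top_right)
  from filterlim_compose[OF tendsto_power_div_exp_0[of n] this]
  have "((\<lambda>s. (1 / k ^ n) * ((k * inverse s) ^ n / exp (k * inverse s))) \<longlongrightarrow> (1 / k ^ n) * 0) (at_right 0)"
    by (intro tendsto_mult_left)
  moreover have "(1 / k ^ n) * ((k * inverse s) ^ n / exp (k * inverse s)) = (1 / s) ^ n * exp (- k / s)" for s
    using k by (simp add: power_mult_distrib exp_minus divide_inverse power_inverse)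
  ultimately show ?thesis by simp
qed

lemma flat_derivative:
  assumes k: "k > 0"
  shows "(flat n k has_real_derivative (- real n * flat (n + 1) k s + k * flat (n + 2) k s)) (at s)"
proof -
  consider "s > 0" | "s < 0" | "s = 0" by linarith
  then show ?thesis
  proof cases
    case 1
    let ?y = "inverse s"
    have i: "(inverse has_real_derivative - (?y ^ Suc (Suc 0))) (at s)" using 1 by (intro DERIV_inverse) simp
    have "((\<lambda>s. inverse s ^ n * exp (- k * inverse s)) has_real_derivative
        (real n * (- (?y ^ Suc (Suc 0)) * ?y ^ (n - Suc 0))) * exp (- k * ?y) + (exp (- k * ?y) * (- k * - (?y ^ Suc (Suc 0)))) * ?y ^ n) (at s)"
      by (rule DERIV_mult[OF DERIV_power[OF i] DERIV_fun_exp[OF DERIV_cmult[OF i]]])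
    moreover have "(real n * (- (?y ^ Suc (Suc 0)) * ?y ^ (n - Suc 0))) * exp (- k * ?y) + (exp (- k * ?y) * (- k * - (?y ^ Suc (Suc 0)))) * ?y ^ n
       = - real n * flat (n + 1) k s + k * flat (n + 2) k s"
      using 1 by (cases n) (simp_all add: flat_def inverse_eq_divide field_simps)
    ultimately have "((\<lambda>s. inverse s ^ n * exp (- k * inverse s)) has_real_derivative (- real n * flat (n + 1) k s + k * flat (n + 2) k s)) (at s)"
      by (simp only:)
    then show ?thesis
      by (rule has_field_derivative_transform_within_open[where S="{0<..}"]) (use 1 in \<open>auto simp: flat_def inverse_eq_divide\<close>)
  next
    case 2
    have "((\<lambda>s. 0) has_real_derivative (- real n * flat (n + 1) k s + k * flat (n + 2) k s)) (at s)"
      using 2 by (simp add: flat_def)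
    then show ?thesis
      by (rule has_field_derivative_transform_within_open[where S="{..<0}"]) (use 2 in \<open>auto simp: flat_def\<close>)
  next
    case 3
    \<comment> \<open>At 0 the left quotient is 0 and the right quotient is
      \<open>flat (n + 1) k\<close>, which tends to 0.\<close>
    have "((\<lambda>h. (flat n k (0 + h) - flat n k 0) / h) \<longlongrightarrow> 0) (at 0)"
      unfolding filterlim_at_split
    proof
      show "((\<lambda>h. (flat n k (0 + h) - flat n k 0) / h) \<longlongrightarrow> 0) (at_left 0)"
        by (rule tendsto_eventually) (auto simp: flat_def eventually_at_filter)
      have "\<forall>\<^sub>F h in at_right 0. (1 / h) ^ (n + 1) * exp (- k / h) = (flat n k (0 + h) - flat n k 0) / h"
        by (auto simp: flat_def eventually_at_filter)
      from Lim_transform_eventually[OF flat_limit[OF k] this]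
      show "((\<lambda>h. (flat n k (0 + h) - flat n k 0) / h) \<longlongrightarrow> 0) (at_right 0)" .
    qed
    then show ?thesis using 3 by (simp add: DERIV_def flat_def)
  qed
qed

text \<open>Closed under directional derivatives by design, the chain rule for ridge functions
  included; \<open>smooth_fun_coinduct\<close> then yields smoothness of all members.\<close>

inductive flat_algebra :: "('a::euclidean_space \<Rightarrow> real) \<Rightarrow> bool" where
  const: "flat_algebra (\<lambda>x. c)"
| ridge: "k > 0 \<Longrightarrow> flat_algebra (\<lambda>x. flat n k (x \<bullet> u + c))"
| add: "flat_algebra f \<Longrightarrow> flat_algebra g \<Longrightarrow> flat_algebra (\<lambda>x. f x + g x)"
| mult: "flat_algebra f \<Longrightarrow> flat_algebra g \<Longrightarrow> flat_algebra (\<lambda>x. f x * g x)"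

lemma flat_algebra_derivative:
  assumes "flat_algebra f"
  shows "(\<forall>x. f differentiable (at x)) \<and> (\<forall>e. flat_algebra (\<lambda>x. frechet_derivative f (at x) e))"
  using assms
proof induction
  case (const c) then show ?case by (auto intro: flat_algebra.const)
next
  case (ridge k n u c)
  have d: "((\<lambda>x. flat n k (x \<bullet> u + c)) has_derivative
      (\<lambda>e. (e \<bullet> u) * (- real n * flat (n + 1) k (x \<bullet> u + c) + k * flat (n + 2) k (x \<bullet> u + c)))) (at x)" for x
    by (rule has_derivative_compose[OF _ flat_derivative[OF ridge, THEN has_field_derivative_imp_has_derivative], THEN has_derivative_eq_rhs])
      (auto intro!: derivative_eq_intros simp: mult.commute)
  have "(\<lambda>x. frechet_derivative (\<lambda>x. flat n k (x \<bullet> u + c)) (at x) e)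
     = (\<lambda>x. (e \<bullet> u) * (- real n * flat (n + 1) k (x \<bullet> u + c) + k * flat (n + 2) k (x \<bullet> u + c)))" for e
    by (rule ext) (rule fun_cong[OF frechet_derivative_at[OF d], symmetric])
  note eq = this
  have "(\<lambda>x. flat n k (x \<bullet> u + c)) differentiable (at x)" for x using d unfolding differentiable_def by blast
  moreover have "flat_algebra (\<lambda>x. frechet_derivative (\<lambda>x. flat n k (x \<bullet> u + c)) (at x) e)" for e
    unfolding eq using ridge by (intro flat_algebra.mult flat_algebra.add flat_algebra.const flat_algebra.ridge)
  ultimately show ?case by blast
next
  case (add f g)
  have "((\<lambda>x. f x + g x) has_derivative (\<lambda>e. frechet_derivative f (at x) e + frechet_derivative g (at x) e)) (at x)" for x
    using add by (intro has_derivative_add) (auto simp flip: frechet_derivative_works)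
  note d = this
  have "(\<lambda>x. frechet_derivative (\<lambda>x. f x + g x) (at x) e) = (\<lambda>x. frechet_derivative f (at x) e + frechet_derivative g (at x) e)" for e
    by (rule ext) (rule fun_cong[OF frechet_derivative_at[OF d], symmetric])
  note eq = this
  have "(\<lambda>x. f x + g x) differentiable (at x)" for x using d unfolding differentiable_def by blast
  moreover have "flat_algebra (\<lambda>x. frechet_derivative (\<lambda>x. f x + g x) (at x) e)" for e
    unfolding eq using add by (intro flat_algebra.add) auto
  ultimately show ?case by blast
next
  case (mult f g)
  have "((\<lambda>x. f x * g x) has_derivative (\<lambda>e. f x * frechet_derivative g (at x) e + frechet_derivative f (at x) e * g x)) (at x)" for x
    using mult by (intro has_derivative_mult) (auto simp flip: frechet_derivative_works)
  note d = this
  have "(\<lambda>x. frechet_derivative (\<lambda>x. f x * g x) (at x) e) = (\<lambda>x. f x * frechet_derivative g (at x) e + frechet_derivative f (at x) e * g x)" for e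
    by (rule ext) (rule fun_cong[OF frechet_derivative_at[OF d], symmetric])
  note eq = this
  have "(\<lambda>x. f x * g x) differentiable (at x)" for x using d unfolding differentiable_def by blast
  moreover have "flat_algebra (\<lambda>x. frechet_derivative (\<lambda>x. f x * g x) (at x) e)" for e
    unfolding eq using mult by (intro flat_algebra.add flat_algebra.mult) auto
  ultimately show ?case by blast
qed

lemma flat_algebra_smooth: "flat_algebra f \<Longrightarrow> smooth_fun f"
  by (rule smooth_fun_coinduct[of flat_algebra]) (use flat_algebra_derivative in blast)+

lemma flat_algebra_prod:
  assumes "finite I" "\<And>i. i \<in> I \<Longrightarrow> flat_algebra (f i)" shows "flat_algebra (\<lambda>x. \<Prod>i\<in>I. f i x)"
  using assms by (induction I) (auto intro: flat_algebra.intros)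

text \<open>\<open>k\<close> controls sharpness and not width: the support stays in the closed box
  for every positive k, and as k tends to 0 the values tend to 1 in the open box.\<close>

definition box_bump :: "real \<Rightarrow> 'a::euclidean_space \<Rightarrow> 'a \<Rightarrow> 'a \<Rightarrow> real" where
  "box_bump k a b x = (\<Prod>i\<in>Basis. flat 0 k (x \<bullet> i - a \<bullet> i) * flat 0 k (b \<bullet> i - x \<bullet> i))"

lemma box_bump_smooth:
  assumes "k > 0" shows "smooth_fun (box_bump k a b)"
proof -
  have "flat_algebra (\<lambda>x. \<Prod>i\<in>Basis. flat 0 k (x \<bullet> i + (- (a \<bullet> i))) * flat 0 k (x \<bullet> (- i) + b \<bullet> i))"
    using assms by (intro flat_algebra_prod flat_algebra.mult flat_algebra.ridge) auto
  from flat_algebra_smooth[OF this] show ?thesis by (simp add: box_bump_def[abs_def])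
qed

lemma box_bump_bounds:
  assumes "k > 0"
  shows "0 \<le> box_bump k a b x" "box_bump k a b x \<le> 1" "x \<notin> box a b \<Longrightarrow> box_bump k a b x = 0"
proof -
  have f: "0 \<le> flat 0 k s" "flat 0 k s \<le> 1" for s using assms by (auto simp: flat_def)
  show "0 \<le> box_bump k a b x" unfolding box_bump_def using f by (intro prod_nonneg) auto
  show "box_bump k a b x \<le> 1" unfolding box_bump_def using f by (intro prod_le_1) (auto intro: mult_le_one)
  show "box_bump k a b x = 0" if nx: "x \<notin> box a b"
  proof -
    obtain i where "i \<in> Basis" "\<not> (a \<bullet> i < x \<bullet> i \<and> x \<bullet> i < b \<bullet> i)" using nx unfolding mem_box by blast
    then show ?thesis unfolding box_bump_def by (intro prod_zero) (auto simp: flat_def intro!: bexI[of _ i])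
  qed
qed

lemma box_bump_test_fun:
  assumes "k > 0" "cbox a b \<subseteq> U" shows "test_fun U (box_bump k a b)"
proof -
  have "{x. box_bump k a b x \<noteq> 0} \<subseteq> cbox a b" using box_bump_bounds(3)[OF assms(1)] box_subset_cbox by blast
  then have c: "closure {x. box_bump k a b x \<noteq> 0} \<subseteq> cbox a b" by (rule closure_minimal) (rule closed_cbox)
  then have "compact (closure {x. box_bump k a b x \<noteq> 0})"
    by (metis closed_closure compact_Int_closed compact_cbox inf.absorb_iff2)
  then show ?thesis using c assms box_bump_smooth by (auto simp: test_fun_def)
qed

lemma box_bump_limit:
  "(\<lambda>m. box_bump (1 / real (Suc m)) a b x) \<longlonglongrightarrow> indicator (box a b) x"
proof (cases "x \<in> box a b")
  case True
  have fl: "(\<lambda>m. flat 0 (1 / real (Suc m)) s) \<longlonglongrightarrow> 1" if "s > 0" for s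
  proof -
    have "(\<lambda>m. exp (- (1 / real (Suc m)) / s)) \<longlonglongrightarrow> exp (- 0 / s)"
      using that by (intro tendsto_intros LIMSEQ_Suc[OF lim_1_over_n]) auto
    then show ?thesis using that by (simp add: flat_def)
  qed
  have "(\<lambda>m. box_bump (1 / real (Suc m)) a b x) \<longlonglongrightarrow> (\<Prod>i\<in>(Basis::'a set). 1 * 1)"
    unfolding box_bump_def using True by (intro tendsto_prod tendsto_mult fl) (auto simp: mem_box)
  then show ?thesis using True by simp
next
  case False
  have "(\<lambda>m. box_bump (1 / real (Suc m)) a b x) = (\<lambda>m. 0)"
    using box_bump_bounds(3)[OF _ False] by (intro ext) simp
  then show ?thesis using False by simp
qed

section \<open>The fundamental lemma of the calculus of variations\<close>

lemma integral_lebesgue_on: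
  fixes f :: "'a::euclidean_space \<Rightarrow> 'b::euclidean_space"
  assumes "U \<in> sets lebesgue"
  shows "integral\<^sup>L (lebesgue_on U) f = (\<integral>x. indicator U x *\<^sub>R f x \<partial>lebesgue)"
    "integrable (lebesgue_on U) f \<longleftrightarrow> integrable lebesgue (\<lambda>x. indicator U x *\<^sub>R f x)"
    "f \<in> borel_measurable (lebesgue_on U) \<longleftrightarrow> (\<lambda>x. indicator U x *\<^sub>R f x) \<in> borel_measurable lebesgue"
  using assms by (auto intro!: integral_restrict_space integrable_restrict_space borel_measurable_restrict_space_iff)

lemma sq_integrable_indicator_cbox: "sq_integrable (indicator (cbox a b) :: 'a::euclidean_space \<Rightarrow> real)"
  unfolding sq_integrable_def
proof
  have "(\<lambda>x. (norm (indicator (cbox a b) x :: real))\<^sup>2) = indicator (cbox a b)" by (auto simp: indicator_def fun_eq_iff)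
  moreover have "integrable lebesgue (indicator (cbox a b) :: 'a \<Rightarrow> real)"
    using lmeasurable_cbox[of a b] by (intro integrable_real_indicator) (auto simp: fmeasurable_def)
  ultimately show "integrable lebesgue (\<lambda>x. (norm (indicator (cbox a b) x :: real))\<^sup>2)" by simp
qed (auto intro: borel_measurable_indicator)

text \<open>Open boxes are an intersection-stable generator of the Borel sets, so the integral
  vanishes over every Borel set by Dynkin's argument. \<open>D\<close> is first replaced by a Borel
  version cut off to one box: the generator argument lives on \<open>lborel\<close>, and the cut-off
  provides integrability.\<close>

lemma AE_zero_of_box_integrals:
  fixes D :: "'a::euclidean_space \<Rightarrow> real"
  assumes D: "sq_integrable D" and Q: "cbox a0 b0 \<subseteq> U"
    and int0: "\<And>a b. cbox a b \<subseteq> U \<Longrightarrow> (\<integral>x. D x * indicator (box a b) x \<partial>lebesgue) = 0"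
  shows "AE x in lebesgue. x \<in> cbox a0 b0 \<longrightarrow> D x = 0"
proof -
  obtain D' where D': "D' \<in> borel_measurable lborel" "AE x in lborel. D x = D' x"
    using completion_ex_borel_measurable_real[OF sq_integrable_measurable[OF D]] by auto
  have [measurable]: "D' \<in> borel_measurable borel" using D'(1) by simp
  have eq: "AE x in lebesgue. D x = D' x" using D'(2) by (simp add: AE_completion_iff)
  define f where "f x = D' x * indicator (box a0 b0) x" for x
  have fm[measurable]: "f \<in> borel_measurable borel" unfolding f_def by measurable
  have DQ: "integrable lebesgue (\<lambda>x. D x * indicator (cbox a0 b0) x)"
    using sq_integrable_inner[OF D sq_integrable_indicator_cbox] by simp
  have "integrable lebesgue (\<lambda>x. D x * indicator (cbox a0 b0) x * indicator (box a0 b0) x)"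
    by (rule integrable_real_mult_indicator[OF _ DQ]) auto
  moreover have "AE x in lebesgue. D x * indicator (cbox a0 b0) x * indicator (box a0 b0) x = f x"
    using eq by eventually_elim (auto simp: f_def indicator_def dest: subsetD[OF box_subset_cbox])
  moreover have fL: "f \<in> borel_measurable lebesgue" by (rule measurable_completion) simp
  ultimately have "integrable lebesgue f" by (intro integrable_cong_AE_imp[OF _ fL])
  then have fi: "integrable lborel f" using fm by (simp add: integrable_completion)
  have fbox: "(\<integral>x. indicator (box a b) x *\<^sub>R f x \<partial>lborel) = 0" for a b
  proof -
    obtain c d where cd: "box a b \<inter> box a0 b0 = box c d" using box_Int_box by blast
    \<comment> \<open>When \<open>box c d\<close> is empty, \<open>cbox c d\<close> may still be
      nonempty and leave \<open>U\<close>; otherwise it is the closure of the open box.\<close>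
    have sub: "cbox c d \<subseteq> U" if "box c d \<noteq> {}"
    proof -
      have "closure (box c d) \<subseteq> cbox a0 b0"
        using cd box_subset_cbox by (intro closure_minimal) (auto simp flip: cd)
      then show ?thesis using Q that by auto
    qed
    have "(\<integral>x. indicator (box a b) x *\<^sub>R f x \<partial>lborel) = (\<integral>x. indicator (box a b) x *\<^sub>R f x \<partial>lebesgue)"
      by (rule integral_completion[symmetric]) measurable
    also have "\<dots> = (\<integral>x. D x * indicator (box c d) x \<partial>lebesgue)"
    proof (rule integral_cong_AE)
      show "AE x in lebesgue. indicator (box a b) x *\<^sub>R f x = D x * indicator (box c d) x"
        using eq by eventually_elim (auto simp: f_def indicator_def simp flip: cd)
      show "(\<lambda>x. D x * indicator (box c d) x) \<in> borel_measurable lebesgue"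
        using sq_integrable_measurable[OF D] by (intro borel_measurable_times borel_measurable_indicator) auto
      show "(\<lambda>x. indicator (box a b) x *\<^sub>R f x) \<in> borel_measurable lebesgue"
        by (intro measurable_completion) measurable
    qed
    also have "\<dots> = 0"
    proof (cases "box c d = {}")
      case False then show ?thesis using int0 sub by blast
    qed simp
    finally show ?thesis .
  qed
  let ?G = "range (\<lambda>(a, b). box a b :: 'a set)"
  have "(\<integral>x\<in>A. f x \<partial>lborel) = (\<integral>x\<in>A. 0 \<partial>lborel)" if "A \<in> sets lborel" for A
  proof -
    have A: "A \<in> sigma_sets UNIV ?G" using that by (simp add: borel_eq_box)
    have stable: "Int_stable ?G"
    proof (rule Int_stableI)
      fix A B :: "'a set" assume "A \<in> ?G" "B \<in> ?G"
      then obtain a b c d where AB: "A = box a b" "B = box c d" by auto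
      obtain p q where "A \<inter> B = box p q" unfolding AB using box_Int_box by blast
      then show "A \<inter> B \<in> ?G" by (intro image_eqI[of _ _ "(p, q)"]) auto
    qed
    have "?G \<subseteq> Pow UNIV" by simp
    from stable this A have "(\<integral>x\<in>A. f x \<partial>lborel) = 0"
    proof (induction rule: sigma_sets_induct_disjoint)
      case (basic A) then show ?case using fbox by (auto simp: set_lebesgue_integral_def)
    next
      case (compl A)
      have A: "A \<in> sets lborel" using compl(1) by (simp add: borel_eq_box)
      have "(\<integral>x. f x \<partial>lborel) = 0"
      proof -
        have "(\<lambda>x. indicator (box a0 b0) x *\<^sub>R f x) = f" by (auto simp: f_def indicator_def fun_eq_iff)
        then show ?thesis using fbox[of a0 b0] by simp
      qed
      moreover have "(\<integral>x. f x \<partial>lborel) = (\<integral>x. indicator (UNIV - A) x *\<^sub>R f x + indicator A x *\<^sub>R f x \<partial>lborel)"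
        by (rule Bochner_Integration.integral_cong) (auto simp: indicator_def)
      moreover have "\<dots> = (\<integral>x\<in>UNIV - A. f x \<partial>lborel) + (\<integral>x\<in>A. f x \<partial>lborel)"
        unfolding set_lebesgue_integral_def using A fi
        by (intro Bochner_Integration.integral_add integrable_mult_indicator) auto
      ultimately show ?case using compl(2) by simp
    next
      case (union F)
      have F: "F i \<in> sets lborel" for i using union(2) by (auto simp: borel_eq_box)
      have "(\<integral>x\<in>(\<Union>i. F i). f x \<partial>lborel) = (\<Sum>i. \<integral>x\<in>F i. f x \<partial>lborel)"
      proof (rule lebesgue_integral_countable_add)
        show "set_integrable lborel (\<Union>i. F i) f"
          unfolding set_integrable_def using F fi by (intro integrable_mult_indicator) auto
      qed (use F union(1) in \<open>auto simp: disjoint_family_on_def\<close>)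
      then show ?case using union(3) by simp
    qed (auto simp: set_lebesgue_integral_def)
    then show ?thesis by (simp add: set_lebesgue_integral_def)
  qed
  from density_unique_real[OF fi _ this] have "AE x in lborel. f x = 0" by simp
  then have f0: "AE x in lebesgue. f x = 0" by (simp add: AE_completion_iff)
  have "cbox a0 b0 - box a0 b0 \<in> null_sets lebesgue"
    using negligible_frontier_interval negligible_iff_null_sets by blast
  then have "AE x in lebesgue. x \<notin> cbox a0 b0 - box a0 b0" by (rule AE_not_in)
  with f0 eq show ?thesis by eventually_elim (auto simp: f_def)
qed

text \<open>Box bumps converge boundedly to indicators of boxes, which reduces the claim to
  \<open>AE_zero_of_box_integrals\<close>; \<open>U\<close> is a countable union of closed boxes, so
  the exceptional null sets add up to a null set.\<close>

lemma fundamental_lemma: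
  fixes d :: "'a::euclidean_space \<Rightarrow> real"
  assumes U: "open U" and d: "L2 U d"
    and int: "\<And>\<phi>. test_fun U \<phi> \<Longrightarrow> (\<integral>x. d x * \<phi> x \<partial>lebesgue_on U) = 0"
  shows "AE x in lebesgue_on U. d x = 0"
proof -
  have UL: "U \<in> sets lebesgue" using U by auto
  define D where "D x = indicator U x *\<^sub>R d x" for x
  have D: "sq_integrable D"
  proof -
    have "(\<lambda>x. (norm (D x))\<^sup>2) = (\<lambda>x. indicator U x *\<^sub>R (d x)\<^sup>2)" by (auto simp: D_def indicator_def)
    then show ?thesis using d unfolding L2_def sq_integrable_def integral_lebesgue_on[OF UL] D_def by auto
  qed
  note Dm = sq_integrable_measurable[OF D]
  have int0: "(\<integral>x. D x * indicator (box a b) x \<partial>lebesgue) = 0" if ab: "cbox a b \<subseteq> U" for a b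
  proof -
    let ?s = "\<lambda>m x. D x * box_bump (1 / real (Suc m)) a b x"
    have bm: "box_bump (1 / real (Suc m)) a b \<in> borel_measurable lebesgue" for m
      using smooth_fun_continuous[OF box_bump_smooth, of "1 / real (Suc m)" a b]
      by (intro measurable_completion) (simp add: borel_measurable_continuous_onI)
    have "(\<lambda>m. \<integral>x. ?s m x \<partial>lebesgue) \<longlonglongrightarrow> (\<integral>x. D x * indicator (box a b) x \<partial>lebesgue)"
    proof (rule integral_dominated_convergence)
      show "integrable lebesgue (\<lambda>x. \<bar>D x * indicator (cbox a b) x\<bar>)"
        using sq_integrable_inner[OF D sq_integrable_indicator_cbox[of a b]] by (intro integrable_abs) simp
      show "AE x in lebesgue. (\<lambda>m. ?s m x) \<longlonglongrightarrow> D x * indicator (box a b) x"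
        by (intro AE_I2 tendsto_intros box_bump_limit)
      show "AE x in lebesgue. norm (?s m x) \<le> \<bar>D x * indicator (cbox a b) x\<bar>" for m
      proof (rule AE_I2)
        fix x
        show "norm (?s m x) \<le> \<bar>D x * indicator (cbox a b) x\<bar>"
        proof (cases "x \<in> cbox a b")
          case True
          then show ?thesis using box_bump_bounds[of "1 / real (Suc m)" a b x]
            by (auto simp: abs_mult intro: mult_left_le)
        next
          case False
          then have "x \<notin> box a b" using box_subset_cbox by blast
          then have "box_bump (1 / real (Suc m)) a b x = 0" by (intro box_bump_bounds(3)) auto
          then show ?thesis by (simp del: of_nat_Suc)
        qed
      qed
      show "(\<lambda>x. D x * indicator (box a b) x) \<in> borel_measurable lebesgue"
        using Dm by (intro borel_measurable_times borel_measurable_indicator) auto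
      show "?s m \<in> borel_measurable lebesgue" for m using Dm bm by (rule borel_measurable_times)
    qed
    moreover have "(\<integral>x. ?s m x \<partial>lebesgue) = 0" for m
      using int[OF box_bump_test_fun[OF _ ab, of "1 / real (Suc m)"]]
      unfolding integral_lebesgue_on[OF UL] by (simp add: D_def mult.assoc)
    ultimately have "(\<lambda>m. 0) \<longlonglongrightarrow> (\<integral>x. D x * indicator (box a b) x \<partial>lebesgue)" by (simp only:)
    from LIMSEQ_unique[OF this tendsto_const] show ?thesis .
  qed
  obtain \<D> where \<D>: "countable \<D>" "\<D> \<subseteq> Pow U" "\<And>X. X \<in> \<D> \<Longrightarrow> \<exists>a b. X = cbox a b" "\<Union>\<D> = U"
  proof (rule open_countable_Union_open_cbox[OF U])
    fix \<D> assume a: "countable \<D>" "\<D> \<subseteq> Pow U" "\<And>X. X \<in> \<D> \<Longrightarrow> \<exists>a b. X = cbox a b" "\<Union>\<D> = U"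
    show thesis by (rule that[OF a])
  qed
  have "AE x in lebesgue. \<forall>X\<in>\<D>. x \<in> X \<longrightarrow> D x = 0"
  proof (subst AE_ball_countable[OF \<D>(1)], rule ballI)
    fix X assume X: "X \<in> \<D>"
    obtain a b where ab: "X = cbox a b" using \<D>(3)[OF X] by blast
    then have "cbox a b \<subseteq> U" using \<D>(2) X by auto
    from AE_zero_of_box_integrals[OF D this int0] show "AE x in lebesgue. x \<in> X \<longrightarrow> D x = 0" by (simp add: ab)
  qed
  then have "AE x in lebesgue. x \<in> U \<longrightarrow> d x = 0"
  proof eventually_elim
    case (elim x)
    show ?case
    proof
      assume x: "x \<in> U"
      then obtain X where "X \<in> \<D>" "x \<in> X" using \<D>(4) by blast
      then have "D x = 0" using elim by blast
      then show "d x = 0" using x by (simp add: D_def)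
    qed
  qed
  then show ?thesis using UL by (subst AE_restrict_space_iff) auto
qed

text \<open>Difference quotients are moved from \<open>\<eta>\<close> to \<open>f\<close> by translation invariance, which replaces
  Rademacher's theorem.\<close>
lemma lipschitz_integral_bound:
  fixes f \<eta> :: "'a::euclidean_space \<Rightarrow> real"
  assumes U: "open U" and f: "L-lipschitz_on U f"
    and \<eta>: "\<And>x. (\<eta> has_derivative \<eta>' x) (at x)" "continuous_on UNIV (\<lambda>x. \<eta>' x e)"
    and K: "compact K" "K \<subseteq> U" "\<And>x. x \<notin> K \<Longrightarrow> \<eta> x = 0"
  shows "\<bar>\<integral>x. f x * \<eta>' x e \<partial>lebesgue_on U\<bar> \<le> L * norm e * (\<integral>x. \<bar>\<eta> x\<bar> \<partial>lebesgue_on U)"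
proof -
  have UL: "U \<in> sets lebesgue" "U \<in> sets borel" using U by auto
  have L: "L \<ge> 0" using f lipschitz_on_nonneg by blast
  have \<eta>c: "continuous_on UNIV \<eta>" using has_derivative_continuous[OF \<eta>(1)] by (intro continuous_at_imp_continuous_on) auto
  define F where "F x = indicator U x *\<^sub>R f x" for x
  have Fm[measurable]: "F \<in> borel_measurable borel"
    unfolding F_def using lipschitz_on_continuous_on[OF f] UL by (intro borel_measurable_continuous_on_indicator)
  have \<eta>m[measurable]: "\<eta> \<in> borel_measurable borel" "(\<lambda>x. \<eta>' x e) \<in> borel_measurable borel"
    using \<eta>c \<eta>(2) by (auto intro: borel_measurable_continuous_onI)
  obtain \<delta> where \<delta>: "\<delta> > 0" "(\<Union>x\<in>K. cball x \<delta>) \<subseteq> U"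
    using compact_subset_open_imp_cball_epsilon_subset[OF K(1) U K(2)] by blast
  \<comment> \<open>The support enlarged by \<delta>. It contains every point that a shift by at
    most \<delta> moves into the support, and still lies in \<open>U\<close>, where f is
    Lipschitz.\<close>
  define K' where "K' = {x + y | x y. x \<in> K \<and> y \<in> cball 0 \<delta>}"
  have K': "compact K'" unfolding K'_def by (intro compact_sums K compact_cball)
  have K'U: "K' \<subseteq> U"
  proof
    fix z assume "z \<in> K'"
    then obtain x y where "z = x + y" "x \<in> K" "norm y \<le> \<delta>" by (auto simp: K'_def)
    then have "z \<in> cball x \<delta>" by (simp add: dist_norm)
    then show "z \<in> U" using \<delta>(2) \<open>x \<in> K\<close> by blast
  qed
  have K'I: "x \<in> K'" if "x + y \<in> K" "norm y \<le> \<delta>" for x y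
    unfolding K'_def using that by (intro CollectI exI[of _ "x + y"] exI[of _ "- y"]) auto
  have KK': "K \<subseteq> K'" using K'I[of _ 0] \<delta>(1) by auto
  have \<eta>'0: "\<eta>' x e = 0" if "x \<notin> K" for x
  proof -
    have "(\<eta> has_derivative (\<lambda>_. 0)) (at x)"
      by (rule has_derivative_transform_within_open[of "\<lambda>_. 0" _ _ _ "- K"])
        (use that K compact_imp_closed in auto)
    then show ?thesis using has_derivative_unique[OF \<eta>(1)] by metis
  qed
  obtain C where C: "\<And>x. \<bar>\<eta>' x e\<bar> \<le> C"
  proof -
    have "bounded ((\<lambda>x. \<eta>' x e) ` K)"
      using K(1) \<eta>(2) by (intro compact_imp_bounded compact_continuous_image) (auto intro: continuous_on_subset)
    then obtain C where "\<And>x. x \<in> K \<Longrightarrow> \<bar>\<eta>' x e\<bar> \<le> C" by (auto simp: bounded_iff)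
    then have "\<bar>\<eta>' x e\<bar> \<le> max C 0" for x using \<eta>'0[of x] by (cases "x \<in> K") (auto simp: le_max_iff_disj)
    then show ?thesis using that by blast
  qed
  obtain CF where CF: "\<And>x. x \<in> K' \<Longrightarrow> \<bar>f x\<bar> \<le> CF" "CF \<ge> 0"
  proof -
    have "bounded (f ` K')"
      using K' K'U lipschitz_on_continuous_on[OF f]
      by (intro compact_imp_bounded compact_continuous_image) (auto intro: continuous_on_subset)
    then obtain C where C: "\<And>x. x \<in> K' \<Longrightarrow> \<bar>f x\<bar> \<le> C" by (auto simp: bounded_iff)
    show ?thesis by (rule that[of "max C 0"]) (use C in \<open>auto simp: le_max_iff_disj\<close>)
  qed
  \<comment> \<open>Positive steps tending to 0 with |h m e| \<le> \<delta>; writing 1 + norm e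
    covers e = 0.\<close>
  obtain h where h: "\<And>m::nat. h m > 0" "\<And>m. norm (h m *\<^sub>R e) \<le> \<delta>" "h \<longlonglongrightarrow> (0::real)"
  proof (rule that[of "\<lambda>m. \<delta> / ((1 + norm e) * real (Suc m))"])
    have ne: "1 + norm e > 0" by (simp add: add_pos_nonneg)
    show "0 < \<delta> / ((1 + norm e) * real (Suc m))" for m using \<delta>(1) ne by (intro divide_pos_pos mult_pos_pos) auto
    show "norm ((\<delta> / ((1 + norm e) * real (Suc m))) *\<^sub>R e) \<le> \<delta>" for m
    proof -
      have "norm e \<le> (1 + norm e) * 1" by simp
      also have "\<dots> \<le> (1 + norm e) * real (Suc m)" using ne by (intro mult_left_mono) auto
      finally have "\<delta> * norm e \<le> \<delta> * ((1 + norm e) * real (Suc m))" using \<delta>(1) by simp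
      then show ?thesis using \<delta>(1) ne by (simp add: divide_le_eq abs_of_pos del: of_nat_Suc)
    qed
    have "(\<lambda>m. (\<delta> / (1 + norm e)) * (1 / real (Suc m))) \<longlonglongrightarrow> (\<delta> / (1 + norm e)) * 0"
      by (intro tendsto_intros LIMSEQ_Suc[OF lim_1_over_n])
    then show "(\<lambda>m. \<delta> / ((1 + norm e) * real (Suc m))) \<longlonglongrightarrow> 0" by simp
  qed
  let ?q = "\<lambda>m x. F x * ((\<eta> (x + h m *\<^sub>R e) - \<eta> x) / h m)"
  have dl: "((\<lambda>s. \<eta> (x + s *\<^sub>R e)) has_real_derivative \<eta>' (x + s *\<^sub>R e) e) (at s)" for s x
  proof -
    have "((\<lambda>s. \<eta> (x + s *\<^sub>R e)) has_derivative (\<lambda>r. \<eta>' (x + s *\<^sub>R e) (r *\<^sub>R e))) (at s)"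
      by (rule has_derivative_compose[OF _ \<eta>(1)]) (auto intro!: derivative_eq_intros)
    moreover have "\<eta>' (x + s *\<^sub>R e) (r *\<^sub>R e) = \<eta>' (x + s *\<^sub>R e) e * r" for r
      using linear_scale[OF has_derivative_linear[OF \<eta>(1)]] by simp
    ultimately show ?thesis by (simp add: has_field_derivative_def)
  qed
  have quot: "\<bar>(\<eta> (x + t *\<^sub>R e) - \<eta> x) / t\<bar> \<le> C" if tpos: "t > 0" for t x
  proof -
    obtain z where "\<eta> (x + t *\<^sub>R e) - \<eta> (x + 0 *\<^sub>R e) = (t - 0) * \<eta>' (x + z *\<^sub>R e) e"
      using MVT2[of 0 t "\<lambda>s. \<eta> (x + s *\<^sub>R e)" "\<lambda>s. \<eta>' (x + s *\<^sub>R e) e", OF tpos dl] by blast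
    then show ?thesis using C tpos by simp
  qed
  have q0: "?q m x = 0" if "x \<notin> K'" for m x
  proof -
    have "x \<notin> K" "x + h m *\<^sub>R e \<notin> K" using that KK' K'I[OF _ h(2)] by auto
    then show ?thesis using K(3) by simp
  qed
  have Kint: "integrable lborel (indicator K' :: 'a \<Rightarrow> real)"
    using borel_compact[OF K'] emeasure_bounded_finite[OF compact_imp_bounded[OF K']]
    by (intro integrable_real_indicator) auto
  have bound: "\<bar>?q m x\<bar> \<le> CF * C * indicator K' x" for m x
  proof (cases "x \<in> K'")
    case True
    then have "\<bar>F x\<bar> \<le> CF" using CF K'U by (auto simp: F_def)
    moreover have "\<bar>(\<eta> (x + h m *\<^sub>R e) - \<eta> x) / h m\<bar> \<le> C" by (rule quot[OF h(1)])
    ultimately have "\<bar>F x\<bar> * \<bar>(\<eta> (x + h m *\<^sub>R e) - \<eta> x) / h m\<bar> \<le> CF * C" using CF(2) by (intro mult_mono) auto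
    then show ?thesis using True by (simp only: abs_mult) simp
  qed (use q0 in simp)
  have lim: "(\<lambda>m. ?q m x) \<longlonglongrightarrow> F x * \<eta>' x e" for x
  proof (intro tendsto_mult tendsto_const)
    have d: "((\<lambda>s. \<eta> (x + s *\<^sub>R e)) has_real_derivative \<eta>' x e) (at 0)" using dl[of x 0] by simp
    have "filterlim h (at 0) sequentially"
      using h by (simp add: filterlim_at less_imp_neq[OF h(1), symmetric])
    from filterlim_compose[OF d[unfolded DERIV_def] this]
    show "(\<lambda>m. (\<eta> (x + h m *\<^sub>R e) - \<eta> x) / h m) \<longlonglongrightarrow> \<eta>' x e" by simp
  qed
  have conv: "(\<lambda>m. \<integral>x. ?q m x \<partial>lborel) \<longlonglongrightarrow> (\<integral>x. F x * \<eta>' x e \<partial>lborel)"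
  proof (rule integral_dominated_convergence[where w="\<lambda>x. CF * C * indicator K' x"])
    show "integrable lborel (\<lambda>x. CF * C * indicator K' x)" using Kint by (intro integrable_mult_right)
    show "AE x in lborel. norm (?q m x) \<le> CF * C * indicator K' x" for m using bound by (intro AE_I2) simp
    show "AE x in lborel. (\<lambda>m. ?q m x) \<longlonglongrightarrow> F x * \<eta>' x e" using lim by (intro AE_I2)
  qed measurable
  have \<eta>int: "integrable lborel (\<lambda>x. \<bar>\<eta> x\<bar>)"
  proof -
    obtain B where B: "\<And>x. x \<in> K \<Longrightarrow> \<bar>\<eta> x\<bar> \<le> B"
    proof -
      have "bounded (\<eta> ` K)"
        using K(1) \<eta>c by (intro compact_imp_bounded compact_continuous_image) (auto intro: continuous_on_subset)
      then show ?thesis using that by (auto simp: bounded_iff)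
    qed
    show ?thesis
    proof (rule Bochner_Integration.integrable_bound[of _ "\<lambda>x. B * indicator K' x"])
      show "integrable lborel (\<lambda>x. B * indicator K' x)" using Kint by (intro integrable_mult_right)
      show "AE x in lborel. norm \<bar>\<eta> x\<bar> \<le> norm (B * indicator K' x)"
      proof (rule AE_I2)
        fix x show "norm \<bar>\<eta> x\<bar> \<le> norm (B * indicator K' x)"
          using B[of x] K(3)[of x] KK' by (cases "x \<in> K") (auto simp: subset_iff)
      qed
    qed measurable
  qed
  have Fb: "integrable lborel (\<lambda>x. F (x - y) * \<eta> x)" if "norm y \<le> \<delta>" for y
  proof (rule Bochner_Integration.integrable_bound[of _ "\<lambda>x. CF * \<bar>\<eta> x\<bar>"])
    show "integrable lborel (\<lambda>x. CF * \<bar>\<eta> x\<bar>)" using \<eta>int by (intro integrable_mult_right)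
    show "AE x in lborel. norm (F (x - y) * \<eta> x) \<le> norm (CF * \<bar>\<eta> x\<bar>)"
    proof (rule AE_I2)
      fix x show "norm (F (x - y) * \<eta> x) \<le> norm (CF * \<bar>\<eta> x\<bar>)"
      proof (cases "x \<in> K")
        case True
        then have "x - y \<in> K'" using K'I[of "x - y" y] that by simp
        then have "\<bar>F (x - y)\<bar> \<le> CF" using CF K'U by (auto simp: F_def)
        then show ?thesis using CF(2) by (simp add: abs_mult mult_right_mono)
      qed (simp add: K(3))
    qed
  qed measurable
  have est: "\<bar>\<integral>x. ?q m x \<partial>lborel\<bar> \<le> L * norm e * (\<integral>x. \<bar>\<eta> x\<bar> \<partial>lborel)" for m
  proof -
    let ?y = "h m *\<^sub>R e"
    \<comment> \<open>Translation moves the shift from \<eta> to \<open>F\<close>, with opposite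
      sign. The Lipschitz bound for \<open>F\<close> then contains a factor \<open>h m\<close>,
      which cancels the denominator of the quotient.\<close>
    have tr: "(\<integral>x. F x * \<eta> (x + ?y) \<partial>lborel) = (\<integral>x. F (x - ?y) * \<eta> x \<partial>lborel)"
      "integrable lborel (\<lambda>x. F x * \<eta> (x + ?y))"
    proof -
      have "(\<integral>x. F (x - ?y) * \<eta> x \<partial>distr lborel borel ((+) ?y)) = (\<integral>x. F (?y + x - ?y) * \<eta> (?y + x) \<partial>lborel)"
        by (rule integral_distr) measurable
      then show "(\<integral>x. F x * \<eta> (x + ?y) \<partial>lborel) = (\<integral>x. F (x - ?y) * \<eta> x \<partial>lborel)"
        by (simp add: lborel_distr_plus add.commute)
      have "integrable (distr lborel borel ((+) ?y)) (\<lambda>x. F (x - ?y) * \<eta> x)"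
        using Fb[OF h(2)] by (simp add: lborel_distr_plus)
      then show "integrable lborel (\<lambda>x. F x * \<eta> (x + ?y))"
        by (subst (asm) integrable_distr_eq) (measurable, simp add: add.commute)
    qed
    have F0: "integrable lborel (\<lambda>x. F x * \<eta> x)" using Fb[of 0] \<delta>(1) by simp
    have "(\<integral>x. ?q m x \<partial>lborel) = (\<integral>x. (F x * \<eta> (x + ?y) - F x * \<eta> x) / h m \<partial>lborel)"
      by (simp add: algebra_simps)
    also have "\<dots> = ((\<integral>x. F (x - ?y) * \<eta> x \<partial>lborel) - (\<integral>x. F x * \<eta> x \<partial>lborel)) / h m"
      using tr F0 by simp
    also have "\<dots> = (\<integral>x. (F (x - ?y) - F x) * \<eta> x \<partial>lborel) / h m"
      using Fb[OF h(2)] F0 by (simp add: left_diff_distrib)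
    finally have eq: "(\<integral>x. ?q m x \<partial>lborel) = (\<integral>x. (F (x - ?y) - F x) * \<eta> x \<partial>lborel) / h m" .
    have "\<bar>\<integral>x. (F (x - ?y) - F x) * \<eta> x \<partial>lborel\<bar> \<le> (\<integral>x. (L * norm ?y) * \<bar>\<eta> x\<bar> \<partial>lborel)"
    proof (rule integral_abs_bound_integral)
      show "integrable lborel (\<lambda>x. (F (x - ?y) - F x) * \<eta> x)"
        unfolding left_diff_distrib using Fb[OF h(2)] F0 by (rule Bochner_Integration.integrable_diff)
      show "integrable lborel (\<lambda>x. L * norm ?y * \<bar>\<eta> x\<bar>)" using \<eta>int by (intro integrable_mult_right)
      fix x
      show "\<bar>(F (x - ?y) - F x) * \<eta> x\<bar> \<le> L * norm ?y * \<bar>\<eta> x\<bar>"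
      proof (cases "x \<in> K")
        case True
        have "x - ?y \<in> K'" using K'I[of "x - ?y" ?y] True h(2) by simp
        then have U: "x - ?y \<in> U" "x \<in> U" using K'U True K(2) by auto
        then have "\<bar>F (x - ?y) - F x\<bar> = dist (f (x - ?y)) (f x)" by (simp add: F_def dist_real_def)
        also have "\<dots> \<le> L * dist (x - ?y) x" by (rule lipschitz_onD[OF f U])
        also have "dist (x - ?y) x = norm ?y" by (simp add: dist_norm)
        finally show ?thesis by (simp only: abs_mult) (rule mult_right_mono, auto)
      qed (simp add: K(3))
    qed
    also have "\<dots> = L * norm ?y * (\<integral>x. \<bar>\<eta> x\<bar> \<partial>lborel)" by simp
    finally have "\<bar>\<integral>x. (F (x - ?y) - F x) * \<eta> x \<partial>lborel\<bar> / h m \<le> L * norm ?y * (\<integral>x. \<bar>\<eta> x\<bar> \<partial>lborel) / h m"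
      using h(1)[of m] by (intro divide_right_mono) auto
    also have "\<dots> = L * norm e * (\<integral>x. \<bar>\<eta> x\<bar> \<partial>lborel)" using h(1)[of m] by simp
    finally show ?thesis unfolding eq using h(1)[of m] by simp
  qed
  have "\<bar>\<integral>x. F x * \<eta>' x e \<partial>lborel\<bar> \<le> L * norm e * (\<integral>x. \<bar>\<eta> x\<bar> \<partial>lborel)"
    by (rule tendsto_upperbound[OF tendsto_rabs[OF conv]]) (use est in auto)
  moreover have "(\<integral>x. F x * \<eta>' x e \<partial>lborel) = (\<integral>x. f x * \<eta>' x e \<partial>lebesgue_on U)"
  proof -
    have "(\<integral>x. F x * \<eta>' x e \<partial>lborel) = (\<integral>x. F x * \<eta>' x e \<partial>lebesgue)"
      by (rule integral_completion[symmetric]) measurable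
    then show ?thesis by (simp add: integral_lebesgue_on[OF UL(1)] F_def mult.assoc)
  qed
  moreover have "(\<integral>x. \<bar>\<eta> x\<bar> \<partial>lborel) = (\<integral>x. \<bar>\<eta> x\<bar> \<partial>lebesgue_on U)"
  proof -
    have "(\<lambda>x. indicator U x *\<^sub>R \<bar>\<eta> x\<bar>) = (\<lambda>x. \<bar>\<eta> x\<bar>)" using K by (auto simp: fun_eq_iff indicator_def)
    moreover have "(\<integral>x. \<bar>\<eta> x\<bar> \<partial>lborel) = (\<integral>x. \<bar>\<eta> x\<bar> \<partial>lebesgue)"
      by (rule integral_completion[symmetric]) measurable
    ultimately show ?thesis by (simp add: integral_lebesgue_on[OF UL(1)])
  qed
  ultimately show ?thesis by simp
qed

section \<open>Sobolev spaces as subspaces of a Hilbert space\<close>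

text \<open>The class of the extension by zero; meaningful only for F with \<open>L2v U F\<close>,
  since classes of other functions are unspecified.\<close>

definition emb :: "'a::euclidean_space set \<Rightarrow> ('a \<Rightarrow> 'b::euclidean_space) \<Rightarrow> ('a, 'b) l2" where
  "emb U F = abs_l2 (\<lambda>x. indicator U x *\<^sub>R F x)"

lemma L2_eq_L2v: "L2 U f = L2v U f"
  by (simp add: L2_def L2v_def)

lemma L2v_iff: "open U \<Longrightarrow> L2v U F \<longleftrightarrow> sq_integrable (\<lambda>x. indicator U x *\<^sub>R F x)"
proof -
  assume "open U"
  then have UL: "U \<in> sets lebesgue" by auto
  have "(\<lambda>x. (norm (indicator U x *\<^sub>R F x))\<^sup>2) = (\<lambda>x. indicator U x *\<^sub>R (norm (F x))\<^sup>2)"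
    by (auto simp: indicator_def)
  then show ?thesis unfolding L2v_def sq_integrable_def integral_lebesgue_on[OF UL] by simp
qed

lemma AE_lebesgue_on_open: "open U \<Longrightarrow> (AE x in lebesgue_on U. P x) \<longleftrightarrow> (AE x in lebesgue. x \<in> U \<longrightarrow> P x)"
  by (subst AE_restrict_space_iff) auto

lemma emb_inner:
  assumes U: "open U" and F: "L2v U F" "L2v U G"
  shows "emb U F \<bullet> emb U G = (\<integral>x. F x \<bullet> G x \<partial>lebesgue_on U)" "integrable (lebesgue_on U) (\<lambda>x. F x \<bullet> G x)"
proof -
  have UL: "U \<in> sets lebesgue" using U by auto
  have s: "sq_integrable (\<lambda>x. indicator U x *\<^sub>R F x)" "sq_integrable (\<lambda>x. indicator U x *\<^sub>R G x)"
    using F L2v_iff[OF U] by auto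
  have eq: "(\<lambda>x. (indicator U x *\<^sub>R F x) \<bullet> (indicator U x *\<^sub>R G x)) = (\<lambda>x. indicator U x *\<^sub>R (F x \<bullet> G x))"
    by (auto simp: indicator_def)
  have "emb U F \<bullet> emb U G = (\<integral>x. (indicator U x *\<^sub>R F x) \<bullet> (indicator U x *\<^sub>R G x) \<partial>lebesgue)"
    unfolding emb_def by (intro inner_l2_cong rep_abs_l2 s)
  then show "emb U F \<bullet> emb U G = (\<integral>x. F x \<bullet> G x \<partial>lebesgue_on U)"
    unfolding eq integral_lebesgue_on(1)[OF UL] .
  show "integrable (lebesgue_on U) (\<lambda>x. F x \<bullet> G x)"
    unfolding integral_lebesgue_on(2)[OF UL] eq[symmetric] by (rule sq_integrable_inner[OF s])
qed

lemma rep_emb: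
  assumes U: "open U" and F: "L2v U F" shows "AE x in lebesgue_on U. rep_l2 (emb U F) x = F x"
proof -
  have "AE x in lebesgue. rep_l2 (emb U F) x = indicator U x *\<^sub>R F x"
    unfolding emb_def using F L2v_iff[OF U] by (intro rep_abs_l2) auto
  then show ?thesis unfolding AE_lebesgue_on_open[OF U] by eventually_elim simp
qed

lemma emb_eq_iff:
  assumes U: "open U" and F: "L2v U F" "L2v U G"
  shows "emb U F = emb U G \<longleftrightarrow> (AE x in lebesgue_on U. F x = G x)"
proof -
  have "emb U F = emb U G \<longleftrightarrow> (AE x in lebesgue. indicator U x *\<^sub>R F x = indicator U x *\<^sub>R G x)"
    unfolding emb_def using F L2v_iff[OF U] by (intro abs_l2_eq_iff) auto
  also have "\<dots> \<longleftrightarrow> (AE x in lebesgue. x \<in> U \<longrightarrow> F x = G x)"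
    by (intro AE_cong) (auto simp: indicator_def)
  finally show ?thesis by (simp add: AE_lebesgue_on_open[OF U])
qed

lemma L2v_linear:
  assumes U: "open U" and F: "L2v U F" "L2v U G" shows "L2v U (\<lambda>x. F x + c *\<^sub>R G x)"
proof -
  have "sq_integrable (\<lambda>x. indicator U x *\<^sub>R F x + c *\<^sub>R (indicator U x *\<^sub>R G x))"
    using F L2v_iff[OF U] by (intro sq_integrable_add sq_integrable_scaleR) auto
  then show ?thesis unfolding L2v_iff[OF U] by (simp add: algebra_simps)
qed

lemma emb_linear:
  assumes U: "open U" and F: "L2v U F" "L2v U G"
  shows "emb U (\<lambda>x. F x + c *\<^sub>R G x) = emb U F + c *\<^sub>R emb U G"
proof (rule l2_eqI)
  have "AE x in lebesgue. rep_l2 (emb U (\<lambda>x. F x + c *\<^sub>R G x)) x = indicator U x *\<^sub>R (F x + c *\<^sub>R G x)"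
    "AE x in lebesgue. rep_l2 (emb U F) x = indicator U x *\<^sub>R F x"
    "AE x in lebesgue. rep_l2 (emb U G) x = indicator U x *\<^sub>R G x"
    unfolding emb_def by (rule rep_abs_l2[OF iffD1[OF L2v_iff[OF U]]], rule L2v_linear[OF U F] F)+
  then show "AE x in lebesgue. rep_l2 (emb U (\<lambda>x. F x + c *\<^sub>R G x)) x = rep_l2 (emb U F + c *\<^sub>R emb U G) x"
    using rep_l2_plus[of "emb U F" "c *\<^sub>R emb U G"] rep_l2_scaleR[of c "emb U G"]
    by eventually_elim (simp add: algebra_simps)
qed

lemma L2v_zero: "L2v U (\<lambda>x. 0)"
  by (simp add: L2v_def)

lemma emb_zero: "emb U (\<lambda>x. 0) = 0"
  by (simp add: emb_def zero_l2_def)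

lemma L2v_rep: "open U \<Longrightarrow> L2v U (rep_l2 u)"
proof -
  assume U: "open U"
  show ?thesis unfolding L2v_iff[OF U]
  proof (rule sq_integrable_bound[OF _ sq_integrable_norm[OF sq_integrable_rep[of u]]])
    show "(\<lambda>x. indicator U x *\<^sub>R rep_l2 u x) \<in> borel_measurable lebesgue"
      using sq_integrable_measurable[OF sq_integrable_rep] U by (intro borel_measurable_scaleR borel_measurable_indicator) auto
    show "(norm (indicator U x *\<^sub>R rep_l2 u x))\<^sup>2 \<le> (norm (rep_l2 u x))\<^sup>2" for x by (auto simp: indicator_def)
  qed
qed

lemma emb_rep_emb: "open U \<Longrightarrow> L2v U F \<Longrightarrow> emb U (rep_l2 (emb U F)) = emb U F"
  by (simp add: emb_eq_iff[OF _ L2v_rep] rep_emb)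

text \<open>The map u |-> \<open>emb U (rep_l2 u)\<close> cuts u off outside \<open>U\<close>. Its
  linearity and the contraction property that follows make its fixed points,
  \<open>supported U\<close>, a closed subspace.\<close>

lemma emb_rep_linear:
  assumes U: "open U" shows "emb U (rep_l2 (u + c *\<^sub>R v)) = emb U (rep_l2 u) + c *\<^sub>R emb U (rep_l2 v)"
proof -
  have "AE x in lebesgue. rep_l2 (u + c *\<^sub>R v) x = rep_l2 u x + c *\<^sub>R rep_l2 v x"
    using rep_l2_plus[of u "c *\<^sub>R v"] rep_l2_scaleR[of c v] by eventually_elim simp
  then have "AE x in lebesgue_on U. rep_l2 (u + c *\<^sub>R v) x = rep_l2 u x + c *\<^sub>R rep_l2 v x"
    unfolding AE_lebesgue_on_open[OF U] by eventually_elim simp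
  then have "emb U (rep_l2 (u + c *\<^sub>R v)) = emb U (\<lambda>x. rep_l2 u x + c *\<^sub>R rep_l2 v x)"
    by (subst emb_eq_iff[OF U L2v_rep[OF U] L2v_linear[OF U L2v_rep[OF U] L2v_rep[OF U]]])
  then show ?thesis by (simp only: emb_linear[OF U L2v_rep[OF U] L2v_rep[OF U]])
qed

lemma emb_rep_norm:
  fixes u :: "('a::euclidean_space, 'b::euclidean_space) l2"
  assumes U: "open U" shows "norm (emb U (rep_l2 u)) \<le> norm u"
proof -
  let ?E = "\<lambda>x. indicator U x *\<^sub>R rep_l2 u x"
  have s: "sq_integrable ?E" using L2v_rep[OF U] L2v_iff[OF U] by blast
  have "emb U (rep_l2 u) \<bullet> emb U (rep_l2 u) = (\<integral>x. ?E x \<bullet> ?E x \<partial>lebesgue)"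
    unfolding emb_def by (intro inner_l2_cong rep_abs_l2 s)
  also have "\<dots> \<le> (\<integral>x. rep_l2 u x \<bullet> rep_l2 u x \<partial>lebesgue)"
    by (intro integral_mono sq_integrable_inner s sq_integrable_rep) (auto simp: indicator_def)
  finally have "(norm (emb U (rep_l2 u)))\<^sup>2 \<le> (norm u)\<^sup>2" unfolding power2_norm_eq_inner by (simp add: inner_l2_def)
  then show ?thesis by (rule power2_le_imp_le) simp
qed

text \<open>The copy of L2 (U) inside L2 of the whole space. Limits and Riesz representers are found
  in the ambient space and have to be recognised as functions on \<open>U\<close>.\<close>

definition supported :: "'a::euclidean_space set \<Rightarrow> ('a, 'b::euclidean_space) l2 set" where
  "supported U = {u. emb U (rep_l2 u) = u}"

lemma supported_emb: "open U \<Longrightarrow> L2v U F \<Longrightarrow> emb U F \<in> supported U"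
  by (simp add: supported_def emb_rep_emb)

lemma supported_subspace:
  assumes U: "open U" shows "subspace (supported U :: ('a::euclidean_space, 'b::euclidean_space) l2 set)"
proof (rule subspaceI)
  show "(0 :: ('a, 'b) l2) \<in> supported U" using supported_emb[OF U L2v_zero[where 'b='b]] by (simp add: emb_zero)
  fix u v :: "('a, 'b) l2" and c assume u: "u \<in> supported U"
  have "emb U (rep_l2 (0 + c *\<^sub>R u)) = emb U (rep_l2 0) + c *\<^sub>R emb U (rep_l2 u)" by (rule emb_rep_linear[OF U])
  then show "c *\<^sub>R u \<in> supported U" using u \<open>0 \<in> supported U\<close> by (simp add: supported_def)
  assume "v \<in> supported U"
  then show "u + v \<in> supported U" using u emb_rep_linear[OF U, of u 1 v] by (simp add: supported_def)
qed

lemma supported_closed: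
  assumes U: "open U" shows "closed (supported U :: ('a::euclidean_space, 'b::euclidean_space) l2 set)"
  unfolding closed_sequential_limits
proof (intro allI impI, elim conjE)
  fix X and l :: "('a, 'b) l2" assume X: "\<forall>n. X n \<in> supported U" "X \<longlonglongrightarrow> l"
  have d: "norm (X n - emb U (rep_l2 l)) \<le> norm (X n - l)" for n
  proof -
    have "X n - emb U (rep_l2 l) = emb U (rep_l2 (X n + (-1) *\<^sub>R l))"
      unfolding emb_rep_linear[OF U] using X(1) by (simp add: supported_def)
    then show ?thesis using emb_rep_norm[OF U, of "X n + (-1) *\<^sub>R l"] by simp
  qed
  have "(\<lambda>n. norm (X n - l)) \<longlonglongrightarrow> 0" using X(2) by (simp add: LIM_zero tendsto_norm_zero)
  then have "(\<lambda>n. X n - emb U (rep_l2 l)) \<longlonglongrightarrow> 0" by (rule Lim_null_comparison[rotated]) (use d in simp)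
  then have "X \<longlonglongrightarrow> emb U (rep_l2 l)" by (rule LIM_zero_cancel)
  then show "l \<in> supported U" unfolding supported_def using LIMSEQ_unique[OF _ X(2)] by blast
qed

lemma sq_integrable_compact_support:
  fixes f :: "'a::euclidean_space \<Rightarrow> 'b::euclidean_space"
  assumes "continuous_on UNIV f" "compact K" "\<And>x. x \<notin> K \<Longrightarrow> f x = 0"
  shows "sq_integrable f"
proof -
  have "bounded (f ` K)"
    using assms by (intro compact_imp_bounded compact_continuous_image) (auto intro: continuous_on_subset)
  then obtain C where C: "\<And>x. x \<in> K \<Longrightarrow> norm (f x) \<le> C" by (auto simp: bounded_iff)
  show ?thesis
  proof (rule sq_integrable_bound)
    show "f \<in> borel_measurable lebesgue"
      using assms(1) by (intro measurable_completion) (simp add: borel_measurable_continuous_onI)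
    show "integrable lebesgue (\<lambda>x. C\<^sup>2 * indicator K x)"
      using lmeasurable_compact[OF assms(2)] by (intro integrable_mult_right integrable_real_indicator) (auto simp: fmeasurable_def)
    show "(norm (f x))\<^sup>2 \<le> C\<^sup>2 * indicator K x" for x
      using C[of x] assms(3)[of x] by (cases "x \<in> K") (auto intro: power_mono)
  qed
qed

lemma test_fun_smooth: "test_fun U \<phi> \<Longrightarrow> smooth_fun \<phi>"
  by (simp add: test_fun_def)

lemma test_fun_support:
  assumes "test_fun U \<phi>"
  obtains K where "compact K" "K \<subseteq> U" "\<And>x. x \<notin> K \<Longrightarrow> \<phi> x = 0" "\<And>x e. x \<notin> K \<Longrightarrow> frechet_derivative \<phi> (at x) e = 0"
proof
  let ?K = "closure {x. \<phi> x \<noteq> 0}"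
  show "compact ?K" "?K \<subseteq> U" using assms by (auto simp: test_fun_def)
  show z: "\<phi> x = 0" if "x \<notin> ?K" for x using that closure_subset[of "{x. \<phi> x \<noteq> 0}"] by auto
  show "frechet_derivative \<phi> (at x) e = 0" if "x \<notin> ?K" for x e
  proof -
    have "(\<phi> has_derivative (\<lambda>_. 0)) (at x)"
    proof (rule has_derivative_transform_within_open[of "\<lambda>_. 0" _ _ _ "- ?K"])
      show "0 = \<phi> y" if "y \<in> - ?K" for y by (rule z[symmetric, OF ComplD[OF that]])
    qed (use that in \<open>simp_all only: has_derivative_const open_Compl closed_closure Compl_iff not_False_eq_True\<close>)
    from fun_cong[OF frechet_derivative_at[OF this], of e] show ?thesis by (simp only:)
  qed
qed

lemma cgrad_nth: "cgrad \<phi> x $ i = frechet_derivative \<phi> (at x) (axis i 1)"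
  by (simp add: cgrad_def)

lemma cgrad_continuous: "smooth_fun \<phi> \<Longrightarrow> continuous_on UNIV (cgrad \<phi>)"
  unfolding cgrad_def[abs_def] by (intro continuous_on_vec_lambda smooth_fun_continuous_derivative)

lemma test_fun_L2:
  assumes U: "open U" and \<phi>: "test_fun U (\<phi> :: real^'n \<Rightarrow> real)"
  shows "L2 U \<phi>" "L2v U (cgrad \<phi>)"
proof -
  obtain K where K: "compact K" "K \<subseteq> U" "\<And>x. x \<notin> K \<Longrightarrow> \<phi> x = 0" "\<And>x e. x \<notin> K \<Longrightarrow> frechet_derivative \<phi> (at x) e = 0"
    using test_fun_support[OF \<phi>] by blast
  have "(\<lambda>x. indicator U x *\<^sub>R \<phi> x) = \<phi>" using K by (auto simp: indicator_def fun_eq_iff)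
  then show "L2 U \<phi>" unfolding L2_eq_L2v L2v_iff[OF U]
    using sq_integrable_compact_support[OF smooth_fun_continuous[OF test_fun_smooth[OF \<phi>]] K(1,3)] by simp
  have z: "cgrad \<phi> x = 0" if "x \<notin> K" for x using K(4)[OF that] by (simp add: cgrad_def vec_eq_iff)
  then have "(\<lambda>x. indicator U x *\<^sub>R cgrad \<phi> x) = cgrad \<phi>" using K(2) by (auto simp: indicator_def fun_eq_iff)
  then show "L2v U (cgrad \<phi>)" unfolding L2v_iff[OF U]
    using sq_integrable_compact_support[OF cgrad_continuous[OF test_fun_smooth[OF \<phi>]] K(1) z] by simp
qed

text \<open>The bound from which both integration by parts (\<open>f = 1\<close>, \<open>L = 0\<close>) and the estimates on \<open>div (b \<phi>)\<close> follow.\<close>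
lemma lipschitz_product_bound:
  fixes \<phi> \<psi> :: "real^'n \<Rightarrow> real"
  assumes U: "open U" and f: "L-lipschitz_on U f" and \<phi>: "test_fun U \<phi>" and \<psi>: "test_fun U \<psi>"
  shows "\<bar>\<integral>x. f x * (\<phi> x * cgrad \<psi> x $ i + \<psi> x * cgrad \<phi> x $ i) \<partial>lebesgue_on U\<bar>
    \<le> L * (\<integral>x. \<bar>\<phi> x * \<psi> x\<bar> \<partial>lebesgue_on U)"
proof -
  let ?d = "\<lambda>x e. \<phi> x * frechet_derivative \<psi> (at x) e + frechet_derivative \<phi> (at x) e * \<psi> x"
  obtain K where K: "compact K" "K \<subseteq> U" "\<And>x. x \<notin> K \<Longrightarrow> \<phi> x = 0"
    "\<And>x e. x \<notin> K \<Longrightarrow> frechet_derivative \<phi> (at x) e = 0"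
    using test_fun_support[OF \<phi>] by blast
  have "\<bar>\<integral>x. f x * ?d x (axis i 1) \<partial>lebesgue_on U\<bar> \<le> L * norm (axis i 1 :: real^'n) * (\<integral>x. \<bar>\<phi> x * \<psi> x\<bar> \<partial>lebesgue_on U)"
  proof (rule lipschitz_integral_bound[OF U f _ _ K(1,2)])
    show "((\<lambda>x. \<phi> x * \<psi> x) has_derivative ?d x) (at x)" for x
      by (intro has_derivative_mult smooth_fun_has_derivative test_fun_smooth[OF \<phi>] test_fun_smooth[OF \<psi>])
    show "continuous_on UNIV (\<lambda>x. ?d x (axis i 1))"
      by (intro continuous_intros smooth_fun_continuous smooth_fun_continuous_derivative test_fun_smooth[OF \<phi>] test_fun_smooth[OF \<psi>])
    show "\<phi> x * \<psi> x = 0" if "x \<notin> K" for x using K(3)[OF that] by simp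
  qed
  then show ?thesis by (simp add: cgrad_nth mult.commute)
qed

lemma L2v_component:
  assumes U: "open U" and G: "L2v U (G :: 'a::euclidean_space \<Rightarrow> real^'n)" shows "L2 U (\<lambda>x. G x $ i)"
  unfolding L2_eq_L2v L2v_iff[OF U]
proof (rule sq_integrable_bound)
  have s: "sq_integrable (\<lambda>x. indicator U x *\<^sub>R G x)" using G L2v_iff[OF U] by blast
  have "(\<lambda>x. (indicator U x *\<^sub>R G x) \<bullet> axis i 1) \<in> borel_measurable lebesgue"
    using sq_integrable_measurable[OF s] by (intro borel_measurable_inner) auto
  then show "(\<lambda>x. indicator U x *\<^sub>R G x $ i) \<in> borel_measurable lebesgue" by (simp add: inner_axis)
  show "integrable lebesgue (\<lambda>x. (norm (indicator U x *\<^sub>R G x))\<^sup>2)" by (rule sq_integrable_norm[OF s])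
  show "(norm (indicator U x *\<^sub>R G x $ i))\<^sup>2 \<le> (norm (indicator U x *\<^sub>R G x))\<^sup>2" for x
    using component_le_norm_cart[of "indicator U x *\<^sub>R G x" i] by (intro power_mono) auto
qed

lemma L2v_scaleR_axis:
  assumes U: "open U" and \<phi>: "L2 U \<phi>" shows "L2v U (\<lambda>x. \<phi> x *\<^sub>R (v::'b::euclidean_space))"
  unfolding L2v_iff[OF U]
proof (rule sq_integrable_bound)
  have s: "sq_integrable (\<lambda>x. indicator U x *\<^sub>R \<phi> x)" using \<phi> L2v_iff[OF U] L2_eq_L2v by blast
  have "(\<lambda>x. (indicator U x *\<^sub>R \<phi> x) *\<^sub>R v) \<in> borel_measurable lebesgue"
    by (rule borel_measurable_scaleR[OF sq_integrable_measurable[OF s] borel_measurable_const])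
  then show "(\<lambda>x. indicator U x *\<^sub>R \<phi> x *\<^sub>R v) \<in> borel_measurable lebesgue" by simp
  show "integrable lebesgue (\<lambda>x. (norm (indicator U x *\<^sub>R \<phi> x))\<^sup>2 * (norm v)\<^sup>2)"
    by (intro integrable_mult_left sq_integrable_norm[OF s])
  show "(norm (indicator U x *\<^sub>R \<phi> x *\<^sub>R v))\<^sup>2 \<le> (norm (indicator U x *\<^sub>R \<phi> x))\<^sup>2 * (norm v)\<^sup>2" for x
    by (simp add: power_mult_distrib)
qed

section \<open>Weak gradients and the graph space\<close>

text \<open>Written with inner products, the defining relation is visibly linear, depends on classes
  only and survives L2 limits.\<close>

lemma weak_grad_inner_iff:
  fixes u :: "real^'n \<Rightarrow> real"
  assumes U: "open U" and u: "L2 U u" and G: "L2v U G"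
  shows "is_weak_grad U u G \<longleftrightarrow> (\<forall>\<phi> i. test_fun U \<phi> \<longrightarrow>
    emb U u \<bullet> emb U (\<lambda>x. cgrad \<phi> x $ i) = - (emb U G \<bullet> emb U (\<lambda>x. \<phi> x *\<^sub>R axis i 1)))"
proof -
  have "(\<integral>x. u x * cgrad \<phi> x $ i \<partial>lebesgue_on U) = emb U u \<bullet> emb U (\<lambda>x. cgrad \<phi> x $ i)"
    "(\<integral>x. G x $ i * \<phi> x \<partial>lebesgue_on U) = emb U G \<bullet> emb U (\<lambda>x. \<phi> x *\<^sub>R axis i 1)" if \<phi>: "test_fun U \<phi>" for \<phi> i
  proof -
    have 1: "L2v U (\<lambda>x. cgrad \<phi> x $ i)" using L2v_component[OF U test_fun_L2(2)[OF U \<phi>]] by (simp add: L2_eq_L2v)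
    have 2: "L2v U (\<lambda>x. \<phi> x *\<^sub>R axis i 1 :: real^'n)" by (rule L2v_scaleR_axis[OF U test_fun_L2(1)[OF U \<phi>]])
    show "(\<integral>x. u x * cgrad \<phi> x $ i \<partial>lebesgue_on U) = emb U u \<bullet> emb U (\<lambda>x. cgrad \<phi> x $ i)"
      using emb_inner(1)[OF U _ 1, of u] u by (simp add: L2_eq_L2v)
    show "(\<integral>x. G x $ i * \<phi> x \<partial>lebesgue_on U) = emb U G \<bullet> emb U (\<lambda>x. \<phi> x *\<^sub>R axis i 1)"
      using emb_inner(1)[OF U G 2] by (simp add: inner_axis mult.commute)
  qed
  then show ?thesis unfolding is_weak_grad_def by auto
qed

lemma test_fun_weak_grad:
  assumes U: "open U" and \<phi>: "test_fun U (\<phi> :: real^'n \<Rightarrow> real)" shows "is_weak_grad U \<phi> (cgrad \<phi>)"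
  unfolding is_weak_grad_def
proof (intro allI impI)
  fix \<psi> i assume \<psi>: "test_fun U \<psi>"
  have "0-lipschitz_on U (\<lambda>x. 1::real)" by (rule lipschitz_onI) auto
  from lipschitz_product_bound[OF U this \<phi> \<psi>, of i]
  have "(\<integral>x. \<phi> x * cgrad \<psi> x $ i + cgrad \<phi> x $ i * \<psi> x \<partial>lebesgue_on U) = 0" by (simp add: mult.commute)
  moreover have "integrable (lebesgue_on U) (\<lambda>x. \<phi> x * cgrad \<psi> x $ i)" "integrable (lebesgue_on U) (\<lambda>x. cgrad \<phi> x $ i * \<psi> x)"
    using emb_inner(2)[OF U, of \<phi> "\<lambda>x. cgrad \<psi> x $ i"] emb_inner(2)[OF U, of "\<lambda>x. cgrad \<phi> x $ i" \<psi>]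
      test_fun_L2[OF U \<phi>] test_fun_L2[OF U \<psi>] L2v_component[OF U] by (auto simp: L2_eq_L2v)
  ultimately show "(\<integral>x. \<phi> x * cgrad \<psi> x $ i \<partial>lebesgue_on U) = - (\<integral>x. cgrad \<phi> x $ i * \<psi> x \<partial>lebesgue_on U)"
    by (simp add: eq_neg_iff_add_eq_0)
qed

text \<open>Makes the \<open>SOME\<close> in \<open>wgrad\<close> harmless: inside integrals any
  square integrable weak gradient may stand for it.\<close>

lemma weak_grad_unique:
  fixes u :: "real^'n \<Rightarrow> real"
  assumes U: "open U" and G: "L2v U G" "is_weak_grad U u G" and G': "L2v U G'" "is_weak_grad U u G'"
  shows "AE x in lebesgue_on U. G x = G' x"
proof -
  have "AE x in lebesgue_on U. G x $ i - G' x $ i = 0" for i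
  proof (rule fundamental_lemma[OF U])
    have L: "L2v U (\<lambda>x. G x $ i)" "L2v U (\<lambda>x. G' x $ i)" using L2v_component[OF U] G G' by (auto simp: L2_eq_L2v)
    show "L2 U (\<lambda>x. G x $ i - G' x $ i)" using L2v_linear[OF U L, of "-1"] by (simp add: L2_eq_L2v)
    fix \<phi> assume \<phi>: "test_fun U \<phi>"
    have p: "L2v U \<phi>" using test_fun_L2(1)[OF U \<phi>] by (simp add: L2_eq_L2v)
    have "(\<integral>x. G x $ i * \<phi> x \<partial>lebesgue_on U) = (\<integral>x. G' x $ i * \<phi> x \<partial>lebesgue_on U)"
      using G(2)[unfolded is_weak_grad_def, rule_format, OF \<phi>, of i]
        G'(2)[unfolded is_weak_grad_def, rule_format, OF \<phi>, of i] by linarith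
    moreover have "integrable (lebesgue_on U) (\<lambda>x. G x $ i * \<phi> x)" "integrable (lebesgue_on U) (\<lambda>x. G' x $ i * \<phi> x)"
      using emb_inner(2)[OF U L(1) p] emb_inner(2)[OF U L(2) p] by auto
    ultimately show "(\<integral>x. (G x $ i - G' x $ i) * \<phi> x \<partial>lebesgue_on U) = 0" by (simp add: left_diff_distrib)
  qed
  then have "AE x in lebesgue_on U. \<forall>i\<in>UNIV. G x $ i - G' x $ i = 0" by (subst AE_ball_countable) auto
  then show ?thesis by eventually_elim (simp add: vec_eq_iff)
qed

lemma wgrad_props: assumes "H1 U u" shows "L2 U u" "L2v U (wgrad U u)" "is_weak_grad U u (wgrad U u)"
proof -
  show "L2 U u" using assms by (simp add: H1_def)
  have "\<exists>G. L2v U G \<and> is_weak_grad U u G" using assms by (simp add: H1_def)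
  from someI_ex[OF this] show "L2v U (wgrad U u)" "is_weak_grad U u (wgrad U u)" by (auto simp: wgrad_def)
qed

text \<open>The graph embedding u |-> (u, grad u), chosen because the norm of the product space is
  then \<open>H1norm\<close>.\<close>

definition sob :: "(real^'n) set \<Rightarrow> (real^'n \<Rightarrow> real) \<Rightarrow> (real^'n, real) l2 \<times> (real^'n, real^'n) l2" where
  "sob U u = (emb U u, emb U (wgrad U u))"

lemma H1I: "L2 U u \<Longrightarrow> L2v U G \<Longrightarrow> is_weak_grad U u G \<Longrightarrow> H1 U u"
  by (auto simp: H1_def)

lemma sob_eq:
  assumes U: "open U" and u: "L2 U u" "L2v U G" "is_weak_grad U u G" shows "sob U u = (emb U u, emb U G)"
proof -
  note w = wgrad_props[OF H1I[OF u]]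
  have "emb U (wgrad U u) = emb U G"
    using weak_grad_unique[OF U w(2,3) u(2,3)] by (simp add: emb_eq_iff[OF U w(2) u(2)])
  then show ?thesis by (simp add: sob_def)
qed

lemma sob_linear:
  fixes u w :: "real^'n \<Rightarrow> real"
  assumes U: "open U" and u: "H1 U u" and w: "H1 U w"
  shows "H1 U (\<lambda>x. u x + c * w x)" "sob U (\<lambda>x. u x + c * w x) = sob U u + c *\<^sub>R sob U w"
proof -
  note u' = wgrad_props[OF u] and w' = wgrad_props[OF w]
  have L: "L2v U (\<lambda>x. u x + c *\<^sub>R w x)" using u'(1) w'(1) by (intro L2v_linear[OF U]) (auto simp: L2_eq_L2v)
  have G: "L2v U (\<lambda>x. wgrad U u x + c *\<^sub>R wgrad U w x)" by (rule L2v_linear[OF U u'(2) w'(2)])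
  have e1: "emb U (\<lambda>x. u x + c * w x) = emb U u + c *\<^sub>R emb U w"
    using emb_linear[OF U, of u w c] u'(1) w'(1) by (simp add: L2_eq_L2v)
  have e2: "emb U (\<lambda>x. wgrad U u x + c *\<^sub>R wgrad U w x) = emb U (wgrad U u) + c *\<^sub>R emb U (wgrad U w)"
    by (rule emb_linear[OF U u'(2) w'(2)])
  have L': "L2 U (\<lambda>x. u x + c * w x)" using L by (simp add: L2_eq_L2v)
  have wg: "is_weak_grad U (\<lambda>x. u x + c * w x) (\<lambda>x. wgrad U u x + c *\<^sub>R wgrad U w x)"
    unfolding weak_grad_inner_iff[OF U L' G] e1 e2
    using u'(3) w'(3) unfolding weak_grad_inner_iff[OF U u'(1,2)] weak_grad_inner_iff[OF U w'(1,2)]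
    by (simp add: inner_add_left)
  show "H1 U (\<lambda>x. u x + c * w x)" by (rule H1I[OF L' G wg])
  show "sob U (\<lambda>x. u x + c * w x) = sob U u + c *\<^sub>R sob U w"
    unfolding sob_eq[OF U L' G wg] e1 e2 by (simp add: sob_def)
qed

lemma norm_emb_sq: "open U \<Longrightarrow> L2v U F \<Longrightarrow> (norm (emb U F))\<^sup>2 = (\<integral>x. (norm (F x))\<^sup>2 \<partial>lebesgue_on U)"
  unfolding power2_norm_eq_inner by (rule emb_inner(1))

lemma norm_emb: "open U \<Longrightarrow> L2 U f \<Longrightarrow> norm (emb U f) = L2norm U f"
  unfolding L2norm_def using norm_emb_sq[of U f] by (intro real_sqrt_unique[symmetric]) (simp_all add: L2_eq_L2v)

lemma norm_sob:
  assumes U: "open U" and u: "H1 U u" shows "norm (sob U u) = H1norm U u"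
  using wgrad_props[OF u] norm_emb_sq[OF U, of u] norm_emb_sq[OF U, of "wgrad U u"]
  by (simp add: sob_def norm_prod_def H1norm_def L2_eq_L2v)

lemma test_fun_H1: "open U \<Longrightarrow> test_fun U \<phi> \<Longrightarrow> H1 U \<phi>"
  by (rule H1I[OF test_fun_L2 test_fun_weak_grad])

lemma sob_test_fun: "open U \<Longrightarrow> test_fun U \<phi> \<Longrightarrow> sob U \<phi> = (emb U \<phi>, emb U (cgrad \<phi>))"
  by (rule sob_eq[OF _ test_fun_L2 test_fun_weak_grad])

lemma sob_diff_norm:
  assumes U: "open U" "H1 U u" "H1 U w" shows "H1norm U (\<lambda>x. u x - w x) = norm (sob U u - sob U w)"
  using norm_sob[OF U(1) sob_linear(1)[OF U, of "-1"]] sob_linear(2)[OF U, of "-1"] by simp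

text \<open>The space of classes that plays the role of \<open>V\<close> in the abstract
  problem.\<close>

definition sobolev0 :: "(real^'n) set \<Rightarrow> ((real^'n, real) l2 \<times> (real^'n, real^'n) l2) set" where
  "sobolev0 U = sob U ` {u. H10 U u}"

text \<open>Closedness of the weak gradient: its relation to test functions consists of inner
  products and passes to limits of (\<phi>, grad \<phi>) in both components. Closedness of
  \<open>supported U\<close> first identifies the limit with a pair of functions on
  \<open>U\<close>.\<close>

lemma sobolev0_eq_closure:
  fixes U :: "(real^'n) set"
  assumes U: "open U" shows "sobolev0 U = closure (sob U ` {\<phi>. test_fun U \<phi>})"
proof (intro equalityI subsetI)
  fix p assume "p \<in> sobolev0 U"
  then obtain u where u: "p = sob U u" "H10 U u" by (auto simp: sobolev0_def)
  then obtain \<phi> where \<phi>: "\<And>k. test_fun U (\<phi> k)" "(\<lambda>k. H1norm U (\<lambda>x. u x - \<phi> k x)) \<longlonglongrightarrow> 0" "H1 U u"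
    by (auto simp: H10_def)
  have "(\<lambda>k. norm (sob U u - sob U (\<phi> k))) \<longlonglongrightarrow> 0"
    using \<phi>(2) sob_diff_norm[OF U \<phi>(3) test_fun_H1[OF U \<phi>(1)]] by simp
  then have "(\<lambda>k. sob U (\<phi> k)) \<longlonglongrightarrow> sob U u"
    unfolding norm_minus_commute[of "sob U u"] using tendsto_norm_zero_iff LIM_zero_cancel by blast
  then show "p \<in> closure (sob U ` {\<phi>. test_fun U \<phi>})"
    unfolding u(1) closure_sequential using \<phi>(1) by (intro exI[of _ "\<lambda>k. sob U (\<phi> k)"]) auto
next
  fix p assume "p \<in> closure (sob U ` {\<phi>. test_fun U \<phi>})"
  then obtain X where X: "\<forall>n. X n \<in> sob U ` {\<phi>. test_fun U \<phi>}" "X \<longlonglongrightarrow> p" unfolding closure_sequential by blast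
  then have "\<forall>n. \<exists>\<phi>. test_fun U \<phi> \<and> X n = sob U \<phi>" by blast
  then obtain \<phi> where \<phi>: "\<And>n. test_fun U (\<phi> n)" "\<And>n. X n = sob U (\<phi> n)" by metis
  obtain f G where p: "p = (f, G)" by (cases p)
  have lim: "(\<lambda>n. emb U (\<phi> n)) \<longlonglongrightarrow> f" "(\<lambda>n. emb U (wgrad U (\<phi> n))) \<longlonglongrightarrow> G"
    using tendsto_fst[OF X(2)] tendsto_snd[OF X(2)] by (auto simp: \<phi>(2) sob_def p)
  note w = wgrad_props[OF test_fun_H1[OF U \<phi>(1)]]
  have "f \<in> supported U" "G \<in> supported U"
    using closed_sequentially[OF supported_closed[OF U] _ lim(1)] closed_sequentially[OF supported_closed[OF U] _ lim(2)]
      supported_emb[OF U] w by (auto simp: L2_eq_L2v)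
  then have e: "emb U (rep_l2 f) = f" "emb U (rep_l2 G) = G" by (auto simp: supported_def)
  have L: "L2 U (rep_l2 f)" "L2v U (rep_l2 G)" using L2v_rep[OF U] by (auto simp: L2_eq_L2v)
  have wg: "is_weak_grad U (rep_l2 f) (rep_l2 G)"
    unfolding weak_grad_inner_iff[OF U L] e
  proof (intro allI impI)
    fix \<psi> i assume \<psi>: "test_fun U \<psi>"
    have "emb U (\<phi> n) \<bullet> emb U (\<lambda>x. cgrad \<psi> x $ i) = - (emb U (wgrad U (\<phi> n)) \<bullet> emb U (\<lambda>x. \<psi> x *\<^sub>R axis i 1))" for n
      using w(3)[of n] \<psi> unfolding weak_grad_inner_iff[OF U w(1,2)] by blast
    moreover have "(\<lambda>n. emb U (\<phi> n) \<bullet> emb U (\<lambda>x. cgrad \<psi> x $ i)) \<longlonglongrightarrow> f \<bullet> emb U (\<lambda>x. cgrad \<psi> x $ i)"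
      by (intro tendsto_intros lim)
    moreover have "(\<lambda>n. - (emb U (wgrad U (\<phi> n)) \<bullet> emb U (\<lambda>x. \<psi> x *\<^sub>R axis i 1))) \<longlonglongrightarrow> - (G \<bullet> emb U (\<lambda>x. \<psi> x *\<^sub>R axis i 1))"
      by (intro tendsto_intros lim)
    ultimately show "f \<bullet> emb U (\<lambda>x. cgrad \<psi> x $ i) = - (G \<bullet> emb U (\<lambda>x. \<psi> x *\<^sub>R axis i 1))"
      using LIMSEQ_unique by simp
  qed
  have sp: "sob U (rep_l2 f) = p" using sob_eq[OF U L wg] e p by simp
  have H: "H1 U (rep_l2 f)" by (rule H1I[OF L wg])
  have "(\<lambda>k. norm (p - X k)) \<longlonglongrightarrow> 0"
    using X(2) tendsto_norm_zero[OF LIM_zero] by (simp add: norm_minus_commute[of p])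
  then have "(\<lambda>k. H1norm U (\<lambda>x. rep_l2 f x - \<phi> k x)) \<longlonglongrightarrow> 0"
    using sob_diff_norm[OF U H test_fun_H1[OF U \<phi>(1)]] by (simp add: sp \<phi>(2))
  then have "H10 U (rep_l2 f)" unfolding H10_def using H \<phi>(1) by blast
  then show "p \<in> sobolev0 U" unfolding sobolev0_def using sp by blast
qed

lemma test_fun_sobolev0: "open U \<Longrightarrow> test_fun U \<phi> \<Longrightarrow> sob U \<phi> \<in> sobolev0 U"
  by (simp only: sobolev0_eq_closure) (rule subsetD[OF closure_subset], simp)

lemma sobolev0_closed_subspace:
  fixes U :: "(real^'n) set"
  assumes U: "open U" shows "closed (sobolev0 U)" "subspace (sobolev0 U)"
proof -
  show "closed (sobolev0 U)" unfolding sobolev0_eq_closure[OF U] by simp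
  have "subspace (sob U ` {\<phi>. test_fun U \<phi>})"
  proof (rule subspaceI)
    have z: "sob U (\<lambda>x. 0) = 0"
      using sob_linear(2)[OF U test_fun_H1[OF U test_fun_zero] test_fun_H1[OF U test_fun_zero], of "-1"] by simp
    then show "0 \<in> sob U ` {\<phi>. test_fun U \<phi>}" using test_fun_zero by force
    fix x y c assume "x \<in> sob U ` {\<phi>. test_fun U \<phi>}"
    then obtain \<phi> where \<phi>: "test_fun U \<phi>" "x = sob U \<phi>" by blast
    show "c *\<^sub>R x \<in> sob U ` {\<phi>. test_fun U \<phi>}"
      using test_fun_linear[OF test_fun_zero \<phi>(1), of c]
        sob_linear(2)[OF U test_fun_H1[OF U test_fun_zero] test_fun_H1[OF U \<phi>(1)], of c]
      unfolding \<phi>(2) by (intro image_eqI[of _ _ "\<lambda>x. 0 + c * \<phi> x"]) (auto simp: z)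
    assume "y \<in> sob U ` {\<phi>. test_fun U \<phi>}"
    then obtain \<psi> where \<psi>: "test_fun U \<psi>" "y = sob U \<psi>" by blast
    show "x + y \<in> sob U ` {\<phi>. test_fun U \<phi>}"
      using test_fun_linear[OF \<phi>(1) \<psi>(1), of 1] sob_linear(2)[OF U test_fun_H1[OF U \<phi>(1)] test_fun_H1[OF U \<psi>(1)], of 1]
      unfolding \<phi>(2) \<psi>(2) by (intro image_eqI[of _ _ "\<lambda>x. \<phi> x + 1 * \<psi> x"]) auto
  qed
  then show "subspace (sobolev0 U)" unfolding sobolev0_eq_closure[OF U] by (rule subspace_closure)
qed

lemma H10_iff:
  assumes U: "open U" shows "H10 U u \<longleftrightarrow> H1 U u \<and> sob U u \<in> sobolev0 U"
proof
  assume "H1 U u \<and> sob U u \<in> sobolev0 U"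
  then have H: "H1 U u" and cl: "sob U u \<in> closure (sob U ` {\<phi>. test_fun U \<phi>})"
    unfolding sobolev0_eq_closure[OF U] by (rule conjunct1, rule conjunct2)
  obtain X where X: "\<forall>n. X n \<in> sob U ` {\<phi>. test_fun U \<phi>}" "X \<longlonglongrightarrow> sob U u" using cl unfolding closure_sequential by blast
  then have "\<forall>n. \<exists>\<phi>. test_fun U \<phi> \<and> X n = sob U \<phi>" by blast
  then obtain \<phi> where \<phi>: "\<And>n. test_fun U (\<phi> n)" "\<And>n. X n = sob U (\<phi> n)" by metis
  have "(\<lambda>k. norm (sob U u - X k)) \<longlonglongrightarrow> 0"
    using X(2) tendsto_norm_zero[OF LIM_zero] by (simp add: norm_minus_commute[of "sob U u"])
  then have "(\<lambda>k. H1norm U (\<lambda>x. u x - \<phi> k x)) \<longlonglongrightarrow> 0"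
    using sob_diff_norm[OF U H test_fun_H1[OF U \<phi>(1)]] by (simp add: \<phi>(2))
  then show "H10 U u" unfolding H10_def using H \<phi>(1) by blast
qed (auto simp: H10_def sobolev0_def)

lemma H10_linear:
  assumes U: "open U" and u: "H10 U u" "H10 U w"
  shows "H10 U (\<lambda>x. u x + c * w x)"
proof -
  have h: "H1 U u" "H1 U w" "sob U u \<in> sobolev0 U" "sob U w \<in> sobolev0 U" using u H10_iff[OF U] by auto
  have "sob U u + c *\<^sub>R sob U w \<in> sobolev0 U"
    using h sobolev0_closed_subspace(2)[OF U] by (intro subspace_add subspace_scale)
  then show ?thesis using sob_linear[OF U h(1,2), of c] H10_iff[OF U] by auto
qed

text \<open>If u vanishes almost everywhere, 0 is an admissible weak gradient, and uniqueness gives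
  grad u = 0. This is the injectivity of \<open>\<iota>\<close> demanded by the abstract
  problem.\<close>

lemma sobolev0_fst_inj:
  fixes U :: "(real^'n) set"
  assumes U: "open U" and p: "p \<in> sobolev0 U" "fst p = 0" shows "p = 0"
proof -
  obtain u where u: "p = sob U u" "H1 U u" using p(1) by (auto simp: sobolev0_def H10_def)
  have e: "emb U u = 0" using p(2) u(1) by (simp add: sob_def)
  have "is_weak_grad U u (\<lambda>x. 0)"
    unfolding weak_grad_inner_iff[OF U wgrad_props(1)[OF u(2)] L2v_zero] by (simp add: e emb_zero)
  from sob_eq[OF U wgrad_props(1)[OF u(2)] L2v_zero this] show ?thesis by (simp add: u(1) e emb_zero zero_prod_def)
qed

text \<open>The component orthogonal to the closure is supported in \<open>U\<close> and annihilates
  all test functions, so it vanishes by the fundamental lemma. Hence every L2 function is an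
  admissible initial velocity.\<close>

lemma L2_in_closure:
  fixes U :: "(real^'n) set"
  assumes U: "open U" and \<psi>: "L2 U \<psi>" shows "emb U \<psi> \<in> closure (fst ` sobolev0 U)"
proof -
  let ?W = "closure (fst ` sobolev0 U)"
  have W: "subspace ?W" "closed ?W"
    using sobolev0_closed_subspace[OF U] by (auto intro!: subspace_closure linear_subspace_image linear_fst)
  obtain z where z: "z \<in> ?W" "\<And>x. x \<in> ?W \<Longrightarrow> x \<bullet> emb U \<psi> = x \<bullet> z"
    using orthogonal_projection_on[OF W, of "emb U \<psi>"] by blast
  have "fst ` sobolev0 U \<subseteq> supported U"
    by (auto simp: sobolev0_def sob_def H10_def intro!: supported_emb[OF U] dest: wgrad_props(1)[unfolded L2_eq_L2v])
  then have "?W \<subseteq> supported U" by (intro closure_minimal supported_closed[OF U])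
  then have zs: "z \<in> supported U" using z(1) by auto
  define d where "d = emb U \<psi> - z"
  have ds: "d \<in> supported U"
    unfolding d_def using supported_subspace[OF U] supported_emb[OF U] \<psi> zs by (intro subspace_diff) (auto simp: L2_eq_L2v)
  then have e: "emb U (rep_l2 d) = d" by (simp add: supported_def)
  have "AE x in lebesgue_on U. rep_l2 d x = 0"
  proof (rule fundamental_lemma[OF U])
    show "L2 U (rep_l2 d)" using L2v_rep[OF U] by (simp add: L2_eq_L2v)
    fix \<phi> assume \<phi>: "test_fun U \<phi>"
    have p: "L2v U \<phi>" using test_fun_L2(1)[OF U \<phi>] by (simp add: L2_eq_L2v)
    have "sob U \<phi> \<in> sobolev0 U" by (rule test_fun_sobolev0[OF U \<phi>])
    then have "emb U \<phi> \<in> fst ` sobolev0 U" by (intro image_eqI[of _ _ "sob U \<phi>"]) (simp add: sob_def)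
    then have "emb U \<phi> \<in> ?W" by (rule subsetD[OF closure_subset])
    then have "emb U \<phi> \<bullet> d = 0" using z(2) by (simp add: d_def inner_diff_right)
    then show "(\<integral>x. rep_l2 d x * \<phi> x \<partial>lebesgue_on U) = 0"
      using emb_inner(1)[OF U L2v_rep[OF U] p, of d] by (simp add: e inner_commute)
  qed
  then have "emb U (rep_l2 d) = emb U (\<lambda>x. 0)" by (simp add: emb_eq_iff[OF U L2v_rep[OF U] L2v_zero])
  then have "d = 0" by (simp add: e emb_zero)
  then show ?thesis using z(1) by (simp add: d_def)
qed

section \<open>The divergence of a Lipschitz multiple of a Sobolev function\<close>

text \<open>The way back from a point of the graph to a function; the solution is read off in this
  way.\<close>

lemma sobolev0_rep:
  fixes U :: "(real^'n) set"
  assumes U: "open U" and p: "p \<in> sobolev0 U"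
  shows "H10 U (rep_l2 (fst p))" "sob U (rep_l2 (fst p)) = p"
proof -
  obtain u where u: "p = sob U u" "H1 U u" using p by (auto simp: sobolev0_def H10_def)
  note w = wgrad_props[OF u(2)]
  have L: "L2 U (rep_l2 (fst p))" using L2v_rep[OF U] by (simp add: L2_eq_L2v)
  have e: "emb U (rep_l2 (fst p)) = emb U u"
    using emb_rep_emb[OF U, of u] w(1) by (simp add: u(1) sob_def L2_eq_L2v)
  have wg: "is_weak_grad U (rep_l2 (fst p)) (wgrad U u)"
    using w(3) unfolding weak_grad_inner_iff[OF U L w(2)] weak_grad_inner_iff[OF U w(1,2)] e .
  have "sob U (rep_l2 (fst p)) = sob U u" unfolding sob_eq[OF U L w(2) wg] e by (simp add: sob_def)
  then show s: "sob U (rep_l2 (fst p)) = p" by (simp only: u(1))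
  show "H10 U (rep_l2 (fst p))" using H1I[OF L w(2) wg] p s H10_iff[OF U] by simp
qed

lemma sobolev0_approx:
  fixes U :: "(real^'n) set"
  assumes U: "open U" and u: "H10 U u"
  obtains \<phi> where "\<And>n. test_fun U (\<phi> n)" "(\<lambda>n. sob U (\<phi> n)) \<longlonglongrightarrow> sob U u"
proof -
  have "sob U u \<in> closure (sob U ` {\<phi>. test_fun U \<phi>})"
    using u H10_iff[OF U] unfolding sobolev0_eq_closure[OF U] by simp
  then obtain X where X: "\<forall>n. X n \<in> sob U ` {\<phi>. test_fun U \<phi>}" "X \<longlonglongrightarrow> sob U u" unfolding closure_sequential by blast
  then have "\<forall>n. \<exists>\<phi>. test_fun U \<phi> \<and> X n = sob U \<phi>" by blast
  then obtain \<phi> where \<phi>: "\<And>n. test_fun U (\<phi> n)" "\<And>n. X n = sob U (\<phi> n)" by metis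
  have "X = (\<lambda>n. sob U (\<phi> n))" using \<phi>(2) by (rule ext)
  then show ?thesis using that[of \<phi>] \<phi>(1) X(2) by simp
qed

lemma tendsto_emb_sob: "(\<lambda>n. sob U (\<phi> n)) \<longlonglongrightarrow> sob U u \<Longrightarrow> (\<lambda>n. emb U (\<phi> n)) \<longlonglongrightarrow> emb U u"
  using tendsto_fst[of "\<lambda>n. sob U (\<phi> n)" "sob U u"] by (simp add: sob_def)

text \<open>A single time slice of \<open>b\<close>, with the Lipschitz condition componentwise, as
  \<open>lipschitz_product_bound\<close> uses it.\<close>

locale lipschitz_field =
  fixes U :: "(real^'n) set" and b :: "real^'n \<Rightarrow> real^'n" and L Mb :: real
  assumes U: "open U" and b_lip: "\<And>i. L-lipschitz_on U (\<lambda>x. b x $ i)" and b_bound: "\<And>x. x \<in> U \<Longrightarrow> norm (b x) \<le> Mb"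
    and Mb: "Mb \<ge> 0"
begin

lemma L_nonneg: "L \<ge> 0" using lipschitz_on_nonneg[OF b_lip] .

lemma b_measurable: "(\<lambda>x. indicator U x *\<^sub>R b x) \<in> borel_measurable lebesgue"
proof -
  have "continuous_on U (\<lambda>x. \<chi> i. b x $ i)"
    by (intro continuous_on_vec_lambda lipschitz_on_continuous_on[OF b_lip])
  then have "continuous_on U b" by simp
  then show ?thesis using U by (intro measurable_completion) (simp add: borel_measurable_continuous_on_indicator)
qed

lemma L2v_mult_bounded:
  fixes F :: "real^'n \<Rightarrow> real^'n"
  assumes F: "L2v U F" shows "L2v U (\<lambda>x. b x \<bullet> F x)"
  unfolding L2v_iff[OF U]
proof (rule sq_integrable_bound)
  have s: "sq_integrable (\<lambda>x. indicator U x *\<^sub>R F x)" using F L2v_iff[OF U] by blast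
  have "(\<lambda>x. (indicator U x *\<^sub>R b x) \<bullet> (indicator U x *\<^sub>R F x)) \<in> borel_measurable lebesgue"
    by (rule borel_measurable_inner[OF b_measurable sq_integrable_measurable[OF s]])
  moreover have "(\<lambda>x. (indicator U x *\<^sub>R b x) \<bullet> (indicator U x *\<^sub>R F x)) = (\<lambda>x. indicator U x *\<^sub>R (b x \<bullet> F x))"
    by (auto simp: indicator_def fun_eq_iff)
  ultimately show "(\<lambda>x. indicator U x *\<^sub>R (b x \<bullet> F x)) \<in> borel_measurable lebesgue" by simp
  show "integrable lebesgue (\<lambda>x. Mb\<^sup>2 * (norm (indicator U x *\<^sub>R F x))\<^sup>2)"
    by (intro integrable_mult_right sq_integrable_norm[OF s])
  show "(norm (indicator U x *\<^sub>R (b x \<bullet> F x)))\<^sup>2 \<le> Mb\<^sup>2 * (norm (indicator U x *\<^sub>R F x))\<^sup>2" for x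
  proof (cases "x \<in> U")
    case True
    have "\<bar>b x \<bullet> F x\<bar> \<le> norm (b x) * norm (F x)" by (rule Cauchy_Schwarz_ineq2)
    also have "\<dots> \<le> Mb * norm (F x)" using b_bound[OF True] by (rule mult_right_mono) simp
    finally have "\<bar>b x \<bullet> F x\<bar>\<^sup>2 \<le> (Mb * norm (F x))\<^sup>2" by (rule power_mono) simp
    then show ?thesis using True by (simp add: power_mult_distrib)
  qed simp
qed

lemma norm_emb_mult:
  assumes F: "L2v U F" shows "norm (emb U (\<lambda>x. b x \<bullet> F x)) \<le> Mb * norm (emb U F)"
proof (rule power2_le_imp_le)
  have "(norm (emb U (\<lambda>x. b x \<bullet> F x)))\<^sup>2 = (\<integral>x. (norm (b x \<bullet> F x))\<^sup>2 \<partial>lebesgue_on U)"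
    by (rule norm_emb_sq[OF U L2v_mult_bounded[OF F]])
  also have "\<dots> \<le> (\<integral>x. Mb\<^sup>2 * (norm (F x))\<^sup>2 \<partial>lebesgue_on U)"
  proof (rule integral_mono)
    show "integrable (lebesgue_on U) (\<lambda>x. (norm (b x \<bullet> F x))\<^sup>2)" using L2v_mult_bounded[OF F] by (simp add: L2v_def)
    show "integrable (lebesgue_on U) (\<lambda>x. Mb\<^sup>2 * (norm (F x))\<^sup>2)" using F by (simp add: L2v_def)
    fix x assume "x \<in> space (lebesgue_on U)"
    then have x: "x \<in> U" by simp
    have "\<bar>b x \<bullet> F x\<bar> \<le> norm (b x) * norm (F x)" by (rule Cauchy_Schwarz_ineq2)
    also have "\<dots> \<le> Mb * norm (F x)" using b_bound[OF x] by (rule mult_right_mono) simp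
    finally have "\<bar>b x \<bullet> F x\<bar>\<^sup>2 \<le> (Mb * norm (F x))\<^sup>2" by (rule power_mono) simp
    then show "(norm (b x \<bullet> F x))\<^sup>2 \<le> Mb\<^sup>2 * (norm (F x))\<^sup>2" by (simp add: power_mult_distrib)
  qed
  also have "\<dots> = (Mb * norm (emb U F))\<^sup>2" by (simp add: power_mult_distrib norm_emb_sq[OF U F])
  finally show "(norm (emb U (\<lambda>x. b x \<bullet> F x)))\<^sup>2 \<le> (Mb * norm (emb U F))\<^sup>2" .
qed (use Mb in simp)

text \<open>The two terms add up to the integral of b . grad (\<phi> \<psi>), which formally equals
  that of - (div b) \<phi> \<psi>: the operator b . grad is skew up to a bounded one. Each of the
  \<open>CARD('n)\<close> components contributes at most \<open>L\<close>.\<close>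

lemma product_rule_bound:
  assumes \<phi>: "test_fun U \<phi>" and \<psi>: "test_fun U \<psi>"
  shows "\<bar>emb U \<phi> \<bullet> emb U (\<lambda>x. b x \<bullet> cgrad \<psi> x) + emb U \<psi> \<bullet> emb U (\<lambda>x. b x \<bullet> cgrad \<phi> x)\<bar>
    \<le> real CARD('n) * L * norm (emb U \<phi>) * norm (emb U \<psi>)"
proof -
  have p: "L2v U \<phi>" "L2v U \<psi>" "L2v U (cgrad \<phi>)" "L2v U (cgrad \<psi>)"
    using test_fun_L2[OF U \<phi>] test_fun_L2[OF U \<psi>] by (auto simp: L2_eq_L2v)
  have bi: "L2v U (\<lambda>x. b x $ i * F x)" if F: "L2v U F" for F i
  proof -
    have "L2v U (\<lambda>x. b x \<bullet> (F x *\<^sub>R axis i 1))"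
      using F by (intro L2v_mult_bounded L2v_scaleR_axis[OF U]) (simp add: L2_eq_L2v)
    then show ?thesis by (simp add: inner_axis mult.commute)
  qed
  have gi: "L2v U (\<lambda>x. cgrad \<phi> x $ i)" "L2v U (\<lambda>x. cgrad \<psi> x $ i)" for i
    using L2v_component[OF U p(3)] L2v_component[OF U p(4)] by (auto simp: L2_eq_L2v)
  let ?f = "\<lambda>i x. b x $ i * (\<phi> x * cgrad \<psi> x $ i + \<psi> x * cgrad \<phi> x $ i)"
  have int: "integrable (lebesgue_on U) (?f i)" for i
  proof -
    have "integrable (lebesgue_on U) (\<lambda>x. \<phi> x \<bullet> (b x $ i * cgrad \<psi> x $ i) + \<psi> x \<bullet> (b x $ i * cgrad \<phi> x $ i))"
      by (intro Bochner_Integration.integrable_add emb_inner(2)[OF U] p bi gi)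
    then show ?thesis by (simp add: algebra_simps)
  qed
  have "emb U \<phi> \<bullet> emb U (\<lambda>x. b x \<bullet> cgrad \<psi> x) + emb U \<psi> \<bullet> emb U (\<lambda>x. b x \<bullet> cgrad \<phi> x)
      = (\<integral>x. \<phi> x \<bullet> (b x \<bullet> cgrad \<psi> x) \<partial>lebesgue_on U) + (\<integral>x. \<psi> x \<bullet> (b x \<bullet> cgrad \<phi> x) \<partial>lebesgue_on U)"
    using emb_inner(1)[OF U p(1) L2v_mult_bounded[OF p(4)]] emb_inner(1)[OF U p(2) L2v_mult_bounded[OF p(3)]] by simp
  also have "\<dots> = (\<integral>x. \<phi> x \<bullet> (b x \<bullet> cgrad \<psi> x) + \<psi> x \<bullet> (b x \<bullet> cgrad \<phi> x) \<partial>lebesgue_on U)"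
    by (intro Bochner_Integration.integral_add[symmetric] emb_inner(2)[OF U] p L2v_mult_bounded)
  also have "\<dots> = (\<integral>x. (\<Sum>i\<in>UNIV. ?f i x) \<partial>lebesgue_on U)"
    by (intro Bochner_Integration.integral_cong refl) (simp add: inner_vec_def sum_distrib_left sum.distrib algebra_simps)
  also have "\<dots> = (\<Sum>i\<in>UNIV. \<integral>x. ?f i x \<partial>lebesgue_on U)" by (intro Bochner_Integration.integral_sum int)
  finally have eq: "emb U \<phi> \<bullet> emb U (\<lambda>x. b x \<bullet> cgrad \<psi> x) + emb U \<psi> \<bullet> emb U (\<lambda>x. b x \<bullet> cgrad \<phi> x)
      = (\<Sum>i\<in>UNIV. \<integral>x. ?f i x \<partial>lebesgue_on U)" .
  have "(\<integral>x. \<bar>\<phi> x * \<psi> x\<bar> \<partial>lebesgue_on U) \<le> norm (emb U \<phi>) * norm (emb U \<psi>)"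
  proof -
    have abs: "L2v U (\<lambda>x. \<bar>F x\<bar>)" "norm (emb U (\<lambda>x. \<bar>F x\<bar>)) = norm (emb U F)" if F: "L2v U F" for F :: "real^'n \<Rightarrow> real"
    proof -
      show a: "L2v U (\<lambda>x. \<bar>F x\<bar>)" using F by (auto simp: L2v_def)
      have "(norm (emb U (\<lambda>x. \<bar>F x\<bar>)))\<^sup>2 = (norm (emb U F))\<^sup>2" unfolding norm_emb_sq[OF U a] norm_emb_sq[OF U F] by simp
      then show "norm (emb U (\<lambda>x. \<bar>F x\<bar>)) = norm (emb U F)" by (simp add: power2_eq_iff_nonneg)
    qed
    have "(\<integral>x. \<bar>\<phi> x * \<psi> x\<bar> \<partial>lebesgue_on U) = emb U (\<lambda>x. \<bar>\<phi> x\<bar>) \<bullet> emb U (\<lambda>x. \<bar>\<psi> x\<bar>)"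
      using emb_inner(1)[OF U abs(1)[OF p(1)] abs(1)[OF p(2)]] by (simp add: abs_mult)
    also have "\<dots> \<le> norm (emb U \<phi>) * norm (emb U \<psi>)"
      using norm_cauchy_schwarz[of "emb U (\<lambda>x. \<bar>\<phi> x\<bar>)" "emb U (\<lambda>x. \<bar>\<psi> x\<bar>)"] by (simp add: abs p)
    finally show ?thesis .
  qed
  then have each: "\<bar>\<integral>x. ?f i x \<partial>lebesgue_on U\<bar> \<le> L * (norm (emb U \<phi>) * norm (emb U \<psi>))" for i
    using lipschitz_product_bound[OF U b_lip \<phi> \<psi>, of i i] L_nonneg by (meson mult_left_mono order_trans)
  have "\<bar>\<Sum>i\<in>UNIV. \<integral>x. ?f i x \<partial>lebesgue_on U\<bar> \<le> (\<Sum>i\<in>(UNIV::'n set). L * (norm (emb U \<phi>) * norm (emb U \<psi>)))"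
    by (rule order_trans[OF sum_abs sum_mono]) (rule each)
  then show ?thesis unfolding eq by (simp add: mult_ac)
qed

text \<open>The derivative moves from \<psi> to u at the price of \<open>product_rule_bound\<close>,
  first for test functions in place of u and then by density. Only the L2 norm of \<psi> remains, so
  the distributional divergence is an L2 function.\<close>

lemma div_functional_bound:
  assumes u: "H10 U u" and \<psi>: "test_fun U \<psi>"
  shows "\<bar>emb U u \<bullet> emb U (\<lambda>x. b x \<bullet> cgrad \<psi> x)\<bar> \<le> (real CARD('n) * L + Mb) * norm (sob U u) * norm (emb U \<psi>)"
proof -
  obtain \<phi> where \<phi>: "\<And>n. test_fun U (\<phi> n)" "(\<lambda>n. sob U (\<phi> n)) \<longlonglongrightarrow> sob U u" using sobolev0_approx[OF U u] by blast
  have test: "\<bar>emb U f \<bullet> emb U (\<lambda>x. b x \<bullet> cgrad \<psi> x)\<bar> \<le> (real CARD('n) * L + Mb) * norm (sob U f) * norm (emb U \<psi>)" if f: "test_fun U f" for f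
  proof -
    have n: "norm (emb U f) \<le> norm (sob U f)" "norm (emb U (cgrad f)) \<le> norm (sob U f)"
      unfolding sob_test_fun[OF U f] norm_prod_def by (auto intro!: real_le_rsqrt)
    have "\<bar>emb U \<psi> \<bullet> emb U (\<lambda>x. b x \<bullet> cgrad f x)\<bar> \<le> norm (emb U \<psi>) * (Mb * norm (sob U f))"
      by (rule order_trans[OF Cauchy_Schwarz_ineq2 mult_left_mono[OF order_trans[OF norm_emb_mult[OF test_fun_L2(2)[OF U f]] mult_left_mono[OF n(2) Mb]] norm_ge_zero]])
    moreover have "real CARD('n) * L * norm (emb U f) * norm (emb U \<psi>) \<le> real CARD('n) * L * norm (sob U f) * norm (emb U \<psi>)"
      using n(1) L_nonneg by (intro mult_right_mono mult_left_mono) auto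
    ultimately show ?thesis using product_rule_bound[OF f \<psi>] by (simp add: algebra_simps)
  qed
  have "(\<lambda>n. \<bar>emb U (\<phi> n) \<bullet> emb U (\<lambda>x. b x \<bullet> cgrad \<psi> x)\<bar>) \<longlonglongrightarrow> \<bar>emb U u \<bullet> emb U (\<lambda>x. b x \<bullet> cgrad \<psi> x)\<bar>"
    by (intro tendsto_intros tendsto_emb_sob \<phi>)
  moreover have "(\<lambda>n. (real CARD('n) * L + Mb) * norm (sob U (\<phi> n)) * norm (emb U \<psi>)) \<longlonglongrightarrow> (real CARD('n) * L + Mb) * norm (sob U u) * norm (emb U \<psi>)"
    by (intro tendsto_intros \<phi>)
  ultimately show ?thesis by (rule LIMSEQ_le) (use test[OF \<phi>(1)] in auto)
qed

lemma weak_div_inner_iff: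
  assumes u: "L2 U u" and d: "L2 U d"
  shows "is_weak_div U (\<lambda>x. u x *\<^sub>R b x) d \<longleftrightarrow>
    (\<forall>\<psi>. test_fun U \<psi> \<longrightarrow> emb U d \<bullet> emb U \<psi> = - (emb U u \<bullet> emb U (\<lambda>x. b x \<bullet> cgrad \<psi> x)))"
proof -
  have "(\<integral>x. d x * \<psi> x \<partial>lebesgue_on U) = emb U d \<bullet> emb U \<psi>"
    "(\<integral>x. (u x *\<^sub>R b x) \<bullet> cgrad \<psi> x \<partial>lebesgue_on U) = emb U u \<bullet> emb U (\<lambda>x. b x \<bullet> cgrad \<psi> x)" if \<psi>: "test_fun U \<psi>" for \<psi>
    using emb_inner(1)[OF U, of d \<psi>] emb_inner(1)[OF U, of u "\<lambda>x. b x \<bullet> cgrad \<psi> x"] test_fun_L2[OF U \<psi>] u d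
    by (auto simp: L2_eq_L2v L2v_mult_bounded)
  then show ?thesis unfolding is_weak_div_def by auto
qed

text \<open>Riesz representation on the subspace of embedded test functions. It need not be closed,
  which is why the version with a representer in the closure is applied; the closure lies in
  \<open>supported U\<close>, so the representer is a function on \<open>U\<close>.\<close>

lemma weak_div_exists:
  assumes u: "H10 U u" shows "\<exists>d. L2 U d \<and> is_weak_div U (\<lambda>x. u x *\<^sub>R b x) d"
proof -
  have uL: "L2 U u" using u wgrad_props(1) by (auto simp: H10_def)
  define S where "S = emb U ` {\<psi>. test_fun U \<psi>}"
  define F where "F \<psi> = - (emb U u \<bullet> emb U (\<lambda>x. b x \<bullet> cgrad \<psi> x))" for \<psi>
  let ?K = "(real CARD('n) * L + Mb) * norm (sob U u)"
  have Fb: "\<bar>F \<psi>\<bar> \<le> ?K * norm (emb U \<psi>)" if "test_fun U \<psi>" for \<psi> using div_functional_bound[OF u that] by (simp add: F_def)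
  have emb_lin: "emb U (\<lambda>x. \<phi> x + c * \<psi> x) = emb U \<phi> + c *\<^sub>R emb U \<psi>" if "test_fun U \<phi>" "test_fun U \<psi>" for \<phi> \<psi> c
    using emb_linear[OF U, of \<phi> \<psi> c] test_fun_L2(1)[OF U that(1)] test_fun_L2(1)[OF U that(2)] by (simp add: L2_eq_L2v)
  have Flin: "F (\<lambda>x. \<phi> x + c * \<psi> x) = F \<phi> + c * F \<psi>" if t: "test_fun U \<phi>" "test_fun U \<psi>" for \<phi> \<psi> c
  proof -
    have "cgrad (\<lambda>x. \<phi> x + c * \<psi> x) x = cgrad \<phi> x + c *\<^sub>R cgrad \<psi> x" for x
    proof -
      have "((\<lambda>x. \<phi> x + c * \<psi> x) has_derivative (\<lambda>e. frechet_derivative \<phi> (at x) e + c * frechet_derivative \<psi> (at x) e)) (at x)"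
        by (intro has_derivative_add has_derivative_mult_right smooth_fun_has_derivative test_fun_smooth[OF t(1)] test_fun_smooth[OF t(2)])
      from frechet_derivative_at[OF this, symmetric] show ?thesis by (simp add: cgrad_def vec_eq_iff)
    qed
    then have "emb U (\<lambda>x. b x \<bullet> cgrad (\<lambda>x. \<phi> x + c * \<psi> x) x) = emb U (\<lambda>x. b x \<bullet> cgrad \<phi> x + c *\<^sub>R (b x \<bullet> cgrad \<psi> x))"
      by (simp add: inner_add_right)
    also have "\<dots> = emb U (\<lambda>x. b x \<bullet> cgrad \<phi> x) + c *\<^sub>R emb U (\<lambda>x. b x \<bullet> cgrad \<psi> x)"
      by (intro emb_linear[OF U] L2v_mult_bounded test_fun_L2(2)[OF U] t)
    finally show ?thesis by (simp add: F_def inner_add_right)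
  qed
  \<comment> \<open>\<open>F\<close> is given on functions but the Riesz lemma needs a form on
    classes. The choice is immaterial: \<open>Fb\<close> applied to a difference of two
    representatives gives 0.\<close>
  define f where "f p = F (SOME \<psi>. test_fun U \<psi> \<and> emb U \<psi> = p)" for p
  have f: "f (emb U \<psi>) = F \<psi>" if \<psi>: "test_fun U \<psi>" for \<psi>
  proof -
    define \<phi> where "\<phi> = (SOME \<phi>. test_fun U \<phi> \<and> emb U \<phi> = emb U \<psi>)"
    have \<phi>: "test_fun U \<phi>" "emb U \<phi> = emb U \<psi>"
      using someI[of "\<lambda>\<phi>. test_fun U \<phi> \<and> emb U \<phi> = emb U \<psi>" \<psi>] \<psi> by (auto simp: \<phi>_def)
    have "\<bar>F (\<lambda>x. \<phi> x + (-1) * \<psi> x)\<bar> \<le> ?K * norm (emb U (\<lambda>x. \<phi> x + (-1) * \<psi> x))"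
      by (rule Fb[OF test_fun_linear[OF \<phi>(1) \<psi>]])
    then have "F \<phi> = F \<psi>" unfolding emb_lin[OF \<phi>(1) \<psi>] Flin[OF \<phi>(1) \<psi>] by (simp add: \<phi>(2))
    then show ?thesis by (simp add: f_def \<phi>_def)
  qed
  have SI: "emb U \<psi> \<in> S" if "test_fun U \<psi>" for \<psi> using that by (simp add: S_def)
  have "subspace S"
  proof (rule subspaceI)
    show "0 \<in> S" using SI[OF test_fun_zero] by (simp add: emb_zero)
    fix x y c assume "x \<in> S"
    then obtain \<phi> where \<phi>: "test_fun U \<phi>" "x = emb U \<phi>" by (auto simp: S_def)
    show "c *\<^sub>R x \<in> S"
      using SI[OF test_fun_linear[OF test_fun_zero \<phi>(1), of c]] unfolding emb_lin[OF test_fun_zero \<phi>(1)] by (simp add: emb_zero \<phi>(2))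
    assume "y \<in> S"
    then obtain \<psi> where \<psi>: "test_fun U \<psi>" "y = emb U \<psi>" by (auto simp: S_def)
    show "x + y \<in> S"
      using SI[OF test_fun_linear[OF \<phi>(1) \<psi>(1), of 1]] unfolding emb_lin[OF \<phi>(1) \<psi>(1)] by (simp add: \<phi>(2) \<psi>(2))
  qed
  moreover have "linear_form_on S f"
    unfolding linear_form_on_def
  proof (intro ballI allI)
    fix x y c assume "x \<in> S" "y \<in> S"
    then obtain \<phi> \<psi> where \<phi>: "test_fun U \<phi>" "x = emb U \<phi>" and \<psi>: "test_fun U \<psi>" "y = emb U \<psi>" by (auto simp: S_def)
    show "f (x + c *\<^sub>R y) = f x + c * f y"
      using f[OF test_fun_linear[OF \<phi>(1) \<psi>(1), of c]] f[OF \<phi>(1)] f[OF \<psi>(1)]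
      unfolding emb_lin[OF \<phi>(1) \<psi>(1)] Flin[OF \<phi>(1) \<psi>(1)] by (simp add: \<phi>(2) \<psi>(2))
  qed
  moreover have "\<bar>f x\<bar> \<le> ?K * norm x" if "x \<in> S" for x using that Fb f by (auto simp: S_def)
  ultimately obtain z where z: "z \<in> closure S" "\<And>x. x \<in> S \<Longrightarrow> f x = x \<bullet> z"
    using riesz_representation_dense[of S f ?K] by blast
  have "S \<subseteq> supported U" using supported_emb[OF U] test_fun_L2(1)[OF U] by (auto simp: S_def L2_eq_L2v)
  then have "closure S \<subseteq> supported U" by (intro closure_minimal supported_closed[OF U])
  then have e: "emb U (rep_l2 z) = z" using z(1) by (auto simp: supported_def)
  have Lz: "L2 U (rep_l2 z)" using L2v_rep[OF U] by (simp add: L2_eq_L2v)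
  have "is_weak_div U (\<lambda>x. u x *\<^sub>R b x) (rep_l2 z)"
    unfolding weak_div_inner_iff[OF uL Lz] e
  proof (intro allI impI)
    fix \<psi> assume \<psi>: "test_fun U \<psi>"
    show "z \<bullet> emb U \<psi> = - (emb U u \<bullet> emb U (\<lambda>x. b x \<bullet> cgrad \<psi> x))"
      using z(2)[OF SI[OF \<psi>]] f[OF \<psi>] by (simp add: F_def inner_commute)
  qed
  then show ?thesis using Lz by blast
qed

section \<open>The operator u |-> div (b u)\<close>

definition dv :: "(real^'n \<Rightarrow> real) \<Rightarrow> (real^'n, real) l2" where
  "dv u = emb U (wdiv U (\<lambda>x. u x *\<^sub>R b x))"

lemma wdiv_L2: "H10 U u \<Longrightarrow> L2 U (wdiv U (\<lambda>x. u x *\<^sub>R b x))"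
  and wdiv_weak_div: "H10 U u \<Longrightarrow> is_weak_div U (\<lambda>x. u x *\<^sub>R b x) (wdiv U (\<lambda>x. u x *\<^sub>R b x))"
  using someI_ex[OF weak_div_exists, of u] unfolding wdiv_def by auto

lemma dv_inner:
  assumes "H10 U u" "test_fun U \<psi>" shows "dv u \<bullet> emb U \<psi> = - (emb U u \<bullet> emb U (\<lambda>x. b x \<bullet> cgrad \<psi> x))"
proof -
  have uL: "L2 U u" using assms(1) wgrad_props(1) by (auto simp: H10_def)
  show ?thesis using wdiv_weak_div[OF assms(1)] assms(2)
    unfolding weak_div_inner_iff[OF uL wdiv_L2[OF assms(1)]] dv_def by blast
qed

lemma dv_closure: "H10 U u \<Longrightarrow> dv u \<in> closure (fst ` sobolev0 U)"
  unfolding dv_def by (rule L2_in_closure[OF U wdiv_L2])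

lemma dense_test: "closure (fst ` sobolev0 U) = closure (emb U ` {\<psi>. test_fun U \<psi>})"
proof
  show "closure (emb U ` {\<psi>. test_fun U \<psi>}) \<subseteq> closure (fst ` sobolev0 U)"
    using L2_in_closure[OF U test_fun_L2(1)[OF U]] by (intro closure_minimal) auto
  have "fst ` sobolev0 U \<subseteq> closure (emb U ` {\<psi>. test_fun U \<psi>})"
  proof
    fix y assume "y \<in> fst ` sobolev0 U"
    then obtain u where u: "H10 U u" "y = emb U u" by (auto simp: sobolev0_def sob_def)
    obtain \<phi> where \<phi>: "\<And>n. test_fun U (\<phi> n)" "(\<lambda>n. sob U (\<phi> n)) \<longlonglongrightarrow> sob U u" using sobolev0_approx[OF U u(1)] by blast
    show "y \<in> closure (emb U ` {\<psi>. test_fun U \<psi>})"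
      unfolding closure_sequential u(2) using \<phi>(1) tendsto_emb_sob[OF \<phi>(2)] by (intro exI[of _ "\<lambda>n. emb U (\<phi> n)"]) auto
  qed
  then show "closure (fst ` sobolev0 U) \<subseteq> closure (emb U ` {\<psi>. test_fun U \<psi>})" by (intro closure_minimal) auto
qed

text \<open>The bound of \<open>div_functional_bound\<close> extends from test functions to their
  closure, which contains \<open>dv u\<close>; testing \<open>dv u\<close> with itself gives its
  norm.\<close>

lemma dv_norm: assumes u: "H10 U u" shows "norm (dv u) \<le> (real CARD('n) * L + Mb) * norm (sob U u)"
proof -
  let ?K = "(real CARD('n) * L + Mb) * norm (sob U u)"
  have "closed {x. \<bar>dv u \<bullet> x\<bar> \<le> ?K * norm x}" by (intro closed_Collect_le continuous_intros)
  moreover have "emb U ` {\<psi>. test_fun U \<psi>} \<subseteq> {x. \<bar>dv u \<bullet> x\<bar> \<le> ?K * norm x}"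
    using dv_inner[OF u] div_functional_bound[OF u] by auto
  ultimately have "closure (emb U ` {\<psi>. test_fun U \<psi>}) \<subseteq> {x. \<bar>dv u \<bullet> x\<bar> \<le> ?K * norm x}" by (intro closure_minimal)
  then have "\<bar>dv u \<bullet> dv u\<bar> \<le> ?K * norm (dv u)" using dv_closure[OF u] unfolding dense_test by blast
  then have "norm (dv u) * norm (dv u) \<le> ?K * norm (dv u)" by (simp add: power2_norm_eq_inner flip: power2_eq_square)
  moreover have "0 \<le> ?K" using L_nonneg Mb by simp
  ultimately show ?thesis by (cases "dv u = 0") auto
qed

text \<open>Elements of the closure of the test functions are determined by their products with test
  functions. Linearity of \<open>dv\<close> and its independence of representatives follow, although
  \<open>wdiv\<close> is a \<open>SOME\<close>-choice.\<close>

lemma dv_eqI: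
  assumes "z \<in> closure (fst ` sobolev0 U)" "H10 U u"
    "\<And>\<psi>. test_fun U \<psi> \<Longrightarrow> z \<bullet> emb U \<psi> = - (emb U u \<bullet> emb U (\<lambda>x. b x \<bullet> cgrad \<psi> x))"
  shows "dv u = z"
proof -
  let ?d = "dv u - z"
  have W: "subspace (closure (fst ` sobolev0 U))"
    using sobolev0_closed_subspace[OF U] by (intro subspace_closure linear_subspace_image linear_fst)
  have "closure (emb U ` {\<psi>. test_fun U \<psi>}) \<subseteq> {x. ?d \<bullet> x = 0}"
    using dv_inner[OF assms(2)] assms(3) by (intro closure_minimal closed_hyperplane) (auto simp: inner_diff_left)
  moreover have "?d \<in> closure (fst ` sobolev0 U)" using W dv_closure[OF assms(2)] assms(1) by (rule subspace_diff)
  ultimately have "?d \<bullet> ?d = 0" unfolding dense_test by blast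
  then show ?thesis by simp
qed

lemma dv_linear:
  assumes u: "H10 U u" "H10 U w" shows "dv (\<lambda>x. u x + c * w x) = dv u + c *\<^sub>R dv w"
proof (rule dv_eqI)
  have W: "subspace (closure (fst ` sobolev0 U))"
    using sobolev0_closed_subspace[OF U] by (intro subspace_closure linear_subspace_image linear_fst)
  show "dv u + c *\<^sub>R dv w \<in> closure (fst ` sobolev0 U)"
    using W dv_closure[OF u(1)] dv_closure[OF u(2)] by (intro subspace_add subspace_scale)
  show "H10 U (\<lambda>x. u x + c * w x)" by (rule H10_linear[OF U u])
  have "emb U (\<lambda>x. u x + c * w x) = emb U u + c *\<^sub>R emb U w"
    using emb_linear[OF U, of u w c] u wgrad_props(1) by (auto simp: L2_eq_L2v H10_def)
  then show "(dv u + c *\<^sub>R dv w) \<bullet> emb U \<psi> = - (emb U (\<lambda>x. u x + c * w x) \<bullet> emb U (\<lambda>x. b x \<bullet> cgrad \<psi> x))"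
    if "test_fun U \<psi>" for \<psi>
    using dv_inner[OF u(1) that] dv_inner[OF u(2) that] by (simp add: inner_add_left)
qed

lemma dv_cong: assumes "H10 U u" "H10 U w" "emb U u = emb U w" shows "dv u = dv w"
  by (rule dv_eqI[OF dv_closure[OF assms(2)] assms(1)]) (simp add: dv_inner[OF assms(2)] assms(3))

lemma dv_tendsto:
  assumes u: "H10 U u" and \<phi>: "\<And>n. H10 U (\<phi> n)" "(\<lambda>n. sob U (\<phi> n)) \<longlonglongrightarrow> sob U u"
  shows "(\<lambda>n. dv (\<phi> n)) \<longlonglongrightarrow> dv u"
proof -
  have nb: "norm (dv (\<phi> n) - dv u) \<le> (real CARD('n) * L + Mb) * norm (sob U (\<phi> n) - sob U u)" for n
    using dv_norm[OF H10_linear[OF U \<phi>(1) u, of n "-1"]] dv_linear[OF \<phi>(1) u, of n "-1"]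
      sob_linear(2)[OF U, of "\<phi> n" u "-1"] \<phi>(1)[of n] u by (simp add: H10_def)
  have lim: "(\<lambda>n. (real CARD('n) * L + Mb) * norm (sob U (\<phi> n) - sob U u)) \<longlonglongrightarrow> 0"
    using tendsto_norm_zero[OF LIM_zero[OF \<phi>(2)]] by (rule tendsto_mult_right_zero)
  have "(\<lambda>n. dv (\<phi> n) - dv u) \<longlonglongrightarrow> 0"
    by (rule Lim_null_comparison[OF always_eventually[OF allI[OF nb]] lim])
  then show ?thesis by (rule LIM_zero_cancel)
qed

lemma test_fun_H10: "test_fun U \<phi> \<Longrightarrow> H10 U \<phi>"
  by (simp add: H10_iff[OF U] test_fun_H1[OF U] test_fun_sobolev0[OF U])

text \<open>For one and the same test function the two terms of \<open>product_rule_bound\<close>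
  coincide, so each is at most half of the bound and no derivative survives. Continuity of
  \<open>dv\<close> on H10 carries this over to u.\<close>

lemma dv_skew: assumes u: "H10 U u" shows "emb U u \<bullet> dv u \<ge> - (real CARD('n) * L) * (norm (emb U u))\<^sup>2"
proof -
  obtain \<phi> where \<phi>: "\<And>n. test_fun U (\<phi> n)" "(\<lambda>n. sob U (\<phi> n)) \<longlonglongrightarrow> sob U u" using sobolev0_approx[OF U u] by blast
  have "- (real CARD('n) * L) * (norm (emb U (\<phi> n)))\<^sup>2 \<le> emb U (\<phi> n) \<bullet> dv (\<phi> n)" for n
  proof -
    define I where "I = emb U (\<phi> n) \<bullet> emb U (\<lambda>x. b x \<bullet> cgrad (\<phi> n) x)"
    have "\<bar>2 * I\<bar> \<le> real CARD('n) * L * (norm (emb U (\<phi> n)))\<^sup>2"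
      using product_rule_bound[OF \<phi>(1) \<phi>(1), of n n] unfolding I_def[symmetric] by (simp add: power2_eq_square mult_ac)
    moreover have "emb U (\<phi> n) \<bullet> dv (\<phi> n) = - I"
      using dv_inner[OF test_fun_H10[OF \<phi>(1)] \<phi>(1), of n n] by (simp add: inner_commute I_def)
    moreover have "0 \<le> real CARD('n) * L * (norm (emb U (\<phi> n)))\<^sup>2" using L_nonneg by simp
    ultimately show ?thesis by simp
  qed
  moreover have "(\<lambda>n. - (real CARD('n) * L) * (norm (emb U (\<phi> n)))\<^sup>2) \<longlonglongrightarrow> - (real CARD('n) * L) * (norm (emb U u))\<^sup>2"
    by (intro tendsto_intros tendsto_emb_sob \<phi>)
  moreover have "(\<lambda>n. emb U (\<phi> n) \<bullet> dv (\<phi> n)) \<longlonglongrightarrow> emb U u \<bullet> dv u"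
    by (intro tendsto_intros tendsto_emb_sob dv_tendsto u test_fun_H10 \<phi>)
  ultimately show ?thesis by (intro LIMSEQ_le) auto
qed

end

section \<open>The operators of the wave equation\<close>

lemma L2v_dominated:
  fixes F :: "'a::euclidean_space \<Rightarrow> 'b::euclidean_space" and G :: "'a \<Rightarrow> 'c::euclidean_space"
  assumes U: "open U" and F: "L2v U F" and G: "(\<lambda>x. indicator U x *\<^sub>R G x) \<in> borel_measurable lebesgue"
    and C: "0 \<le> C" "\<And>x. x \<in> U \<Longrightarrow> norm (G x) \<le> C * norm (F x)"
  shows "L2v U G" "norm (emb U G) \<le> C * norm (emb U F)"
proof -
  have s: "sq_integrable (\<lambda>x. indicator U x *\<^sub>R F x)" using F L2v_iff[OF U] by blast
  have le: "(norm (G x))\<^sup>2 \<le> C\<^sup>2 * (norm (F x))\<^sup>2" if "x \<in> U" for x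
    using power_mono[OF C(2)[OF that] norm_ge_zero, of 2] by (simp add: power_mult_distrib)
  show LG: "L2v U G" unfolding L2v_iff[OF U]
  proof (rule sq_integrable_bound[OF G])
    show "integrable lebesgue (\<lambda>x. C\<^sup>2 * (norm (indicator U x *\<^sub>R F x))\<^sup>2)"
      by (intro integrable_mult_right sq_integrable_norm[OF s])
    show "(norm (indicator U x *\<^sub>R G x))\<^sup>2 \<le> C\<^sup>2 * (norm (indicator U x *\<^sub>R F x))\<^sup>2" for x
      using le[of x] by (cases "x \<in> U") auto
  qed
  show "norm (emb U G) \<le> C * norm (emb U F)"
  proof (rule power2_le_imp_le)
    have "(norm (emb U G))\<^sup>2 \<le> (\<integral>x. C\<^sup>2 * (norm (F x))\<^sup>2 \<partial>lebesgue_on U)"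
      unfolding norm_emb_sq[OF U LG] using F LG le by (intro integral_mono) (auto simp: L2v_def)
    then show "(norm (emb U G))\<^sup>2 \<le> (C * norm (emb U F))\<^sup>2"
      by (simp add: power_mult_distrib norm_emb_sq[OF U F])
  qed (use C in simp)
qed

lemma norm_matrix_vector_le: "norm (A *v w) \<le> norm A * norm (w :: real^'n)" for A :: "real^'n^'m"
proof -
  have "norm (A *v w) = L2_set (\<lambda>i. norm (A $ i \<bullet> w)) UNIV" by (simp add: norm_vec_def matrix_mult_dot)
  also have "\<dots> \<le> L2_set (\<lambda>i. norm (A $ i) * norm w) UNIV"
    by (intro L2_set_mono) (auto simp: Cauchy_Schwarz_ineq2)
  also have "\<dots> = norm A * norm w" by (simp add: norm_vec_def L2_set_left_distrib)
  finally show ?thesis .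
qed

lemma measurable_matrix_vector:
  fixes A :: "real^'n \<Rightarrow> real^'n^'n"
  assumes U: "open U" and A: "continuous_on U A" and F: "L2v U F"
  shows "(\<lambda>x. indicator U x *\<^sub>R (A x *v F x)) \<in> borel_measurable lebesgue"
proof -
  have c: "continuous_on UNIV (\<lambda>z. fst z *v (snd z :: real^'n) :: real^'n)"
    unfolding matrix_mult_dot by (intro continuous_on_vec_lambda continuous_intros)
  have "(\<lambda>x. indicator U x *\<^sub>R A x) \<in> borel_measurable lebesgue"
    using A U by (intro measurable_completion) (simp add: borel_measurable_continuous_on_indicator)
  moreover have "(\<lambda>x. indicator U x *\<^sub>R F x) \<in> borel_measurable lebesgue"
    using F L2v_iff[OF U] sq_integrable_measurable by blast
  ultimately have "(\<lambda>x. (indicator U x *\<^sub>R A x) *v (indicator U x *\<^sub>R F x)) \<in> borel_measurable lebesgue"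
    using c by (rule borel_measurable_continuous_Pair)
  moreover have "(\<lambda>x. (indicator U x *\<^sub>R A x) *v (indicator U x *\<^sub>R F x)) = (\<lambda>x. indicator U x *\<^sub>R (A x *v F x))"
    by (auto simp: indicator_def fun_eq_iff)
  ultimately show ?thesis by simp
qed

text \<open>Slices of a jointly Borel kernel are Borel, and parameter integrals of jointly Borel
  integrands are measurable. The Lebesgue measurable factor \<open>h\<close> does not depend on t
  and can be exchanged for a Borel version once and for all.\<close>

lemma measurable_param_integral:
  fixes K :: "real \<times> 'a::euclidean_space \<Rightarrow> real"
  assumes K: "K \<in> borel_measurable borel" and h: "h \<in> borel_measurable lebesgue"
  shows "(\<lambda>t. \<integral>x. K (t, x) * h x \<partial>lebesgue) \<in> borel_measurable borel"
proof -
  obtain h' where h': "h' \<in> borel_measurable lborel" "AE x in lborel. h x = h' x"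
    using completion_ex_borel_measurable_real[OF h] by auto
  have [measurable]: "h' \<in> borel_measurable borel" using h'(1) by simp
  have K2[measurable]: "K \<in> borel_measurable (borel \<Otimes>\<^sub>M borel)" using K by (simp add: borel_prod)
  have sec[measurable]: "(\<lambda>x. K (t, x)) \<in> borel_measurable borel" for t by measurable
  have "(\<integral>x. K (t, x) * h x \<partial>lebesgue) = (\<integral>x. K (t, x) * h' x \<partial>lborel)" for t
  proof -
    have "(\<integral>x. K (t, x) * h x \<partial>lebesgue) = (\<integral>x. K (t, x) * h' x \<partial>lebesgue)"
    proof (rule integral_cong_AE)
      show "(\<lambda>x. K (t, x) * h x) \<in> borel_measurable lebesgue"
        by (rule borel_measurable_times[OF measurable_completion h]) simp
      show "(\<lambda>x. K (t, x) * h' x) \<in> borel_measurable lebesgue" by (intro measurable_completion) measurable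
      have "AE x in lebesgue. h x = h' x" using h'(2) by (simp add: AE_completion_iff)
      then show "AE x in lebesgue. K (t, x) * h x = K (t, x) * h' x" by eventually_elim simp
    qed
    also have "\<dots> = (\<integral>x. K (t, x) * h' x \<partial>lborel)" by (rule integral_completion) measurable
    finally show ?thesis .
  qed
  moreover have "(\<lambda>t. \<integral>x. K (t, x) * h' x \<partial>lborel) \<in> borel_measurable borel"
    by (rule lborel.borel_measurable_lebesgue_integral) measurable
  ultimately show ?thesis by simp
qed

lemma borel_measurable_lebesgue_onI:
  "f \<in> borel_measurable borel \<Longrightarrow> f \<in> borel_measurable (lebesgue_on S)"
  by (intro measurable_restrict_space1 measurable_completion) simp

text \<open>The hypotheses in usable form: explicit constants, and \<open>a\<close>,
  \<open>g\<close> Borel on all of space-time, so that every time slice is measurable and not merely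
  almost every one.\<close>

locale wave_data =
  fixes U :: "(real^'n) set" and T :: real
    and B :: "real \<Rightarrow> real^'n \<Rightarrow> real^'n^'n" and b :: "real \<Rightarrow> real^'n \<Rightarrow> real^'n"
    and a :: "real \<times> (real^'n) \<Rightarrow> real^'n" and g :: "real \<times> (real^'n) \<Rightarrow> real"
    and v0 v1 :: "real^'n \<Rightarrow> real" and LB MB cB Ma Lb Mb :: real
  assumes U: "open U" and T: "T > 0"
    and B_lip: "\<And>t s x y. t \<in> {0..T} \<Longrightarrow> s \<in> {0..T} \<Longrightarrow> x \<in> U \<Longrightarrow> y \<in> U \<Longrightarrow>
      norm (B t x - B s y) \<le> LB * (\<bar>t - s\<bar> + norm (x - y))"
    and B_bound: "\<And>t x. t \<in> {0..T} \<Longrightarrow> x \<in> U \<Longrightarrow> norm (B t x) \<le> MB"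
    and B_sym: "\<And>t x. t \<in> {0..T} \<Longrightarrow> x \<in> U \<Longrightarrow> transpose (B t x) = B t x"
    and B_coercive: "\<And>t x w. t \<in> {0..T} \<Longrightarrow> x \<in> U \<Longrightarrow> (B t x *v w) \<bullet> w \<ge> cB * (norm w)\<^sup>2"
    and a_meas: "a \<in> borel_measurable borel" and a_bound: "\<And>z. norm (a z) \<le> Ma"
    and b_lip: "\<And>t s x y. t \<in> {0..T} \<Longrightarrow> s \<in> {0..T} \<Longrightarrow> x \<in> U \<Longrightarrow> y \<in> U \<Longrightarrow>
      norm (b t x - b s y) \<le> Lb * (\<bar>t - s\<bar> + norm (x - y))"
    and b_bound: "\<And>t x. t \<in> {0..T} \<Longrightarrow> x \<in> U \<Longrightarrow> norm (b t x) \<le> Mb"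
    and g_meas: "g \<in> borel_measurable borel" and g_fin: "(\<integral>\<^sup>+z. ennreal ((g z)\<^sup>2) \<partial>lborel) < \<infinity>"
    and v0: "H10 U v0" and v1: "L2 U v1"
    and nonneg: "0 \<le> LB" "0 \<le> MB" "0 < cB" "0 \<le> Ma" "0 \<le> Lb" "0 \<le> Mb"
begin

lemma field: assumes t: "t \<in> {0..T}" shows "lipschitz_field U (b t) Lb Mb"
proof
  show "Lb-lipschitz_on U (\<lambda>x. b t x $ i)" for i
  proof (rule lipschitz_onI)
    fix x y assume "x \<in> U" "y \<in> U"
    then have "norm (b t x - b t y) \<le> Lb * norm (x - y)" using b_lip[OF t t, of x y] by simp
    then show "dist (b t x $ i) (b t y $ i) \<le> Lb * dist x y"
      using component_le_norm_cart[of "b t x - b t y" i] by (simp add: dist_norm)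
  qed (use nonneg in simp)
qed (use U b_bound[OF t] nonneg in auto)

lemma B_cont: assumes t: "t \<in> {0..T}" shows "continuous_on U (B t)"
proof (rule lipschitz_on_continuous_on[OF lipschitz_onI])
  show "dist (B t x) (B t y) \<le> LB * dist x y" if "x \<in> U" "y \<in> U" for x y
    using B_lip[OF t t that] by (simp add: dist_norm)
qed (use nonneg in simp)

definition "Bm t q = emb U (\<lambda>x. B t x *v rep_l2 q x)"
text \<open>The identity in the first component makes \<open>Bo\<close> coercive on the whole graph,
  with constant min 1 cB; the \<open>- fst p\<close> in \<open>Co\<close> takes it back.
  \<open>Co\<close> and \<open>Do\<close> are written for the test function, so a \<phi> and div (b
  \<phi>) appear and the solution enters only linearly through inner products.\<close>

definition "Bo t p = (fst p, Bm t (snd p))"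
definition "Co t p = (- fst p, emb U (\<lambda>x. rep_l2 (fst p) x *\<^sub>R a (t, x)))"
definition "Do t p = 2 *\<^sub>R emb U (wdiv U (\<lambda>x. rep_l2 (fst p) x *\<^sub>R b t x))"
text \<open>Times with a slice that is not square integrable form a null set; there the value 0
  keeps the forcing a genuine vector at every time.\<close>

definition "gh t = (if (\<integral>\<^sup>+x. ennreal ((g (t, x))\<^sup>2) \<partial>lborel) < \<infinity> then emb U (\<lambda>x. g (t, x)) else 0)"
text \<open>Each summand is the constant of one operator bound, and all are nonnegative, so each is
  at most the sum.\<close>

definition "Mc = (1 + MB) + LB + (1 + Ma) + 2 * (real CARD('n) * Lb + Mb) + 2 * (real CARD('n) * Lb)"

lemma B_mult:
  assumes t: "t \<in> {0..T}" and F: "L2v U F"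
  shows "L2v U (\<lambda>x. B t x *v F x)" "norm (emb U (\<lambda>x. B t x *v F x)) \<le> MB * norm (emb U F)"
proof -
  have "norm (B t x *v F x) \<le> MB * norm (F x)" if "x \<in> U" for x
    using order_trans[OF norm_matrix_vector_le mult_right_mono[OF B_bound[OF t that] norm_ge_zero]] .
  note * = L2v_dominated[OF U F measurable_matrix_vector[OF U B_cont[OF t] F] nonneg(2) this]
  show "L2v U (\<lambda>x. B t x *v F x)" "norm (emb U (\<lambda>x. B t x *v F x)) \<le> MB * norm (emb U F)" using * by auto
qed

lemma Bm_emb: assumes t: "t \<in> {0..T}" and F: "L2v U F" shows "Bm t (emb U F) = emb U (\<lambda>x. B t x *v F x)"
proof -
  have "AE x in lebesgue_on U. B t x *v rep_l2 (emb U F) x = B t x *v F x"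
    using rep_emb[OF U F] by eventually_elim simp
  then show ?thesis unfolding Bm_def by (subst emb_eq_iff[OF U B_mult(1)[OF t L2v_rep[OF U]] B_mult(1)[OF t F]])
qed

lemma Bm_linear: assumes t: "t \<in> {0..T}" shows "Bm t (q + c *\<^sub>R r) = Bm t q + c *\<^sub>R Bm t r"
proof -
  have "AE x in lebesgue. rep_l2 (q + c *\<^sub>R r) x = rep_l2 q x + c *\<^sub>R rep_l2 r x"
    using rep_l2_plus[of q "c *\<^sub>R r"] rep_l2_scaleR[of c r] by eventually_elim simp
  then have "AE x in lebesgue_on U. B t x *v rep_l2 (q + c *\<^sub>R r) x = B t x *v rep_l2 q x + c *\<^sub>R (B t x *v rep_l2 r x)"
    unfolding AE_lebesgue_on_open[OF U] by eventually_elim (simp add: matrix_vector_right_distrib matrix_vector_mult_scaleR)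
  then have "Bm t (q + c *\<^sub>R r) = emb U (\<lambda>x. B t x *v rep_l2 q x + c *\<^sub>R (B t x *v rep_l2 r x))"
    unfolding Bm_def
    by (subst emb_eq_iff[OF U B_mult(1)[OF t L2v_rep[OF U]] L2v_linear[OF U B_mult(1)[OF t L2v_rep[OF U]] B_mult(1)[OF t L2v_rep[OF U]]]])
  then show ?thesis unfolding Bm_def by (simp only: emb_linear[OF U B_mult(1)[OF t L2v_rep[OF U]] B_mult(1)[OF t L2v_rep[OF U]]])
qed

lemma sobolev0_emb:
  assumes "p \<in> sobolev0 U" shows "emb U (rep_l2 (fst p)) = fst p" "emb U (rep_l2 (snd p)) = snd p"
proof -
  obtain u where u: "p = sob U u" "H1 U u" using assms by (auto simp: sobolev0_def H10_def)
  show "emb U (rep_l2 (fst p)) = fst p" "emb U (rep_l2 (snd p)) = snd p"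
    using emb_rep_emb[OF U, of u] emb_rep_emb[OF U wgrad_props(2)[OF u(2)]] wgrad_props(1)[OF u(2)]
    by (auto simp: u(1) sob_def L2_eq_L2v)
qed

lemma Bm_sym:
  assumes t: "t \<in> {0..T}" and F: "L2v U F" "L2v U G"
  shows "emb U F \<bullet> emb U (\<lambda>x. B t x *v G x) = emb U G \<bullet> emb U (\<lambda>x. B t x *v F x)"
  unfolding emb_inner(1)[OF U F(1) B_mult(1)[OF t F(2)]] emb_inner(1)[OF U F(2) B_mult(1)[OF t F(1)]]
proof (rule Bochner_Integration.integral_cong[OF refl])
  fix x assume "x \<in> space (lebesgue_on U)"
  then have x: "x \<in> U" by simp
  have "F x \<bullet> (B t x *v G x) = (transpose (B t x) *v F x) \<bullet> G x" by (simp add: dot_lmul_matrix)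
  then show "F x \<bullet> (B t x *v G x) = G x \<bullet> (B t x *v F x)" by (simp only: B_sym[OF t x] inner_commute)
qed

lemma Bm_coercive:
  assumes t: "t \<in> {0..T}" and F: "L2v U F"
  shows "emb U F \<bullet> emb U (\<lambda>x. B t x *v F x) \<ge> cB * (norm (emb U F))\<^sup>2"
proof -
  have "cB * (norm (emb U F))\<^sup>2 = (\<integral>x. cB * (norm (F x))\<^sup>2 \<partial>lebesgue_on U)" by (simp add: norm_emb_sq[OF U F])
  also have "\<dots> \<le> (\<integral>x. F x \<bullet> (B t x *v F x) \<partial>lebesgue_on U)"
    using F emb_inner(2)[OF U F B_mult(1)[OF t F]] B_coercive[OF t]
    by (intro integral_mono) (auto simp: L2v_def inner_commute[of "F _"])
  also have "\<dots> = emb U F \<bullet> emb U (\<lambda>x. B t x *v F x)" by (rule emb_inner(1)[OF U F B_mult(1)[OF t F], symmetric])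
  finally show ?thesis .
qed

lemma Bm_norm: "t \<in> {0..T} \<Longrightarrow> norm (Bm t q) \<le> MB * norm q"
  unfolding Bm_def using order_trans[OF B_mult(2)[OF _ L2v_rep[OF U]] mult_left_mono[OF emb_rep_norm[OF U] nonneg(2)]] .

lemma Bm_lip:
  assumes t: "t \<in> {0..T}" "s \<in> {0..T}" shows "norm (Bm t q - Bm s q) \<le> LB * \<bar>t - s\<bar> * norm q"
proof -
  let ?F = "rep_l2 q"
  note L = L2v_rep[OF U, of q]
  have "Bm t q - Bm s q = emb U (\<lambda>x. B t x *v ?F x + (-1) *\<^sub>R (B s x *v ?F x))"
    unfolding Bm_def emb_linear[OF U B_mult(1)[OF t(1) L] B_mult(1)[OF t(2) L]] by simp
  also have "\<dots> = emb U (\<lambda>x. (B t x - B s x) *v ?F x)" by (simp add: matrix_vector_mult_diff_rdistrib)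
  finally have e: "Bm t q - Bm s q = emb U (\<lambda>x. (B t x - B s x) *v ?F x)" .
  have m: "(\<lambda>x. indicator U x *\<^sub>R ((B t x - B s x) *v ?F x)) \<in> borel_measurable lebesgue"
    by (intro measurable_matrix_vector U continuous_on_diff B_cont t L)
  have "norm ((B t x - B s x) *v ?F x) \<le> (LB * \<bar>t - s\<bar>) * norm (?F x)" if "x \<in> U" for x
    using order_trans[OF norm_matrix_vector_le mult_right_mono[OF B_lip[OF t that that] norm_ge_zero]] by simp
  from L2v_dominated(2)[OF U L m _ this] have "norm (Bm t q - Bm s q) \<le> LB * \<bar>t - s\<bar> * norm (emb U ?F)"
    unfolding e using nonneg by simp
  also have "\<dots> \<le> LB * \<bar>t - s\<bar> * norm q" using nonneg by (intro mult_left_mono emb_rep_norm[OF U]) auto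
  finally show ?thesis .
qed

lemma a_section: "(\<lambda>x. a (t, x)) \<in> borel_measurable borel"
proof -
  have [measurable]: "a \<in> borel_measurable (borel \<Otimes>\<^sub>M borel)" using a_meas by (simp add: borel_prod)
  show ?thesis by measurable
qed

lemma a_mult:
  assumes f: "L2v U f" shows "L2v U (\<lambda>x. f x *\<^sub>R a (t, x))" "norm (emb U (\<lambda>x. f x *\<^sub>R a (t, x))) \<le> Ma * norm (emb U f)"
proof -
  have "(\<lambda>x. indicator U x *\<^sub>R f x) \<in> borel_measurable lebesgue"
    using f L2v_iff[OF U] sq_integrable_measurable by blast
  then have "(\<lambda>x. (indicator U x *\<^sub>R f x) *\<^sub>R a (t, x)) \<in> borel_measurable lebesgue"
    by (rule borel_measurable_scaleR[OF _ measurable_completion]) (use a_section[of t] in simp)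
  then have m: "(\<lambda>x. indicator U x *\<^sub>R (f x *\<^sub>R a (t, x))) \<in> borel_measurable lebesgue" by simp
  have "norm (f x *\<^sub>R a (t, x)) \<le> Ma * norm (f x)" for x
    using mult_right_mono[OF a_bound[of "(t, x)"] norm_ge_zero[of "f x"]] by (simp add: mult.commute)
  from L2v_dominated[OF U f m nonneg(4) this]
  show "L2v U (\<lambda>x. f x *\<^sub>R a (t, x))" "norm (emb U (\<lambda>x. f x *\<^sub>R a (t, x))) \<le> Ma * norm (emb U f)" by auto
qed

lemma a_emb: assumes f: "L2v U f"
  shows "emb U (\<lambda>x. rep_l2 (emb U f) x *\<^sub>R a (t, x)) = emb U (\<lambda>x. f x *\<^sub>R a (t, x))"
proof -
  have "AE x in lebesgue_on U. rep_l2 (emb U f) x *\<^sub>R a (t, x) = f x *\<^sub>R a (t, x)"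
    using rep_emb[OF U f] by eventually_elim simp
  then show ?thesis by (subst emb_eq_iff[OF U a_mult(1)[OF L2v_rep[OF U]] a_mult(1)[OF f]])
qed

lemma a_linear: "emb U (\<lambda>x. rep_l2 (p + c *\<^sub>R q) x *\<^sub>R a (t, x))
  = emb U (\<lambda>x. rep_l2 p x *\<^sub>R a (t, x)) + c *\<^sub>R emb U (\<lambda>x. rep_l2 q x *\<^sub>R a (t, x))"
proof -
  have "AE x in lebesgue. rep_l2 (p + c *\<^sub>R q) x = rep_l2 p x + c *\<^sub>R rep_l2 q x"
    using rep_l2_plus[of p "c *\<^sub>R q"] rep_l2_scaleR[of c q] by eventually_elim simp
  then have "AE x in lebesgue_on U. rep_l2 (p + c *\<^sub>R q) x *\<^sub>R a (t, x) = rep_l2 p x *\<^sub>R a (t, x) + c *\<^sub>R (rep_l2 q x *\<^sub>R a (t, x))"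
    unfolding AE_lebesgue_on_open[OF U] by eventually_elim (simp add: scaleR_add_left)
  then have "emb U (\<lambda>x. rep_l2 (p + c *\<^sub>R q) x *\<^sub>R a (t, x)) = emb U (\<lambda>x. rep_l2 p x *\<^sub>R a (t, x) + c *\<^sub>R (rep_l2 q x *\<^sub>R a (t, x)))"
    by (subst emb_eq_iff[OF U a_mult(1)[OF L2v_rep[OF U]] L2v_linear[OF U a_mult(1)[OF L2v_rep[OF U]] a_mult(1)[OF L2v_rep[OF U]]]])
  then show ?thesis by (simp only: emb_linear[OF U a_mult(1)[OF L2v_rep[OF U]] a_mult(1)[OF L2v_rep[OF U]]])
qed

text \<open>Componentwise the product is an integral of a Borel kernel against a fixed Lebesgue
  measurable function, which is the situation of \<open>measurable_param_integral\<close>.\<close>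

lemma a_inner_measurable:
  assumes F: "L2v U F" and f: "L2v U f"
  shows "(\<lambda>t. emb U F \<bullet> emb U (\<lambda>x. f x *\<^sub>R a (t, x))) \<in> borel_measurable borel"
proof -
  have UL: "U \<in> sets lebesgue" using U by auto
  have m: "(\<lambda>x. indicator U x *\<^sub>R F x) \<in> borel_measurable lebesgue" "(\<lambda>x. indicator U x *\<^sub>R f x) \<in> borel_measurable lebesgue"
    using F f L2v_iff[OF U] sq_integrable_measurable by blast+
  let ?h = "\<lambda>i x. (indicator U x *\<^sub>R F x) $ i * (indicator U x *\<^sub>R f x)"
  have hm: "?h i \<in> borel_measurable lebesgue" for i
  proof -
    have "(\<lambda>x. (indicator U x *\<^sub>R F x) \<bullet> axis i 1) \<in> borel_measurable lebesgue"
      by (rule borel_measurable_inner[OF m(1) borel_measurable_const])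
    then have "(\<lambda>x. (indicator U x *\<^sub>R F x) $ i) \<in> borel_measurable lebesgue" by (simp add: inner_axis)
    then show ?thesis by (rule borel_measurable_times[OF _ m(2)])
  qed
  have am: "(\<lambda>z. a z $ i) \<in> borel_measurable borel" for i
  proof -
    have "(\<lambda>z. a z \<bullet> axis i 1) \<in> borel_measurable borel" using a_meas by (intro borel_measurable_inner) auto
    then show ?thesis by (simp add: inner_axis)
  qed
  have int: "integrable lebesgue (\<lambda>x. a (t, x) $ i * ?h i x)" for t i
  proof -
    have "L2v U (\<lambda>x. f x *\<^sub>R (a (t, x) $ i))"
      using L2v_component[OF U a_mult(1)[OF f, of t], of i] by (simp add: L2_eq_L2v)
    moreover have "L2v U (\<lambda>x. F x $ i)" using L2v_component[OF U F, of i] by (simp add: L2_eq_L2v)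
    ultimately have "integrable (lebesgue_on U) (\<lambda>x. (F x $ i) \<bullet> (f x *\<^sub>R (a (t, x) $ i)))" by (intro emb_inner(2)[OF U])
    then have "integrable lebesgue (\<lambda>x. indicator U x *\<^sub>R ((F x $ i) \<bullet> (f x *\<^sub>R (a (t, x) $ i))))"
      by (simp only: integral_lebesgue_on(2)[OF UL])
    moreover have "(\<lambda>x. indicator U x *\<^sub>R ((F x $ i) \<bullet> (f x *\<^sub>R (a (t, x) $ i)))) = (\<lambda>x. a (t, x) $ i * ?h i x)"
      by (auto simp: indicator_def fun_eq_iff)
    ultimately show ?thesis by simp
  qed
  have "emb U F \<bullet> emb U (\<lambda>x. f x *\<^sub>R a (t, x)) = (\<Sum>i\<in>UNIV. \<integral>x. a (t, x) $ i * ?h i x \<partial>lebesgue)" for t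
  proof -
    have "emb U F \<bullet> emb U (\<lambda>x. f x *\<^sub>R a (t, x)) = (\<integral>x. indicator U x *\<^sub>R (F x \<bullet> (f x *\<^sub>R a (t, x))) \<partial>lebesgue)"
      unfolding emb_inner(1)[OF U F a_mult(1)[OF f]] integral_lebesgue_on(1)[OF UL] ..
    also have "\<dots> = (\<integral>x. (\<Sum>i\<in>UNIV. a (t, x) $ i * ?h i x) \<partial>lebesgue)"
      by (intro Bochner_Integration.integral_cong refl)
        (auto simp: indicator_def inner_vec_def sum_distrib_left mult_ac)
    also have "\<dots> = (\<Sum>i\<in>UNIV. \<integral>x. a (t, x) $ i * ?h i x \<partial>lebesgue)" by (intro Bochner_Integration.integral_sum int)
    finally show ?thesis .
  qed
  moreover have "(\<lambda>t. \<Sum>i\<in>UNIV. \<integral>x. a (t, x) $ i * ?h i x \<partial>lebesgue) \<in> borel_measurable borel"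
    by (intro borel_measurable_sum measurable_param_integral am hm)
  ultimately show ?thesis by (simp only:)
qed

lemma Do_eq: assumes "t \<in> {0..T}" shows "Do t p = 2 *\<^sub>R lipschitz_field.dv U (b t) (rep_l2 (fst p))"
  by (simp add: Do_def lipschitz_field.dv_def[OF field[OF assms]])

lemma Do_sob: assumes t: "t \<in> {0..T}" and u: "H10 U u" shows "Do t (sob U u) = 2 *\<^sub>R lipschitz_field.dv U (b t) u"
proof -
  interpret lipschitz_field U "b t" Lb Mb by (rule field[OF t])
  have p: "sob U u \<in> sobolev0 U" using u H10_iff[OF U] by blast
  have "emb U (rep_l2 (fst (sob U u))) = emb U u" using sobolev0_emb(1)[OF p] by (simp add: sob_def)
  then have "dv (rep_l2 (fst (sob U u))) = dv u" by (intro dv_cong sobolev0_rep(1)[OF U p] u)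
  then show ?thesis by (simp add: Do_eq[OF t])
qed

text \<open>\<open>wdiv\<close> is chosen separately at each time, so its definition says nothing
  about measurability in t. With a test function in place of w, the weak divergence turns the
  product into - 2 u . (b . grad \<phi>), which is Lipschitz in t; general w are reached by
  pointwise limits.\<close>

lemma Do_measurable:
  assumes w: "H10 U w" and u: "H10 U u"
  shows "(\<lambda>t. emb U w \<bullet> Do t (sob U u)) \<in> borel_measurable (lebesgue_on {0..T})"
proof -
  obtain \<phi> where \<phi>: "\<And>n. test_fun U (\<phi> n)" "(\<lambda>n. sob U (\<phi> n)) \<longlonglongrightarrow> sob U w" using sobolev0_approx[OF U w] by blast
  have "(\<lambda>t. - 2 * (emb U u \<bullet> emb U (\<lambda>x. b t x \<bullet> cgrad (\<phi> n) x))) \<in> borel_measurable (lebesgue_on {0..T})" for n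
  proof (rule continuous_imp_measurable_on_sets_lebesgue)
    let ?G = "cgrad (\<phi> n)"
    have G: "L2v U ?G" by (rule test_fun_L2(2)[OF U \<phi>(1)])
    have d: "norm (emb U (\<lambda>x. b t x \<bullet> ?G x) - emb U (\<lambda>x. b s x \<bullet> ?G x)) \<le> Lb * \<bar>t - s\<bar> * norm (emb U ?G)"
      if t: "t \<in> {0..T}" "s \<in> {0..T}" for t s
    proof -
      interpret t: lipschitz_field U "b t" Lb Mb by (rule field[OF t(1)])
      interpret s: lipschitz_field U "b s" Lb Mb by (rule field[OF t(2)])
      have e: "emb U (\<lambda>x. b t x \<bullet> ?G x) - emb U (\<lambda>x. b s x \<bullet> ?G x) = emb U (\<lambda>x. b t x \<bullet> ?G x + (-1) *\<^sub>R (b s x \<bullet> ?G x))"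
        unfolding emb_linear[OF U t.L2v_mult_bounded[OF G] s.L2v_mult_bounded[OF G]] by simp
      have L: "L2v U (\<lambda>x. b t x \<bullet> ?G x + (-1) *\<^sub>R (b s x \<bullet> ?G x))"
        by (rule L2v_linear[OF U t.L2v_mult_bounded[OF G] s.L2v_mult_bounded[OF G]])
      have m: "(\<lambda>x. indicator U x *\<^sub>R (b t x \<bullet> ?G x + (-1) *\<^sub>R (b s x \<bullet> ?G x))) \<in> borel_measurable lebesgue"
        using L L2v_iff[OF U] sq_integrable_measurable by blast
      have "norm (b t x \<bullet> ?G x + (-1) *\<^sub>R (b s x \<bullet> ?G x)) \<le> (Lb * \<bar>t - s\<bar>) * norm (?G x)" if "x \<in> U" for x
      proof -
        have "norm (b t x \<bullet> ?G x + (-1) *\<^sub>R (b s x \<bullet> ?G x)) = \<bar>(b t x - b s x) \<bullet> ?G x\<bar>" by (simp add: inner_diff_left)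
        also have "\<dots> \<le> norm (b t x - b s x) * norm (?G x)" by (rule Cauchy_Schwarz_ineq2)
        also have "\<dots> \<le> (Lb * \<bar>t - s\<bar>) * norm (?G x)" using b_lip[OF t that that] by (intro mult_right_mono) auto
        finally show ?thesis .
      qed
      from L2v_dominated(2)[OF U G m _ this] show ?thesis unfolding e using nonneg by simp
    qed
    show "continuous_on {0..T} (\<lambda>t. - 2 * (emb U u \<bullet> emb U (\<lambda>x. b t x \<bullet> ?G x)))"
    proof (intro continuous_intros lipschitz_on_continuous_on[where L="Lb * norm (emb U ?G)"] lipschitz_onI)
      show "dist (emb U (\<lambda>x. b t x \<bullet> ?G x)) (emb U (\<lambda>x. b s x \<bullet> ?G x)) \<le> Lb * norm (emb U ?G) * dist t s"
        if "t \<in> {0..T}" "s \<in> {0..T}" for t s using d[OF that] by (simp add: dist_norm mult_ac)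
    qed (use nonneg in simp)
  qed simp
  then show ?thesis
  proof (rule borel_measurable_LIMSEQ_real[rotated])
    fix t assume "t \<in> space (lebesgue_on {0..T})"
    then have t: "t \<in> {0..T}" by simp
    interpret t: lipschitz_field U "b t" Lb Mb by (rule field[OF t])
    have "emb U (\<phi> n) \<bullet> Do t (sob U u) = - 2 * (emb U u \<bullet> emb U (\<lambda>x. b t x \<bullet> cgrad (\<phi> n) x))" for n
      using t.dv_inner[OF u \<phi>(1)] by (simp add: Do_sob[OF t u] inner_commute)
    moreover have "(\<lambda>n. emb U (\<phi> n) \<bullet> Do t (sob U u)) \<longlonglongrightarrow> emb U w \<bullet> Do t (sob U u)"
      by (intro tendsto_intros tendsto_emb_sob \<phi>)
    ultimately show "(\<lambda>n. - 2 * (emb U u \<bullet> emb U (\<lambda>x. b t x \<bullet> cgrad (\<phi> n) x))) \<longlonglongrightarrow> emb U w \<bullet> Do t (sob U u)" by simp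
  qed
qed

lemma g_section: "(\<lambda>x. g (t, x)) \<in> borel_measurable borel"
proof -
  have [measurable]: "g \<in> borel_measurable (borel \<Otimes>\<^sub>M borel)" using g_meas by (simp add: borel_prod)
  show ?thesis by measurable
qed

lemma g_section_L2:
  assumes fin: "(\<integral>\<^sup>+x. ennreal ((g (t, x))\<^sup>2) \<partial>lborel) < \<infinity>"
  shows "L2v U (\<lambda>x. g (t, x))" "ennreal ((norm (emb U (\<lambda>x. g (t, x))))\<^sup>2) \<le> (\<integral>\<^sup>+x. ennreal ((g (t, x))\<^sup>2) \<partial>lborel)"
proof -
  have sm: "(\<lambda>x. (g (t, x))\<^sup>2) \<in> borel_measurable borel" using g_section by measurable
  have i: "integrable lborel (\<lambda>x. (g (t, x))\<^sup>2)" using fin sm by (intro integrableI_bounded) auto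
  then have il: "integrable lebesgue (\<lambda>x. (g (t, x))\<^sup>2)" using sm by (simp add: integrable_completion)
  have sq: "sq_integrable (\<lambda>x. g (t, x))"
    unfolding sq_integrable_def using il g_section by (auto intro: measurable_completion)
  show L: "L2v U (\<lambda>x. g (t, x))" unfolding L2v_iff[OF U]
  proof (rule sq_integrable_bound[OF _ sq_integrable_norm[OF sq]])
    show "(\<lambda>x. indicator U x *\<^sub>R g (t, x)) \<in> borel_measurable lebesgue"
      using sq_integrable_measurable[OF sq] U by (intro borel_measurable_scaleR borel_measurable_indicator) auto
    show "(norm (indicator U x *\<^sub>R g (t, x)))\<^sup>2 \<le> (norm (g (t, x)))\<^sup>2" for x by (auto simp: indicator_def)
  qed
  have "(norm (emb U (\<lambda>x. g (t, x))))\<^sup>2 = (\<integral>x. indicator U x *\<^sub>R (g (t, x))\<^sup>2 \<partial>lebesgue)"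
    using norm_emb_sq[OF U L] U by (simp add: integral_lebesgue_on(1))
  also have "\<dots> \<le> (\<integral>x. (g (t, x))\<^sup>2 \<partial>lebesgue)"
    using il U by (intro integral_mono integrable_mult_indicator) (auto simp: indicator_def)
  also have "\<dots> = (\<integral>x. (g (t, x))\<^sup>2 \<partial>lborel)" by (rule integral_completion) (use sm in simp)
  finally show "ennreal ((norm (emb U (\<lambda>x. g (t, x))))\<^sup>2) \<le> (\<integral>\<^sup>+x. ennreal ((g (t, x))\<^sup>2) \<partial>lborel)"
    using i by (simp add: nn_integral_eq_integral ennreal_leI)
qed

lemma gh_norm_le: "ennreal ((norm (gh t))\<^sup>2) \<le> (\<integral>\<^sup>+x. ennreal ((g (t, x))\<^sup>2) \<partial>lborel)"
  using g_section_L2(2) by (simp add: gh_def)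

lemma g_section_measurable: "(\<lambda>t. \<integral>\<^sup>+x. ennreal ((g (t, x))\<^sup>2) \<partial>lborel) \<in> borel_measurable borel"
  "(\<integral>\<^sup>+t. \<integral>\<^sup>+x. ennreal ((g (t, x))\<^sup>2) \<partial>lborel \<partial>lborel) < \<infinity>"
proof -
  have [measurable]: "g \<in> borel_measurable (borel \<Otimes>\<^sub>M borel)" using g_meas by (simp add: borel_prod)
  show "(\<lambda>t. \<integral>\<^sup>+x. ennreal ((g (t, x))\<^sup>2) \<partial>lborel) \<in> borel_measurable borel"
    by (rule lborel.borel_measurable_nn_integral) measurable
  have "(\<integral>\<^sup>+t. \<integral>\<^sup>+x. (\<lambda>z. ennreal ((g z)\<^sup>2)) (t, x) \<partial>lborel \<partial>lborel) = (\<integral>\<^sup>+z. ennreal ((g z)\<^sup>2) \<partial>(lborel \<Otimes>\<^sub>M lborel))"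
    by (rule lborel.nn_integral_fst) measurable
  then show "(\<integral>\<^sup>+t. \<integral>\<^sup>+x. ennreal ((g (t, x))\<^sup>2) \<partial>lborel \<partial>lborel) < \<infinity>" using g_fin by (simp add: lborel_prod)
qed

lemma gh_inner_measurable: assumes f: "L2v U f" shows "(\<lambda>t. gh t \<bullet> emb U f) \<in> borel_measurable borel"
proof -
  have UL: "U \<in> sets lebesgue" using U by auto
  have hm: "(\<lambda>x. indicator U x *\<^sub>R f x) \<in> borel_measurable lebesgue"
    using f L2v_iff[OF U] sq_integrable_measurable by blast
  define I where "I t = (\<integral>\<^sup>+x. ennreal ((g (t, x))\<^sup>2) \<partial>lborel)" for t
  define h where "h t = (\<integral>x. g (t, x) * (indicator U x *\<^sub>R f x) \<partial>lebesgue)" for t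
  have [measurable]: "I \<in> borel_measurable borel" "h \<in> borel_measurable borel"
    unfolding I_def h_def by (rule g_section_measurable(1) measurable_param_integral[OF g_meas hm])+
  have "gh t \<bullet> emb U f = (if I t < \<infinity> then h t else 0)" for t
    using emb_inner(1)[OF U g_section_L2(1) f, of t] by (simp add: I_def h_def gh_def integral_lebesgue_on(1)[OF UL] mult_ac)
  moreover have "(\<lambda>t. if I t < \<infinity> then h t else 0) \<in> borel_measurable borel" by measurable
  ultimately show ?thesis by (simp only:)
qed

lemma gh_norm_measurable: "(\<lambda>t. (norm (gh t))\<^sup>2) \<in> borel_measurable borel"
proof -
  have UB: "U \<in> sets borel" using U by auto
  have [measurable]: "g \<in> borel_measurable (borel \<Otimes>\<^sub>M borel)" using g_meas by (simp add: borel_prod)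
  define I where "I t = (\<integral>\<^sup>+x. ennreal ((g (t, x))\<^sup>2) \<partial>lborel)" for t
  define h where "h t = (\<integral>x. indicator U x *\<^sub>R (g (t, x))\<^sup>2 \<partial>lborel)" for t
  have hm: "h \<in> borel_measurable borel" unfolding h_def
    by (rule lborel.borel_measurable_lebesgue_integral) (use UB in measurable)
  have Im: "I \<in> borel_measurable borel" unfolding I_def by (rule g_section_measurable(1))
  have "(norm (gh t))\<^sup>2 = (if I t < \<infinity> then h t else 0)" for t
  proof -
    have "(\<integral>x. indicator U x *\<^sub>R (g (t, x))\<^sup>2 \<partial>lebesgue) = h t"
      unfolding h_def by (rule integral_completion) (use g_section UB in measurable)
    then show ?thesis using norm_emb_sq[OF U g_section_L2(1), of t] U by (simp add: I_def gh_def integral_lebesgue_on(1))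
  qed
  moreover have "(\<lambda>t. if I t < \<infinity> then h t else 0) \<in> borel_measurable borel" using hm Im by measurable
  ultimately show ?thesis by (simp only:)
qed

lemma gh_integrable: "integrable (lebesgue_on {0..T}) (\<lambda>t. (norm (gh t))\<^sup>2)"
proof -
  have "(\<integral>\<^sup>+t. ennreal ((norm (gh t))\<^sup>2) \<partial>lborel) \<le> (\<integral>\<^sup>+t. \<integral>\<^sup>+x. ennreal ((g (t, x))\<^sup>2) \<partial>lborel \<partial>lborel)"
    by (intro nn_integral_mono gh_norm_le)
  also have "\<dots> < \<infinity>" by (rule g_section_measurable(2))
  finally have "integrable lborel (\<lambda>t. (norm (gh t))\<^sup>2)" using gh_norm_measurable by (intro integrableI_bounded) auto
  then have "integrable lebesgue (\<lambda>t. (norm (gh t))\<^sup>2)" using gh_norm_measurable by (simp add: integrable_completion)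
  then have "integrable lebesgue (\<lambda>t. indicator {0..T} t *\<^sub>R (norm (gh t))\<^sup>2)" by (intro integrable_mult_indicator) auto
  then show ?thesis by (subst integral_lebesgue_on(2)) auto
qed

lemma hyperbolic: "hyperbolic_system (sobolev0 U) fst Bo Co Do gh T Mc (min 1 cB) (sob U v0) (emb U v1)"
proof (rule hyperbolic_system.intro)
  note closed = sobolev0_closed_subspace[OF U]
  have N: "0 \<le> real CARD('n) * Lb" using nonneg by simp
  have M: "1 + MB \<le> Mc" "LB \<le> Mc" "1 + Ma \<le> Mc" "2 * (real CARD('n) * Lb + Mb) \<le> Mc" "2 * (real CARD('n) * Lb) \<le> Mc" "0 \<le> Mc"
    unfolding Mc_def using nonneg N by auto
  show "T > 0" "0 \<le> Mc" "0 < min 1 cB" "closed (sobolev0 U)" "subspace (sobolev0 U)" using T M nonneg closed by auto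
  show "linear fst" by (rule linear_fst)
  show nf: "norm (fst x) \<le> norm x" for x :: "(real^'n, real) l2 \<times> (real^'n, real^'n) l2"
    using norm_fst_le[of "fst x" "snd x"] by simp
  show "x \<in> sobolev0 U \<Longrightarrow> fst x = 0 \<Longrightarrow> x = 0" for x by (rule sobolev0_fst_inj[OF U])
  show "sob U v0 \<in> sobolev0 U" using v0 H10_iff[OF U] by blast
  show "emb U v1 \<in> closure (fst ` sobolev0 U)" by (rule L2_in_closure[OF U v1])
  fix s assume s: "s \<in> {0..T}"
  show "linear_form_on (sobolev0 U) (\<lambda>y. x \<bullet> Bo s y)" for x
    unfolding linear_form_on_def Bo_def by (simp add: Bm_linear[OF s] inner_add_right inner_prod_def algebra_simps)
  show "linear_form_on (sobolev0 U) (\<lambda>y. x \<bullet> Co s y)" for x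
    unfolding linear_form_on_def Co_def by (simp add: a_linear inner_add_right inner_prod_def algebra_simps)
  interpret lipschitz_field U "b s" Lb Mb by (rule field[OF s])
  show "linear_form_on (sobolev0 U) (\<lambda>y. h \<bullet> Do s y)" for h
    unfolding linear_form_on_def
  proof (intro ballI allI)
    fix x y c assume "x \<in> sobolev0 U" "y \<in> sobolev0 U"
    then obtain u w where u: "x = sob U u" "H10 U u" and w: "y = sob U w" "H10 U w" by (auto simp: sobolev0_def)
    have "x + c *\<^sub>R y = sob U (\<lambda>x. u x + c * w x)"
      using sob_linear(2)[OF U, of u w c] u w by (simp add: H10_def)
    then show "h \<bullet> Do s (x + c *\<^sub>R y) = h \<bullet> Do s x + c * (h \<bullet> Do s y)"
      using Do_sob[OF s H10_linear[OF U u(2) w(2), of c]] Do_sob[OF s u(2)] Do_sob[OF s w(2)]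
      by (simp add: u(1) w(1) dv_linear[OF u(2) w(2)] inner_add_right algebra_simps)
  qed
  fix y assume y: "y \<in> sobolev0 U"
  obtain u where u: "y = sob U u" "H10 U u" using y by (auto simp: sobolev0_def)
  have ns: "norm (snd y) \<le> norm y" using norm_snd_le[of "snd y" "fst y"] by simp
  show "norm (Bo s y) \<le> Mc * norm y"
  proof -
    have "norm (Bo s y) \<le> norm (fst y) + norm (Bm s (snd y))" unfolding Bo_def by (rule norm_Pair_le)
    also have "\<dots> \<le> norm y + MB * norm y"
      using nf Bm_norm[OF s, of "snd y"] mult_left_mono[OF ns nonneg(2)] by (intro add_mono) auto
    also have "\<dots> = (1 + MB) * norm y" by (simp add: algebra_simps)
    also have "\<dots> \<le> Mc * norm y" using M(1) by (rule mult_right_mono) simp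
    finally show ?thesis .
  qed
  show "norm (Co s y) \<le> Mc * norm (fst y)"
  proof -
    have "norm (Co s y) \<le> norm (- fst y) + norm (emb U (\<lambda>x. rep_l2 (fst y) x *\<^sub>R a (s, x)))" unfolding Co_def by (rule norm_Pair_le)
    also have "\<dots> \<le> norm (fst y) + Ma * norm (fst y)"
      using a_mult(2)[OF L2v_rep[OF U], of "fst y" s] mult_left_mono[OF emb_rep_norm[OF U, of "fst y"] nonneg(4)] by auto
    also have "\<dots> = (1 + Ma) * norm (fst y)" by (simp add: algebra_simps)
    also have "\<dots> \<le> Mc * norm (fst y)" using M(3) by (rule mult_right_mono) simp
    finally show ?thesis .
  qed
  show "norm (Do s y) \<le> Mc * norm y"
  proof -
    have "norm (Do s y) \<le> 2 * ((real CARD('n) * Lb + Mb) * norm y)" using dv_norm[OF u(2)] by (simp add: u(1) Do_sob[OF s u(2)])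
    also have "\<dots> = (2 * (real CARD('n) * Lb + Mb)) * norm y" by simp
    also have "\<dots> \<le> Mc * norm y" using M(4) by (rule mult_right_mono) simp
    finally show ?thesis .
  qed
  show "- Mc * (norm (fst y))\<^sup>2 \<le> fst y \<bullet> Do s y"
  proof -
    have "(2 * (real CARD('n) * Lb)) * (norm (fst y))\<^sup>2 \<le> Mc * (norm (fst y))\<^sup>2" using M(5) by (rule mult_right_mono) simp
    moreover have "- (2 * (real CARD('n) * Lb)) * (norm (fst y))\<^sup>2 \<le> fst y \<bullet> Do s y"
    proof -
      have e: "fst y = emb U u" by (simp add: u(1) sob_def)
      have "2 * (- (real CARD('n) * Lb) * (norm (emb U u))\<^sup>2) \<le> 2 * (emb U u \<bullet> dv u)"
        using dv_skew[OF u(2)] by (rule mult_left_mono) simp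
      moreover have "fst y \<bullet> Do s y = 2 * (emb U u \<bullet> dv u)" unfolding e unfolding u(1) Do_sob[OF s u(2)] by simp
      ultimately show ?thesis unfolding e by (simp only: mult.assoc mult_minus_left mult_minus_right)
    qed
    ultimately show ?thesis by simp
  qed
  note ey = sobolev0_emb[OF y]
  note By = Bm_emb[OF s L2v_rep[OF U, of "snd y"], unfolded ey]
  show "min 1 cB * (norm y)\<^sup>2 \<le> y \<bullet> Bo s y"
  proof -
    have "(norm y)\<^sup>2 = (norm (fst y))\<^sup>2 + (norm (snd y))\<^sup>2" by (simp add: norm_prod_def)
    then have "min 1 cB * (norm y)\<^sup>2 = min 1 cB * (norm (fst y))\<^sup>2 + min 1 cB * (norm (snd y))\<^sup>2" by (simp add: distrib_left)
    also have "\<dots> \<le> 1 * (norm (fst y))\<^sup>2 + cB * (norm (snd y))\<^sup>2" by (intro add_mono mult_right_mono) auto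
    also have "\<dots> \<le> fst y \<bullet> fst y + snd y \<bullet> Bm s (snd y)"
      using Bm_coercive[OF s L2v_rep[OF U, of "snd y"], unfolded ey] unfolding By by (simp add: power2_norm_eq_inner)
    finally show ?thesis by (simp add: Bo_def inner_prod_def)
  qed
  fix x assume x: "x \<in> sobolev0 U"
  note ex = sobolev0_emb[OF x]
  note Bx = Bm_emb[OF s L2v_rep[OF U, of "snd x"], unfolded ex]
  show "x \<bullet> Bo s y = y \<bullet> Bo s x"
    using Bm_sym[OF s L2v_rep[OF U, of "snd x"] L2v_rep[OF U, of "snd y"], unfolded ex ey]
    by (simp add: Bo_def inner_prod_def By Bx inner_commute[of "fst x"])
  fix r assume r: "r \<in> {0..T}"
  show "\<bar>x \<bullet> Bo s y - x \<bullet> Bo r y\<bar> \<le> Mc * \<bar>s - r\<bar> * norm x * norm y"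
  proof -
    have "\<bar>x \<bullet> Bo s y - x \<bullet> Bo r y\<bar> = \<bar>snd x \<bullet> (Bm s (snd y) - Bm r (snd y))\<bar>" by (simp add: Bo_def inner_prod_def inner_diff_right)
    also have "\<dots> \<le> norm (snd x) * norm (Bm s (snd y) - Bm r (snd y))" by (rule Cauchy_Schwarz_ineq2)
    also have "\<dots> \<le> norm x * (LB * \<bar>s - r\<bar> * norm y)"
    proof (rule mult_mono)
      show "norm (snd x) \<le> norm x" using norm_snd_le[of "snd x" "fst x"] by simp
      show "norm (Bm s (snd y) - Bm r (snd y)) \<le> LB * \<bar>s - r\<bar> * norm y"
        by (rule order_trans[OF Bm_lip[OF s r] mult_left_mono[OF ns]]) (use nonneg in simp)
    qed auto
    also have "\<dots> = LB * (\<bar>s - r\<bar> * norm x * norm y)" by simp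
    also have "\<dots> \<le> Mc * (\<bar>s - r\<bar> * norm x * norm y)" using M(2) by (rule mult_right_mono) simp
    finally show ?thesis by (simp add: mult.assoc)
  qed
next
  show "(\<lambda>s. (norm (gh s))\<^sup>2) integrable_on {0..T}" using gh_integrable by (intro integrable_on_lebesgue_on) auto
  fix y assume y: "y \<in> sobolev0 U"
  obtain u where u: "y = sob U u" "H10 U u" using y by (auto simp: sobolev0_def)
  note ey = sobolev0_emb[OF y]
  show "(\<lambda>s. gh s \<bullet> fst y) \<in> borel_measurable (lebesgue_on {0..T})"
    using gh_inner_measurable[OF L2v_rep[OF U, of "fst y"]] unfolding ey by (rule borel_measurable_lebesgue_onI)
  fix x assume x: "x \<in> sobolev0 U"
  obtain w where w: "x = sob U w" "H10 U w" using x by (auto simp: sobolev0_def)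
  show "(\<lambda>s. fst x \<bullet> Do s y) \<in> borel_measurable (lebesgue_on {0..T})"
    using Do_measurable[OF w(2) u(2)] by (simp add: u(1) w(1) sob_def)
  have "(\<lambda>s. - (fst x \<bullet> fst y) + snd x \<bullet> emb U (\<lambda>z. rep_l2 (fst y) z *\<^sub>R a (s, z))) \<in> borel_measurable borel"
    using a_inner_measurable[OF L2v_rep[OF U, of "snd x"] L2v_rep[OF U, of "fst y"], unfolded sobolev0_emb[OF x]] by (intro borel_measurable_add) auto
  then show "(\<lambda>s. x \<bullet> Co s y) \<in> borel_measurable (lebesgue_on {0..T})"
    by (intro borel_measurable_lebesgue_onI) (simp add: Co_def inner_prod_def)
qed

end

section \<open>Integration by parts in time\<close>

lemma test_fun_real_derivative:
  assumes "test_fun {0<..<T} (\<phi> :: real \<Rightarrow> real)"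
  shows "(\<phi> has_real_derivative deriv \<phi> t) (at t)" "continuous_on UNIV (deriv \<phi>)" "\<phi> 0 = 0" "\<phi> T = 0"
proof -
  have sm: "smooth_fun \<phi>" using assms by (simp add: test_fun_def)
  have d: "(\<phi> has_real_derivative deriv \<phi> t) (at t)" for t
    using smooth_fun_differentiable[OF sm] by (simp add: DERIV_deriv_iff_real_differentiable)
  then show "(\<phi> has_real_derivative deriv \<phi> t) (at t)" .
  have "frechet_derivative \<phi> (at t) 1 = deriv \<phi> t" for t
    using fun_cong[OF frechet_derivative_at[OF d[unfolded has_field_derivative_def]], of t 1] by simp
  then show "continuous_on UNIV (deriv \<phi>)" using smooth_fun_continuous_derivative[OF sm, of 1] by simp
  have z: "\<phi> t = 0" if "t \<notin> {0<..<T}" for t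
  proof (rule ccontr)
    assume "\<phi> t \<noteq> 0"
    then have "t \<in> closure {x. \<phi> x \<noteq> 0}" by (intro subsetD[OF closure_subset]) simp
    then have "t \<in> {0<..<T}" using assms unfolding test_fun_def by (meson subsetD)
    with that show False by contradiction
  qed
  show "\<phi> 0 = 0" "\<phi> T = 0" using z[of 0] z[of T] by simp_all
qed

lemma integral_by_parts_AC:
  fixes f F \<phi> \<phi>' :: "real \<Rightarrow> real"
  assumes T: "0 < T" and f: "f absolutely_integrable_on {0..T}"
    and F: "\<And>t. t \<in> {0..T} \<Longrightarrow> F t = F 0 + integral {0..t} f"
    and \<phi>: "\<And>t. (\<phi> has_real_derivative \<phi>' t) (at t)" "continuous_on UNIV \<phi>'" "\<phi> 0 = 0" "\<phi> T = 0"
  shows "(\<lambda>t. f t * \<phi> t) absolutely_integrable_on {0..T}" "(\<lambda>t. F t * \<phi>' t) absolutely_integrable_on {0..T}"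
    "integral {0..T} (\<lambda>t. f t * \<phi> t) = - integral {0..T} (\<lambda>t. F t * \<phi>' t)"
proof -
  let ?I = "{0..T}"
  have fi: "f integrable_on ?I" by (rule set_lebesgue_integral_eq_integral(1)[OF f])
  have \<phi>c: "continuous_on ?I \<phi>" by (intro continuous_at_imp_continuous_on ballI DERIV_isCont[OF \<phi>(1)])
  have \<phi>'c: "continuous_on ?I \<phi>'" by (rule continuous_on_subset[OF \<phi>(2)]) simp
  have Fc: "continuous_on ?I F"
  proof (rule continuous_on_eq)
    show "continuous_on ?I (\<lambda>t. F 0 + integral {0..t} f)"
      by (intro continuous_intros indefinite_integral_continuous_1[OF fi])
    show "F 0 + integral {0..t} f = F t" if "t \<in> ?I" for t by (rule F[OF that, symmetric])
  qed
  have bnd: "\<exists>C\<ge>0. \<forall>t\<in>?I. \<bar>h t\<bar> \<le> C" if "continuous_on ?I h" for h :: "real \<Rightarrow> real"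
  proof -
    have "bounded (h ` ?I)" using that by (intro compact_imp_bounded compact_continuous_image) auto
    then obtain C where C: "\<forall>t\<in>?I. \<bar>h t\<bar> \<le> C" by (auto simp: bounded_iff)
    then have "\<bar>h 0\<bar> \<le> C" using T by simp
    then have "0 \<le> C" by linarith
    then show ?thesis using C by blast
  qed
  have fa: "(\<lambda>t. \<bar>f t\<bar>) integrable_on ?I" using f unfolding absolutely_integrable_on_def by simp
  show a1: "(\<lambda>t. f t * \<phi> t) absolutely_integrable_on ?I"
  proof -
    have "bounded (\<phi> ` ?I)" using \<phi>c by (intro compact_imp_bounded compact_continuous_image) auto
    moreover have "\<phi> \<in> borel_measurable (lebesgue_on ?I)" by (rule continuous_imp_measurable_on_sets_lebesgue[OF \<phi>c]) simp
    ultimately have "(\<lambda>t. \<phi> t * f t) absolutely_integrable_on ?I"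
      using f by (intro absolutely_integrable_bounded_measurable_product_real) auto
    then show ?thesis by (simp add: mult.commute)
  qed
  show a2: "(\<lambda>t. F t * \<phi>' t) absolutely_integrable_on ?I"
    by (intro absolutely_integrable_continuous_real continuous_intros Fc \<phi>'c)
  have i1: "(\<lambda>t. f t * \<phi> t) integrable_on ?I" "(\<lambda>t. F t * \<phi>' t) integrable_on ?I"
    by (rule set_lebesgue_integral_eq_integral(1)[OF a1], rule set_lebesgue_integral_eq_integral(1)[OF a2])
  obtain C where C: "C \<ge> 0" "\<And>t. t \<in> ?I \<Longrightarrow> \<bar>\<phi>' t\<bar> \<le> C" using bnd[OF \<phi>'c] by blast
  define N where "N t = integral {0..t} (\<lambda>s. \<bar>f s\<bar>)" for t
  define P where "P t = f t * \<phi> t + F t * \<phi>' t" for t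
  define G where "G t = integral {0..t} P - F t * \<phi> t" for t
  have Pi: "P integrable_on ?I" unfolding P_def by (intro integrable_add i1)
  have split: "integral {0..s} h + integral {s..t} h = integral {0..t} h"
    if h: "h integrable_on ?I" and st: "s \<in> ?I" "t \<in> ?I" "s \<le> t" for h :: "real \<Rightarrow> real" and s t
  proof (rule Henstock_Kurzweil_Integration.integral_combine)
    show "h integrable_on {0..t}" using st by (intro integrable_on_subinterval[OF h]) auto
  qed (use st in auto)
  have inc: "\<bar>G t - G s\<bar> \<le> 2 * C * (t - s) * (N t - N s)" if st: "s \<in> ?I" "t \<in> ?I" "s \<le> t" for s t
  proof -
    let ?J = "{s..t}"
    have J: "?J \<subseteq> ?I" using st by auto
    note sub = integrable_on_subinterval[OF _ J]
    have fd: "F r - F s = integral {s..r} f" "{s..r} \<subseteq> ?I" if "r \<in> ?J" for r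
    proof -
      have "r \<in> ?I" "s \<le> r" using that st by auto
      from split[OF fi st(1) this] show "F r - F s = integral {s..r} f" using F[OF st(1)] F[OF \<open>r \<in> ?I\<close>] by linarith
      show "{s..r} \<subseteq> ?I" using that st by auto
    qed
    have Nd: "N t - N s = integral ?J (\<lambda>s. \<bar>f s\<bar>)" using split[OF fa st] unfolding N_def by linarith
    have Fr: "\<bar>F r - F s\<bar> \<le> N t - N s" if r: "r \<in> ?J" for r
    proof -
      have "norm (integral {s..r} f) \<le> integral {s..r} (\<lambda>s. \<bar>f s\<bar>)"
        by (rule Henstock_Kurzweil_Integration.integral_norm_bound_integral[OF
              integrable_on_subinterval[OF fi fd(2)[OF r]] integrable_on_subinterval[OF fa fd(2)[OF r]]]) simp
      also have "\<dots> \<le> integral ?J (\<lambda>s. \<bar>f s\<bar>)"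
        using r by (intro integral_subset_le integrable_on_subinterval[OF fa fd(2)[OF r]] sub[OF fa]) auto
      finally show ?thesis by (simp add: fd(1)[OF r] Nd)
    qed
    have \<phi>r: "\<bar>\<phi> r - \<phi> t\<bar> \<le> C * (t - s)" if r: "r \<in> ?J" for r
    proof -
      have "norm (\<phi> r - \<phi> t) \<le> C * norm (r - t)"
      proof (rule field_differentiable_bound[of ?I])
        show "(\<phi> has_field_derivative \<phi>' x) (at x within ?I)" for x by (rule DERIV_subset[OF \<phi>(1)]) simp
        show "norm (\<phi>' x) \<le> C" if "x \<in> ?I" for x using C(2)[OF that] by simp
      qed (use r st in auto)
      also have "\<dots> \<le> C * (t - s)" using r C(1) by (intro mult_left_mono) auto
      finally show ?thesis by simp
    qed
    have \<phi>i: "(\<phi>' has_integral (\<phi> t - \<phi> s)) ?J"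
    proof (rule fundamental_theorem_of_calculus[OF st(3)])
      show "(\<phi> has_vector_derivative \<phi>' x) (at x within ?J)" for x
        using DERIV_subset[OF \<phi>(1)[of x] subset_UNIV, of ?J] by (simp add: has_real_derivative_iff_has_vector_derivative)
    qed
    have "(f has_integral (F t - F s)) ?J"
      using integrable_integral[OF sub[OF fi]] fd(1)[of t] st by simp
    \<comment> \<open>With \<phi> frozen at t and \<open>F\<close> at s the integral is exactly the
      increment of F \<phi>; what remains of \<open>P\<close> consists of products with a small
      factor each.\<close>
    then have "((\<lambda>r. P r - (f r * \<phi> t + F s * \<phi>' r)) has_integral
        (integral ?J P - ((F t - F s) * \<phi> t + F s * (\<phi> t - \<phi> s)))) ?J"
      by (intro has_integral_diff has_integral_add has_integral_mult_left has_integral_mult_right \<phi>i integrable_integral[OF sub[OF Pi]])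
    moreover have "integral ?J P - ((F t - F s) * \<phi> t + F s * (\<phi> t - \<phi> s)) = G t - G s"
      using split[OF Pi st] unfolding G_def by (simp add: algebra_simps)
    moreover have "(\<lambda>r. P r - (f r * \<phi> t + F s * \<phi>' r)) = (\<lambda>r. f r * (\<phi> r - \<phi> t) + (F r - F s) * \<phi>' r)"
      by (simp add: P_def fun_eq_iff algebra_simps)
    ultimately have hi: "((\<lambda>r. f r * (\<phi> r - \<phi> t) + (F r - F s) * \<phi>' r) has_integral (G t - G s)) ?J" by simp
    have "norm (G t - G s) \<le> integral ?J (\<lambda>r. \<bar>f r\<bar> * (C * (t - s)) + (N t - N s) * C)"
      unfolding integral_unique[OF hi, symmetric]
    proof (rule Henstock_Kurzweil_Integration.integral_norm_bound_integral[OF has_integral_integrable[OF hi]])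
      show "(\<lambda>r. \<bar>f r\<bar> * (C * (t - s)) + (N t - N s) * C) integrable_on ?J"
        by (intro integrable_add integrable_on_mult_left sub[OF fa] integrable_const_ivl)
      fix r assume r: "r \<in> ?J"
      have "\<bar>f r * (\<phi> r - \<phi> t)\<bar> \<le> \<bar>f r\<bar> * (C * (t - s))"
        unfolding abs_mult by (rule mult_left_mono[OF \<phi>r[OF r]]) simp
      moreover have "\<bar>(F r - F s) * \<phi>' r\<bar> \<le> (N t - N s) * C"
        unfolding abs_mult using Fr[OF r] C(2)[of r] J r by (intro mult_mono) auto
      ultimately show "norm (f r * (\<phi> r - \<phi> t) + (F r - F s) * \<phi>' r) \<le> \<bar>f r\<bar> * (C * (t - s)) + (N t - N s) * C"
        using abs_triangle_ineq[of "f r * (\<phi> r - \<phi> t)" "(F r - F s) * \<phi>' r"] unfolding real_norm_def by linarith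
    qed
    also have "\<dots> = (N t - N s) * (C * (t - s)) + (t - s) * ((N t - N s) * C)"
    proof (rule integral_unique[OF has_integral_add])
      show "((\<lambda>r. \<bar>f r\<bar> * (C * (t - s))) has_integral (N t - N s) * (C * (t - s))) ?J"
        unfolding Nd by (rule has_integral_mult_left[OF integrable_integral[OF sub[OF fa]]])
      show "((\<lambda>r. (N t - N s) * C) has_integral (t - s) * ((N t - N s) * C)) ?J"
        using has_integral_const_real[of "(N t - N s) * C" s t] st(3) by simp
    qed
    finally show ?thesis by (simp add: algebra_simps)
  qed
  have Nc: "continuous_on ?I N" unfolding N_def by (rule indefinite_integral_continuous_1[OF fa])
  have inc': "\<bar>G t - G s\<bar> \<le> 2 * C * \<bar>t - s\<bar> * \<bar>N t - N s\<bar>" if st: "s \<in> ?I" "t \<in> ?I" for s t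
  proof (cases "s \<le> t")
    case True
    have "2 * C * (t - s) * (N t - N s) \<le> 2 * C * (t - s) * \<bar>N t - N s\<bar>" using True C(1) by (intro mult_left_mono) auto
    with inc[OF st True] True show ?thesis by simp
  next
    case False
    then have ts: "t \<le> s" by simp
    have "2 * C * (s - t) * (N s - N t) \<le> 2 * C * (s - t) * \<bar>N s - N t\<bar>" using ts C(1) by (intro mult_left_mono) auto
    with inc[OF st(2,1) ts] have "\<bar>G s - G t\<bar> \<le> 2 * C * \<bar>s - t\<bar> * \<bar>N s - N t\<bar>" using ts by simp
    then show ?thesis by (simp only: abs_minus_commute)
  qed
  have "(G has_real_derivative 0) (at t within ?I)" if t: "t \<in> ?I" for t
    unfolding has_field_derivative_iff
  proof (rule Lim_null_comparison)
    show "\<forall>\<^sub>F s in at t within ?I. norm ((G s - G t) / (s - t)) \<le> 2 * C * \<bar>N s - N t\<bar>"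
      unfolding eventually_at_filter
    proof (rule always_eventually, intro allI impI)
      fix s assume "s \<noteq> t" "s \<in> ?I"
      then have "\<bar>G s - G t\<bar> / \<bar>s - t\<bar> \<le> 2 * C * \<bar>s - t\<bar> * \<bar>N s - N t\<bar> / \<bar>s - t\<bar>"
        by (intro divide_right_mono inc' t) auto
      with \<open>s \<noteq> t\<close> show "norm ((G s - G t) / (s - t)) \<le> 2 * C * \<bar>N s - N t\<bar>" by (simp add: mult_ac)
    qed
    have "(N \<longlongrightarrow> N t) (at t within ?I)" using Nc t by (simp add: continuous_on)
    then have "((\<lambda>s. 2 * C * \<bar>N s - N t\<bar>) \<longlongrightarrow> 2 * C * \<bar>N t - N t\<bar>) (at t within ?I)" by (intro tendsto_intros)
    then show "((\<lambda>s. 2 * C * \<bar>N s - N t\<bar>) \<longlongrightarrow> 0) (at t within ?I)" by simp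
  qed
  then obtain c where c: "\<And>t. t \<in> ?I \<Longrightarrow> G t = c"
    using has_field_derivative_zero_constant[of ?I G] by (auto intro: convex_closed_interval)
  have "G T = G 0" using c[of 0] c[of T] T by simp
  then have "integral ?I P = 0" using \<phi>(3,4) by (simp add: G_def)
  then show "integral ?I (\<lambda>t. f t * \<phi> t) = - integral ?I (\<lambda>t. F t * \<phi>' t)"
    unfolding P_def Henstock_Kurzweil_Integration.integral_add[OF i1] by linarith
qed

lemma lebesgue_integral_open_interval:
  fixes h :: "real \<Rightarrow> real"
  assumes "h absolutely_integrable_on {0..T}"
  shows "integral\<^sup>L (lebesgue_on {0<..<T}) h = integral {0..T} h"
proof -
  have "h absolutely_integrable_on {0<..<T}" using assms by (rule set_integrable_subset) auto
  then have "integrable (lebesgue_on {0<..<T}) h" by (rule absolutely_integrable_imp_integrable) simp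
  then have "integral\<^sup>L (lebesgue_on {0<..<T}) h = integral {0<..<T} h" by (rule lebesgue_integral_eq_integral) simp
  then show ?thesis by (simp only: integral_open_interval_real)
qed

lemma weak_time_derivative:
  fixes f F :: "real \<Rightarrow> real"
  assumes T: "0 < T" and f: "f absolutely_integrable_on {0..T}"
    and F: "\<And>t. t \<in> {0..T} \<Longrightarrow> (f has_integral (F t - F 0)) {0..t}" and \<phi>: "test_fun {0<..<T} \<phi>"
  shows "(\<integral>t. f t * \<phi> t \<partial>lebesgue_on {0<..<T}) = - (\<integral>t. F t * deriv \<phi> t \<partial>lebesgue_on {0<..<T})"
proof -
  have "F t = F 0 + integral {0..t} f" if "t \<in> {0..T}" for t using integral_unique[OF F[OF that]] by simp
  note p = integral_by_parts_AC[OF T f this test_fun_real_derivative[OF \<phi>]]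
  show ?thesis using p(3) by (simp only: lebesgue_integral_open_interval[OF p(1)] lebesgue_integral_open_interval[OF p(2)])
qed

context hyperbolic_system
begin

lemma flux_linear: "s \<in> {0..T} \<Longrightarrow> linear_form_on V (\<lambda>y. flux u w y s)"
proof -
  assume s: "s \<in> {0..T}"
  have "linear_form_on V (\<lambda>y. u \<bullet> Bo s y + u \<bullet> Co s y + w \<bullet> Do s y + (-1) * (g s \<bullet> \<iota> y))"
    by (intro linear_form_on_plus linear_form_on_cmult Bo_lin Co_lin Do_lin linear_form_on_inner_linear(1)[OF \<iota>(1)] s)
  then show ?thesis by (simp add: flux_def)
qed

text \<open>Linear in |g|, unlike \<open>flux_bound\<close>: the square of this bound has to be
  integrable in time for the acceleration to be square integrable with values in the dual
  space.\<close>

lemma flux_bound_norm: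
  assumes s: "s \<in> {0..T}" and y: "y \<in> V" and "norm u \<le> K" "norm w \<le> K"
  shows "\<bar>flux u w y s\<bar> \<le> (3 * M * K + norm (g s)) * norm y"
proof -
  have K: "0 \<le> K" using assms(3) norm_ge_zero order_trans by blast
  have "\<bar>u \<bullet> Bo s y\<bar> \<le> M * K * norm y"
    by (rule order_trans[OF Bo_bound[OF s y]]) (use M assms in \<open>auto intro!: mult_right_mono mult_left_mono\<close>)
  moreover have "\<bar>u \<bullet> Co s y\<bar> \<le> M * K * norm y"
    by (rule order_trans[OF Co_bound[OF s y]]) (use M assms K \<iota>(2) in \<open>auto intro!: mult_mono\<close>)
  moreover have "\<bar>w \<bullet> Do s y\<bar> \<le> M * K * norm y"
    by (rule order_trans[OF Do_bound[OF s y]]) (use M assms in \<open>auto intro!: mult_right_mono mult_left_mono\<close>)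
  moreover have "\<bar>g s \<bullet> \<iota> y\<bar> \<le> norm (g s) * norm y"
    by (rule order_trans[OF Cauchy_Schwarz_ineq2 mult_left_mono[OF \<iota>(2)]]) simp
  ultimately show ?thesis unfolding flux_def by (simp add: algebra_simps)
qed

lemma increment_bound_zero:
  fixes f k :: "real \<Rightarrow> real"
  assumes int: "\<And>t. t \<in> {0..T} \<Longrightarrow> (f has_integral (X t - X 0)) {0..t}"
    and k: "k integrable_on {0..T}" "\<And>s. s \<in> {0..T} \<Longrightarrow> \<bar>f s\<bar> \<le> k s" and st: "s \<in> {0..T}" "t \<in> {0..T}"
  shows "\<bar>X t - X s\<bar> \<le> \<bar>integral {0..t} k - integral {0..s} k\<bar>"
proof (rule increment_bound[where \<theta>="\<lambda>t. t" and f=f])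
  show "(f has_integral (X t - X s)) {s..t}" if "s \<in> {0..T}" "t \<in> {0..T}" "s \<le> t" for s t
  proof -
    have i: "f integrable_on {0..t}" using int[OF that(2)] by (rule has_integral_integrable)
    then have "f integrable_on {s..t}" using that by (auto intro: integrable_on_subinterval)
    moreover have "integral {0..s} f + integral {s..t} f = integral {0..t} f"
      using i that by (intro Henstock_Kurzweil_Integration.integral_combine) auto
    then have "integral {s..t} f = X t - X s"
      using integral_unique[OF int[OF that(1)]] integral_unique[OF int[OF that(2)]] by simp
    ultimately show ?thesis by (simp add: has_integral_integrable_integral)
  qed
qed (use k st in auto)

end

section \<open>From the abstract solution to a strong-weak solution\<close>

lemma integral_lebesgue_on_cong_AE:
  fixes f h :: "'a::euclidean_space \<Rightarrow> real"
  assumes U: "open U" and f: "f \<in> borel_measurable (lebesgue_on U)" and ae: "AE x in lebesgue_on U. f x = h x"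
  shows "integral\<^sup>L (lebesgue_on U) f = integral\<^sup>L (lebesgue_on U) h"
proof -
  have UL: "U \<in> sets lebesgue" using U by auto
  have m: "(\<lambda>x. indicator U x *\<^sub>R f x) \<in> borel_measurable lebesgue"
    using f UL by (simp add: borel_measurable_restrict_space_iff)
  have e: "AE x in lebesgue. indicator U x *\<^sub>R f x = indicator U x *\<^sub>R h x"
    using ae unfolding AE_lebesgue_on_open[OF U] by eventually_elim (simp add: indicator_def)
  show ?thesis unfolding integral_lebesgue_on(1)[OF UL]
    by (rule integral_cong_AE[OF m borel_measurable_AE[OF m e] e])
qed

lemma nn_integral_interval_bounded:
  assumes "\<And>t. t \<in> {0..T} \<Longrightarrow> f t \<le> C"
  shows "(\<integral>\<^sup>+t. ennreal (f t) \<partial>lebesgue_on {0..T::real}) < \<infinity>"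
proof -
  have "(\<integral>\<^sup>+t. ennreal (f t) \<partial>lebesgue_on {0..T}) \<le> (\<integral>\<^sup>+t. ennreal C \<partial>lebesgue_on {0..T})"
    using assms by (intro nn_integral_mono ennreal_leI) auto
  also have "\<dots> = ennreal C * emeasure lebesgue {0..T}" by (simp add: emeasure_restrict_space)
  also have "\<dots> < \<infinity>" by (cases "0 \<le> T") (simp_all add: ennreal_mult_less_top)
  finally show ?thesis .
qed

lemma H10_H1: "H10 U u \<Longrightarrow> H1 U u"
  by (simp add: H10_def)

lemma H10_L2: "H10 U u \<Longrightarrow> L2 U u"
  by (simp add: H10_def H1_def)

lemma sob_in_sobolev0: "H10 U u \<Longrightarrow> sob U u \<in> sobolev0 U"
  by (simp add: sobolev0_def)

lemma l2pair_emb: "open U \<Longrightarrow> L2 U f \<Longrightarrow> L2 U h \<Longrightarrow> l2pair U f h = emb U f \<bullet> emb U h"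
  using emb_inner(1)[of U f h] by (simp add: l2pair_def L2_eq_L2v)

text \<open>A supremum of reals is informative only for nonempty bounded sets: \<open>C\<close>
  bounds the set, and a representative of the zero vector shows that it is nonempty.\<close>

lemma Hm1norm_bounds:
  fixes U :: "(real^'n) set"
  assumes U: "open U" and C: "0 \<le> C" "\<And>u. H10 U u \<Longrightarrow> \<bar>F u\<bar> \<le> C * H1norm U u"
  shows "0 \<le> Hm1norm U F" "Hm1norm U F \<le> C"
proof -
  let ?S = "{\<bar>F u\<bar> | u. H10 U u \<and> H1norm U u \<le> 1}"
  let ?z = "rep_l2 (fst (0 :: (real^'n, real) l2 \<times> (real^'n, real^'n) l2))"
  have 0: "0 \<in> sobolev0 U" by (rule subspace_0[OF sobolev0_closed_subspace(2)[OF U]])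
  have z: "H10 U ?z" "H1norm U ?z = 0"
    using sobolev0_rep[OF U 0] norm_sob[OF U H10_H1[OF sobolev0_rep(1)[OF U 0]]] by auto
  have le: "x \<le> C" if "x \<in> ?S" for x
  proof -
    obtain u where u: "x = \<bar>F u\<bar>" "H10 U u" "H1norm U u \<le> 1" using \<open>x \<in> ?S\<close> by auto
    have "x \<le> C * H1norm U u" using C(2)[OF u(2)] u(1) by simp
    also have "\<dots> \<le> C * 1" by (rule mult_left_mono[OF u(3) C(1)])
    finally show ?thesis by simp
  qed
  have mem: "\<bar>F ?z\<bar> \<in> ?S" using z by auto
  show "Hm1norm U F \<le> C" unfolding Hm1norm_def using mem le by (intro cSup_least) auto
  have "bdd_above ?S" by (rule bdd_aboveI[of _ C]) (rule le)
  then have "\<bar>F ?z\<bar> \<le> Hm1norm U F" unfolding Hm1norm_def by (intro cSup_upper mem)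
  then show "0 \<le> Hm1norm U F" using abs_ge_zero order_trans by blast
qed

lemma Hm1_l2pair:
  assumes U: "open U" and f: "L2 U f" shows "Hm1 U (l2pair U f)"
  unfolding Hm1_def
proof (intro conjI exI allI impI)
  fix u assume u: "H10 U u"
  show "\<bar>l2pair U f u\<bar> \<le> norm (emb U f) * H1norm U u"
  proof -
    have "\<bar>l2pair U f u\<bar> \<le> norm (emb U f) * norm (emb U u)"
      unfolding l2pair_emb[OF U f H10_L2[OF u]] by (rule Cauchy_Schwarz_ineq2)
    also have "\<dots> \<le> norm (emb U f) * norm (sob U u)" unfolding sob_def by (intro mult_left_mono norm_fst_le) simp
    finally show ?thesis by (simp add: norm_sob[OF U H10_H1[OF u]])
  qed
  fix w c assume w: "H10 U w"
  have "emb U (\<lambda>x. u x + c * w x) = emb U u + c *\<^sub>R emb U w"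
    using sob_linear(2)[OF U H10_H1[OF u] H10_H1[OF w], of c] by (simp add: sob_def)
  then show "l2pair U f (\<lambda>x. u x + c * w x) = l2pair U f u + c * l2pair U f w"
    unfolding l2pair_emb[OF U f H10_L2[OF u]] l2pair_emb[OF U f H10_L2[OF w]] l2pair_emb[OF U f H10_L2[OF H10_linear[OF U u w]]]
    by (simp add: inner_add_right)
qed

text \<open>A functional in the sense of \<^const>\<open>Hm1\<close> acts on functions; its boundedness makes it
  invariant under changes on null sets, so that it descends to \<^const>\<open>sobolev0\<close>.\<close>

lemma Hm1_riesz:
  fixes U :: "(real^'n) set"
  assumes U: "open U" and \<Lambda>: "Hm1 U \<Lambda>"
  obtains z where "\<And>u. H10 U u \<Longrightarrow> \<Lambda> u = sob U u \<bullet> z"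
proof -
  have lin: "\<Lambda> (\<lambda>x. u x + c * w x) = \<Lambda> u + c * \<Lambda> w" if "H10 U u" "H10 U w" for u w c using \<Lambda> that by (simp add: Hm1_def)
  obtain C where C: "\<And>u. H10 U u \<Longrightarrow> \<bar>\<Lambda> u\<bar> \<le> C * norm (sob U u)"
    using \<Lambda> norm_sob[OF U H10_H1] unfolding Hm1_def by metis
  have cong: "\<Lambda> u = \<Lambda> w" if u: "H10 U u" and w: "H10 U w" and e: "sob U u = sob U w" for u w
  proof -
    have "sob U (\<lambda>x. u x + (-1) * w x) = 0" using sob_linear(2)[OF U H10_H1[OF u] H10_H1[OF w], of "-1"] e by simp
    then have "\<bar>\<Lambda> (\<lambda>x. u x + (-1) * w x)\<bar> \<le> 0" using C[OF H10_linear[OF U u w, of "-1"]] by simp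
    then show ?thesis using lin[OF u w, of "-1"] by simp
  qed
  let ?f = "\<lambda>p. \<Lambda> (rep_l2 (fst p))"
  have fs: "?f (sob U u) = \<Lambda> u" if u: "H10 U u" for u
    by (rule cong[OF sobolev0_rep(1)[OF U sob_in_sobolev0[OF u]] u sobolev0_rep(2)[OF U sob_in_sobolev0[OF u]]])
  have "linear_form_on (sobolev0 U) ?f" unfolding linear_form_on_def
  proof (intro ballI allI)
    fix x y c assume "x \<in> sobolev0 U" "y \<in> sobolev0 U"
    then obtain u w where u: "x = sob U u" "H10 U u" and w: "y = sob U w" "H10 U w" by (auto simp: sobolev0_def)
    have e: "x + c *\<^sub>R y = sob U (\<lambda>x. u x + c * w x)" using sob_linear(2)[OF U H10_H1[OF u(2)] H10_H1[OF w(2)], of c] u w by simp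
    show "?f (x + c *\<^sub>R y) = ?f x + c * ?f y"
      unfolding e fs[OF H10_linear[OF U u(2) w(2)]] unfolding u(1) w(1) fs[OF u(2)] fs[OF w(2)] by (rule lin[OF u(2) w(2)])
  qed
  moreover have "\<bar>?f x\<bar> \<le> C * norm x" if "x \<in> sobolev0 U" for x
    using C[OF sobolev0_rep(1)[OF U that]] sobolev0_rep(2)[OF U that] by simp
  ultimately obtain z where z: "\<And>x. x \<in> sobolev0 U \<Longrightarrow> ?f x = x \<bullet> z"
    using riesz_representation_on[OF sobolev0_closed_subspace(2,1)[OF U], of ?f C] by blast
  show ?thesis
  proof
    show "\<Lambda> u = sob U u \<bullet> z" if "H10 U u" for u using z[OF sob_in_sobolev0[OF that]] fs[OF that] by simp
  qed
qed

context wave_data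
begin

sublocale sys: hyperbolic_system "sobolev0 U" fst Bo Co Do gh T Mc "min 1 cB" "sob U v0" "emb U v1"
  by (rule hyperbolic)

text \<open>The L2 products that \<open>Bo\<close> adds and \<open>Co\<close> subtracts cancel here,
  which leaves the terms of the weak equation; symmetry of \<open>B\<close> moves the matrix from
  the test function to the solution.\<close>

lemma flux_sob:
  assumes t: "t \<in> {0..T}" and v: "H10 U v" and w: "L2 U w" and \<phi>: "H10 U \<phi>"
  shows "sys.flux (sob U v) (emb U w) (sob U \<phi>) t
    = (\<integral>x. (B t x *v wgrad U v x) \<bullet> wgrad U \<phi> x \<partial>lebesgue_on U)
      + (\<integral>x. (a (t, x) \<bullet> wgrad U v x) * \<phi> x \<partial>lebesgue_on U)
      + 2 * l2pair U w (wdiv U (\<lambda>x. \<phi> x *\<^sub>R b t x)) - gh t \<bullet> emb U \<phi>"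
    "(\<lambda>x. (a (t, x) \<bullet> wgrad U v x) * \<phi> x) \<in> borel_measurable (lebesgue_on U)"
proof -
  interpret lipschitz_field U "b t" Lb Mb by (rule field[OF t])
  note gv = wgrad_props(2)[OF H10_H1[OF v]] and g\<phi> = wgrad_props(2)[OF H10_H1[OF \<phi>]]
  have \<phi>L: "L2v U \<phi>" using H10_L2[OF \<phi>] by (simp add: L2_eq_L2v)
  have comm: "(\<lambda>x. wgrad U v x \<bullet> (\<phi> x *\<^sub>R a (t, x))) = (\<lambda>x. (a (t, x) \<bullet> wgrad U v x) * \<phi> x)"
    by (simp add: fun_eq_iff inner_commute)
  have Bt: "emb U (wgrad U v) \<bullet> Bm t (emb U (wgrad U \<phi>)) = (\<integral>x. (B t x *v wgrad U v x) \<bullet> wgrad U \<phi> x \<partial>lebesgue_on U)"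
    unfolding Bm_emb[OF t g\<phi>] Bm_sym[OF t gv g\<phi>] emb_inner(1)[OF U g\<phi> B_mult(1)[OF t gv]] by (simp add: inner_commute)
  have At: "emb U (wgrad U v) \<bullet> emb U (\<lambda>x. rep_l2 (emb U \<phi>) x *\<^sub>R a (t, x)) = (\<integral>x. (a (t, x) \<bullet> wgrad U v x) * \<phi> x \<partial>lebesgue_on U)"
    unfolding a_emb[OF \<phi>L] emb_inner(1)[OF U gv a_mult(1)[OF \<phi>L]] comm ..
  have Dt: "emb U w \<bullet> Do t (sob U \<phi>) = 2 * l2pair U w (wdiv U (\<lambda>x. \<phi> x *\<^sub>R b t x))"
    unfolding Do_sob[OF t \<phi>] dv_def l2pair_emb[OF U w wdiv_L2[OF \<phi>]] by simp
  have "sob U v \<bullet> Bo t (sob U \<phi>) = emb U v \<bullet> emb U \<phi> + emb U (wgrad U v) \<bullet> Bm t (emb U (wgrad U \<phi>))"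
    "sob U v \<bullet> Co t (sob U \<phi>) = - (emb U v \<bullet> emb U \<phi>) + emb U (wgrad U v) \<bullet> emb U (\<lambda>x. rep_l2 (emb U \<phi>) x *\<^sub>R a (t, x))"
    "gh t \<bullet> fst (sob U \<phi>) = gh t \<bullet> emb U \<phi>"
    by (simp_all add: Bo_def Co_def sob_def)
  then show "sys.flux (sob U v) (emb U w) (sob U \<phi>) t
    = (\<integral>x. (B t x *v wgrad U v x) \<bullet> wgrad U \<phi> x \<partial>lebesgue_on U)
      + (\<integral>x. (a (t, x) \<bullet> wgrad U v x) * \<phi> x \<partial>lebesgue_on U)
      + 2 * l2pair U w (wdiv U (\<lambda>x. \<phi> x *\<^sub>R b t x)) - gh t \<bullet> emb U \<phi>"
    unfolding sys.flux_def Dt Bt At by simp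
  show "(\<lambda>x. (a (t, x) \<bullet> wgrad U v x) * \<phi> x) \<in> borel_measurable (lebesgue_on U)"
    using borel_measurable_integrable[OF emb_inner(2)[OF U gv a_mult(1)[OF \<phi>L, of t]]] unfolding comm .
qed

lemma gh_finite: "AE t in lebesgue_on {0..T}. (\<integral>\<^sup>+x. ennreal ((g (t, x))\<^sup>2) \<partial>lborel) < \<infinity>"
proof -
  have "AE t in lborel. (\<integral>\<^sup>+x. ennreal ((g (t, x))\<^sup>2) \<partial>lborel) \<noteq> \<infinity>"
    using g_section_measurable by (intro nn_integral_noteq_infinite) auto
  then have "AE t in lebesgue. (\<integral>\<^sup>+x. ennreal ((g (t, x))\<^sup>2) \<partial>lborel) \<noteq> \<infinity>" by (rule AE_completion)
  then show ?thesis by (subst AE_restrict_space_iff) (auto simp: less_top)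
qed

end

context wave_data
begin

text \<open>\<open>a0\<close> and \<open>g0\<close> are the given data, \<open>a\<close> and
  \<open>g\<close> their Borel versions. Agreement on almost every slice is enough because they
  enter the equation only under spatial integrals and at almost every time.\<close>

lemma solution:
  assumes slice: "AE t in lebesgue_on {0..T}. AE x in lebesgue_on U. a0 t x = a (t, x) \<and> g0 t x = g (t, x)"
  shows "\<exists>v vd vdd. strong_weak_solution_with T U B a0 b g0 v0 v1 v vd vdd
           \<and> weakly_cont_H10 T U v \<and> weakly_cont_L2 T U vd"
proof -
  let ?I = "{0..T}"
  obtain u w where u: "\<And>t. t \<in> ?I \<Longrightarrow> u t \<in> sobolev0 U \<and> norm (u t) \<le> sys.sol_bound"
    and w: "\<And>t. t \<in> ?I \<Longrightarrow> w t \<in> closure (fst ` sobolev0 U) \<and> norm (w t) \<le> sys.sol_bound"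
    and init: "u 0 = sob U v0" "w 0 = emb U v1"
    and uc: "\<And>y. continuous_on ?I (\<lambda>t. u t \<bullet> y)" and wc: "\<And>h. continuous_on ?I (\<lambda>t. w t \<bullet> h)"
    and ui: "\<And>t h. t \<in> ?I \<Longrightarrow> ((\<lambda>s. w s \<bullet> h) has_integral (fst (u t) \<bullet> h - fst (sob U v0) \<bullet> h)) {0..t}"
    and wi: "\<And>t y. t \<in> ?I \<Longrightarrow> y \<in> sobolev0 U \<Longrightarrow>
       ((\<lambda>s. - sys.flux (u s) (w s) y s) has_integral (w t \<bullet> fst y - emb U v1 \<bullet> fst y)) {0..t}"
  proof -
    show thesis by (rule sys.weak_solution_exists) (fact that)
  qed
  define K where "K = sys.sol_bound"
  define v where "v t = rep_l2 (fst (u t))" for t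
  define vd where "vd t = rep_l2 (w t)" for t
  \<comment> \<open>The acceleration is defined through the equation, so (iii) becomes an identity;
    that it is the weak derivative of \<open>vd\<close> is the content of the integrated
    equation.\<close>
  define vdd where "vdd t \<phi> = - sys.flux (u t) (w t) (sob U \<phi>) t" for t \<phi>
  have T0: "0 \<in> ?I" using T by simp
  have uK: "norm (u t) \<le> K" and wK: "norm (w t) \<le> K" if "t \<in> ?I" for t
    using u[OF that] w[OF that] by (simp_all add: K_def)
  have K: "0 \<le> K" using order_trans[OF norm_ge_zero uK[OF T0]] .
  have M: "0 \<le> Mc" by (rule sys.M)
  have vH: "H10 U (v t)" and vs: "sob U (v t) = u t" if "t \<in> ?I" for t
    using sobolev0_rep[OF U conjunct1[OF u[OF that]]] by (simp_all add: v_def)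
  have vL: "L2 U (v t)" and vdL: "L2 U (vd t)" for t by (simp_all add: v_def vd_def L2_eq_L2v L2v_rep[OF U])
  have ve: "emb U (v t) = fst (u t)" if "t \<in> ?I" for t using arg_cong[OF vs[OF that], of fst] by (simp add: sob_def)
  have we: "emb U (vd t) = w t" if "t \<in> ?I" for t
  proof -
    have "closure (fst ` sobolev0 U) \<subseteq> supported U"
      using sobolev0_emb(1) by (intro closure_minimal supported_closed[OF U]) (auto simp: supported_def)
    then have "w t \<in> supported U" using conjunct1[OF w[OF that]] by (rule subsetD)
    then show ?thesis by (simp add: supported_def vd_def)
  qed
  have pv: "l2pair U (v t) \<psi> = fst (u t) \<bullet> emb U \<psi>" if "t \<in> ?I" "L2 U \<psi>" for t \<psi>
    using l2pair_emb[OF U vL that(2)] ve[OF that(1)] by simp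
  have pw: "l2pair U (vd t) \<psi> = w t \<bullet> emb U \<psi>" if "t \<in> ?I" "L2 U \<psi>" for t \<psi>
    using l2pair_emb[OF U vdL that(2)] we[OF that(1)] by simp
  have vdc: "continuous_on ?I (\<lambda>t. l2pair U (vd t) \<psi>)" if "L2 U \<psi>" for \<psi>
    by (rule continuous_on_eq[OF wc[of "emb U \<psi>"]]) (use pw[OF _ that] in simp)
  have vint: "((\<lambda>s. l2pair U (vd s) \<psi>) has_integral (l2pair U (v t) \<psi> - l2pair U (v 0) \<psi>)) {0..t}"
    if t: "t \<in> ?I" and \<psi>: "L2 U \<psi>" for t \<psi>
  proof -
    have "((\<lambda>s. w s \<bullet> emb U \<psi>) has_integral (l2pair U (v t) \<psi> - l2pair U (v 0) \<psi>)) {0..t}"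
      using ui[OF t, of "emb U \<psi>"] by (simp add: pv[OF t \<psi>] pv[OF T0 \<psi>] init)
    then show ?thesis by (rule has_integral_eq[rotated]) (use t pw[OF _ \<psi>] in auto)
  qed
  have vdint: "((\<lambda>s. vdd s \<psi>) has_integral (l2pair U (vd t) \<psi> - l2pair U (vd 0) \<psi>)) {0..t}"
    if t: "t \<in> ?I" and \<psi>: "H10 U \<psi>" for t \<psi>
    using wi[OF t sob_in_sobolev0[OF \<psi>]]
    by (simp add: vdd_def pw[OF t H10_L2[OF \<psi>]] pw[OF T0 H10_L2[OF \<psi>]] init sob_def)
  \<comment> \<open>An integrable majorant of the acceleration in the dual norm; its primitive will
    be the modulus of continuity of \<open>vd\<close> with values in the dual space.\<close>
  define k where "k s = 3 * Mc * K + 1 + (norm (gh s))\<^sup>2" for s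
  have ki: "k integrable_on ?I" unfolding k_def by (intro integrable_add integrable_const_ivl sys.g_int)
  have sqb: "x \<le> 1 + x\<^sup>2" for x :: real using zero_le_power2[of "x - 1/2"] by (simp add: power2_eq_square algebra_simps)
  have fluxb: "\<bar>vdd s \<psi>\<bar> \<le> (3 * Mc * K + norm (gh s)) * H1norm U \<psi>" if s: "s \<in> ?I" and \<psi>: "H10 U \<psi>" for s \<psi>
    using sys.flux_bound_norm[OF s sob_in_sobolev0[OF \<psi>] uK[OF s] wK[OF s]]
    by (simp add: vdd_def norm_sob[OF U H10_H1[OF \<psi>]])
  have H1n: "0 \<le> H1norm U \<psi>" if "H10 U \<psi>" for \<psi> using norm_ge_zero[of "sob U \<psi>"] unfolding norm_sob[OF U H10_H1[OF that]] .
  have vddk: "\<bar>vdd s \<psi>\<bar> \<le> k s * H1norm U \<psi>" if s: "s \<in> ?I" and \<psi>: "H10 U \<psi>" for s \<psi>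
    by (rule order_trans[OF fluxb[OF s \<psi>] mult_right_mono[OF _ H1n[OF \<psi>]]]) (use sqb[of "norm (gh s)"] in \<open>simp add: k_def\<close>)
  have vddi: "(\<lambda>s. vdd s \<psi>) integrable_on ?I" if "H10 U \<psi>" for \<psi>
    using vdint[OF _ that, of T] T by (auto intro: has_integral_integrable)

  have c1: "L2_H10 T U v"
    unfolding L2_H10_def
  proof (intro conjI allI impI)
    show "AE t in lebesgue_on ?I. H10 U (v t)" by (rule AE_I2) (simp add: vH)
    fix \<psi> and \<Psi> :: "real^'n \<Rightarrow> real^'n" assume \<psi>: "L2 U \<psi>" "L2v U \<Psi>"
    have "continuous_on ?I (\<lambda>t. l2pair U (v t) \<psi> + (\<integral>x. wgrad U (v t) x \<bullet> \<Psi> x \<partial>lebesgue_on U))"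
    proof (rule continuous_on_eq[OF uc[of "(emb U \<psi>, emb U \<Psi>)"]])
      fix t assume t: "t \<in> ?I"
      have "snd (u t) = emb U (wgrad U (v t))" using arg_cong[OF vs[OF t], of snd] by (simp add: sob_def)
      then show "u t \<bullet> (emb U \<psi>, emb U \<Psi>) = l2pair U (v t) \<psi> + (\<integral>x. wgrad U (v t) x \<bullet> \<Psi> x \<partial>lebesgue_on U)"
        using emb_inner(1)[OF U wgrad_props(2)[OF H10_H1[OF vH[OF t]]] \<psi>(2)]
        by (simp add: inner_prod_def pv[OF t \<psi>(1)])
    qed
    then show "(\<lambda>t. l2pair U (v t) \<psi> + (\<integral>x. wgrad U (v t) x \<bullet> \<Psi> x \<partial>lebesgue_on U)) \<in> borel_measurable (lebesgue_on ?I)"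
      by (rule continuous_imp_measurable_on_sets_lebesgue) simp
  next
    show "(\<integral>\<^sup>+t. ennreal ((H1norm U (v t))\<^sup>2) \<partial>lebesgue_on ?I) < \<infinity>"
    proof (rule nn_integral_interval_bounded[where C="K\<^sup>2"])
      fix t assume t: "t \<in> ?I"
      show "(H1norm U (v t))\<^sup>2 \<le> K\<^sup>2"
        unfolding norm_sob[OF U H10_H1[OF vH[OF t]], symmetric] vs[OF t] by (intro power_mono uK t norm_ge_zero)
    qed
  qed

  have c2: "time_deriv_L2 T U v vd"
    unfolding time_deriv_L2_def
  proof (intro allI impI)
    fix \<phi> \<psi> assume \<phi>: "test_fun {0<..<T} \<phi>" and \<psi>: "L2 U \<psi>"
    have "(\<lambda>t. l2pair U (vd t) \<psi>) absolutely_integrable_on ?I" by (intro absolutely_integrable_continuous_real vdc \<psi>)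
    from weak_time_derivative[OF T this vint[OF _ \<psi>] \<phi>]
    show "(\<integral>t. l2pair U (v t) \<psi> * deriv \<phi> t \<partial>lebesgue_on {0<..<T}) = - (\<integral>t. l2pair U (vd t) \<psi> * \<phi> t \<partial>lebesgue_on {0<..<T})"
      by simp
  qed

  have c3: "L2_L2 T U vd"
    unfolding L2_L2_def
  proof (intro conjI allI impI)
    show "AE t in lebesgue_on ?I. L2 U (vd t)" by (rule AE_I2) (simp add: vdL)
    show "(\<lambda>t. l2pair U (vd t) \<psi>) \<in> borel_measurable (lebesgue_on ?I)" if "L2 U \<psi>" for \<psi>
      by (rule continuous_imp_measurable_on_sets_lebesgue[OF vdc[OF that]]) simp
    show "(\<integral>\<^sup>+t. ennreal ((L2norm U (vd t))\<^sup>2) \<partial>lebesgue_on ?I) < \<infinity>"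
    proof (rule nn_integral_interval_bounded[where C="K\<^sup>2"])
      fix t assume t: "t \<in> ?I"
      show "(L2norm U (vd t))\<^sup>2 \<le> K\<^sup>2"
        unfolding norm_emb[OF U vdL, symmetric] we[OF t] by (intro power_mono wK t norm_ge_zero)
    qed
  qed

  have c4: "time_deriv_Hm1 T U vd vdd"
    unfolding time_deriv_Hm1_def
  proof (intro allI impI)
    fix \<phi> \<psi> assume \<phi>: "test_fun {0<..<T} \<phi>" and \<psi>: "H10 U \<psi>"
    have "(\<lambda>t. vdd t \<psi>) absolutely_integrable_on ?I"
    proof (rule absolutely_integrable_integrable_bound[OF _ vddi[OF \<psi>] integrable_on_mult_left[OF ki]])
      show "norm (vdd s \<psi>) \<le> k s * H1norm U \<psi>" if "s \<in> ?I" for s using vddk[OF that \<psi>] by simp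
    qed
    from weak_time_derivative[OF T this vdint[OF _ \<psi>] \<phi>]
    show "(\<integral>t. vdd t \<psi> * \<phi> t \<partial>lebesgue_on {0<..<T}) = - (\<integral>t. l2pair U (vd t) \<psi> * deriv \<phi> t \<partial>lebesgue_on {0<..<T})" .
  qed

  have vddH: "Hm1 U (vdd t)" if t: "t \<in> ?I" for t
    unfolding Hm1_def
  proof (intro conjI exI allI impI)
    show "\<bar>vdd t \<psi>\<bar> \<le> k t * H1norm U \<psi>" if "H10 U \<psi>" for \<psi> by (rule vddk[OF t that])
    fix p q c assume p: "H10 U p" and q: "H10 U q"
    show "vdd t (\<lambda>x. p x + c * q x) = vdd t p + c * vdd t q"
      using linear_form_onD[OF sys.flux_linear[OF t] sob_in_sobolev0[OF p] sob_in_sobolev0[OF q], of "u t" "w t" c]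
      unfolding vdd_def sob_linear(2)[OF U H10_H1[OF p] H10_H1[OF q]] by (simp add: algebra_simps)
  qed

  have c5: "L2_Hm1 T U vdd"
    unfolding L2_Hm1_def
  proof (intro conjI allI impI)
    show "AE t in lebesgue_on ?I. Hm1 U (vdd t)" by (rule AE_I2) (simp add: vddH)
    show "(\<lambda>t. vdd t \<psi>) \<in> borel_measurable (lebesgue_on ?I)" if "H10 U \<psi>" for \<psi> by (rule integrable_imp_measurable[OF vddi[OF that]])
    let ?m = "\<lambda>t. 2 * (3 * Mc * K)\<^sup>2 + 2 * (norm (gh t))\<^sup>2"
    have "integrable (lebesgue_on ?I) (\<lambda>t. 2 * (3 * Mc * K)\<^sup>2)"
      by (rule finite_measure.integrable_const) (rule finite_measure_lebesgue_on, simp)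
    then have "integrable (lebesgue_on ?I) ?m" 
      by (rule Bochner_Integration.integrable_add) (intro integrable_mult_right gh_integrable)
    then have fin: "(\<integral>\<^sup>+t. ennreal (?m t) \<partial>lebesgue_on ?I) < \<infinity>" by (subst nn_integral_eq_integral) auto
    have "(\<integral>\<^sup>+t. ennreal ((Hm1norm U (vdd t))\<^sup>2) \<partial>lebesgue_on ?I) \<le> (\<integral>\<^sup>+t. ennreal (?m t) \<partial>lebesgue_on ?I)"
    proof (intro nn_integral_mono ennreal_leI)
      fix t assume "t \<in> space (lebesgue_on ?I)"
      then have t: "t \<in> ?I" by simp
      have "0 \<le> 3 * Mc * K + norm (gh t)" using M K by simp
      note h = Hm1norm_bounds[OF U this fluxb[OF t]]
      have "(Hm1norm U (vdd t))\<^sup>2 \<le> (3 * Mc * K + norm (gh t))\<^sup>2" using h by (intro power_mono)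
      also have "\<dots> \<le> ?m t" using zero_le_power2[of "3 * Mc * K - norm (gh t)"] by (simp add: power2_eq_square algebra_simps)
      finally show "(Hm1norm U (vdd t))\<^sup>2 \<le> ?m t" .
    qed
    also note fin
    finally show "(\<integral>\<^sup>+t. ennreal ((Hm1norm U (vdd t))\<^sup>2) \<partial>lebesgue_on ?I) < \<infinity>" .
  qed

  have d1: "((\<lambda>s. L2norm U (\<lambda>x. v s x - v t x)) \<longlongrightarrow> 0) (at t within ?I)" if t: "t \<in> ?I" for t
  proof (rule Lim_null_comparison)
    have "norm (L2norm U (\<lambda>x. v s x - v t x)) \<le> K * \<bar>s - t\<bar>" if s: "s \<in> ?I" for s
    proof -
      \<comment> \<open>Testing the increment with itself turns the weak identity into Lipschitz
        continuity in the L2 norm.\<close>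
      define h where "h = fst (u s) - fst (u t)"
      have L: "L2 U (\<lambda>x. v s x - v t x)" using L2v_linear[OF U, of "v s" "v t" "-1"] vL by (simp add: L2_eq_L2v)
      have "emb U (\<lambda>x. v s x - v t x) = h"
        using emb_linear[OF U, of "v s" "v t" "-1"] vL[of s] vL[of t] by (simp add: L2_eq_L2v ve[OF s] ve[OF t] h_def)
      then have n: "L2norm U (\<lambda>x. v s x - v t x) = norm h" using norm_emb[OF U L] by simp
      have "\<bar>fst (u s) \<bullet> h - fst (u t) \<bullet> h\<bar> \<le> \<bar>integral {0..s} (\<lambda>_. K * norm h) - integral {0..t} (\<lambda>_. K * norm h)\<bar>"
      proof (rule sys.increment_bound_zero[where X="\<lambda>r. fst (u r) \<bullet> h" and f="\<lambda>r. w r \<bullet> h"])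
        show "((\<lambda>r. w r \<bullet> h) has_integral (fst (u r) \<bullet> h - fst (u 0) \<bullet> h)) {0..r}" if "r \<in> ?I" for r
          using ui[OF that] by (simp add: init)
        show "\<bar>w r \<bullet> h\<bar> \<le> K * norm h" if "r \<in> ?I" for r
          by (rule order_trans[OF Cauchy_Schwarz_ineq2 mult_right_mono[OF wK[OF that] norm_ge_zero]])
      qed (use s t in auto)
      also have "\<dots> = \<bar>s * (K * norm h) - t * (K * norm h)\<bar>" using s t by (simp add: mult_ac)
      also have "\<dots> = \<bar>s - t\<bar> * (K * norm h)"
        using K by (simp add: left_diff_distrib[symmetric] abs_mult)
      finally have hh: "norm h * norm h \<le> (K * \<bar>s - t\<bar>) * norm h"
        by (simp add: inner_diff_left[symmetric] h_def[symmetric] power2_norm_eq_inner[symmetric] power2_eq_square mult_ac)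
      have "norm h \<le> K * \<bar>s - t\<bar>"
      proof (cases "h = 0")
        case False
        then show ?thesis using mult_right_le_imp_le[OF hh] by simp
      qed (use K in simp)
      then show ?thesis by (simp add: n)
    qed
    then show "\<forall>\<^sub>F s in at t within ?I. norm (L2norm U (\<lambda>x. v s x - v t x)) \<le> K * \<bar>s - t\<bar>"
      unfolding eventually_at_filter by (intro always_eventually) simp
    have "((\<lambda>s. K * \<bar>s - t\<bar>) \<longlongrightarrow> K * \<bar>t - t\<bar>) (at t within ?I)" by (intro tendsto_intros)
    then show "((\<lambda>s. K * \<bar>s - t\<bar>) \<longlongrightarrow> 0) (at t within ?I)" by simp
  qed

  have d2: "AE x in lebesgue_on U. v 0 x = v0 x"
  proof -
    have "emb U (v 0) = emb U v0" by (simp add: ve[OF T0] init sob_def)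
    then show ?thesis using emb_eq_iff[OF U, of "v 0" v0] vL[of 0] H10_L2[OF v0] by (simp add: L2_eq_L2v)
  qed

  define \<kappa> where "\<kappa> t = integral {0..t} k" for t
  have d3: "((\<lambda>s. Hm1norm U (l2pair U (\<lambda>x. vd s x - vd t x))) \<longlongrightarrow> 0) (at t within ?I)" if t: "t \<in> ?I" for t
  proof (rule Lim_null_comparison)
    have "norm (Hm1norm U (l2pair U (\<lambda>x. vd s x - vd t x))) \<le> \<bar>\<kappa> s - \<kappa> t\<bar>" if s: "s \<in> ?I" for s
    proof -
      have L: "L2 U (\<lambda>x. vd s x - vd t x)" using L2v_linear[OF U, of "vd s" "vd t" "-1"] vdL by (simp add: L2_eq_L2v)
      have "emb U (\<lambda>x. vd s x - vd t x) = w s - w t"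
        using emb_linear[OF U, of "vd s" "vd t" "-1"] vdL[of s] vdL[of t] by (simp add: L2_eq_L2v we[OF s] we[OF t])
      then have n: "l2pair U (\<lambda>x. vd s x - vd t x) \<psi> = l2pair U (vd s) \<psi> - l2pair U (vd t) \<psi>" if "L2 U \<psi>" for \<psi>
        using l2pair_emb[OF U L that] pw[OF s that] pw[OF t that] by (simp add: inner_diff_left)
      have b: "\<bar>l2pair U (\<lambda>x. vd s x - vd t x) \<psi>\<bar> \<le> \<bar>\<kappa> s - \<kappa> t\<bar> * H1norm U \<psi>" if \<psi>: "H10 U \<psi>" for \<psi>
      proof -
        have "\<bar>l2pair U (vd s) \<psi> - l2pair U (vd t) \<psi>\<bar>
            \<le> \<bar>integral {0..s} (\<lambda>r. k r * H1norm U \<psi>) - integral {0..t} (\<lambda>r. k r * H1norm U \<psi>)\<bar>"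
          by (rule sys.increment_bound_zero[where X="\<lambda>r. l2pair U (vd r) \<psi>", OF vdint[OF _ \<psi>] integrable_on_mult_left[OF ki] vddk[OF _ \<psi>] t s])
        also have "\<dots> = \<bar>\<kappa> s - \<kappa> t\<bar> * H1norm U \<psi>"
          using H1n[OF \<psi>] by (simp add: \<kappa>_def left_diff_distrib[symmetric] abs_mult)
        finally show ?thesis by (simp add: n[OF H10_L2[OF \<psi>]])
      qed
      show ?thesis using Hm1norm_bounds[OF U abs_ge_zero b] by simp
    qed
    then show "\<forall>\<^sub>F s in at t within ?I. norm (Hm1norm U (l2pair U (\<lambda>x. vd s x - vd t x))) \<le> \<bar>\<kappa> s - \<kappa> t\<bar>"
      unfolding eventually_at_filter by (intro always_eventually) simp
    have "continuous_on ?I \<kappa>" unfolding \<kappa>_def by (rule indefinite_integral_continuous_1[OF ki])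
    then have "(\<kappa> \<longlongrightarrow> \<kappa> t) (at t within ?I)" using t by (simp add: continuous_on)
    then have "((\<lambda>s. \<bar>\<kappa> s - \<kappa> t\<bar>) \<longlongrightarrow> \<bar>\<kappa> t - \<kappa> t\<bar>) (at t within ?I)" by (intro tendsto_intros)
    then show "((\<lambda>s. \<bar>\<kappa> s - \<kappa> t\<bar>) \<longlongrightarrow> 0) (at t within ?I)" by simp
  qed

  have d4: "l2pair U (vd 0) \<psi> = l2pair U v1 \<psi>" if "H10 U \<psi>" for \<psi>
    using pw[OF T0 H10_L2[OF that]] l2pair_emb[OF U v1 H10_L2[OF that]] init by simp

  have e: "AE t in lebesgue_on ?I. \<forall>\<phi>. H10 U \<phi> \<longrightarrow>
          vdd t \<phi>
          + (\<integral>x. (B t x *v wgrad U (v t) x) \<bullet> wgrad U \<phi> x \<partial>lebesgue_on U)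
          + (\<integral>x. (a0 t x \<bullet> wgrad U (v t) x) * \<phi> x \<partial>lebesgue_on U)
          + 2 * l2pair U (vd t) (wdiv U (\<lambda>x. \<phi> x *\<^sub>R b t x))
          = l2pair U (g0 t) \<phi>"
    \<comment> \<open>The exceptional times are those at which the Borel versions differ from the
      data on a slice, or at which \<open>gh\<close> has its default value 0.\<close>
    using slice gh_finite AE_space
  proof eventually_elim
    case (elim t)
    then have t: "t \<in> ?I" by simp
    show ?case
    proof (intro allI impI)
      fix \<phi> assume \<phi>: "H10 U \<phi>"
      have A: "(\<integral>x. (a (t, x) \<bullet> wgrad U (v t) x) * \<phi> x \<partial>lebesgue_on U) = (\<integral>x. (a0 t x \<bullet> wgrad U (v t) x) * \<phi> x \<partial>lebesgue_on U)"
        by (rule integral_lebesgue_on_cong_AE[OF U flux_sob(2)[OF t vH[OF t] vdL \<phi>]])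
          (use elim(1) in \<open>eventually_elim, simp\<close>)
      have gL: "L2 U (\<lambda>x. g (t, x))" using g_section_L2(1)[OF elim(2)] by (simp add: L2_eq_L2v)
      have "gh t \<bullet> emb U \<phi> = l2pair U (\<lambda>x. g (t, x)) \<phi>"
        using elim(2) l2pair_emb[OF U gL H10_L2[OF \<phi>]] by (simp add: gh_def)
      also have "\<dots> = l2pair U (g0 t) \<phi>" unfolding l2pair_def
      proof (rule integral_lebesgue_on_cong_AE[OF U])
        show "(\<lambda>x. g (t, x) * \<phi> x) \<in> borel_measurable (lebesgue_on U)"
          using gL H10_L2[OF \<phi>] by (intro borel_measurable_times) (auto simp: L2_def)
        show "AE x in lebesgue_on U. g (t, x) * \<phi> x = g0 t x * \<phi> x" using elim(1) by eventually_elim simp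
      qed
      finally have G: "gh t \<bullet> emb U \<phi> = l2pair U (g0 t) \<phi>" .
      show "vdd t \<phi>
          + (\<integral>x. (B t x *v wgrad U (v t) x) \<bullet> wgrad U \<phi> x \<partial>lebesgue_on U)
          + (\<integral>x. (a0 t x \<bullet> wgrad U (v t) x) * \<phi> x \<partial>lebesgue_on U)
          + 2 * l2pair U (vd t) (wdiv U (\<lambda>x. \<phi> x *\<^sub>R b t x))
          = l2pair U (g0 t) \<phi>"
        using flux_sob(1)[OF t vH[OF t] vdL[of t] \<phi>] unfolding vs[OF t] we[OF t] vdd_def A G by simp
    qed
  qed

  have "strong_weak_solution_with T U B a0 b g0 v0 v1 v vd vdd"
    unfolding strong_weak_solution_with_def
    using c1 c2 c3 c4 c5 vL d1 d2 Hm1_l2pair[OF U vdL] d3 d4 e by simp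
  moreover have "weakly_cont_H10 T U v"
    unfolding weakly_cont_H10_def
  proof (intro conjI ballI allI impI)
    show "H10 U (v t)" if "t \<in> ?I" for t by (rule vH[OF that])
    fix \<Lambda> assume "Hm1 U \<Lambda>"
    then obtain z where z: "\<And>u. H10 U u \<Longrightarrow> \<Lambda> u = sob U u \<bullet> z" using Hm1_riesz[OF U] by blast
    show "continuous_on ?I (\<lambda>t. \<Lambda> (v t))"
      by (rule continuous_on_eq[OF uc[of z]]) (simp add: z[OF vH] vs)
  qed
  moreover have "weakly_cont_L2 T U vd" using vdL vdc by (simp add: weakly_cont_L2_def)
  ultimately show ?thesis by blast
qed

end

section \<open>Borel versions of the data\<close>

lemma lebesgue_borel_version:
  fixes f :: "'a::euclidean_space \<Rightarrow> 'b::euclidean_space"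
  assumes S: "S \<in> sets lebesgue" and f: "f \<in> borel_measurable (lebesgue_on S)"
  obtains f' where "f' \<in> borel_measurable borel" "AE z in lborel. z \<in> S \<longrightarrow> f z = f' z"
proof -
  let ?f = "\<lambda>z. indicator S z *\<^sub>R f z"
  have m: "?f \<in> borel_measurable lebesgue" using f S by (simp add: borel_measurable_restrict_space_iff)
  have "\<exists>F. F \<in> borel_measurable lborel \<and> (AE z in lborel. ?f z \<bullet> i = F z)" for i
    using completion_ex_borel_measurable_real[OF borel_measurable_inner[OF m borel_measurable_const[of i]]] by blast
  then obtain F where F: "\<And>i. F i \<in> borel_measurable lborel" "\<And>i. AE z in lborel. ?f z \<bullet> i = F i z" by metis
  show ?thesis
  proof
    show "(\<lambda>z. \<Sum>i\<in>Basis. F i z *\<^sub>R i) \<in> borel_measurable borel"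
      using F(1) by (intro borel_measurable_sum borel_measurable_scaleR borel_measurable_const) simp
    have "AE z in lborel. \<forall>i\<in>Basis. ?f z \<bullet> i = F i z"
      using F(2) by (intro AE_finite_allI) auto
    then show "AE z in lborel. z \<in> S \<longrightarrow> f z = (\<Sum>i\<in>Basis. F i z *\<^sub>R i)"
    proof eventually_elim
      case (elim z)
      show ?case
      proof
        assume "z \<in> S"
        then have "(\<Sum>i\<in>Basis. F i z *\<^sub>R i) = (\<Sum>i\<in>Basis. (f z \<bullet> i) *\<^sub>R i)" using elim by (intro sum.cong) auto
        then show "f z = (\<Sum>i\<in>Basis. F i z *\<^sub>R i)" by (simp add: euclidean_representation)
      qed
    qed
  qed
qed

lemma AE_lborel_slices:
  fixes P :: "real \<times> 'a::euclidean_space \<Rightarrow> bool"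
  assumes U: "open U" and P: "AE z in lborel. z \<in> {0<..<T} \<times> U \<longrightarrow> P z"
  shows "AE t in lebesgue_on {0..T}. AE x in lebesgue_on U. P (t, x)"
proof -
  have "AE z in lborel \<Otimes>\<^sub>M lborel. z \<in> {0<..<T} \<times> U \<longrightarrow> P z" using P by (simp only: lborel_prod)
  then have "AE t in lborel. AE x in lborel. (t, x) \<in> {0<..<T} \<times> U \<longrightarrow> P (t, x)" by (rule lborel_pair.AE_pair)
  then have "AE t in lborel. t \<in> {0..T} \<longrightarrow> (AE x in lebesgue_on U. P (t, x))"
    \<comment> \<open>The end points 0 and T are outside the open cylinder but form a null set of
      times.\<close>
    using AE_lborel_singleton[of 0] AE_lborel_singleton[of T]
  proof eventually_elim
    case (elim t)
    show ?case
    proof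
      assume "t \<in> {0..T}"
      then have t: "t \<in> {0<..<T}" using elim(2,3) by auto
      have "AE x in lborel. x \<in> U \<longrightarrow> P (t, x)" using elim(1) by eventually_elim (use t in simp)
      then show "AE x in lebesgue_on U. P (t, x)" unfolding AE_lebesgue_on_open[OF U] by (rule AE_completion)
    qed
  qed
  then have "AE t in lebesgue. t \<in> {0..T} \<longrightarrow> (AE x in lebesgue_on U. P (t, x))" by (rule AE_completion)
  then show ?thesis by (subst AE_restrict_space_iff) auto
qed

text \<open>An essential bound becomes a bound at every point: the Borel version is replaced by 0
  wherever it exceeds \<open>C\<close>, which changes it on \<open>S\<close> only in a null
  set.\<close>

lemma borel_version_bounded:
  fixes f :: "'a::euclidean_space \<Rightarrow> 'b::euclidean_space"
  assumes S: "S \<in> sets lebesgue" and f: "f \<in> borel_measurable (lebesgue_on S)" and M: "AE z in lebesgue_on S. norm (f z) \<le> M"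
  obtains f' C where "f' \<in> borel_measurable borel" "0 \<le> C" "\<And>z. norm (f' z) \<le> C" "AE z in lborel. z \<in> S \<longrightarrow> f z = f' z"
proof -
  obtain h where h: "h \<in> borel_measurable borel" "AE z in lborel. z \<in> S \<longrightarrow> f z = h z"
    by (rule lebesgue_borel_version[OF S f])
  define C where "C = max 0 M"
  have "AE z in lebesgue. z \<in> S \<longrightarrow> norm (f z) \<le> M" using M S by (simp add: AE_restrict_space_iff)
  then have Mb: "AE z in lborel. z \<in> S \<longrightarrow> norm (f z) \<le> M" by (simp only: AE_completion_iff)
  show ?thesis
  proof
    show "(\<lambda>z. if norm (h z) \<le> C then h z else 0) \<in> borel_measurable borel" using h(1) by measurable
    show "0 \<le> C" by (simp add: C_def)
    then show "norm (if norm (h z) \<le> C then h z else 0) \<le> C" for z by simp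
    show "AE z in lborel. z \<in> S \<longrightarrow> f z = (if norm (h z) \<le> C then h z else 0)"
      using h(2) Mb by eventually_elim (auto simp: C_def)
  qed
qed

text \<open>The cut-off by the indicator of \<open>S\<close> makes the square integral over the
  whole space finite, as the Fubini argument for the slices requires.\<close>

lemma borel_version_L2:
  fixes f :: "'a::euclidean_space \<Rightarrow> real"
  assumes S: "open S" and f: "L2 S f"
  obtains f' where "f' \<in> borel_measurable borel" "(\<integral>\<^sup>+z. ennreal ((f' z)\<^sup>2) \<partial>lborel) < \<infinity>"
    "AE z in lborel. z \<in> S \<longrightarrow> f z = f' z"
proof -
  have SL: "S \<in> sets lebesgue" using S by auto
  obtain h where h: "h \<in> borel_measurable borel" "AE z in lborel. z \<in> S \<longrightarrow> f z = h z"
    by (rule lebesgue_borel_version[OF SL, of f]) (use f in \<open>auto simp: L2_def\<close>)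
  have int: "integrable lebesgue (\<lambda>z. indicator S z *\<^sub>R (f z)\<^sup>2)"
    using f by (simp add: L2_def integral_lebesgue_on(2)[OF SL])
  show ?thesis
  proof
    show "(\<lambda>z. indicator S z * h z) \<in> borel_measurable borel"
      using h(1) S by (intro borel_measurable_times borel_measurable_indicator) auto
    have "(\<integral>\<^sup>+z. ennreal ((indicator S z * h z)\<^sup>2) \<partial>lborel) = (\<integral>\<^sup>+z. ennreal (indicator S z *\<^sub>R (f z)\<^sup>2) \<partial>lborel)"
      by (rule nn_integral_cong_AE) (use h(2) in \<open>eventually_elim, auto simp: indicator_def\<close>)
    also have "\<dots> = (\<integral>\<^sup>+z. ennreal (indicator S z *\<^sub>R (f z)\<^sup>2) \<partial>lebesgue)" by (rule nn_integral_completion[symmetric])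
    also have "\<dots> = ennreal (\<integral>z. indicator S z *\<^sub>R (f z)\<^sup>2 \<partial>lebesgue)" by (rule nn_integral_eq_integral[OF int]) simp
    also have "\<dots> < \<infinity>" by simp
    finally show "(\<integral>\<^sup>+z. ennreal ((indicator S z * h z)\<^sup>2) \<partial>lborel) < \<infinity>" .
    show "AE z in lborel. z \<in> S \<longrightarrow> f z = indicator S z * h z" using h(2) by eventually_elim auto
  qed
qed

text \<open>The sup bound comes from compactness of the closed cylinder; the sum |t - s| + |x - y|
  dominates the distance in the product and separates the two variables for later use.\<close>

lemma lipschitz_coefficient:
  fixes F :: "real \<Rightarrow> 'a::euclidean_space \<Rightarrow> 'b::real_normed_vector"
  assumes U: "bounded U" and F: "\<exists>L. L-lipschitz_on ({0..T} \<times> closure U) (\<lambda>(t, y). F t y)"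
  obtains L C where "0 \<le> L" "0 \<le> C"
    "\<And>t s x y. t \<in> {0..T} \<Longrightarrow> s \<in> {0..T} \<Longrightarrow> x \<in> U \<Longrightarrow> y \<in> U \<Longrightarrow> norm (F t x - F s y) \<le> L * (\<bar>t - s\<bar> + norm (x - y))"
    "\<And>t x. t \<in> {0..T} \<Longrightarrow> x \<in> U \<Longrightarrow> norm (F t x) \<le> C"
proof -
  let ?S = "{0..T} \<times> closure U" and ?F = "\<lambda>(t, y). F t y"
  obtain L where L: "L-lipschitz_on ?S ?F" using F by blast
  have L0: "0 \<le> L" by (rule lipschitz_on_nonneg[OF L])
  have mem: "(t, x) \<in> ?S" if "t \<in> {0..T}" "x \<in> U" for t x using that closure_subset[of U] by auto
  have "compact ?S" using U by (intro compact_Times) auto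
  then have "bounded (?F ` ?S)" by (intro compact_imp_bounded compact_continuous_image lipschitz_on_continuous_on[OF L])
  then obtain C where C: "\<And>z. z \<in> ?S \<Longrightarrow> norm (?F z) \<le> C" unfolding bounded_iff by blast
  show ?thesis
  proof
    show "0 \<le> L" "0 \<le> max 0 C" using L0 by auto
    fix t x assume tx: "t \<in> {0..T}" "x \<in> U"
    show "norm (F t x) \<le> max 0 C" using C[OF mem[OF tx]] by simp
    fix s y assume sy: "s \<in> {0..T}" "y \<in> U"
    have "norm (F t x - F s y) \<le> L * dist (t, x) (s, y)"
      using lipschitz_onD[OF L mem[OF tx] mem[OF sy]] by (simp add: dist_norm)
    also have "dist (t, x) (s, y) \<le> \<bar>t - s\<bar> + norm (x - y)"
      using norm_Pair_le[of "t - s" "x - y"] by (simp add: dist_norm)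
    finally show "norm (F t x - F s y) \<le> L * (\<bar>t - s\<bar> + norm (x - y))" using L0 by (simp add: mult_left_mono)
  qed
qed

theorem theorem3p2:
  fixes U :: "(real^'n) set" and T :: real
    and B :: "real \<Rightarrow> real^'n \<Rightarrow> real^'n^'n"
    and a b :: "real \<Rightarrow> real^'n \<Rightarrow> real^'n"
    and g :: "real \<Rightarrow> real^'n \<Rightarrow> real"
    and v0 v1 :: "real^'n \<Rightarrow> real"
  assumes "U \<noteq> {}" and "open U" and "bounded U" and "lipschitz_boundary U"
    and "T > 0"
    and "\<exists>L. L-lipschitz_on ({0..T} \<times> closure U) (\<lambda>(t, y). B t y)"
    and "\<forall>t\<in>{0..T}. \<forall>y\<in>closure U. transpose (B t y) = B t y"
    and "\<exists>cB>0. \<forall>t\<in>{0..T}. \<forall>y\<in>closure U. \<forall>w. (B t y *v w) \<bullet> w \<ge> cB * (norm w)^2"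
    and "(\<lambda>(t, y). a t y) \<in> borel_measurable (lebesgue_on ({0..T} \<times> closure U))"
    and "\<exists>M. AE z in lebesgue_on ({0..T} \<times> closure U). norm ((\<lambda>(t, y). a t y) z) \<le> M"
    and "\<exists>L. L-lipschitz_on ({0..T} \<times> closure U) (\<lambda>(t, y). b t y)"
    and "L2 ({0<..<T} \<times> U) (\<lambda>(t, y). g t y)"
    and "H10 U v0"
    and "L2 U v1"
  shows "\<exists>v vd vdd. strong_weak_solution_with T U B a b g v0 v1 v vd vdd
           \<and> weakly_cont_H10 T U v \<and> weakly_cont_L2 T U vd"
proof -
  note U = \<open>open U\<close>
  let ?S = "{0..T} \<times> closure U" and ?Q = "{0<..<T} \<times> U"
  have cl: "x \<in> closure U" if "x \<in> U" for x using that by (rule subsetD[OF closure_subset])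
  obtain LB MB where B: "0 \<le> LB" "0 \<le> MB"
    "\<And>t s x y. t \<in> {0..T} \<Longrightarrow> s \<in> {0..T} \<Longrightarrow> x \<in> U \<Longrightarrow> y \<in> U \<Longrightarrow> norm (B t x - B s y) \<le> LB * (\<bar>t - s\<bar> + norm (x - y))"
    "\<And>t x. t \<in> {0..T} \<Longrightarrow> x \<in> U \<Longrightarrow> norm (B t x) \<le> MB"
  proof -
    show thesis by (rule lipschitz_coefficient[OF \<open>bounded U\<close> assms(6)]) (fact that)
  qed
  obtain Lb Mb where b: "0 \<le> Lb" "0 \<le> Mb"
    "\<And>t s x y. t \<in> {0..T} \<Longrightarrow> s \<in> {0..T} \<Longrightarrow> x \<in> U \<Longrightarrow> y \<in> U \<Longrightarrow> norm (b t x - b s y) \<le> Lb * (\<bar>t - s\<bar> + norm (x - y))"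
    "\<And>t x. t \<in> {0..T} \<Longrightarrow> x \<in> U \<Longrightarrow> norm (b t x) \<le> Mb"
  proof -
    show thesis by (rule lipschitz_coefficient[OF \<open>bounded U\<close> assms(11)]) (fact that)
  qed
  obtain cB where cB: "cB > 0" "\<And>t y w. t \<in> {0..T} \<Longrightarrow> y \<in> closure U \<Longrightarrow> (B t y *v w) \<bullet> w \<ge> cB * (norm w)^2"
    using assms(8) by blast
  have "closed ?S" by (intro closed_Times) auto
  then have S: "?S \<in> sets lebesgue" by (intro sets_completionI_sets) simp
  obtain M where M: "AE z in lebesgue_on ?S. norm ((\<lambda>(t, y). a t y) z) \<le> M" using assms(10) by blast
  obtain a' Ma where a': "a' \<in> borel_measurable borel" "0 \<le> Ma" "\<And>z. norm (a' z) \<le> Ma"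
    "AE z in lborel. z \<in> ?S \<longrightarrow> (\<lambda>(t, y). a t y) z = a' z"
  proof -
    show thesis by (rule borel_version_bounded[OF S assms(9) M]) (fact that)
  qed
  have Q: "open ?Q" using U by (intro open_Times) auto
  obtain g' where g': "g' \<in> borel_measurable borel" "(\<integral>\<^sup>+z. ennreal ((g' z)\<^sup>2) \<partial>lborel) < \<infinity>"
    "AE z in lborel. z \<in> ?Q \<longrightarrow> (\<lambda>(t, y). g t y) z = g' z"
  proof -
    show thesis by (rule borel_version_L2[OF Q assms(12)]) (fact that)
  qed
  have sym: "transpose (B t x) = B t x" if "t \<in> {0..T}" "x \<in> U" for t x
    using bspec[OF bspec[OF assms(7) that(1)] cl[OF that(2)]] .
  interpret wave_data U T B b a' g' v0 v1 LB MB cB Ma Lb Mb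
    by (rule wave_data.intro)
      (fact U assms(5) B sym cB(1) cB(2)[OF _ cl] a' b g'(1,2) assms(13,14))+
  \<comment> \<open>\<open>a\<close> is given on the closed cylinder and \<open>g\<close> on the
    open one; they are compared with their Borel versions on the smaller set.\<close>
  have "AE z in lborel. z \<in> ?Q \<longrightarrow> a (fst z) (snd z) = a' z \<and> g (fst z) (snd z) = g' z"
    using a'(4) g'(3) 
  proof eventually_elim
    case (elim z)
    show ?case
    proof
      assume z: "z \<in> ?Q"
      have "z \<in> ?S" using z cl[of "snd z"] by (auto simp: mem_Times_iff)
      then show "a (fst z) (snd z) = a' z \<and> g (fst z) (snd z) = g' z"
        using z elim by (simp add: split_beta)
    qed
  qed
  from AE_lborel_slices[OF U this]
  have "AE t in lebesgue_on {0..T}. AE x in lebesgue_on U. a t x = a' (t, x) \<and> g t x = g' (t, x)" by simp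
  then show ?thesis by (rule solution)
qed

end
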